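(* Let $M$ be a finite regular monoid and $K$ a field. Then the augmented simplicial chain complex $C_\bullet(\Delta(M/\mathscr R),K)\to K$ is a resolution of the trivial $KM$-module $K$ by modules which are filtered by induced modules. Moreover, if the characteristic of $K$ divides the order of no maximal subgroup of $M$, and the sandwich matrices of the $\mathscr J$-classes of $M$ are right invertible over the corresponding group algebras, then it is a projective resolution. More generally, under these latter assumptions, if $V$ is a $KG(M)$-module, then $C_\bullet(\Delta(M/\mathscr R),V)\to V$ is a projective resolution of $V$, where $C_q(\Delta(M/\mathscr R),V)$ is viewed as the tensor product $C_q(\Delta(M/\mathscr R),K)\otimes_K V$ as a $KM$-module.
   Context: Modules are left modules; $KM$ is the monoid algebra; $K$ as a module is trivial (all $m\in M$ act as the identity). $M$ is regular if for each $m\in M$ there is $n$ with $mnm=m$. $M/\mathscr R$ is the poset of principal right ideals $aM$ ordered by inclusion, with order-preserving left action $m\cdot aM=maM$. $\Delta(P)$ is the order complex of a poset $P$. $C_q(\Delta(M/\mathscr R),K)$ has $K$-basis the strict chains $\sigma$ of length $q$ in $M/\mathscr R$ (simplices oriented by the order), with $m\sigma$ the image chain if it still has $q+1$ distinct elements and $0$ otherwise. For an idempotent $e$, $G_e$ is the group of units of $eMe$ (the maximal subgroup at $e$), $L_e=\{m\in M\mid Mm=Me\}$, $L(e)=Me\setminus L_e$, and $KL_e=KMe/KL(e)$ is a $KM$-$KG_e$-bimodule with basis $L_e$ ($m\cdot l=ml$ if $ml\in L_e$, and $0$ otherwise). $\mathrm{Ind}_e(W)=KL_e\otimes_{KG_e}W$;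 an induced module is one isomorphic to $\mathrm{Ind}_e(W)$ for some idempotent $e$ and $KG_e$-module $W$. A module is filtered by induced modules if it has a finite chain of submodules from $0$ to itself whose successive quotients are induced modules. $G(M)$ is the universal group receiving a homomorphism $\psi$ from $M$; $KG(M)$-modules are inflated to $KM$ along $\psi$. Tensor products over $K$ have the diagonal action $m(u\otimes v)=mu\otimes mv$. Green's relations: $a\mathrel{\mathscr J}b$ iff $MaM=MbM$; $a\mathrel{\mathscr L}b$ iff $Ma=Mb$; $a\mathrel{\mathscr R}b$ iff $aM=bM$. Sandwich matrix of a $\mathscr J$-class $J$ containing an idempotent $e$: let $A$ and $B$ index the $\mathscr R$-classes and $\mathscr L$-classes in $J$; choose $r_a\mathrel{\mathscr L}e$ in the $\mathscr R$-class $a$ for each $a\in A$ and $\ell_b\mathrel{\mathscr R}e$ in the $\mathscr L$-class $b$ for each $b\in B$. Then $P$ is the $B\times A$ matrix over $KG_e$ with $P_{ba}=\ell_br_a$ if $\ell_br_a\in G_e$, and $P_{ba}=0$ otherwise. Right invertibility of $P$ over $KG_e$ (existence of an $A\times B$ matrix $Q$ over $KG_e$ with $PQ=I$) does not depend on the choices. *)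

theory Defs
  imports "HOL-Algebra.Algebra"
begin

section \<open>Left modules over a ring\<close>

text \<open>The locale \<^locale>\<open>module\<close> of HOL-Algebra requires a commutative ring. The records of type
  \<^typ>\<open>('r, 'a) module\<close> are used for modules over noncommutative rings too; their multiplicative
  fields (inherited from \<^typ>\<open>'a ring\<close>) play no role.\<close>

locale left_module = R?: ring R + M?: abelian_group M for R :: "('a, 'c) ring_scheme" (structure) and
    M :: "('a, 'b, 'd) module_scheme" (structure) +
  assumes smult_closed [simp, intro]:
      "\<lbrakk>a \<in> carrier R; x \<in> carrier M\<rbrakk> \<Longrightarrow> a \<odot>\<^bsub>M\<^esub> x \<in> carrier M"
    and smult_l_distr:
      "\<lbrakk>a \<in> carrier R; b \<in> carrier R; x \<in> carrier M\<rbrakk> \<Longrightarrow>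
        (a \<oplus>\<^bsub>R\<^esub> b) \<odot>\<^bsub>M\<^esub> x = a \<odot>\<^bsub>M\<^esub> x \<oplus>\<^bsub>M\<^esub> b \<odot>\<^bsub>M\<^esub> x"
    and smult_r_distr:
      "\<lbrakk>a \<in> carrier R; x \<in> carrier M; y \<in> carrier M\<rbrakk> \<Longrightarrow>
        a \<odot>\<^bsub>M\<^esub> (x \<oplus>\<^bsub>M\<^esub> y) = a \<odot>\<^bsub>M\<^esub> x \<oplus>\<^bsub>M\<^esub> a \<odot>\<^bsub>M\<^esub> y"
    and smult_assoc1:
      "\<lbrakk>a \<in> carrier R; b \<in> carrier R; x \<in> carrier M\<rbrakk> \<Longrightarrow>
        (a \<otimes>\<^bsub>R\<^esub> b) \<odot>\<^bsub>M\<^esub> x = a \<odot>\<^bsub>M\<^esub> (b \<odot>\<^bsub>M\<^esub> x)"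
    and smult_one [simp]: "x \<in> carrier M \<Longrightarrow> \<one>\<^bsub>R\<^esub> \<odot>\<^bsub>M\<^esub> x = x"

definition left_module_hom ::
  "('r, 'c) ring_scheme \<Rightarrow> ('r, 'a) module \<Rightarrow> ('r, 'b) module \<Rightarrow> ('a \<Rightarrow> 'b) set"
  where "left_module_hom R A B =
    {f \<in> carrier A \<rightarrow> carrier B.
       (\<forall>x\<in>carrier A. \<forall>y\<in>carrier A. f (x \<oplus>\<^bsub>A\<^esub> y) = f x \<oplus>\<^bsub>B\<^esub> f y) \<and>
       (\<forall>r\<in>carrier R. \<forall>x\<in>carrier A. f (r \<odot>\<^bsub>A\<^esub> x) = r \<odot>\<^bsub>B\<^esub> f x)}"

definition left_module_iso ::
  "('r, 'c) ring_scheme \<Rightarrow> ('r, 'a) module \<Rightarrow> ('r, 'b) module \<Rightarrow> bool"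
  where "left_module_iso R A B \<longleftrightarrow>
    (\<exists>f\<in>left_module_hom R A B. bij_betw f (carrier A) (carrier B))"

definition quotient_module :: "('r, 'a) module \<Rightarrow> 'a set \<Rightarrow> ('r, 'a set) module"
  where "quotient_module A N =
    \<lparr>carrier = a_rcosets\<^bsub>A\<^esub> N, monoid.mult = undefined, one = undefined,
     ring.zero = N, ring.add = set_add A, module.smult = (\<lambda>r S. (\<Union>x\<in>S. a_r_coset A N (r \<odot>\<^bsub>A\<^esub> x)))\<rparr>"

text \<open>Projectivity is the lifting property. HOL cannot quantify over the types carrying the test
  modules \<open>A\<close> and \<open>B\<close> inside a definition, so these types are parameters: a theorem concluding
  \<open>projective_module TYPE('x) TYPE('y) R P\<close> with type variables \<open>'x\<close>, \<open>'y\<close> covers all test modules.\<close>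

definition projective_module ::
  "'x itself \<Rightarrow> 'y itself \<Rightarrow> ('r, 'c) ring_scheme \<Rightarrow> ('r, 'a) module \<Rightarrow> bool"
  where "projective_module _ _ R P \<longleftrightarrow> left_module R P \<and>
    (\<forall>(A :: ('r, 'x) module) (B :: ('r, 'y) module). \<forall>f\<in>left_module_hom R A B.
      \<forall>g\<in>left_module_hom R P B.
        left_module R A \<and> left_module R B \<and> f ` carrier A = carrier B \<longrightarrow>
        (\<exists>h\<in>left_module_hom R P A. \<forall>p\<in>carrier P. f (h p) = g p))"

text \<open>\<open>d q\<close> is the differential from \<open>C (q + 1)\<close> to \<open>C q\<close>, and \<open>\<epsilon>\<close> the augmentation from \<open>C 0\<close> to \<open>N\<close>.\<close>

definition resolution ::
  "('r, 'c) ring_scheme \<Rightarrow> (nat \<Rightarrow> ('r, 'a) module) \<Rightarrow> (nat \<Rightarrow> 'a \<Rightarrow> 'a) \<Rightarrow>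
   ('a \<Rightarrow> 'b) \<Rightarrow> ('r, 'b) module \<Rightarrow> bool"
  where "resolution R C d \<epsilon> N \<longleftrightarrow>
    (\<forall>q. left_module R (C q)) \<and> left_module R N \<and>
    (\<forall>q. d q \<in> left_module_hom R (C (Suc q)) (C q)) \<and> \<epsilon> \<in> left_module_hom R (C 0) N \<and>
    \<epsilon> ` carrier (C 0) = carrier N \<and>
    a_kernel (C 0) N \<epsilon> = d 0 ` carrier (C 1) \<and>
    (\<forall>q. a_kernel (C (Suc q)) (C q) (d q) = d (Suc q) ` carrier (C (Suc (Suc q))))"

definition projective_resolution ::
  "'x itself \<Rightarrow> 'y itself \<Rightarrow> ('r, 'c) ring_scheme \<Rightarrow> (nat \<Rightarrow> ('r, 'a) module) \<Rightarrow>
   (nat \<Rightarrow> 'a \<Rightarrow> 'a) \<Rightarrow> ('a \<Rightarrow> 'b) \<Rightarrow> ('r, 'b) module \<Rightarrow> bool"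
  where "projective_resolution tx ty R C d \<epsilon> N \<longleftrightarrow>
    resolution R C d \<epsilon> N \<and> (\<forall>q. projective_module tx ty R (C q))"


section \<open>Tensor products\<close>

text \<open>The tensor product of a right \<open>R\<close>-module (an abelian group \<open>A\<close> with right action \<open>ra\<close>) and a
  left \<open>R\<close>-module \<open>B\<close>: the free abelian group on pairs modulo the balanced bilinear relations.
  The group operation is written multiplicatively, following \<^const>\<open>free_Abelian_group\<close>.\<close>

definition tensor_relations ::
  "('r, 'c) ring_scheme \<Rightarrow> ('a, 'd) ring_scheme \<Rightarrow> ('a \<Rightarrow> 'r \<Rightarrow> 'a) \<Rightarrow> ('r, 'b) module \<Rightarrow>
   ('a \<times> 'b \<Rightarrow>\<^sub>0 int) set"
  where "tensor_relations R A ra B =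
    {frag_of (a \<oplus>\<^bsub>A\<^esub> a', b) - frag_of (a, b) - frag_of (a', b) | a a' b.
       a \<in> carrier A \<and> a' \<in> carrier A \<and> b \<in> carrier B} \<union>
    {frag_of (a, b \<oplus>\<^bsub>B\<^esub> b') - frag_of (a, b) - frag_of (a, b') | a b b'.
       a \<in> carrier A \<and> b \<in> carrier B \<and> b' \<in> carrier B} \<union>
    {frag_of (ra a r, b) - frag_of (a, r \<odot>\<^bsub>B\<^esub> b) | a r b.
       a \<in> carrier A \<and> r \<in> carrier R \<and> b \<in> carrier B}"

definition tensor_null ::
  "('r, 'c) ring_scheme \<Rightarrow> ('a, 'd) ring_scheme \<Rightarrow> ('a \<Rightarrow> 'r \<Rightarrow> 'a) \<Rightarrow> ('r, 'b) module \<Rightarrow>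
   ('a \<times> 'b \<Rightarrow>\<^sub>0 int) set"
  where "tensor_null R A ra B =
    generate (free_Abelian_group (carrier A \<times> carrier B)) (tensor_relations R A ra B)"

definition tensor_group ::
  "('r, 'c) ring_scheme \<Rightarrow> ('a, 'd) ring_scheme \<Rightarrow> ('a \<Rightarrow> 'r \<Rightarrow> 'a) \<Rightarrow> ('r, 'b) module \<Rightarrow>
   ('a \<times> 'b \<Rightarrow>\<^sub>0 int) set monoid"
  where "tensor_group R A ra B =
    free_Abelian_group (carrier A \<times> carrier B) Mod tensor_null R A ra B"

text \<open>\<open>f \<otimes> g\<close>, mapping into the tensor product of \<open>A\<close> and \<open>B\<close>. The cosets in the union coincide
  whenever \<open>f \<otimes> g\<close> is well defined.\<close>

definition tensor_map ::
  "('r, 'c) ring_scheme \<Rightarrow> ('a, 'd) ring_scheme \<Rightarrow> ('a \<Rightarrow> 'r \<Rightarrow> 'a) \<Rightarrow> ('r, 'b) module \<Rightarrow>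
   ('e \<Rightarrow> 'a) \<Rightarrow> ('f \<Rightarrow> 'b) \<Rightarrow> ('e \<times> 'f \<Rightarrow>\<^sub>0 int) set \<Rightarrow> ('a \<times> 'b \<Rightarrow>\<^sub>0 int) set"
  where "tensor_map R A ra B f g T =
    (\<Union>t\<in>T. tensor_null R A ra B #>\<^bsub>free_Abelian_group (carrier A \<times> carrier B)\<^esub>
      frag_extend (\<lambda>(a, b). frag_of (f a, g b)) t)"

text \<open>The homomorphism to \<open>N\<close> sending \<open>a \<otimes> b\<close> to \<open>\<beta> a b\<close>, for balanced \<open>\<beta>\<close>.\<close>

definition tensor_lift ::
  "('n, 'c) ring_scheme \<Rightarrow> ('a \<Rightarrow> 'b \<Rightarrow> 'n) \<Rightarrow> ('a \<times> 'b \<Rightarrow>\<^sub>0 int) set \<Rightarrow> 'n"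
  where "tensor_lift N \<beta> T =
    the_elem ((\<lambda>t. finsum N (\<lambda>(a, b). [Poly_Mapping.lookup t (a, b)] \<cdot>\<^bsub>N\<^esub> \<beta> a b) (Poly_Mapping.keys t)) ` T)"


section \<open>Monoid algebras and modules with a basis\<close>

definition supp :: "('k, 'c) ring_scheme \<Rightarrow> 'b set \<Rightarrow> ('b \<Rightarrow> 'k) \<Rightarrow> 'b set"
  where "supp K B f = {b \<in> B. f b \<noteq> \<zero>\<^bsub>K\<^esub>}"

definition fin_supp_funs :: "('k, 'c) ring_scheme \<Rightarrow> 'b set \<Rightarrow> ('b \<Rightarrow> 'k) set"
  where "fin_supp_funs K B = {f \<in> B \<rightarrow>\<^sub>E carrier K. finite (supp K B f)}"

text \<open>The formal sum \<open>c \<cdot> b\<close> in the free \<open>K\<close>-module with basis \<open>B\<close>.\<close>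

definition basis_scaled :: "('k, 'c) ring_scheme \<Rightarrow> 'b set \<Rightarrow> 'b \<Rightarrow> 'k \<Rightarrow> ('b \<Rightarrow> 'k)"
  where "basis_scaled K B b c = (\<lambda>x\<in>B. if x = b then c else \<zero>\<^bsub>K\<^esub>)"

definition monoid_algebra ::
  "('k, 'c) ring_scheme \<Rightarrow> ('m, 'd) monoid_scheme \<Rightarrow> ('m \<Rightarrow> 'k) ring"
  where "monoid_algebra K M =
    \<lparr>carrier = fin_supp_funs K (carrier M),
     monoid.mult = (\<lambda>x y. \<lambda>m\<in>carrier M. finsum K (\<lambda>(a, b). x a \<otimes>\<^bsub>K\<^esub> y b)
        {(a, b) \<in> supp K (carrier M) x \<times> supp K (carrier M) y. a \<otimes>\<^bsub>M\<^esub> b = m}),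
     one = basis_scaled K (carrier M) \<one>\<^bsub>M\<^esub> \<one>\<^bsub>K\<^esub>,
     ring.zero = (\<lambda>m\<in>carrier M. \<zero>\<^bsub>K\<^esub>),
     ring.add = (\<lambda>x y. \<lambda>m\<in>carrier M. x m \<oplus>\<^bsub>K\<^esub> y m)\<rparr>"

text \<open>The \<open>KM\<close>-module with \<open>K\<close>-basis \<open>B\<close> on which \<open>m\<close> sends a basis element \<open>b\<close> to \<open>b'\<close> if
  \<open>act m b = Some b'\<close>, and to \<open>0\<close> if \<open>act m b = None\<close>.\<close>

definition based_module ::
  "('k, 'c) ring_scheme \<Rightarrow> ('m, 'd) monoid_scheme \<Rightarrow> 'b set \<Rightarrow> ('m \<Rightarrow> 'b \<Rightarrow> 'b option) \<Rightarrow>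
   ('m \<Rightarrow> 'k, 'b \<Rightarrow> 'k) module"
  where "based_module K M B act =
    \<lparr>carrier = fin_supp_funs K B, monoid.mult = undefined, one = undefined,
     ring.zero = (\<lambda>b\<in>B. \<zero>\<^bsub>K\<^esub>),
     ring.add = (\<lambda>f g. \<lambda>b\<in>B. f b \<oplus>\<^bsub>K\<^esub> g b),
     module.smult = (\<lambda>x f. \<lambda>b\<in>B. finsum K (\<lambda>(m, b'). x m \<otimes>\<^bsub>K\<^esub> f b')
        {(m, b') \<in> supp K (carrier M) x \<times> supp K B f. act m b' = Some b})\<rparr>"

definition trivial_module ::
  "('k, 'c) ring_scheme \<Rightarrow> ('m, 'd) monoid_scheme \<Rightarrow> ('m \<Rightarrow> 'k, 'k) module"
  where "trivial_module K M =
    \<lparr>carrier = carrier K, monoid.mult = undefined, one = undefined,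
     ring.zero = \<zero>\<^bsub>K\<^esub>, ring.add = ring.add K,
     module.smult = (\<lambda>x c. (\<Oplus>\<^bsub>K\<^esub>m\<in>supp K (carrier M) x. x m) \<otimes>\<^bsub>K\<^esub> c)\<rparr>"

text \<open>The \<open>KM\<close>-module obtained from a \<open>KG\<close>-module along a homomorphism \<open>\<psi>\<close> from \<open>M\<close> to \<open>G\<close>.\<close>

definition inflation ::
  "('k, 'c) ring_scheme \<Rightarrow> ('m, 'd) monoid_scheme \<Rightarrow> ('g, 'e) monoid_scheme \<Rightarrow> ('m \<Rightarrow> 'g) \<Rightarrow>
   ('g \<Rightarrow> 'k, 'v) module \<Rightarrow> ('m \<Rightarrow> 'k, 'v) module"
  where "inflation K M G \<psi> V =
    \<lparr>carrier = carrier V, monoid.mult = undefined, one = undefined,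
     ring.zero = \<zero>\<^bsub>V\<^esub>, ring.add = ring.add V,
     module.smult = (\<lambda>x v. (\<lambda>g\<in>carrier G. \<Oplus>\<^bsub>K\<^esub>m\<in>{m \<in> supp K (carrier M) x. \<psi> m = g}. x m) \<odot>\<^bsub>V\<^esub> v)\<rparr>"

text \<open>A \<open>KM\<close>-module is a \<open>K\<close>-vector space through \<open>c \<cdot> v = (c 1) v\<close>. Tensor products over \<open>K\<close> of
  \<open>KM\<close>-modules are taken with respect to this structure (on the left factor written as a right action).\<close>

definition scalar_mult ::
  "('k, 'c) ring_scheme \<Rightarrow> ('m, 'd) monoid_scheme \<Rightarrow> ('m \<Rightarrow> 'k, 'v) module \<Rightarrow> 'k \<Rightarrow> 'v \<Rightarrow> 'v"
  where "scalar_mult K M V c v = basis_scaled K (carrier M) \<one>\<^bsub>M\<^esub> c \<odot>\<^bsub>V\<^esub> v"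

definition underlying_vs ::
  "('k, 'c) ring_scheme \<Rightarrow> ('m, 'd) monoid_scheme \<Rightarrow> ('m \<Rightarrow> 'k, 'v) module \<Rightarrow> ('k, 'v) module"
  where "underlying_vs K M V =
    \<lparr>carrier = carrier V, monoid.mult = undefined, one = undefined,
     ring.zero = \<zero>\<^bsub>V\<^esub>, ring.add = ring.add V, module.smult = scalar_mult K M V\<rparr>"

definition K_tensor_group ::
  "('k, 'c) ring_scheme \<Rightarrow> ('m, 'd) monoid_scheme \<Rightarrow> ('m \<Rightarrow> 'k, 'u) module \<Rightarrow>
   ('m \<Rightarrow> 'k, 'v) module \<Rightarrow> ('u \<times> 'v \<Rightarrow>\<^sub>0 int) set monoid"
  where "K_tensor_group K M U V =
    tensor_group K U (\<lambda>u c. scalar_mult K M U c u) (underlying_vs K M V)"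

definition K_tensor_map ::
  "('k, 'c) ring_scheme \<Rightarrow> ('m, 'd) monoid_scheme \<Rightarrow> ('m \<Rightarrow> 'k, 'u) module \<Rightarrow>
   ('m \<Rightarrow> 'k, 'v) module \<Rightarrow> ('s \<Rightarrow> 'u) \<Rightarrow> ('t \<Rightarrow> 'v) \<Rightarrow>
   ('s \<times> 't \<Rightarrow>\<^sub>0 int) set \<Rightarrow> ('u \<times> 'v \<Rightarrow>\<^sub>0 int) set"
  where "K_tensor_map K M U V =
    tensor_map K U (\<lambda>u c. scalar_mult K M U c u) (underlying_vs K M V)"

text \<open>The diagonal action \<open>m (u \<otimes> v) = m u \<otimes> m v\<close>, extended linearly to \<open>KM\<close>: the coefficient \<open>x m\<close>
  is absorbed in the left factor.\<close>

definition diagonal_tensor ::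
  "('k, 'c) ring_scheme \<Rightarrow> ('m, 'd) monoid_scheme \<Rightarrow> ('m \<Rightarrow> 'k, 'u) module \<Rightarrow>
   ('m \<Rightarrow> 'k, 'v) module \<Rightarrow> ('m \<Rightarrow> 'k, ('u \<times> 'v \<Rightarrow>\<^sub>0 int) set) module"
  where "diagonal_tensor K M U V =
    \<lparr>carrier = carrier (K_tensor_group K M U V), monoid.mult = undefined, one = undefined,
     ring.zero = \<one>\<^bsub>K_tensor_group K M U V\<^esub>, ring.add = monoid.mult (K_tensor_group K M U V),
     module.smult = (\<lambda>x T. \<Otimes>\<^bsub>K_tensor_group K M U V\<^esub>m\<in>supp K (carrier M) x.
        K_tensor_map K M U V
          (\<lambda>u. basis_scaled K (carrier M) m (x m) \<odot>\<^bsub>U\<^esub> u)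
          (\<lambda>v. basis_scaled K (carrier M) m \<one>\<^bsub>K\<^esub> \<odot>\<^bsub>V\<^esub> v) T)\<rparr>"


section \<open>Green's relations, maximal subgroups and induced modules\<close>

definition regular_monoid :: "('m, 'd) monoid_scheme \<Rightarrow> bool"
  where "regular_monoid M \<longleftrightarrow>
    (\<forall>m\<in>carrier M. \<exists>n\<in>carrier M. m \<otimes>\<^bsub>M\<^esub> n \<otimes>\<^bsub>M\<^esub> m = m)"

definition idempotents :: "('m, 'd) monoid_scheme \<Rightarrow> 'm set"
  where "idempotents M = {e \<in> carrier M. e \<otimes>\<^bsub>M\<^esub> e = e}"

definition right_ideal :: "('m, 'd) monoid_scheme \<Rightarrow> 'm \<Rightarrow> 'm set"
  where "right_ideal M a = a <#\<^bsub>M\<^esub> carrier M"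

definition left_ideal :: "('m, 'd) monoid_scheme \<Rightarrow> 'm \<Rightarrow> 'm set"
  where "left_ideal M a = carrier M #>\<^bsub>M\<^esub> a"

definition two_sided_ideal :: "('m, 'd) monoid_scheme \<Rightarrow> 'm \<Rightarrow> 'm set"
  where "two_sided_ideal M a = carrier M <#>\<^bsub>M\<^esub> right_ideal M a"

definition R_class :: "('m, 'd) monoid_scheme \<Rightarrow> 'm \<Rightarrow> 'm set"
  where "R_class M a = {b \<in> carrier M. right_ideal M b = right_ideal M a}"

definition L_class :: "('m, 'd) monoid_scheme \<Rightarrow> 'm \<Rightarrow> 'm set"
  where "L_class M a = {b \<in> carrier M. left_ideal M b = left_ideal M a}"

definition J_class :: "('m, 'd) monoid_scheme \<Rightarrow> 'm \<Rightarrow> 'm set"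
  where "J_class M a = {b \<in> carrier M. two_sided_ideal M b = two_sided_ideal M a}"

definition local_monoid :: "('m, 'd) monoid_scheme \<Rightarrow> 'm \<Rightarrow> 'm monoid"
  where "local_monoid M e =
    \<lparr>carrier = {e \<otimes>\<^bsub>M\<^esub> m \<otimes>\<^bsub>M\<^esub> e | m. m \<in> carrier M}, monoid.mult = monoid.mult M, one = e\<rparr>"

definition maximal_subgroup :: "('m, 'd) monoid_scheme \<Rightarrow> 'm \<Rightarrow> 'm monoid"
  where "maximal_subgroup M e = units_of (local_monoid M e)"

definition KL_module ::
  "('k, 'c) ring_scheme \<Rightarrow> ('m, 'd) monoid_scheme \<Rightarrow> 'm \<Rightarrow> ('m \<Rightarrow> 'k, 'm \<Rightarrow> 'k) module"
  where "KL_module K M e = based_module K M (L_class M e)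
    (\<lambda>m l. if m \<otimes>\<^bsub>M\<^esub> l \<in> L_class M e then Some (m \<otimes>\<^bsub>M\<^esub> l) else None)"

text \<open>The right action of \<open>KG\<^sub>e\<close> on \<open>KL\<^sub>e\<close>; note that \<open>L\<^sub>e G\<^sub>e = L\<^sub>e\<close>.\<close>

definition KL_right_action ::
  "('k, 'c) ring_scheme \<Rightarrow> ('m, 'd) monoid_scheme \<Rightarrow> 'm \<Rightarrow> ('m \<Rightarrow> 'k) \<Rightarrow> ('m \<Rightarrow> 'k) \<Rightarrow> ('m \<Rightarrow> 'k)"
  where "KL_right_action K M e f y = (\<lambda>l\<in>L_class M e. finsum K (\<lambda>(l', g). f l' \<otimes>\<^bsub>K\<^esub> y g)
      {(l', g) \<in> supp K (L_class M e) f \<times> supp K (carrier (maximal_subgroup M e)) y.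
         l' \<otimes>\<^bsub>M\<^esub> g = l})"

definition Ind ::
  "('k, 'c) ring_scheme \<Rightarrow> ('m, 'd) monoid_scheme \<Rightarrow> 'm \<Rightarrow> ('m \<Rightarrow> 'k, 'w) module \<Rightarrow>
   ('m \<Rightarrow> 'k, (('m \<Rightarrow> 'k) \<times> 'w \<Rightarrow>\<^sub>0 int) set) module"
  where "Ind K M e W =
    (let R = monoid_algebra K (maximal_subgroup M e);
         L = KL_module K M e;
         ra = KL_right_action K M e;
         T = tensor_group R L ra W
     in \<lparr>carrier = carrier T, monoid.mult = undefined, one = undefined,
         ring.zero = \<one>\<^bsub>T\<^esub>, ring.add = monoid.mult T,
         module.smult = (\<lambda>x. tensor_map R L ra W (\<lambda>a. x \<odot>\<^bsub>L\<^esub> a) (\<lambda>w. w))\<rparr>)"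

text \<open>The filtration is \<open>F 0 \<subseteq> \<dots> \<subseteq> F n\<close>. The modules \<open>W\<close> range over modules carried by the type of \<open>C\<close>.
  This loses nothing, since \<open>W\<close> embeds as a set into \<open>Ind\<^sub>e(W)\<close> and hence into the
  subquotient of \<open>C\<close> isomorphic to it.\<close>

definition filtered_by_induced ::
  "('k, 'c) ring_scheme \<Rightarrow> ('m, 'd) monoid_scheme \<Rightarrow> ('m \<Rightarrow> 'k, 'a) module \<Rightarrow> bool"
  where "filtered_by_induced K M C \<longleftrightarrow>
    (\<exists>(F :: nat \<Rightarrow> 'a set) (n :: nat).
       F 0 = {\<zero>\<^bsub>C\<^esub>} \<and> F n = carrier C \<and>
       (\<forall>i\<le>n. submodule (F i) (monoid_algebra K M) C) \<and>
       (\<forall>i<n. F i \<subseteq> F (Suc i) \<and>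
         (\<exists>e\<in>idempotents M. \<exists>W :: ('m \<Rightarrow> 'k, 'a) module.
            left_module (monoid_algebra K (maximal_subgroup M e)) W \<and>
            left_module_iso (monoid_algebra K M)
              (quotient_module (C\<lparr>carrier := F (Suc i)\<rparr>) (F i)) (Ind K M e W))))"


section \<open>Sandwich matrices and characteristic\<close>

text \<open>The row index \<open>b\<close> is an \<open>\<L>\<close>-class and the column index \<open>a\<close> an \<open>\<R>\<close>-class.\<close>

definition sandwich_matrix ::
  "('k, 'c) ring_scheme \<Rightarrow> ('m, 'd) monoid_scheme \<Rightarrow> 'm \<Rightarrow> ('m set \<Rightarrow> 'm) \<Rightarrow> ('m set \<Rightarrow> 'm) \<Rightarrow>
   'm set \<Rightarrow> 'm set \<Rightarrow> ('m \<Rightarrow> 'k)"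
  where "sandwich_matrix K M e r l b a =
    (if l b \<otimes>\<^bsub>M\<^esub> r a \<in> carrier (maximal_subgroup M e)
     then basis_scaled K (carrier (maximal_subgroup M e)) (l b \<otimes>\<^bsub>M\<^esub> r a) \<one>\<^bsub>K\<^esub>
     else \<zero>\<^bsub>monoid_algebra K (maximal_subgroup M e)\<^esub>)"

definition right_invertible_matrix ::
  "('r, 'c) ring_scheme \<Rightarrow> 'b set \<Rightarrow> 'a set \<Rightarrow> ('b \<Rightarrow> 'a \<Rightarrow> 'r) \<Rightarrow> bool"
  where "right_invertible_matrix R B A P \<longleftrightarrow>
    (\<exists>Q :: 'a \<Rightarrow> 'b \<Rightarrow> 'r. (\<forall>a\<in>A. \<forall>b\<in>B. Q a b \<in> carrier R) \<and>
      (\<forall>b\<in>B. \<forall>b'\<in>B. (\<Oplus>\<^bsub>R\<^esub>a\<in>A. P b a \<otimes>\<^bsub>R\<^esub> Q a b') = (if b = b' then \<one>\<^bsub>R\<^esub> else \<zero>\<^bsub>R\<^esub>)))"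

text \<open>Right invertibility does not depend on the choices of \<open>e\<close>, \<open>r\<close> and \<open>l\<close>.\<close>

definition sandwich_right_invertible ::
  "('k, 'c) ring_scheme \<Rightarrow> ('m, 'd) monoid_scheme \<Rightarrow> 'm set \<Rightarrow> bool"
  where "sandwich_right_invertible K M J \<longleftrightarrow>
    (\<exists>e\<in>J \<inter> idempotents M. \<exists>r l.
       (\<forall>a\<in>R_class M ` J. r a \<in> a \<and> r a \<in> L_class M e) \<and>
       (\<forall>b\<in>L_class M ` J. l b \<in> b \<and> l b \<in> R_class M e) \<and>
       right_invertible_matrix (monoid_algebra K (maximal_subgroup M e))
         (L_class M ` J) (R_class M ` J) (sandwich_matrix K M e r l))"

text \<open>The function \<^const>\<open>group.ord\<close> is \<open>0\<close> on elements of infinite order.\<close>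

definition ring_char :: "('k, 'c) ring_scheme \<Rightarrow> nat"
  where "ring_char K = group.ord (add_monoid K) \<one>\<^bsub>K\<^esub>"


section \<open>The order complex of the poset of principal right ideals\<close>

definition principal_right_ideals :: "('m, 'd) monoid_scheme \<Rightarrow> 'm set set"
  where "principal_right_ideals M = right_ideal M ` carrier M"

text \<open>A \<open>q\<close>-simplex of the order complex, oriented by the order, is the increasing list of its
  \<open>q + 1\<close> vertices.\<close>

definition strict_chains :: "'p::order set \<Rightarrow> nat \<Rightarrow> 'p list set"
  where "strict_chains P q = {\<sigma>. set \<sigma> \<subseteq> P \<and> length \<sigma> = Suc q \<and> sorted_wrt (<) \<sigma>}"

definition face :: "nat \<Rightarrow> 'p list \<Rightarrow> 'p list"
  where "face i \<sigma> = take i \<sigma> @ drop (Suc i) \<sigma>"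

definition chain_module ::
  "('k, 'c) ring_scheme \<Rightarrow> ('m, 'd) monoid_scheme \<Rightarrow> nat \<Rightarrow> ('m \<Rightarrow> 'k, 'm set list \<Rightarrow> 'k) module"
  where "chain_module K M q = based_module K M (strict_chains (principal_right_ideals M) q)
    (\<lambda>m \<sigma>. let \<tau> = map (\<lambda>I. m <#\<^bsub>M\<^esub> I) \<sigma> in if distinct \<tau> then Some \<tau> else None)"

definition boundary ::
  "('k, 'c) ring_scheme \<Rightarrow> ('m, 'd) monoid_scheme \<Rightarrow> nat \<Rightarrow>
   ('m set list \<Rightarrow> 'k) \<Rightarrow> ('m set list \<Rightarrow> 'k)"
  where "boundary K M q f = (\<lambda>\<tau>\<in>strict_chains (principal_right_ideals M) q.
      finsum K (\<lambda>(\<sigma>, i). if even i then f \<sigma> else \<ominus>\<^bsub>K\<^esub> f \<sigma>)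
        {(\<sigma>, i). \<sigma> \<in> strict_chains (principal_right_ideals M) (Suc q) \<and> i \<le> Suc q \<and> face i \<sigma> = \<tau>})"

definition augmentation ::
  "('k, 'c) ring_scheme \<Rightarrow> ('m, 'd) monoid_scheme \<Rightarrow> ('m set list \<Rightarrow> 'k) \<Rightarrow> 'k"
  where "augmentation K M f = (\<Oplus>\<^bsub>K\<^esub>\<sigma>\<in>strict_chains (principal_right_ideals M) 0. f \<sigma>)"

definition chain_module_coeff ::
  "('k, 'c) ring_scheme \<Rightarrow> ('m, 'd) monoid_scheme \<Rightarrow> ('m \<Rightarrow> 'k, 'v) module \<Rightarrow> nat \<Rightarrow>
   ('m \<Rightarrow> 'k, (('m set list \<Rightarrow> 'k) \<times> 'v \<Rightarrow>\<^sub>0 int) set) module"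
  where "chain_module_coeff K M V q = diagonal_tensor K M (chain_module K M q) V"

definition boundary_coeff ::
  "('k, 'c) ring_scheme \<Rightarrow> ('m, 'd) monoid_scheme \<Rightarrow> ('m \<Rightarrow> 'k, 'v) module \<Rightarrow> nat \<Rightarrow>
   (('m set list \<Rightarrow> 'k) \<times> 'v \<Rightarrow>\<^sub>0 int) set \<Rightarrow> (('m set list \<Rightarrow> 'k) \<times> 'v \<Rightarrow>\<^sub>0 int) set"
  where "boundary_coeff K M V q =
    K_tensor_map K M (chain_module K M q) V (boundary K M q) (\<lambda>v. v)"

text \<open>The augmentation tensored with \<open>V\<close>, followed by the identification of \<open>K \<otimes> V\<close> with \<open>V\<close>.\<close>

definition augmentation_coeff ::
  "('k, 'c) ring_scheme \<Rightarrow> ('m, 'd) monoid_scheme \<Rightarrow> ('m \<Rightarrow> 'k, 'v) module \<Rightarrow>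
   (('m set list \<Rightarrow> 'k) \<times> 'v \<Rightarrow>\<^sub>0 int) set \<Rightarrow> 'v"
  where "augmentation_coeff K M V =
    tensor_lift V (\<lambda>f v. scalar_mult K M V (augmentation K M f) v)"


section \<open>The universal group of a monoid\<close>

text \<open>The group presented by generators \<open>m \<in> M\<close> and relations \<open>m \<cdot> n = mn\<close>. In a word, \<open>(m, True)\<close>
  stands for the generator \<open>m\<close> and \<open>(m, False)\<close> for its inverse. The identity of \<open>M\<close> becomes trivial
  because it is idempotent.\<close>

definition words :: "('m, 'd) monoid_scheme \<Rightarrow> ('m \<times> bool) list set"
  where "words M = lists (carrier M \<times> UNIV)"

inductive_set word_rel ::
  "('m, 'd) monoid_scheme \<Rightarrow> (('m \<times> bool) list \<times> ('m \<times> bool) list) set"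
  for M :: "('m, 'd) monoid_scheme"
  where
    refl: "w \<in> words M \<Longrightarrow> (w, w) \<in> word_rel M"
  | sym: "(v, w) \<in> word_rel M \<Longrightarrow> (w, v) \<in> word_rel M"
  | trans: "(u, v) \<in> word_rel M \<Longrightarrow> (v, w) \<in> word_rel M \<Longrightarrow> (u, w) \<in> word_rel M"
  | cancel: "\<lbrakk>u \<in> words M; v \<in> words M; m \<in> carrier M\<rbrakk>
      \<Longrightarrow> (u @ [(m, b), (m, \<not> b)] @ v, u @ v) \<in> word_rel M"
  | mult: "\<lbrakk>u \<in> words M; v \<in> words M;
        m \<in> carrier M; n \<in> carrier M\<rbrakk>
      \<Longrightarrow> (u @ [(m, True), (n, True)] @ v, u @ [(m \<otimes>\<^bsub>M\<^esub> n, True)] @ v) \<in> word_rel M"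

definition universal_group :: "('m, 'd) monoid_scheme \<Rightarrow> ('m \<times> bool) list set monoid"
  where "universal_group M =
    \<lparr>carrier = words M // word_rel M,
     monoid.mult = (\<lambda>S Y. \<Union>x\<in>S. \<Union>y\<in>Y. word_rel M `` {x @ y}),
     one = word_rel M `` {[]}\<rparr>"

definition universal_map :: "('m, 'd) monoid_scheme \<Rightarrow> 'm \<Rightarrow> ('m \<times> bool) list set"
  where "universal_map M m = word_rel M `` {[(m, True)]}"


lemma words_simps [simp]:
  "[] \<in> words M"
  "(m, b) # w \<in> words M \<longleftrightarrow> m \<in> carrier M \<and> w \<in> words M"
  "v @ w \<in> words M \<longleftrightarrow> v \<in> words M \<and> w \<in> words M"
  by (auto simp: words_def)

lemma words_induct [consumes 1, case_names Nil Cons]: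
  assumes "w \<in> words M" "P []"
    "\<And>m b w. \<lbrakk>m \<in> carrier M; w \<in> words M; P w\<rbrakk> \<Longrightarrow> P ((m, b) # w)"
  shows "P w"
  using assms(1) by (induction w) (auto simp: assms)

lemma word_rel_lists:
  assumes "monoid M" "(v, w) \<in> word_rel M"
  shows "v \<in> words M \<and> w \<in> words M"
  using assms(2) by induction (auto intro: monoid.m_closed[OF assms(1)])

lemma equiv_word_rel:
  assumes "monoid M"
  shows "equiv (words M) (word_rel M)"
proof (rule equivI)
  show "word_rel M \<subseteq> words M \<times> words M"
    using word_rel_lists[OF assms] by auto
  show "refl_on (words M) (word_rel M)"
    by (rule refl_onI) (rule word_rel.refl)
  show "Relation.sym (word_rel M)" by (rule symI) (rule word_rel.sym)
  show "Relation.trans (word_rel M)" by (rule transI) (rule word_rel.trans)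
qed

lemma word_rel_append_left:
  assumes "(v, w) \<in> word_rel M" "u \<in> words M"
  shows "(u @ v, u @ w) \<in> word_rel M"
  using assms(1)
proof induction
  case (cancel u' v m b)
  then show ?case using word_rel.cancel[of "u @ u'" M v m b] assms(2) by simp
next
  case (mult u' v m n)
  then show ?case using word_rel.mult[of "u @ u'" M v m n] assms(2) by simp
qed (use assms(2) in \<open>auto intro: word_rel.intros(1-3)\<close>)

lemma word_rel_append_right:
  assumes "(v, w) \<in> word_rel M" "u \<in> words M"
  shows "(v @ u, w @ u) \<in> word_rel M"
  using assms(1)
proof induction
  case (cancel u' v m b)
  then show ?case using word_rel.cancel[of u' M "v @ u" m b] assms(2) by simp
next
  case (mult u' v m n)
  then show ?case using word_rel.mult[of u' M "v @ u" m n] assms(2) by simp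
qed (use assms(2) in \<open>auto intro: word_rel.intros(1-3)\<close>)

lemma universal_group_mult_class:
  assumes "monoid M" "x \<in> words M" "y \<in> words M"
  shows "word_rel M `` {x} \<otimes>\<^bsub>universal_group M\<^esub> word_rel M `` {y} = word_rel M `` {x @ y}"
proof -
  note eq = equiv_word_rel[OF assms(1)]
  have *: "word_rel M `` {x' @ y'} = word_rel M `` {x @ y}"
    if "(x, x') \<in> word_rel M" "(y, y') \<in> word_rel M" for x' y'
  proof -
    have "(x @ y, x' @ y') \<in> word_rel M"
      using that word_rel_lists[OF assms(1) that(1)] assms(3)
      by (blast intro: word_rel.trans word_rel_append_left word_rel_append_right)
    then show ?thesis using equiv_class_eq[OF eq] by blast
  qed
  have "word_rel M `` {x} \<otimes>\<^bsub>universal_group M\<^esub> word_rel M `` {y}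
      = (\<Union>x'\<in>word_rel M `` {x}. \<Union>y'\<in>word_rel M `` {y}. word_rel M `` {x' @ y'})"
    by (simp add: universal_group_def)
  also have "\<dots> = (\<Union>x'\<in>word_rel M `` {x}. \<Union>y'\<in>word_rel M `` {y}. word_rel M `` {x @ y})"
    by (intro SUP_cong HOL.refl *) (simp_all only: Image_singleton_iff)
  also have "\<dots> = word_rel M `` {x @ y}"
    using word_rel.refl[OF assms(2)] word_rel.refl[OF assms(3)] by blast
  finally show ?thesis .
qed

lemma universal_group_carrierE:
  assumes "S \<in> carrier (universal_group M)"
  obtains x where "x \<in> words M" "S = word_rel M `` {x}"
  using assms by (auto simp: universal_group_def elim: quotientE)

lemma universal_group_classI:
  "x \<in> words M \<Longrightarrow> word_rel M `` {x} \<in> carrier (universal_group M)"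
  by (simp add: universal_group_def quotientI)

lemma universal_group_one: "\<one>\<^bsub>universal_group M\<^esub> = word_rel M `` {[]}"
  by (simp add: universal_group_def)

lemma word_rel_inverse:
  assumes "w \<in> words M"
  shows "(rev (map (\<lambda>(m, b). (m, \<not> b)) w) @ w, []) \<in> word_rel M"
  using assms
proof (induction rule: words_induct)
  case Nil
  then show ?case by (simp add: word_rel.refl)
next
  case (Cons m b w)
  let ?v = "rev (map (\<lambda>(m, b). (m, \<not> b)) w)"
  note m = Cons.hyps(1) and w = Cons.hyps(2)
  have v: "?v \<in> words M" using w by (auto simp: in_lists_conv_set words_def)
  have "(?v @ [(m, \<not> b), (m, \<not> \<not> b)] @ w, ?v @ w) \<in> word_rel M"
    using v w m by (rule word_rel.cancel)
  then show ?case using word_rel.trans[OF _ Cons.IH] by simp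
qed

lemma group_universal_group:
  assumes "monoid M"
  shows "group (universal_group M)"
proof (rule groupI)
  fix S Y assume "S \<in> carrier (universal_group M)" "Y \<in> carrier (universal_group M)"
  then show "S \<otimes>\<^bsub>universal_group M\<^esub> Y \<in> carrier (universal_group M)"
    using assms
    by (auto elim!: universal_group_carrierE simp: universal_group_mult_class
        intro!: universal_group_classI)
next
  show "\<one>\<^bsub>universal_group M\<^esub> \<in> carrier (universal_group M)"
    by (simp add: universal_group_one universal_group_classI)
next
  fix S Y Z assume "S \<in> carrier (universal_group M)" "Y \<in> carrier (universal_group M)"
    "Z \<in> carrier (universal_group M)"
  then obtain x y z where xyz: "x \<in> words M" "S = word_rel M `` {x}"
    "y \<in> words M" "Y = word_rel M `` {y}"
    "z \<in> words M" "Z = word_rel M `` {z}"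
    by (meson universal_group_carrierE)
  then show "S \<otimes>\<^bsub>universal_group M\<^esub> Y \<otimes>\<^bsub>universal_group M\<^esub> Z =
      S \<otimes>\<^bsub>universal_group M\<^esub> (Y \<otimes>\<^bsub>universal_group M\<^esub> Z)"
    by (simp add: universal_group_mult_class[OF assms])
next
  fix S assume "S \<in> carrier (universal_group M)"
  then obtain x where x: "x \<in> words M" "S = word_rel M `` {x}"
    by (rule universal_group_carrierE)
  show "\<one>\<^bsub>universal_group M\<^esub> \<otimes>\<^bsub>universal_group M\<^esub> S = S"
    unfolding x(2) universal_group_one
    by (subst universal_group_mult_class[OF assms _ x(1)]) auto
  let ?y = "rev (map (\<lambda>(m, b). (m, \<not> b)) x)"
  have y: "?y \<in> words M" using x(1) by (auto simp: in_lists_conv_set words_def)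
  have "word_rel M `` {?y} \<otimes>\<^bsub>universal_group M\<^esub> S = \<one>\<^bsub>universal_group M\<^esub>"
    unfolding x(2) universal_group_one universal_group_mult_class[OF assms y x(1)]
    by (rule equiv_class_eq[OF equiv_word_rel[OF assms] word_rel_inverse[OF x(1)]])
  then show "\<exists>Y\<in>carrier (universal_group M). Y \<otimes>\<^bsub>universal_group M\<^esub> S = \<one>\<^bsub>universal_group M\<^esub>"
    using universal_group_classI[OF y] by blast
qed

lemma universal_map_hom:
  assumes "monoid M"
  shows "universal_map M \<in> hom M (universal_group M)"
proof (rule homI)
  fix m n assume mn: "m \<in> carrier M" "n \<in> carrier M"
  show "universal_map M m \<in> carrier (universal_group M)"
    using mn by (simp add: universal_map_def universal_group_classI)
  have "([(m, True), (n, True)], [(m \<otimes>\<^bsub>M\<^esub> n, True)]) \<in> word_rel M"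
    using word_rel.mult[of "[]" M "[]" m n] mn by simp
  then show "universal_map M (m \<otimes>\<^bsub>M\<^esub> n) =
      universal_map M m \<otimes>\<^bsub>universal_group M\<^esub> universal_map M n"
    using mn equiv_class_eq[OF equiv_word_rel[OF assms]]
    by (simp add: universal_map_def universal_group_mult_class[OF assms])
qed

text \<open>The universal property, for groups \<open>H\<close> of any type.\<close>

fun word_value :: "('h, 'e) monoid_scheme \<Rightarrow> ('m \<Rightarrow> 'h) \<Rightarrow> ('m \<times> bool) list \<Rightarrow> 'h" where
  "word_value H h [] = \<one>\<^bsub>H\<^esub>"
| "word_value H h ((m, b) # w) = (if b then h m else inv\<^bsub>H\<^esub> (h m)) \<otimes>\<^bsub>H\<^esub> word_value H h w"

lemma universal_group_exists_hom:
  fixes M :: "('m, 'd) monoid_scheme" and H :: "('h, 'e) monoid_scheme"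
  assumes M: "monoid M" and H: "group H" and h: "h \<in> hom M H"
  shows "\<exists>\<phi>\<in>hom (universal_group M) H. \<forall>m\<in>carrier M. \<phi> (universal_map M m) = h m"
proof -
  interpret H: group H by (rule H)
  have hc: "h m \<in> carrier H" if "m \<in> carrier M" for m using h that by (auto simp: hom_def)
  have vc: "word_value H h w \<in> carrier H" if "w \<in> words M" for w
    using that by (induction rule: words_induct) (auto simp: hc)
  have app: "word_value H h (v @ w) = word_value H h v \<otimes>\<^bsub>H\<^esub> word_value H h w"
    if "v \<in> words M" "w \<in> words M" for v w
    using that(1) by (induction rule: words_induct) (auto simp: hc vc that(2) H.m_assoc)
  have inv: "word_value H h v = word_value H h w" if "(v, w) \<in> word_rel M" for v w
    using that
  proof induction
    case (cancel u v m b)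
    have 1: "word_value H h [(m, b), (m, \<not> b)] = \<one>\<^bsub>H\<^esub>" using cancel hc by simp
    have 2: "[(m, b), (m, \<not> b)] \<in> words M" "[(m, b), (m, \<not> b)] @ v \<in> words M"
      using cancel by auto
    show ?case using cancel(1,2) 1 2 vc
      by (simp only: app) simp
  next
    case (mult u v m n)
    have "word_value H h [(m, True), (n, True)] = word_value H h [(m \<otimes>\<^bsub>M\<^esub> n, True)]"
      using mult hc monoid.m_closed[OF M] h by (simp add: hom_def)
    moreover have "[(m, True), (n, True)] \<in> words M"
      "[(m \<otimes>\<^bsub>M\<^esub> n, True)] \<in> words M"
      using mult monoid.m_closed[OF M] by auto
    ultimately show ?case using mult(1,2) by (simp only: app words_simps simp_thms)
  qed auto
  define \<phi> where "\<phi> S = word_value H h (SOME x. x \<in> S)" for S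
  have \<phi>: "\<phi> (word_rel M `` {x}) = word_value H h x" if "x \<in> words M" for x
  proof -
    have "(SOME y. y \<in> word_rel M `` {x}) \<in> word_rel M `` {x}"
      by (rule someI[of _ x]) (simp add: word_rel.refl[OF that])
    then show ?thesis unfolding \<phi>_def using inv by auto
  qed
  have "\<phi> \<in> hom (universal_group M) H"
  proof (rule homI)
    fix S Y assume "S \<in> carrier (universal_group M)" "Y \<in> carrier (universal_group M)"
    then obtain x y where xy: "x \<in> words M" "S = word_rel M `` {x}"
      "y \<in> words M" "Y = word_rel M `` {y}"
      by (meson universal_group_carrierE)
    show "\<phi> S \<in> carrier H" using xy \<phi> vc by simp
    have "x @ y \<in> words M" using xy by simp
    then show "\<phi> (S \<otimes>\<^bsub>universal_group M\<^esub> Y) = \<phi> S \<otimes>\<^bsub>H\<^esub> \<phi> Y"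
      unfolding xy(2,4) universal_group_mult_class[OF M xy(1,3)]
      by (simp only: \<phi> xy(1,3) app)
  qed
  moreover have "\<phi> (universal_map M m) = h m" if "m \<in> carrier M" for m
    unfolding universal_map_def using \<phi>[of "[(m, True)]"] that hc by simp
  ultimately show ?thesis by blast
qed

lemma universal_group_unique_hom:
  assumes M: "monoid M" and H: "group H"
    and "\<phi> \<in> hom (universal_group M) H" "\<phi>' \<in> hom (universal_group M) H"
    and eq: "\<forall>m\<in>carrier M. \<phi> (universal_map M m) = \<phi>' (universal_map M m)"
    and S: "S \<in> carrier (universal_group M)"
  shows "\<phi> S = \<phi>' S"
proof -
  interpret a: group_hom "universal_group M" H \<phi>
    using group_universal_group[OF M] H assms(3) by (simp add: group_hom_def group_hom_axioms_def)
  interpret b: group_hom "universal_group M" H \<phi>'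
    using group_universal_group[OF M] H assms(4) by (simp add: group_hom_def group_hom_axioms_def)
  have "\<phi> (word_rel M `` {x}) = \<phi>' (word_rel M `` {x})" if "x \<in> words M" for x
    using that
  proof (induction rule: words_induct)
    case Nil
    show ?case using a.hom_one b.hom_one by (simp add: universal_group_one)
  next
    case (Cons m b x)
    note m = Cons.hyps(1) and x = Cons.hyps(2)
    have c: "word_rel M `` {[(m, b)]} \<in> carrier (universal_group M)" for b
      using m by (simp add: universal_group_classI)
    have "word_rel M `` {[(m, False)]} \<otimes>\<^bsub>universal_group M\<^esub> word_rel M `` {[(m, True)]}
        = \<one>\<^bsub>universal_group M\<^esub>"
      using m word_rel.cancel[of "[]" M "[]" m False] equiv_class_eq[OF equiv_word_rel[OF M]]
      by (simp add: universal_group_mult_class[OF M] universal_group_one)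
    then have i: "word_rel M `` {[(m, False)]} = inv\<^bsub>universal_group M\<^esub> (universal_map M m)"
      unfolding universal_map_def using a.G.inv_equality c by metis
    have "\<phi> (word_rel M `` {[(m, b)]}) = \<phi>' (word_rel M `` {[(m, b)]})"
    proof (cases b)
      case True
      then show ?thesis using eq m by (simp add: universal_map_def)
    next
      case False
      then show ?thesis using eq m i c[of True] a.hom_inv b.hom_inv
        by (simp add: universal_map_def)
    qed
    moreover have "word_rel M `` {(m, b) # x} =
        word_rel M `` {[(m, b)]} \<otimes>\<^bsub>universal_group M\<^esub> word_rel M `` {x}"
      using universal_group_mult_class[OF M, of "[(m, b)]" x] m x by simp
    ultimately show ?case
      using Cons.IH a.hom_mult[OF c universal_group_classI[OF x]]
        b.hom_mult[OF c universal_group_classI[OF x]] by simp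
  qed
  then show ?thesis using S by (auto elim: universal_group_carrierE)
qed

end

theory Submission
  imports Defs
begin

text \<open>The poset \<open>M/\<R>\<close> has the greatest element \<open>M\<close>, so its order complex is a cone and the
  augmented chain complex is contractible by a linear homotopy, which survives tensoring with \<open>V\<close>.

  The chains whose top lies in a fixed ideal span a submodule. Removing a \<open>\<J>\<close>-class \<open>J\<close> with
  idempotent \<open>f\<close> from the ideal leaves the chains with top in \<open>J\<close>; each of these is \<open>a \<tau>\<close> with
  \<open>a \<in> L\<^sub>f\<close> and \<open>\<tau>\<close> a chain with top \<open>fM\<close>, uniquely up to \<open>G\<^sub>f\<close>. So the subquotient is induced
  from the permutation module on the chains with top \<open>fM\<close>.

  Right inverses of the sandwich matrices provide, one \<open>\<J>\<close>-class at a time, a right identity \<open>\<eta>\<close>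
  of the ideal algebra \<open>KI\<close> of every ideal \<open>I\<close>. Then \<open>1 - \<eta>\<close> annihilates \<open>KI\<close> on the right, which
  allows one to extend lifts of homomorphisms from the chains below \<open>I\<close> over the next layer; averaging
  over \<open>G\<^sub>f\<close> makes the extension well defined. Hence the chain modules are projective. Tensoring with a
  module on which \<open>M\<close> acts through a group preserves projectivity.\<close>

section \<open>Additive maps and finite sums\<close>

text \<open>What the hypotheses are for. Modulo the smaller ideal, the algebra of a J-class is a
  Munn algebra: matrices X, Y over KG_f with product XPY, where P is the sandwich matrix. A right
  identity of it is a matrix Q with PQ = I, so right invertibility of P is exactly what the right
  identity of a layer asks for; the identities of successive layers combine because (1 - a)(1 - b)
  is again of the form 1 - c. The order of G_f has to be invertible in K because G_f need not act
  freely on the chains with top fM (it fixes the one with a single vertex), so their permutation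
  module is in general not free. Regularity puts an idempotent into every J-class. Finiteness enters
  Green's relations through one fact: in a finite monoid a one-sided inverse is two-sided. Test
  modules for projectivity may be infinite-dimensional, so linear sections of their surjections come
  from Zorn's lemma. Algebraic identities are reduced throughout to scaled basis elements or pure
  tensors by comparing additive maps.\<close>

locale add_map = A: abelian_group A + B: abelian_group B
  for A :: "('a, 'c) ring_scheme" and B :: "('b, 'd) ring_scheme" and f :: "'a \<Rightarrow> 'b" +
  assumes closed: "x \<in> carrier A \<Longrightarrow> f x \<in> carrier B"
    and add: "\<lbrakk>x \<in> carrier A; y \<in> carrier A\<rbrakk> \<Longrightarrow> f (x \<oplus>\<^bsub>A\<^esub> y) = f x \<oplus>\<^bsub>B\<^esub> f y"
begin

lemma zero: "f \<zero>\<^bsub>A\<^esub> = \<zero>\<^bsub>B\<^esub>"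
proof -
  have "f \<zero>\<^bsub>A\<^esub> \<oplus>\<^bsub>B\<^esub> f \<zero>\<^bsub>A\<^esub> = f \<zero>\<^bsub>A\<^esub> \<oplus>\<^bsub>B\<^esub> \<zero>\<^bsub>B\<^esub>"
    using add[of "\<zero>\<^bsub>A\<^esub>" "\<zero>\<^bsub>A\<^esub>"] closed[of "\<zero>\<^bsub>A\<^esub>"] by simp
  then show ?thesis using closed[of "\<zero>\<^bsub>A\<^esub>"] B.add.l_cancel by blast
qed

lemma neg: "x \<in> carrier A \<Longrightarrow> f (\<ominus>\<^bsub>A\<^esub> x) = \<ominus>\<^bsub>B\<^esub> f x"
  using add[of x "\<ominus>\<^bsub>A\<^esub> x"] closed zero
  by (metis A.a_inv_closed A.r_neg B.minus_equality B.add.m_comm)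

lemma diff: "\<lbrakk>x \<in> carrier A; y \<in> carrier A\<rbrakk> \<Longrightarrow> f (x \<ominus>\<^bsub>A\<^esub> y) = f x \<ominus>\<^bsub>B\<^esub> f y"
  by (simp add: A.minus_eq B.minus_eq add neg)

lemma finsum: "g \<in> S \<rightarrow> carrier A \<Longrightarrow> f (finsum A g S) = finsum B (\<lambda>i. f (g i)) S"
proof (induction S rule: infinite_finite_induct)
  case (insert i S)
  then show ?case by (simp add: Pi_def closed add A.finsum_insert B.finsum_insert)
qed (auto simp: zero)

end

lemma add_map_comp: "add_map A B f \<Longrightarrow> add_map B C g \<Longrightarrow> add_map A C (\<lambda>x. g (f x))"
  by (simp add: add_map_def add_map_axioms_def)

lemma add_map_sum:
  assumes "add_map A B f" "add_map A B g"
  shows "add_map A B (\<lambda>x. f x \<oplus>\<^bsub>B\<^esub> g x)"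
proof -
  interpret f: add_map A B f by fact
  interpret g: add_map A B g by fact
  show ?thesis
    by unfold_locales (auto simp: f.closed g.closed f.add g.add f.B.a_ac)
qed

lemma add_map_id: "abelian_group A \<Longrightarrow> add_map A A (\<lambda>x. x)"
  by (simp add: add_map_def add_map_axioms_def)

lemma add_map_zero: "abelian_group A \<Longrightarrow> abelian_group B \<Longrightarrow> add_map A B (\<lambda>x. \<zero>\<^bsub>B\<^esub>)"
  by (simp add: add_map_def add_map_axioms_def abelian_group_def abelian_monoid.zero_closed
      abelian_monoid.l_zero)

lemma add_map_finsum:
  assumes "finite S" "abelian_group A" "abelian_group B" "\<And>i. i \<in> S \<Longrightarrow> add_map A B (f i)"
  shows "add_map A B (\<lambda>x. finsum B (\<lambda>i. f i x) S)"
proof -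
  interpret A: abelian_group A by fact
  interpret B: abelian_group B by fact
  have cl: "i \<in> S \<Longrightarrow> x \<in> carrier A \<Longrightarrow> f i x \<in> carrier B" for i x
    using assms(4) add_map.closed by metis
  show ?thesis
  proof unfold_locales
    fix x y assume x: "x \<in> carrier A" and y: "y \<in> carrier A"
    show "finsum B (\<lambda>i. f i x) S \<in> carrier B" using cl x by (auto intro: B.finsum_closed)
    have "finsum B (\<lambda>i. f i (x \<oplus>\<^bsub>A\<^esub> y)) S = finsum B (\<lambda>i. f i x \<oplus>\<^bsub>B\<^esub> f i y) S"
      using assms(4) cl x y by (intro B.finsum_cong') (auto simp: add_map.add)
    then show "finsum B (\<lambda>i. f i (x \<oplus>\<^bsub>A\<^esub> y)) S = finsum B (\<lambda>i. f i x) S \<oplus>\<^bsub>B\<^esub> finsum B (\<lambda>i. f i y) S"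
      using cl x y by (simp add: B.finsum_addf Pi_def)
  qed
qed

context abelian_monoid
begin

text \<open>Module operations are defined by sums over supports, which change with the arguments.
  Enlarging the index set by zero terms makes it independent of them, so that sums can be added
  termwise.\<close>

lemma finsum_neutral:
  assumes "finite T" "S \<subseteq> T" "\<And>i. i \<in> T - S \<Longrightarrow> f i = \<zero>" "\<And>i. i \<in> S \<Longrightarrow> f i \<in> carrier G"
  shows "finsum G f T = finsum G f S"
proof -
  have "f i \<in> carrier G" if "i \<in> T" for i using assms(3,4) that by (cases "i \<in> S") auto
  then show ?thesis
    using add.finprod_mono_neutral_cong_right[of T S f f] assms by (auto simp: Pi_def)
qed

lemma finsum_single:
  assumes "finite T" "t \<in> T" "\<And>i. i \<in> T \<Longrightarrow> i \<noteq> t \<Longrightarrow> f i = \<zero>" "f t \<in> carrier G"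
  shows "finsum G f T = f t"
proof -
  have "finsum G f T = finsum G f {t}" by (rule finsum_neutral) (use assms in auto)
  then show ?thesis using assms(4) by (simp add: finsum_insert)
qed

end


section \<open>Spaces of functions on a finite set\<close>

text \<open>Spans of sets of basis elements. For invariant \<open>Y\<close> they are the terms of
  the filtration; inside the monoid algebra and for an ideal \<open>Y\<close> they are the ideal
  algebras KI.\<close>

definition supported :: "('k, 'd) ring_scheme \<Rightarrow> 'x set \<Rightarrow> 'x set \<Rightarrow> ('x \<Rightarrow> 'k) set" where
  "supported K B Y = {f \<in> fin_supp_funs K B. (\<forall>b\<in>B - Y. f b = \<zero>\<^bsub>K\<^esub>)}"

text \<open>\<open>F b\<close> is a function of the coefficient instead of a vector to be scaled,
  because the target \<open>A\<close> is treated as a mere abelian group without scalars.\<close>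

definition linext :: "('a, 'e) ring_scheme \<Rightarrow> 'x set \<Rightarrow> ('x \<Rightarrow> 'k \<Rightarrow> 'a) \<Rightarrow> ('x \<Rightarrow> 'k) \<Rightarrow> 'a" where
  "linext A Y F f = (\<Oplus>\<^bsub>A\<^esub>b\<in>Y. F b (f b))"

text \<open>Abstracts from the record: \<open>C\<close> is anything with pointwise addition on the
  functions from \<open>B\<close>, so that the monoid algebra and all based modules share the
  results on bases.\<close>

locale fspace = K: field K for K :: "('k, 'd) ring_scheme" +
  fixes B :: "'x set" and C :: "('x \<Rightarrow> 'k, 'z) ring_scheme"
  assumes finite_B: "finite B"
    and carrier_C: "carrier C = fin_supp_funs K B"
    and zero_C: "\<zero>\<^bsub>C\<^esub> = (\<lambda>b\<in>B. \<zero>\<^bsub>K\<^esub>)"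
    and add_C: "\<And>f g. f \<oplus>\<^bsub>C\<^esub> g = (\<lambda>b\<in>B. f b \<oplus>\<^bsub>K\<^esub> g b)"
begin

lemma carrier_PiE: "carrier C = B \<rightarrow>\<^sub>E carrier K"
  using finite_B by (auto simp: carrier_C fin_supp_funs_def supp_def)

lemma eval_closed: "f \<in> carrier C \<Longrightarrow> b \<in> B \<Longrightarrow> f b \<in> carrier K"
  by (auto simp: carrier_PiE)

lemma C_eqI: "f \<in> carrier C \<Longrightarrow> g \<in> carrier C \<Longrightarrow> (\<And>b. b \<in> B \<Longrightarrow> f b = g b) \<Longrightarrow> f = g"
  by (auto simp: carrier_PiE intro: PiE_ext)

lemma restrict_closed: "(\<And>b. b \<in> B \<Longrightarrow> g b \<in> carrier K) \<Longrightarrow> (\<lambda>b\<in>B. g b) \<in> carrier C"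
  by (auto simp: carrier_PiE)

lemma abelian_C: "abelian_group C"
proof (rule abelian_groupI)
  fix f assume f: "f \<in> carrier C"
  show "\<exists>g\<in>carrier C. g \<oplus>\<^bsub>C\<^esub> f = \<zero>\<^bsub>C\<^esub>"
    by (rule bexI[of _ "\<lambda>b\<in>B. \<ominus>\<^bsub>K\<^esub> f b"])
      (use f in \<open>auto simp: eval_closed add_C zero_C K.l_neg intro!: restrict_closed\<close>)
next
  fix f assume f: "f \<in> carrier C"
  show "\<zero>\<^bsub>C\<^esub> \<oplus>\<^bsub>C\<^esub> f = f"
    by (rule C_eqI) (use f in \<open>auto simp: eval_closed add_C zero_C intro!: restrict_closed\<close>)
qed (auto simp: eval_closed add_C zero_C K.a_assoc intro!: restrict_closed,
    auto simp: eval_closed K.a_comm intro!: restrict_ext)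

sublocale C: abelian_group C by (rule abelian_C)

abbreviation "bs \<equiv> basis_scaled K B"

lemma bs_closed [simp]: "c \<in> carrier K \<Longrightarrow> bs b c \<in> carrier C"
  by (auto simp: carrier_PiE basis_scaled_def)

lemma bs_zero: "bs b \<zero>\<^bsub>K\<^esub> = \<zero>\<^bsub>C\<^esub>"
  by (auto simp: basis_scaled_def zero_C)

lemma bs_add: "c \<in> carrier K \<Longrightarrow> d \<in> carrier K \<Longrightarrow> bs b (c \<oplus>\<^bsub>K\<^esub> d) = bs b c \<oplus>\<^bsub>C\<^esub> bs b d"
  by (auto simp: basis_scaled_def add_C)

lemma bs_add_map: "add_map K C (bs b)"
  by unfold_locales (auto simp: bs_add)

lemma bs_apply: "x \<in> B \<Longrightarrow> bs b c x = (if x = b then c else \<zero>\<^bsub>K\<^esub>)"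
  by (simp add: basis_scaled_def)

lemma eval_add_map: "b \<in> B \<Longrightarrow> add_map C K (\<lambda>f. f b)"
  by unfold_locales (auto simp: eval_closed add_C)

lemma eval_finsum: "F \<in> S \<rightarrow> carrier C \<Longrightarrow> b \<in> B \<Longrightarrow> finsum C F S b = finsum K (\<lambda>s. F s b) S"
  using add_map.finsum[OF eval_add_map] by fast

lemma supported_subset: "supported K B Y \<subseteq> carrier C"
  by (auto simp: supported_def carrier_C)

lemma supported_UNIV: "B \<subseteq> Y \<Longrightarrow> supported K B Y = carrier C"
  by (auto simp: supported_def carrier_C)

lemma bs_supported: "b \<in> Y \<Longrightarrow> c \<in> carrier K \<Longrightarrow> bs b c \<in> supported K B Y"
  using bs_closed[of c b] by (auto simp: supported_def carrier_C bs_apply)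

lemma supported_zero: "\<zero>\<^bsub>C\<^esub> \<in> supported K B Y"
  using C.zero_closed by (auto simp: supported_def carrier_C[symmetric] zero_C)

lemma supported_add: "f \<in> supported K B Y \<Longrightarrow> g \<in> supported K B Y \<Longrightarrow> f \<oplus>\<^bsub>C\<^esub> g \<in> supported K B Y"
  using C.add.m_closed[of f g] by (auto simp: supported_def carrier_C[symmetric]) (simp add: add_C)

lemma expand:
  assumes "f \<in> supported K B Y" "Y \<subseteq> B"
  shows "f = (\<Oplus>\<^bsub>C\<^esub>b\<in>Y. bs b (f b))"
proof (rule C_eqI)
  have f: "f \<in> carrier C" and f0: "\<And>b. b \<in> B - Y \<Longrightarrow> f b = \<zero>\<^bsub>K\<^esub>"
    using assms(1) by (auto simp: supported_def carrier_C)
  have cl: "(\<lambda>b. bs b (f b)) \<in> Y \<rightarrow> carrier C"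
    using f assms(2) by (auto simp: eval_closed)
  show "f \<in> carrier C" by fact
  show "(\<Oplus>\<^bsub>C\<^esub>b\<in>Y. bs b (f b)) \<in> carrier C" using cl by (rule C.finsum_closed)
  fix b assume b: "b \<in> B"
  have "(\<Oplus>\<^bsub>C\<^esub>b\<in>Y. bs b (f b)) b = (\<Oplus>\<^bsub>K\<^esub>b'\<in>Y. if b = b' then f b' else \<zero>\<^bsub>K\<^esub>)"
    using cl b f assms(2) by (subst eval_finsum) (auto simp: bs_apply eval_closed intro!: K.finsum_cong')
  also have "\<dots> = f b"
  proof (cases "b \<in> Y")
    case True
    then show ?thesis
      using f assms(2) finite_subset[OF assms(2) finite_B]
      by (subst K.finsum_singleton[of _ _ f]) (auto simp: eval_closed)
  next
    case False
    then have "(\<Oplus>\<^bsub>K\<^esub>b'\<in>Y. if b = b' then f b' else \<zero>\<^bsub>K\<^esub>) = (\<Oplus>\<^bsub>K\<^esub>b'\<in>Y. \<zero>\<^bsub>K\<^esub>)"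
      by (intro K.finsum_cong') auto
    then show ?thesis using f0 False b by simp
  qed
  finally show "f b = (\<Oplus>\<^bsub>C\<^esub>b\<in>Y. bs b (f b)) b" by simp
qed

lemma supported_induct [consumes 2, case_names zero bs add]:
  assumes "f \<in> supported K B Y" "Y \<subseteq> B"
    and "P \<zero>\<^bsub>C\<^esub>" "\<And>b c. b \<in> Y \<Longrightarrow> c \<in> carrier K \<Longrightarrow> P (bs b c)"
    and "\<And>f g. f \<in> carrier C \<Longrightarrow> g \<in> carrier C \<Longrightarrow> P f \<Longrightarrow> P g \<Longrightarrow> P (f \<oplus>\<^bsub>C\<^esub> g)"
  shows "P f"
proof -
  have "P (\<Oplus>\<^bsub>C\<^esub>b\<in>Z. bs b (f b)) \<and> (\<Oplus>\<^bsub>C\<^esub>b\<in>Z. bs b (f b)) \<in> carrier C" if "finite Z" "Z \<subseteq> Y" for Z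
    using that
  proof (induction Z)
    case (insert b Z)
    have "f b' \<in> carrier K" if "b' \<in> Y" for b'
      using that assms(1,2) supported_subset by (auto intro!: eval_closed)
    then show ?case
      using insert by (subst (1 2) C.finsum_insert) (auto intro!: assms(4,5))
  qed (simp add: assms(3))
  from this[of Y] show ?thesis
    using expand[OF assms(1,2)] finite_subset[OF assms(2) finite_B] by simp
qed

lemma supported_finsum:
  "finite S \<Longrightarrow> (\<And>i. i \<in> S \<Longrightarrow> F i \<in> supported K B Y) \<Longrightarrow> finsum C F S \<in> supported K B Y"
proof (induction S rule: finite_induct)
  case (insert i S)
  then show ?case
    using supported_subset[of Y] by (subst C.finsum_insert) (auto intro: supported_add)
qed (simp add: supported_zero)

lemma supported_neg: "f \<in> supported K B Y \<Longrightarrow> \<ominus>\<^bsub>C\<^esub> f \<in> supported K B Y"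
  using supported_subset[of Y] add_map.neg[OF eval_add_map]
  by (auto simp: supported_def carrier_C[symmetric])

text \<open>Differs from \<open>supported_induct\<close> in that the summands stay in the span of
  \<open>Y\<close>. This is needed for maps that are additive only on that span.\<close>

lemma supported_induct_strong [consumes 2, case_names zero bs add]:
  assumes "f \<in> supported K B Y" "Y \<subseteq> B"
    and "P \<zero>\<^bsub>C\<^esub>" "\<And>b c. b \<in> Y \<Longrightarrow> c \<in> carrier K \<Longrightarrow> P (bs b c)"
    and "\<And>f g. f \<in> supported K B Y \<Longrightarrow> g \<in> supported K B Y \<Longrightarrow> P f \<Longrightarrow> P g \<Longrightarrow> P (f \<oplus>\<^bsub>C\<^esub> g)"
  shows "P f"
proof -
  have "f \<in> supported K B Y \<and> P f"
    using assms(1,2)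
    by (induction rule: supported_induct) (auto simp: assms(3-) supported_zero supported_add bs_supported)
  then show ?thesis by blast
qed

lemma C_induct [consumes 1, case_names zero bs add]:
  assumes "f \<in> carrier C"
    and "P \<zero>\<^bsub>C\<^esub>" "\<And>b c. b \<in> B \<Longrightarrow> c \<in> carrier K \<Longrightarrow> P (bs b c)"
    and "\<And>f g. f \<in> carrier C \<Longrightarrow> g \<in> carrier C \<Longrightarrow> P f \<Longrightarrow> P g \<Longrightarrow> P (f \<oplus>\<^bsub>C\<^esub> g)"
  shows "P f"
  using assms(1) unfolding supported_UNIV[OF subset_refl, symmetric]
  by (rule supported_induct[where Y = B]) (use assms(2-) in auto)

text \<open>The generators include all scalar multiples of basis elements, so additivity is enough
  to determine a map. Most identities between compositions of maps below are verified in this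
  way.\<close>

lemma add_map_eqI:
  assumes "add_map C A f" "add_map C A g" "u \<in> carrier C"
    and "\<And>b c. b \<in> B \<Longrightarrow> c \<in> carrier K \<Longrightarrow> f (bs b c) = g (bs b c)"
  shows "f u = g u"
  using assms(3)
  by (induction rule: C_induct)
    (auto simp: assms(4) add_map.zero[OF assms(1)] add_map.zero[OF assms(2)]
      add_map.add[OF assms(1)] add_map.add[OF assms(2)])

lemma linext_add_map:
  assumes "abelian_group A" "Y \<subseteq> B" "\<And>b. b \<in> Y \<Longrightarrow> add_map K A (F b)"
  shows "add_map C A (linext A Y F)"
  unfolding linext_def
proof (rule add_map_finsum)
  show "finite Y" using assms(2) finite_B by (rule finite_subset)
  fix b assume "b \<in> Y"
  then show "add_map C A (\<lambda>f. F b (f b))"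
    using add_map_comp[OF eval_add_map assms(3)] assms(2) by blast
qed (use assms(1) abelian_C in auto)

lemma linext_bs:
  assumes "abelian_group A" "Y \<subseteq> B" "\<And>b. b \<in> Y \<Longrightarrow> add_map K A (F b)" "c \<in> carrier K" "b \<in> B"
  shows "linext A Y F (bs b c) = (if b \<in> Y then F b c else \<zero>\<^bsub>A\<^esub>)"
proof -
  interpret A: abelian_group A by fact
  have z: "F b' (bs b c b') = \<zero>\<^bsub>A\<^esub>" if "b' \<in> Y" "b' \<noteq> b" for b'
    using that assms(2) add_map.zero[OF assms(3)[OF that(1)]] by (auto simp: bs_apply)
  show ?thesis
  proof (cases "b \<in> Y")
    case True
    then have "linext A Y F (bs b c) = F b (bs b c b)" unfolding linext_def
      using z assms(5) finite_subset[OF assms(2) finite_B] add_map.closed[OF assms(3)] assms(4)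
      by (intro A.finsum_single) (auto simp: bs_apply)
    then show ?thesis using True assms(5) by (simp add: bs_apply)
  next
    case False
    then have "linext A Y F (bs b c) = (\<Oplus>\<^bsub>A\<^esub>b'\<in>Y. \<zero>\<^bsub>A\<^esub>)" unfolding linext_def
      using z by (intro A.finsum_cong') auto
    then show ?thesis using False by simp
  qed
qed

text \<open>This is the projection onto the coordinates in \<open>Y\<close>; it serves to read off a
  kernel from the vanishing of coordinates.\<close>

lemma linext_bs_eval:
  assumes "u \<in> carrier C" "Y \<subseteq> B" "b \<in> B"
  shows "linext C Y bs u b = (if b \<in> Y then u b else \<zero>\<^bsub>K\<^esub>)"
proof -
  have "linext C Y bs u b = (\<Oplus>\<^bsub>K\<^esub>b'\<in>Y. bs b' (u b') b)"
    unfolding linext_def using assms by (intro eval_finsum) (auto simp: eval_closed subset_iff)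
  also have "\<dots> = (if b \<in> Y then u b else \<zero>\<^bsub>K\<^esub>)"
  proof (cases "b \<in> Y")
    case True
    then have "(\<Oplus>\<^bsub>K\<^esub>b'\<in>Y. bs b' (u b') b) = bs b (u b) b"
      using assms finite_subset[OF assms(2) finite_B]
      by (intro K.finsum_single) (auto simp: bs_apply eval_closed)
    then show ?thesis using True assms by (simp add: bs_apply)
  next
    case False
    then have "(\<Oplus>\<^bsub>K\<^esub>b'\<in>Y. bs b' (u b') b) = (\<Oplus>\<^bsub>K\<^esub>b'\<in>Y. \<zero>\<^bsub>K\<^esub>)"
      using assms by (intro K.finsum_cong') (auto simp: bs_apply)
    then show ?thesis using False by simp
  qed
  finally show ?thesis .
qed

end


section \<open>Monoid algebras and based modules\<close>

lemma fspace_based: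
  "field K \<Longrightarrow> finite B \<Longrightarrow> fspace K B (based_module K M B act)"
  by (simp add: fspace_def fspace_axioms_def based_module_def)

lemma fspace_monoid_algebra:
  "field K \<Longrightarrow> finite (carrier M) \<Longrightarrow> fspace K (carrier M) (monoid_algebra K M)"
  by (simp add: fspace_def fspace_axioms_def monoid_algebra_def)

lemma based_smult_gen:
  assumes "field K" "m \<in> carrier M" "b \<in> B" "c \<in> carrier K" "d \<in> carrier K"
  shows "basis_scaled K (carrier M) m c \<odot>\<^bsub>based_module K M B act\<^esub> basis_scaled K B b d =
    (case act m b of None \<Rightarrow> (\<lambda>x\<in>B. \<zero>\<^bsub>K\<^esub>) | Some b' \<Rightarrow> basis_scaled K B b' (c \<otimes>\<^bsub>K\<^esub> d))"
proof -
  interpret K: field K by fact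
  let ?x = "basis_scaled K (carrier M) m c" and ?f = "basis_scaled K B b d"
  have s: "supp K (carrier M) ?x = (if c = \<zero>\<^bsub>K\<^esub> then {} else {m})"
    "supp K B ?f = (if d = \<zero>\<^bsub>K\<^esub> then {} else {b})"
    using assms by (auto simp: supp_def basis_scaled_def)
  have "finsum K (\<lambda>(m, b'). ?x m \<otimes>\<^bsub>K\<^esub> ?f b')
      {(m, b') \<in> supp K (carrier M) ?x \<times> supp K B ?f. act m b' = Some b''}
     = (if act m b = Some b'' then c \<otimes>\<^bsub>K\<^esub> d else \<zero>\<^bsub>K\<^esub>)" for b''
  proof -
    have "{(m, b') \<in> supp K (carrier M) ?x \<times> supp K B ?f. act m b' = Some b''}
      = (if c \<noteq> \<zero>\<^bsub>K\<^esub> \<and> d \<noteq> \<zero>\<^bsub>K\<^esub> \<and> act m b = Some b'' then {(m, b)} else {})"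
      by (auto simp: s split: if_splits)
    moreover have "?x m = c" "?f b = d" using assms by (auto simp: basis_scaled_def)
    ultimately show ?thesis using assms by (auto simp: K.finsum_insert)
  qed
  then show ?thesis
    by (auto simp: based_module_def basis_scaled_def split: option.splits intro!: restrict_ext)
qed

text \<open>The monoid algebra is its own regular module, a based module on
  \<open>carrier M\<close>; this transfers the biadditivity of the module action to the
  product.\<close>

lemma monoid_algebra_mult:
  "x \<otimes>\<^bsub>monoid_algebra K M\<^esub> y =
    x \<odot>\<^bsub>based_module K M (carrier M) (\<lambda>m n. Some (m \<otimes>\<^bsub>M\<^esub> n))\<^esub> y"
  by (simp add: monoid_algebra_def based_module_def)

lemma monoid_algebra_mult_gen:
  assumes "field K" "m \<in> carrier M" "n \<in> carrier M" "c \<in> carrier K" "d \<in> carrier K"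
  shows "basis_scaled K (carrier M) m c \<otimes>\<^bsub>monoid_algebra K M\<^esub> basis_scaled K (carrier M) n d =
    basis_scaled K (carrier M) (m \<otimes>\<^bsub>M\<^esub> n) (c \<otimes>\<^bsub>K\<^esub> d)"
  by (simp add: monoid_algebra_mult based_smult_gen[OF assms])

context left_module
begin

lemma smult_left_add_map: "v \<in> carrier M \<Longrightarrow> add_map R M (\<lambda>x. x \<odot>\<^bsub>M\<^esub> v)"
  by unfold_locales (auto simp: smult_l_distr)

lemma smult_right_add_map: "x \<in> carrier R \<Longrightarrow> add_map M M (\<lambda>v. x \<odot>\<^bsub>M\<^esub> v)"
  by unfold_locales (auto simp: smult_r_distr)

lemma smult_zero_left [simp]: "v \<in> carrier M \<Longrightarrow> \<zero>\<^bsub>R\<^esub> \<odot>\<^bsub>M\<^esub> v = \<zero>\<^bsub>M\<^esub>"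
  using add_map.zero[OF smult_left_add_map] .

lemma smult_zero_right [simp]: "x \<in> carrier R \<Longrightarrow> x \<odot>\<^bsub>M\<^esub> \<zero>\<^bsub>M\<^esub> = \<zero>\<^bsub>M\<^esub>"
  using add_map.zero[OF smult_right_add_map] .

end

locale fm = K: field K + M: monoid M for K :: "('k, 'd) ring_scheme" and M :: "('m, 'c) monoid_scheme" +
  assumes finite_M: "finite (carrier M)"
begin

abbreviation "R \<equiv> monoid_algebra K M"
abbreviation "e \<equiv> basis_scaled K (carrier M)"

sublocale R: fspace K "carrier M" "monoid_algebra K M"
  by (rule fspace_monoid_algebra) (use finite_M K.field_axioms in auto)

text \<open>In place of the supports of \<open>x\<close> and \<open>f\<close> the sum runs over a
  fixed index set, on which biadditivity becomes distributivity in \<open>K\<close> term by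
  term.\<close>

lemma based_smult_eq:
  assumes "finite B" "x \<in> carrier R" "f \<in> carrier (based_module K M B act)"
  shows "x \<odot>\<^bsub>based_module K M B act\<^esub> f =
    (\<lambda>b\<in>B. \<Oplus>\<^bsub>K\<^esub>p\<in>{p \<in> carrier M \<times> B. act (fst p) (snd p) = Some b}. x (fst p) \<otimes>\<^bsub>K\<^esub> f (snd p))"
proof -
  interpret C: fspace K B "based_module K M B act"
    by (rule fspace_based) (use assms K.field_axioms in auto)
  have *: "finsum K (\<lambda>(m, b'). x m \<otimes>\<^bsub>K\<^esub> f b')
      {(m, b') \<in> supp K (carrier M) x \<times> supp K B f. act m b' = Some b}
     = (\<Oplus>\<^bsub>K\<^esub>p\<in>{p \<in> carrier M \<times> B. act (fst p) (snd p) = Some b}. x (fst p) \<otimes>\<^bsub>K\<^esub> f (snd p))" for b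
    unfolding split_def
    by (rule K.finsum_neutral[symmetric])
      (use assms finite_M in \<open>auto simp: supp_def C.eval_closed R.eval_closed\<close>)
  have "x \<odot>\<^bsub>based_module K M B act\<^esub> f = (\<lambda>b\<in>B. finsum K (\<lambda>(m, b'). x m \<otimes>\<^bsub>K\<^esub> f b')
      {(m, b') \<in> supp K (carrier M) x \<times> supp K B f. act m b' = Some b})"
    by (simp add: based_module_def)
  then show ?thesis unfolding * .
qed

text \<open>Stated for an arbitrary partial map \<open>act\<close>, so that it also covers a right
  action written from the left, which is how KG_f acts on KL_f below.\<close>

lemma based_biadd:
  assumes "finite B"
  shows based_smult_closed: "x \<in> carrier R \<Longrightarrow> f \<in> carrier (based_module K M B act) \<Longrightarrow>
      x \<odot>\<^bsub>based_module K M B act\<^esub> f \<in> carrier (based_module K M B act)"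
    and based_smult_left: "f \<in> carrier (based_module K M B act) \<Longrightarrow>
      add_map R (based_module K M B act) (\<lambda>x. x \<odot>\<^bsub>based_module K M B act\<^esub> f)"
    and based_smult_right: "x \<in> carrier R \<Longrightarrow>
      add_map (based_module K M B act) (based_module K M B act) (\<lambda>f. x \<odot>\<^bsub>based_module K M B act\<^esub> f)"
proof -
  let ?C = "based_module K M B act"
  interpret C: fspace K B ?C
    by (rule fspace_based) (use assms K.field_axioms in auto)
  show cl: "x \<odot>\<^bsub>?C\<^esub> f \<in> carrier ?C" if "x \<in> carrier R" "f \<in> carrier ?C" for x f
    using that assms
    by (auto simp: based_smult_eq C.eval_closed R.eval_closed intro!: C.restrict_closed K.finsum_closed)
  show "add_map R ?C (\<lambda>x. x \<odot>\<^bsub>?C\<^esub> f)" if f: "f \<in> carrier ?C" for f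
  proof unfold_locales
    fix x y assume xy: "x \<in> carrier R" "y \<in> carrier R"
    show "(x \<oplus>\<^bsub>R\<^esub> y) \<odot>\<^bsub>?C\<^esub> f = x \<odot>\<^bsub>?C\<^esub> f \<oplus>\<^bsub>?C\<^esub> y \<odot>\<^bsub>?C\<^esub> f"
      unfolding C.add_C based_smult_eq[OF assms xy(1) f] based_smult_eq[OF assms xy(2) f]
        based_smult_eq[OF assms R.C.add.m_closed[OF xy] f]
      by (rule restrict_ext, simp only: restrict_apply', subst K.finsum_addf[symmetric])
        (use xy f in \<open>auto simp: R.add_C C.eval_closed R.eval_closed K.l_distr simp del: K.add.finprod_multf
          intro!: K.finsum_cong'\<close>)
  qed (use cl f in auto)
  show "add_map ?C ?C (\<lambda>f. x \<odot>\<^bsub>?C\<^esub> f)" if x: "x \<in> carrier R" for x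
  proof unfold_locales
    fix f g assume fg: "f \<in> carrier ?C" "g \<in> carrier ?C"
    show "x \<odot>\<^bsub>?C\<^esub> (f \<oplus>\<^bsub>?C\<^esub> g) = x \<odot>\<^bsub>?C\<^esub> f \<oplus>\<^bsub>?C\<^esub> x \<odot>\<^bsub>?C\<^esub> g"
      unfolding based_smult_eq[OF assms x fg(1)] based_smult_eq[OF assms x fg(2)]
        based_smult_eq[OF assms x C.C.add.m_closed[OF fg]]
      by (subst (2) C.add_C, rule restrict_ext, simp only: restrict_apply', subst K.finsum_addf[symmetric])
        (use x fg in \<open>auto simp: C.add_C C.eval_closed R.eval_closed K.r_distr simp del: K.add.finprod_multf
          intro!: K.finsum_cong'\<close>)
  qed (use cl x in auto)
qed

lemma mult_gen: "\<lbrakk>m \<in> carrier M; n \<in> carrier M; c \<in> carrier K; d \<in> carrier K\<rbrakk> \<Longrightarrow>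
    e m c \<otimes>\<^bsub>R\<^esub> e n d = e (m \<otimes>\<^bsub>M\<^esub> n) (c \<otimes>\<^bsub>K\<^esub> d)"
  by (rule monoid_algebra_mult_gen) (auto intro: K.field_axioms)

lemma regular_sel:
  "carrier (based_module K M (carrier M) act) = carrier R"
  "\<zero>\<^bsub>based_module K M (carrier M) act\<^esub> = \<zero>\<^bsub>R\<^esub>"
  "x \<oplus>\<^bsub>based_module K M (carrier M) act\<^esub> y = x \<oplus>\<^bsub>R\<^esub> y"
  by (simp_all add: based_module_def monoid_algebra_def)

lemma mult_closed: "x \<in> carrier R \<Longrightarrow> y \<in> carrier R \<Longrightarrow> x \<otimes>\<^bsub>R\<^esub> y \<in> carrier R"
  unfolding monoid_algebra_mult using based_smult_closed[OF finite_M] by (simp add: regular_sel)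

lemma mult_left: "y \<in> carrier R \<Longrightarrow> add_map R R (\<lambda>x. x \<otimes>\<^bsub>R\<^esub> y)"
  unfolding monoid_algebra_mult using based_smult_left[OF finite_M]
  by (simp add: regular_sel add_map_def add_map_axioms_def R.abelian_C)

lemma mult_right: "x \<in> carrier R \<Longrightarrow> add_map R R (\<lambda>y. x \<otimes>\<^bsub>R\<^esub> y)"
  unfolding monoid_algebra_mult using based_smult_right[OF finite_M]
  by (simp add: regular_sel add_map_def add_map_axioms_def R.abelian_C)

text \<open>Biadditivity reduces \<open>x\<close> and then \<open>y\<close> to scaled monoid
  elements, where the claim is \<open>gen\<close>. The vector \<open>v\<close> remains arbitrary, so
  modules without a chosen basis are covered.\<close>

lemma smult_assocI:
  fixes A :: "('m \<Rightarrow> 'k, 'a) module"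
  assumes closed: "\<And>x v. x \<in> carrier R \<Longrightarrow> v \<in> carrier A \<Longrightarrow> x \<odot>\<^bsub>A\<^esub> v \<in> carrier A"
    and left: "\<And>v. v \<in> carrier A \<Longrightarrow> add_map R A (\<lambda>x. x \<odot>\<^bsub>A\<^esub> v)"
    and right: "\<And>x. x \<in> carrier R \<Longrightarrow> add_map A A (\<lambda>v. x \<odot>\<^bsub>A\<^esub> v)"
    and gen: "\<And>m n c d v. \<lbrakk>m \<in> carrier M; n \<in> carrier M; c \<in> carrier K; d \<in> carrier K; v \<in> carrier A\<rbrakk>
      \<Longrightarrow> e m c \<odot>\<^bsub>A\<^esub> (e n d \<odot>\<^bsub>A\<^esub> v) = e (m \<otimes>\<^bsub>M\<^esub> n) (c \<otimes>\<^bsub>K\<^esub> d) \<odot>\<^bsub>A\<^esub> v"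
    and x: "x \<in> carrier R" and y: "y \<in> carrier R" and v: "v \<in> carrier A"
  shows "(x \<otimes>\<^bsub>R\<^esub> y) \<odot>\<^bsub>A\<^esub> v = x \<odot>\<^bsub>A\<^esub> (y \<odot>\<^bsub>A\<^esub> v)"
  using _ _ x
proof (rule R.add_map_eqI)
  show "add_map R A (\<lambda>x. (x \<otimes>\<^bsub>R\<^esub> y) \<odot>\<^bsub>A\<^esub> v)"
    using add_map_comp[OF mult_left[OF y] left[OF v]] .
  show "add_map R A (\<lambda>x. x \<odot>\<^bsub>A\<^esub> (y \<odot>\<^bsub>A\<^esub> v))" using left closed y v by blast
  fix m c assume m: "m \<in> carrier M" and c: "c \<in> carrier K"
  have ec: "e m c \<in> carrier R" using c by simp
  show "(e m c \<otimes>\<^bsub>R\<^esub> y) \<odot>\<^bsub>A\<^esub> v = e m c \<odot>\<^bsub>A\<^esub> (y \<odot>\<^bsub>A\<^esub> v)"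
    using _ _ y
  proof (rule R.add_map_eqI)
    show "add_map R A (\<lambda>y. (e m c \<otimes>\<^bsub>R\<^esub> y) \<odot>\<^bsub>A\<^esub> v)"
      using add_map_comp[OF mult_right[OF ec] left[OF v]] .
    show "add_map R A (\<lambda>y. e m c \<odot>\<^bsub>A\<^esub> (y \<odot>\<^bsub>A\<^esub> v))"
      using add_map_comp[OF left[OF v] right[OF ec]] .
    fix n d assume "n \<in> carrier M" "d \<in> carrier K"
    then show "(e m c \<otimes>\<^bsub>R\<^esub> e n d) \<odot>\<^bsub>A\<^esub> v = e m c \<odot>\<^bsub>A\<^esub> (e n d \<odot>\<^bsub>A\<^esub> v)"
      using m c v by (simp add: mult_gen gen)
  qed
qed

lemma one_R: "\<one>\<^bsub>R\<^esub> = e \<one>\<^bsub>M\<^esub> \<one>\<^bsub>K\<^esub>"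
  by (simp add: monoid_algebra_def)

lemma ring_R: "ring R"
proof (rule ringI)
  show "abelian_group R" by (rule R.abelian_C)
  let ?A = "based_module K M (carrier M) (\<lambda>m n. Some (m \<otimes>\<^bsub>M\<^esub> n))"
  have gen: "e m c \<otimes>\<^bsub>R\<^esub> (e n d \<otimes>\<^bsub>R\<^esub> v) = e (m \<otimes>\<^bsub>M\<^esub> n) (c \<otimes>\<^bsub>K\<^esub> d) \<otimes>\<^bsub>R\<^esub> v"
    if "m \<in> carrier M" "n \<in> carrier M" "c \<in> carrier K" "d \<in> carrier K" "v \<in> carrier R" for m n c d v
    using _ _ that(5)
  proof (rule R.add_map_eqI)
    show "add_map R R (\<lambda>v. e m c \<otimes>\<^bsub>R\<^esub> (e n d \<otimes>\<^bsub>R\<^esub> v))"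
      using that by (intro add_map_comp[OF mult_right mult_right]) auto
    show "add_map R R (\<lambda>v. e (m \<otimes>\<^bsub>M\<^esub> n) (c \<otimes>\<^bsub>K\<^esub> d) \<otimes>\<^bsub>R\<^esub> v)"
      using that by (intro mult_right) auto
  qed (use that in \<open>simp add: mult_gen M.m_assoc K.m_assoc\<close>)
  show "monoid R"
  proof (rule monoidI)
    fix x y z assume xyz: "x \<in> carrier R" "y \<in> carrier R" "z \<in> carrier R"
    show "x \<otimes>\<^bsub>R\<^esub> y \<otimes>\<^bsub>R\<^esub> z = x \<otimes>\<^bsub>R\<^esub> (y \<otimes>\<^bsub>R\<^esub> z)"
    proof (rule smult_assocI[of ?A, folded monoid_algebra_mult])
      show "add_map R ?A (\<lambda>x. x \<otimes>\<^bsub>R\<^esub> v)" if "v \<in> carrier ?A" for v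
        using that unfolding monoid_algebra_mult by (rule based_smult_left[OF finite_M])
      show "add_map ?A ?A (\<lambda>v. x \<otimes>\<^bsub>R\<^esub> v)" if "x \<in> carrier R" for x
        using that unfolding monoid_algebra_mult by (rule based_smult_right[OF finite_M])
    qed (use xyz gen mult_closed in \<open>auto simp: regular_sel\<close>)
    show "x \<otimes>\<^bsub>R\<^esub> y \<in> carrier R" using xyz by (intro mult_closed)
  next
    show "\<one>\<^bsub>R\<^esub> \<in> carrier R" by (simp add: one_R)
    fix x assume x: "x \<in> carrier R"
    have o: "e \<one>\<^bsub>M\<^esub> \<one>\<^bsub>K\<^esub> \<in> carrier R" by simp
    show "\<one>\<^bsub>R\<^esub> \<otimes>\<^bsub>R\<^esub> x = x" unfolding one_R
      using mult_right[OF o] add_map_id[OF R.abelian_C] x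
      by (rule R.add_map_eqI) (simp add: mult_gen)
    show "x \<otimes>\<^bsub>R\<^esub> \<one>\<^bsub>R\<^esub> = x" unfolding one_R
      using mult_left[OF o] add_map_id[OF R.abelian_C] x
      by (rule R.add_map_eqI) (simp add: mult_gen)
  qed
qed (simp_all add: add_map.add[OF mult_left] add_map.add[OF mult_right])

sublocale RR: ring "monoid_algebra K M" by (rule ring_R)

lemma left_moduleI:
  fixes A :: "('m \<Rightarrow> 'k, 'a) module"
  assumes "abelian_group A"
    and closed: "\<And>x v. x \<in> carrier R \<Longrightarrow> v \<in> carrier A \<Longrightarrow> x \<odot>\<^bsub>A\<^esub> v \<in> carrier A"
    and left: "\<And>v. v \<in> carrier A \<Longrightarrow> add_map R A (\<lambda>x. x \<odot>\<^bsub>A\<^esub> v)"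
    and right: "\<And>x. x \<in> carrier R \<Longrightarrow> add_map A A (\<lambda>v. x \<odot>\<^bsub>A\<^esub> v)"
    and gen: "\<And>m n c d v. \<lbrakk>m \<in> carrier M; n \<in> carrier M; c \<in> carrier K; d \<in> carrier K; v \<in> carrier A\<rbrakk>
      \<Longrightarrow> e m c \<odot>\<^bsub>A\<^esub> (e n d \<odot>\<^bsub>A\<^esub> v) = e (m \<otimes>\<^bsub>M\<^esub> n) (c \<otimes>\<^bsub>K\<^esub> d) \<odot>\<^bsub>A\<^esub> v"
    and one: "\<And>v. v \<in> carrier A \<Longrightarrow> e \<one>\<^bsub>M\<^esub> \<one>\<^bsub>K\<^esub> \<odot>\<^bsub>A\<^esub> v = v"
  shows "left_module R A"
proof -
  have "left_module_axioms R A"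
    by unfold_locales
      (auto simp: closed one one_R add_map.add[OF left] add_map.add[OF right]
        smult_assocI[OF closed left right gen])
  then show ?thesis using assms(1) ring_R by (simp add: left_module_def)
qed

lemma left_module_homI:
  fixes A :: "('m \<Rightarrow> 'k, 'a) module" and B :: "('m \<Rightarrow> 'k, 'b) module"
  assumes "left_module R A" "left_module R B" "add_map A B f"
    and gen: "\<And>m c v. m \<in> carrier M \<Longrightarrow> c \<in> carrier K \<Longrightarrow> v \<in> carrier A \<Longrightarrow> f (e m c \<odot>\<^bsub>A\<^esub> v) = e m c \<odot>\<^bsub>B\<^esub> f v"
  shows "f \<in> left_module_hom R A B"
proof -
  interpret A: left_module R A by fact
  interpret B: left_module R B by fact
  interpret f: add_map A B f by fact
  have "f (x \<odot>\<^bsub>A\<^esub> v) = x \<odot>\<^bsub>B\<^esub> f v" if x: "x \<in> carrier R" and v: "v \<in> carrier A" for x v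
    using x
  proof (induction rule: R.C_induct)
    case zero
    show ?case using v by (simp add: f.zero f.closed)
  next
    case (bs b c)
    then show ?case using gen v by simp
  next
    case (add x y)
    then show ?case using v by (simp add: A.smult_l_distr B.smult_l_distr f.add f.closed)
  qed
  then show ?thesis by (auto simp: left_module_hom_def f.closed f.add)
qed

end

lemma left_module_hom_add_map:
  assumes "left_module R A" "left_module R B" "f \<in> left_module_hom R A B"
  shows "add_map A B f"
proof -
  interpret A: left_module R A by fact
  interpret B: left_module R B by fact
  show ?thesis using assms(3) by unfold_locales (auto simp: left_module_hom_def)
qed

lemma left_module_hom_smult:
  "f \<in> left_module_hom R A B \<Longrightarrow> x \<in> carrier R \<Longrightarrow> v \<in> carrier A \<Longrightarrow> f (x \<odot>\<^bsub>A\<^esub> v) = x \<odot>\<^bsub>B\<^esub> f v"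
  by (simp add: left_module_hom_def)

text \<open>The basis \<open>B\<close> with an adjoined zero, written \<^const>\<open>None\<close>, is an \<open>M\<close>-set.\<close>

locale based = fm K M for K :: "('k, 'd) ring_scheme" and M :: "('m, 'c) monoid_scheme" +
  fixes B :: "'b set" and act :: "'m \<Rightarrow> 'b \<Rightarrow> 'b option"
  assumes finite_basis: "finite B"
    and act_closed: "\<lbrakk>m \<in> carrier M; b \<in> B; act m b = Some b'\<rbrakk> \<Longrightarrow> b' \<in> B"
    and act_one: "b \<in> B \<Longrightarrow> act \<one>\<^bsub>M\<^esub> b = Some b"
    and act_mult: "\<lbrakk>m \<in> carrier M; n \<in> carrier M; b \<in> B\<rbrakk> \<Longrightarrow>
      act (m \<otimes>\<^bsub>M\<^esub> n) b = Option.bind (act n b) (act m)"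
begin

abbreviation "C \<equiv> based_module K M B act"

sublocale C: fspace K B "based_module K M B act"
  by (rule fspace_based) (use finite_basis K.field_axioms in auto)

abbreviation "\<beta> \<equiv> basis_scaled K B"

lemma smult_gen: "\<lbrakk>m \<in> carrier M; b \<in> B; c \<in> carrier K; d \<in> carrier K\<rbrakk> \<Longrightarrow>
    e m c \<odot>\<^bsub>C\<^esub> \<beta> b d = (case act m b of None \<Rightarrow> \<zero>\<^bsub>C\<^esub> | Some b' \<Rightarrow> \<beta> b' (c \<otimes>\<^bsub>K\<^esub> d))"
  unfolding C.zero_C by (rule based_smult_gen[OF K.field_axioms])

lemma left_module_C: "left_module R C"
proof (rule left_moduleI)
  fix m n c d v
  assume 1: "m \<in> carrier M" "n \<in> carrier M" "c \<in> carrier K" "d \<in> carrier K" and v: "v \<in> carrier C"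
  have e: "e m c \<in> carrier R" "e n d \<in> carrier R" "e (m \<otimes>\<^bsub>M\<^esub> n) (c \<otimes>\<^bsub>K\<^esub> d) \<in> carrier R"
    using 1 by auto
  show "e m c \<odot>\<^bsub>C\<^esub> (e n d \<odot>\<^bsub>C\<^esub> v) = e (m \<otimes>\<^bsub>M\<^esub> n) (c \<otimes>\<^bsub>K\<^esub> d) \<odot>\<^bsub>C\<^esub> v"
    using add_map_comp[OF based_smult_right[OF finite_basis e(2)] based_smult_right[OF finite_basis e(1)]]
      based_smult_right[OF finite_basis e(3)] v
  proof (rule C.add_map_eqI)
    fix b a assume b: "b \<in> B" and a: "a \<in> carrier K"
    show "e m c \<odot>\<^bsub>C\<^esub> (e n d \<odot>\<^bsub>C\<^esub> \<beta> b a) = e (m \<otimes>\<^bsub>M\<^esub> n) (c \<otimes>\<^bsub>K\<^esub> d) \<odot>\<^bsub>C\<^esub> \<beta> b a"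
      using 1 b a act_closed[of n b] add_map.zero[OF based_smult_right[OF finite_basis e(1)]]
      by (auto simp: smult_gen act_mult K.m_assoc split: option.splits)
  qed
next
  fix v assume v: "v \<in> carrier C"
  show "e \<one>\<^bsub>M\<^esub> \<one>\<^bsub>K\<^esub> \<odot>\<^bsub>C\<^esub> v = v"
    using based_smult_right[OF finite_basis] add_map_id[OF C.abelian_C] v
    by (rule C.add_map_eqI) (auto simp: smult_gen act_one)
qed (use based_biadd[OF finite_basis] C.abelian_C in auto)

sublocale CM: left_module "monoid_algebra K M" "based_module K M B act"
  by (rule left_module_C)

end

context based
begin

definition invariant :: "'b set \<Rightarrow> bool" where
  "invariant Y \<longleftrightarrow> Y \<subseteq> B \<and> (\<forall>m\<in>carrier M. \<forall>b\<in>Y. \<forall>b'. act m b = Some b' \<longrightarrow> b' \<in> Y)"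

abbreviation "sub Y \<equiv> supported K B Y"
abbreviation "CS Y \<equiv> C\<lparr>carrier := supported K B Y\<rparr>"

lemma supported_smult:
  assumes Y: "invariant Y" and x: "x \<in> carrier R" and f: "f \<in> sub Y"
  shows "x \<odot>\<^bsub>C\<^esub> f \<in> sub Y"
  using x
proof (induction rule: R.C_induct)
  have YB: "Y \<subseteq> B" using Y by (simp add: invariant_def)
  have fC: "f \<in> carrier C" using f C.supported_subset by blast
  case zero
  then show ?case using fC C.supported_zero by simp
next
  case (add x y)
  have fC: "f \<in> carrier C" using f C.supported_subset by blast
  show ?case using add fC by (simp add: CM.smult_l_distr C.supported_add)
next
  case (bs m c)
  have YB: "Y \<subseteq> B" using Y by (simp add: invariant_def)
  have e: "e m c \<in> carrier R" using bs by simp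
  show ?case
    using f YB
  proof (induction rule: C.supported_induct)
    case zero
    then show ?case using e C.supported_zero by simp
  next
    case (bs b d)
    then show ?case
      using \<open>m \<in> carrier M\<close> \<open>c \<in> carrier K\<close> Y YB
      by (auto simp: smult_gen[OF _ subsetD[OF YB]] invariant_def C.supported_zero intro!: C.bs_supported
          split: option.split)
  next
    case (add f g)
    then show ?case using e by (simp add: CM.smult_r_distr C.supported_add)
  qed
qed

lemma submodule_supported:
  assumes "invariant Y"
  shows "submodule (sub Y) R C"
proof -
  have "subgroup (sub Y) (add_monoid C)"
    by (rule C.C.add.subgroupI)
      (use C.supported_subset[of Y] C.supported_zero[of Y] C.supported_neg C.supported_add in auto)
  then show ?thesis
    using supported_smult[OF assms] by (simp add: submodule_def submodule_axioms_def)
qed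

lemma left_module_supported:
  assumes "invariant Y"
  shows "left_module R (CS Y)"
proof -
  have s: "f \<in> sub Y \<Longrightarrow> f \<in> carrier C" for f using C.supported_subset by blast
  have "abelian_group (CS Y)"
  proof (rule abelian_groupI)
    fix f assume "f \<in> carrier (CS Y)"
    then show "\<exists>g\<in>carrier (CS Y). g \<oplus>\<^bsub>CS Y\<^esub> f = \<zero>\<^bsub>CS Y\<^esub>"
      using C.supported_neg[of f Y] s by (auto simp: C.C.l_neg intro!: bexI[of _ "\<ominus>\<^bsub>C\<^esub> f"])
  qed (auto simp: C.supported_add C.supported_zero s C.C.a_assoc intro: C.C.a_comm[OF s s])
  moreover have "left_module_axioms R (CS Y)"
    by unfold_locales
      (auto simp: supported_smult[OF assms] s CM.smult_l_distr CM.smult_r_distr CM.smult_assoc1)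
  ultimately show ?thesis using ring_R by (simp add: left_module_def)
qed

text \<open>The map lives on all of \<open>C\<close>, where it can be given by
  \<open>linext\<close>, but is claimed to be equivariant only on the span of \<open>Y\<close>. The
  layers need this asymmetry: the map onto an induced module is controlled only on the chains below
  the ideal.\<close>

lemma hom_supportedI:
  fixes A :: "('m \<Rightarrow> 'k, 'a) module"
  assumes Y: "invariant Y" and A: "left_module R A" and f: "add_map C A f"
    and gen: "\<And>m c b d. \<lbrakk>m \<in> carrier M; c \<in> carrier K; b \<in> Y; d \<in> carrier K\<rbrakk> \<Longrightarrow>
      e m c \<odot>\<^bsub>A\<^esub> f (\<beta> b d) =
      (case act m b of None \<Rightarrow> \<zero>\<^bsub>A\<^esub> | Some b' \<Rightarrow> f (\<beta> b' (c \<otimes>\<^bsub>K\<^esub> d)))"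
  shows "f \<in> left_module_hom R (CS Y) A"
proof -
  interpret A: left_module R A by fact
  interpret f: add_map C A f by fact
  have YB: "Y \<subseteq> B" using Y by (simp add: invariant_def)
  have s: "f \<in> sub Y \<Longrightarrow> f \<in> carrier C" for f using C.supported_subset by blast
  show ?thesis
  proof (rule left_module_homI[OF left_module_supported[OF Y] A])
    show "add_map (CS Y) A f"
      using left_module_supported[OF Y] A
      by (simp add: add_map_def add_map_axioms_def left_module_def f.closed f.add s)
    fix m c v assume 1: "m \<in> carrier M" "c \<in> carrier K" and v: "v \<in> carrier (CS Y)"
    have e: "e m c \<in> carrier R" using 1 by simp
    from v have "v \<in> sub Y" by simp
    then show "f (e m c \<odot>\<^bsub>CS Y\<^esub> v) = e m c \<odot>\<^bsub>A\<^esub> f v" using YB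
    proof (induction rule: C.supported_induct)
      case zero
      then show ?case using e by (simp add: f.zero)
    next
      case (bs b d)
      then show ?case using 1 gen[OF 1 bs] YB
        by (auto simp: smult_gen f.zero split: option.splits)
    next
      case (add f g)
      then show ?case using e by (simp add: CM.smult_r_distr A.smult_r_distr f.add f.closed)
    qed
  qed
qed

end

lemma (in fm) left_module_hom_basedI:
  fixes A :: "('m \<Rightarrow> 'k, 'a) module"
  assumes "based K M B act" "left_module R A" "add_map (based_module K M B act) A f"
    and gen: "\<And>m c b d. \<lbrakk>m \<in> carrier M; c \<in> carrier K; b \<in> B; d \<in> carrier K\<rbrakk> \<Longrightarrow>
      e m c \<odot>\<^bsub>A\<^esub> f (basis_scaled K B b d) =
      (case act m b of None \<Rightarrow> \<zero>\<^bsub>A\<^esub> | Some b' \<Rightarrow> f (basis_scaled K B b' (c \<otimes>\<^bsub>K\<^esub> d)))"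
  shows "f \<in> left_module_hom R (based_module K M B act) A"
proof -
  interpret based K M B act by fact
  have "f \<in> left_module_hom R (CS B) A"
    by (rule hom_supportedI[OF _ assms(2,3) gen]) (auto simp: invariant_def act_closed)
  then show ?thesis by (simp add: C.supported_UNIV)
qed


section \<open>The chain complex\<close>

text \<open>Exactness concerns the underlying abelian groups only, so the contracting homotopy
  \<open>s\<close>, \<open>t\<close> is merely additive. The cone, which always adds the same
  vertex, does not commute with the monoid.\<close>

lemma resolutionI:
  fixes C :: "nat \<Rightarrow> ('r, 'a) module" and N :: "('r, 'b) module"
  assumes C: "\<And>q. left_module R (C q)" and N: "left_module R N"
    and d: "\<And>q. d q \<in> left_module_hom R (C (Suc q)) (C q)"
    and \<epsilon>: "\<epsilon> \<in> left_module_hom R (C 0) N"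
    and s: "\<And>q. add_map (C q) (C (Suc q)) (s q)" and t: "add_map N (C 0) t"
    and d0: "\<And>x. x \<in> carrier (C 1) \<Longrightarrow> \<epsilon> (d 0 x) = \<zero>\<^bsub>N\<^esub>"
    and dd: "\<And>q x. x \<in> carrier (C (Suc (Suc q))) \<Longrightarrow> d q (d (Suc q) x) = \<zero>\<^bsub>C q\<^esub>"
    and h: "\<And>y. y \<in> carrier N \<Longrightarrow> \<epsilon> (t y) = y"
    and h0: "\<And>x. x \<in> carrier (C 0) \<Longrightarrow> d 0 (s 0 x) \<oplus>\<^bsub>C 0\<^esub> t (\<epsilon> x) = x"
    and hq: "\<And>q x. x \<in> carrier (C (Suc q)) \<Longrightarrow>
      d (Suc q) (s (Suc q) x) \<oplus>\<^bsub>C (Suc q)\<^esub> s q (d q x) = x"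
  shows "resolution R C d \<epsilon> N"
proof -
  interpret C: left_module R "C q" for q by (rule C)
  interpret N: left_module R N by (rule N)
  interpret d: add_map "C (Suc q)" "C q" "d q" for q
    by (rule left_module_hom_add_map[OF C C d])
  interpret \<epsilon>: add_map "C 0" N \<epsilon> by (rule left_module_hom_add_map[OF C N \<epsilon>])
  interpret s: add_map "C q" "C (Suc q)" "s q" for q by (rule s)
  interpret t: add_map N "C 0" t by (rule t)
  have "\<epsilon> ` carrier (C 0) = carrier N"
    using h t.closed \<epsilon>.closed by (auto simp: image_iff) metis
  moreover have "a_kernel (C 0) N \<epsilon> = d 0 ` carrier (C 1)"
  proof
    show "a_kernel (C 0) N \<epsilon> \<subseteq> d 0 ` carrier (C 1)"
    proof
      fix x assume "x \<in> a_kernel (C 0) N \<epsilon>"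
      then have x: "x \<in> carrier (C 0)" "\<epsilon> x = \<zero>\<^bsub>N\<^esub>" by (auto simp: a_kernel_def')
      then have "x = d 0 (s 0 x)" using h0[of x] s.closed[of x 0] by (simp add: t.zero d.closed)
      then show "x \<in> d 0 ` carrier (C 1)" using s.closed[of x 0] x by auto
    qed
  qed (use d0 d.closed[of _ 0] in \<open>auto simp: a_kernel_def'\<close>)
  moreover have "a_kernel (C (Suc q)) (C q) (d q) = d (Suc q) ` carrier (C (Suc (Suc q)))" for q
  proof
    show "a_kernel (C (Suc q)) (C q) (d q) \<subseteq> d (Suc q) ` carrier (C (Suc (Suc q)))"
    proof
      fix x assume "x \<in> a_kernel (C (Suc q)) (C q) (d q)"
      then have x: "x \<in> carrier (C (Suc q))" "d q x = \<zero>\<^bsub>C q\<^esub>" by (auto simp: a_kernel_def')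
      then have "x = d (Suc q) (s (Suc q) x)"
        using hq[of x q] s.closed[of x "Suc q"] by (simp add: s.zero d.closed)
      then show "x \<in> d (Suc q) ` carrier (C (Suc (Suc q)))" using s.closed[of x "Suc q"] x by auto
    qed
  qed (use dd d.closed[of _ "Suc q"] in \<open>auto simp: a_kernel_def'\<close>)
  ultimately show ?thesis using assms(1-4) by (auto simp: resolution_def)
qed

section \<open>Faces of lists\<close>

lemma sorted_wrt_less_iff: "sorted_wrt (<) xs \<longleftrightarrow> sorted_wrt (\<le>) xs \<and> distinct xs"
  for xs :: "'p::order list"
  by (induction xs) (auto simp: less_le)

lemma length_face: "i < length \<sigma> \<Longrightarrow> length (face i \<sigma>) = length \<sigma> - 1"
  by (auto simp: face_def)

lemma nth_face: "i < length \<sigma> \<Longrightarrow> k < length \<sigma> - 1 \<Longrightarrow> face i \<sigma> ! k = (if k < i then \<sigma> ! k else \<sigma> ! Suc k)"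
  by (auto simp: face_def nth_append)

lemma map_face: "map f (face i \<sigma>) = face i (map f \<sigma>)"
  by (simp add: face_def take_map drop_map)

lemma set_face: "set (face i \<sigma>) \<subseteq> set \<sigma>"
  using set_take_subset set_drop_subset by (fastforce simp: face_def)

text \<open>Both sides delete the entries of \<open>\<sigma>\<close> at the positions
  \<open>i\<close> and \<open>Suc j\<close>; once the earlier one is gone, the later one has moved
  down to \<open>j\<close>.\<close>

lemma face_face: "i \<le> j \<Longrightarrow> Suc j < length \<sigma> \<Longrightarrow> face i (face (Suc j) \<sigma>) = face j (face i \<sigma>)"
  by (rule nth_equalityI) (auto simp: length_face nth_face)

lemma face_append: "i < length \<sigma> \<Longrightarrow> face i (\<sigma> @ [t]) = face i \<sigma> @ [t]"
  by (simp add: face_def)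

lemma face_append_last: "face (length \<sigma>) (\<sigma> @ [t]) = \<sigma>"
  by (simp add: face_def)

lemma face_eq_adjacent:
  "Suc j < length \<tau> \<Longrightarrow> \<tau> ! j = \<tau> ! Suc j \<Longrightarrow> face j \<tau> = face (Suc j) \<tau>"
  by (rule nth_equalityI) (auto simp: length_face nth_face less_Suc_eq)

lemma distinct_face: "distinct \<sigma> \<Longrightarrow> i < length \<sigma> \<Longrightarrow> distinct (face i \<sigma>)"
  by (auto simp: distinct_conv_nth nth_face length_face)

text \<open>Deleting a third entry leaves the two equal neighbours in the list, moved down by one
  position if \<open>i < j\<close>. With \<open>face_eq_adjacent\<close> this describes all faces of
  a degenerate image chain.\<close>

lemma face_not_distinct:
  assumes "Suc j < length \<tau>" "\<tau> ! j = \<tau> ! Suc j" "i < length \<tau>" "i \<noteq> j" "i \<noteq> Suc j"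
  shows "\<not> distinct (face i \<tau>)"
proof (cases "i < j")
  case True
  then obtain k where k: "j = Suc k" "i \<le> k" by (cases j) auto
  then have "face i \<tau> ! k = face i \<tau> ! j" using assms by (simp add: nth_face)
  moreover have "k < length (face i \<tau>)" "j < length (face i \<tau>)" "k \<noteq> j"
    using assms k by (auto simp: length_face)
  ultimately show ?thesis by (metis nth_eq_iff_index_eq)
next
  case False
  then have "face i \<tau> ! j = face i \<tau> ! Suc j" using assms by (simp add: nth_face)
  moreover have "Suc j < length (face i \<tau>)" "j < length (face i \<tau>)" "Suc j \<noteq> j"
    using assms False by (auto simp: length_face)
  ultimately show ?thesis by (metis nth_eq_iff_index_eq)
qed

text \<open>Two equal entries of a weakly increasing list squeeze everything between them, so the
  first of them equals its successor.\<close>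

lemma adjacent_eq:
  fixes \<tau> :: "'p::order list"
  assumes "sorted_wrt (\<le>) \<tau>" "\<not> distinct \<tau>"
  obtains j where "Suc j < length \<tau>" "\<tau> ! j = \<tau> ! Suc j"
proof -
  obtain i k where ik: "i < k" "k < length \<tau>" "\<tau> ! i = \<tau> ! k"
    using assms(2) by (metis distinct_conv_nth nat_neq_iff)
  have "\<tau> ! i \<le> \<tau> ! Suc i"
    using assms(1) ik(1,2) by (simp add: sorted_wrt_iff_nth_less)
  moreover have "\<tau> ! Suc i \<le> \<tau> ! k"
    using assms(1) ik(1,2) by (cases "Suc i = k") (auto simp: sorted_wrt_iff_nth_less)
  ultimately have "\<tau> ! i = \<tau> ! Suc i" using ik(3) by (metis order.antisym)
  then show ?thesis using that[of i] ik by auto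
qed

section \<open>Left translation of principal right ideals\<close>

context monoid
begin

lemma mem_right_ideal: "x \<in> right_ideal G a \<longleftrightarrow> (\<exists>y\<in>carrier G. x = a \<otimes> y)"
  by (auto simp: right_ideal_def l_coset_def)

lemma right_ideal_subset: "a \<in> carrier G \<Longrightarrow> right_ideal G a \<subseteq> carrier G"
  by (auto simp: mem_right_ideal)

lemma right_ideal_self: "a \<in> carrier G \<Longrightarrow> a \<in> right_ideal G a"
  by (auto simp: mem_right_ideal intro!: bexI[of _ \<one>])

lemma lcoset_mult:
  "\<lbrakk>m \<in> carrier G; n \<in> carrier G; I \<subseteq> carrier G\<rbrakk> \<Longrightarrow> (m \<otimes> n) <# I = m <# (n <# I)"
  by (auto simp: l_coset_def m_assoc subset_iff)

lemma lcoset_one: "I \<subseteq> carrier G \<Longrightarrow> \<one> <# I = I"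
  by (auto simp: l_coset_def subset_iff)

lemma lcoset_right_ideal:
  "\<lbrakk>m \<in> carrier G; a \<in> carrier G\<rbrakk> \<Longrightarrow> m <# right_ideal G a = right_ideal G (m \<otimes> a)"
  by (simp add: right_ideal_def lcoset_mult)

lemma lcoset_mono: "I \<subseteq> J \<Longrightarrow> m <# I \<subseteq> m <# J"
  by (auto simp: l_coset_def)

lemma principal_subset: "I \<in> principal_right_ideals G \<Longrightarrow> I \<subseteq> carrier G"
  by (auto simp: principal_right_ideals_def dest: right_ideal_subset)

lemma lcoset_principal: "m \<in> carrier G \<Longrightarrow> I \<in> principal_right_ideals G \<Longrightarrow> m <# I \<in> principal_right_ideals G"
  by (auto simp: principal_right_ideals_def lcoset_right_ideal)

text \<open>The whole monoid is generated by the identity as a right ideal; it is the largest vertex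
  and hence the apex of the cone.\<close>

lemma top_principal: "carrier G \<in> principal_right_ideals G"
  by (auto simp: principal_right_ideals_def right_ideal_def lcoset_one intro!: image_eqI[of _ _ \<one>])

end

section \<open>The chain modules and their boundary maps\<close>

context fm
begin

abbreviation "Ch q \<equiv> strict_chains (principal_right_ideals M) q"

definition mact :: "'m \<Rightarrow> 'm set list \<Rightarrow> 'm set list option" where
  "mact m \<sigma> = (let \<tau> = map (\<lambda>I. m <#\<^bsub>M\<^esub> I) \<sigma> in if distinct \<tau> then Some \<tau> else None)"

lemma chain_module_eq: "chain_module K M q = based_module K M (Ch q) mact"
  by (simp add: chain_module_def mact_def[abs_def])

lemma finite_Ch: "finite (Ch q)"
proof -
  have "finite (principal_right_ideals M)" using finite_M by (simp add: principal_right_ideals_def)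
  then show ?thesis
    by (rule finite_subset[OF _ finite_lists_length_eq[of _ "Suc q"], rotated])
      (auto simp: strict_chains_def)
qed

lemma Ch_subset: "\<sigma> \<in> Ch q \<Longrightarrow> I \<in> set \<sigma> \<Longrightarrow> I \<subseteq> carrier M"
  by (auto simp: strict_chains_def dest!: M.principal_subset)

lemma map_lcoset_mult:
  "\<lbrakk>m \<in> carrier M; n \<in> carrier M; \<sigma> \<in> Ch q\<rbrakk> \<Longrightarrow>
    map (\<lambda>I. (m \<otimes>\<^bsub>M\<^esub> n) <#\<^bsub>M\<^esub> I) \<sigma> = map (\<lambda>I. m <#\<^bsub>M\<^esub> I) (map (\<lambda>I. n <#\<^bsub>M\<^esub> I) \<sigma>)"
  unfolding map_map by (rule map_cong[OF HOL.refl]) (metis M.lcoset_mult Ch_subset o_apply)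

lemma map_lcoset_sorted:
  "\<sigma> \<in> Ch q \<Longrightarrow> sorted_wrt (\<le>) (map (\<lambda>I. m <#\<^bsub>M\<^esub> I) \<sigma>)"
  by (simp add: strict_chains_def sorted_wrt_iff_nth_less M.lcoset_mono less_imp_le)

lemma Ch_distinct: "\<sigma> \<in> Ch q \<Longrightarrow> distinct \<sigma>"
  by (simp add: strict_chains_def sorted_wrt_less_iff)

text \<open>Translation is monotone for inclusion, so an image chain is weakly increasing, and
  strictly so as soon as its entries are distinct.\<close>

lemma mact_closed:
  assumes "m \<in> carrier M" "\<sigma> \<in> Ch q" "mact m \<sigma> = Some \<tau>"
  shows "\<tau> \<in> Ch q"
  using assms map_lcoset_sorted[OF assms(2), of m]
  by (auto simp: mact_def Let_def strict_chains_def sorted_wrt_less_iff subset_iff M.lcoset_principal split: if_splits)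

text \<open>A repetition created by one translation persists under the next; hence undefinedness
  propagates as the adjoined zero requires.\<close>

lemma based_chain: "based K M (Ch q) mact"
proof unfold_locales
  fix \<sigma> assume s: "\<sigma> \<in> Ch q"
  have "map (\<lambda>I. \<one>\<^bsub>M\<^esub> <#\<^bsub>M\<^esub> I) \<sigma> = \<sigma>" using Ch_subset[OF s] by (simp add: M.lcoset_one map_idI)
  then show "mact \<one>\<^bsub>M\<^esub> \<sigma> = Some \<sigma>" using Ch_distinct[OF s] by (simp add: mact_def)
  fix m n assume "m \<in> carrier M" "n \<in> carrier M"
  then show "mact (m \<otimes>\<^bsub>M\<^esub> n) \<sigma> = Option.bind (mact n \<sigma>) (mact m)"
    using s by (auto simp: mact_def Let_def map_lcoset_mult distinct_map simp del: map_map)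
qed (auto intro: finite_Ch mact_closed)

sublocale Q: based K M "strict_chains (principal_right_ideals M) q" mact for q
  by (rule based_chain)

abbreviation "CM q \<equiv> based_module K M (Ch q) mact"
abbreviation "bq q \<equiv> basis_scaled K (Ch q)"

text \<open>The sign is put on the coefficient, so that a signed face is again a scaled basis
  element.\<close>

definition sg :: "nat \<Rightarrow> 'k \<Rightarrow> 'k" where "sg i c = (if even i then c else \<ominus>\<^bsub>K\<^esub> c)"

lemma sg_closed [simp]: "c \<in> carrier K \<Longrightarrow> sg i c \<in> carrier K" by (simp add: sg_def)
lemma sg_sg [simp]: "c \<in> carrier K \<Longrightarrow> sg i (sg i c) = c" by (simp add: sg_def)
lemma sg_commute: "c \<in> carrier K \<Longrightarrow> sg i (sg j c) = sg j (sg i c)" by (simp add: sg_def)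
lemma sg_Suc: "c \<in> carrier K \<Longrightarrow> sg (Suc i) c = \<ominus>\<^bsub>K\<^esub> sg i c" by (simp add: sg_def)
lemma sg_mult: "c \<in> carrier K \<Longrightarrow> d \<in> carrier K \<Longrightarrow> c \<otimes>\<^bsub>K\<^esub> sg i d = sg i (c \<otimes>\<^bsub>K\<^esub> d)"
  by (simp add: sg_def K.r_minus)
lemma sg_add_map: "add_map K K (sg i)"
  by unfold_locales (auto simp: sg_def K.minus_add)
lemma bq_neg: "c \<in> carrier K \<Longrightarrow> bq q \<sigma> (\<ominus>\<^bsub>K\<^esub> c) = \<ominus>\<^bsub>CM q\<^esub> bq q \<sigma> c"
  by (rule add_map.neg[OF Q.C.bs_add_map])

lemma face_Ch:
  assumes "\<sigma> \<in> Ch (Suc q)" "i \<le> Suc q"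
  shows "face i \<sigma> \<in> Ch q"
proof -
  have l: "length \<sigma> = Suc (Suc q)" and s: "sorted_wrt (<) \<sigma>" and P: "set \<sigma> \<subseteq> principal_right_ideals M"
    using assms(1) by (auto simp: strict_chains_def)
  have "sorted_wrt (<) (face i \<sigma>)"
    using s assms(2) l by (auto simp: sorted_wrt_iff_nth_less length_face nth_face)
  then show ?thesis
    using P l assms(2) set_face[of i \<sigma>] by (auto simp: strict_chains_def length_face)
qed

lemma boundary_add_map: "add_map (CM (Suc q)) (CM q) (boundary K M q)"
proof unfold_locales
  let ?S = "\<lambda>\<tau>. {(\<sigma>, i). \<sigma> \<in> Ch (Suc q) \<and> i \<le> Suc q \<and> face i \<sigma> = \<tau>}"
  have b: "boundary K M q f = (\<lambda>\<tau>\<in>Ch q. finsum K (\<lambda>p. sg (snd p) (f (fst p))) (?S \<tau>))" for f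
    by (simp add: boundary_def sg_def split_def)
  fix f assume f: "f \<in> carrier (CM (Suc q))"
  show "boundary K M q f \<in> carrier (CM q)"
    unfolding b by (rule Q.C.restrict_closed) (use f in \<open>auto simp: Q.C.eval_closed intro!: K.finsum_closed\<close>)
  fix g assume g: "g \<in> carrier (CM (Suc q))"
  show "boundary K M q (f \<oplus>\<^bsub>CM (Suc q)\<^esub> g) = boundary K M q f \<oplus>\<^bsub>CM q\<^esub> boundary K M q g"
    unfolding b by (subst (2) Q.C.add_C, rule restrict_ext, simp only: restrict_apply',
      subst K.finsum_addf[symmetric])
      (use f g in \<open>auto simp: Q.C.add_C Q.C.eval_closed add_map.add[OF sg_add_map]
        simp del: K.add.finprod_multf intro!: K.finsum_cong'\<close>)
qed

text \<open>The definition of \<open>boundary\<close> collects, for each target chain, all pairs of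
  a chain and a position with that face. Read off from a single source chain instead, this is the
  usual alternating sum of faces.\<close>

lemma boundary_bs:
  assumes "\<sigma> \<in> Ch (Suc q)" and c: "c \<in> carrier K"
  shows "boundary K M q (bq (Suc q) \<sigma> c) = (\<Oplus>\<^bsub>CM q\<^esub>i\<in>{..Suc q}. bq q (face i \<sigma>) (sg i c))"
proof (rule Q.C.C_eqI)
  let ?S = "\<lambda>\<tau>. {(\<sigma>, i). \<sigma> \<in> Ch (Suc q) \<and> i \<le> Suc q \<and> face i \<sigma> = \<tau>}"
  show "boundary K M q (bq (Suc q) \<sigma> c) \<in> carrier (CM q)"
    using add_map.closed[OF boundary_add_map] c by simp
  show "(\<Oplus>\<^bsub>CM q\<^esub>i\<in>{..Suc q}. bq q (face i \<sigma>) (sg i c)) \<in> carrier (CM q)"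
    using c by (intro Q.C.C.finsum_closed) auto
  fix \<tau> assume t: "\<tau> \<in> Ch q"
  let ?T = "{i \<in> {..Suc q}. face i \<sigma> = \<tau>}" and ?f = "bq (Suc q) \<sigma> c"
  have "boundary K M q ?f \<tau> = finsum K (\<lambda>p. sg (snd p) (?f (fst p))) (?S \<tau>)"
    using t by (simp add: boundary_def sg_def split_def)
  also have "\<dots> = finsum K (\<lambda>p. sg (snd p) (?f (fst p))) (Pair \<sigma> ` ?T)"
  proof (rule K.finsum_neutral)
    have "?S \<tau> \<subseteq> Ch (Suc q) \<times> {..Suc q}" by auto
    then show "finite (?S \<tau>)" by (rule finite_subset) (use finite_Ch in auto)
  qed (use assms in \<open>auto simp: Q.C.bs_apply sg_def\<close>)
  also have "\<dots> = (\<Oplus>\<^bsub>K\<^esub>i\<in>?T. sg i c)"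
    using assms by (subst K.finsum_reindex) (auto simp: Q.C.bs_apply inj_on_def intro!: K.finsum_cong')
  also have "\<dots> = (\<Oplus>\<^bsub>K\<^esub>i\<in>?T. bq q (face i \<sigma>) (sg i c) \<tau>)"
    using c t by (intro K.finsum_cong') (auto simp: Q.C.bs_apply)
  also have "\<dots> = (\<Oplus>\<^bsub>K\<^esub>i\<in>{..Suc q}. bq q (face i \<sigma>) (sg i c) \<tau>)"
    using c t by (intro K.finsum_neutral[symmetric]) (auto simp: Q.C.bs_apply)
  also have "\<dots> = (\<Oplus>\<^bsub>CM q\<^esub>i\<in>{..Suc q}. bq q (face i \<sigma>) (sg i c)) \<tau>"
    using c t by (subst Q.C.eval_finsum) auto
  finally show "boundary K M q ?f \<tau> = \<dots>" .
qed

text \<open>The faces of a degenerate image chain cancel in pairs.\<close>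

lemma boundary_hom: "boundary K M q \<in> left_module_hom R (CM (Suc q)) (CM q)"
proof (rule left_module_hom_basedI[OF based_chain Q.left_module_C boundary_add_map])
  fix m c \<sigma> d
  assume m: "m \<in> carrier M" and c: "c \<in> carrier K" and s: "\<sigma> \<in> Ch (Suc q)" and d: "d \<in> carrier K"
  let ?\<tau> = "map (\<lambda>I. m <#\<^bsub>M\<^esub> I) \<sigma>"
  have l: "length ?\<tau> = Suc (Suc q)" using s by (simp add: strict_chains_def)
  have cd: "c \<otimes>\<^bsub>K\<^esub> d \<in> carrier K" using c d by simp
  define t where "t i = (if distinct (face i ?\<tau>) then bq q (face i ?\<tau>) (sg i (c \<otimes>\<^bsub>K\<^esub> d)) else \<zero>\<^bsub>CM q\<^esub>)" for i
  have tc: "t i \<in> carrier (CM q)" for i using cd by (simp add: t_def)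
  have "e m c \<odot>\<^bsub>CM q\<^esub> boundary K M q (bq (Suc q) \<sigma> d) =
      (\<Oplus>\<^bsub>CM q\<^esub>i\<in>{..Suc q}. e m c \<odot>\<^bsub>CM q\<^esub> bq q (face i \<sigma>) (sg i d))"
    unfolding boundary_bs[OF s d] using c d
    by (intro add_map.finsum[OF Q.CM.smult_right_add_map]) auto
  also have "\<dots> = (\<Oplus>\<^bsub>CM q\<^esub>i\<in>{..Suc q}. t i)"
    using m c d s tc by (intro Q.C.C.finsum_cong')
      (auto simp: Q.smult_gen face_Ch mact_def map_face t_def sg_mult)
  finally have 1: "e m c \<odot>\<^bsub>CM q\<^esub> boundary K M q (bq (Suc q) \<sigma> d) = (\<Oplus>\<^bsub>CM q\<^esub>i\<in>{..Suc q}. t i)" .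
  show "e m c \<odot>\<^bsub>CM q\<^esub> boundary K M q (bq (Suc q) \<sigma> d) = (case mact m \<sigma> of
    None \<Rightarrow> \<zero>\<^bsub>CM q\<^esub> | Some b' \<Rightarrow> boundary K M q (bq (Suc q) b' (c \<otimes>\<^bsub>K\<^esub> d)))"
  proof (cases "distinct ?\<tau>")
    case True
    then have a: "mact m \<sigma> = Some ?\<tau>" by (simp add: mact_def)
    show ?thesis
      unfolding 1 a option.case boundary_bs[OF mact_closed[OF m s a] cd]
      using True tc l cd by (intro Q.C.C.finsum_cong') (auto simp: t_def distinct_face)
  next
    case False
    then have a: "mact m \<sigma> = None" by (simp add: mact_def)
    \<comment> \<open>For equal neighbours at \<open>j\<close> and \<open>Suc j\<close>, the faces
      \<open>j\<close> and \<open>Suc j\<close> are the same list with opposite signs, and every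
      other face still contains the equal pair.\<close>
    obtain j where j: "Suc j < length ?\<tau>" "?\<tau> ! j = ?\<tau> ! Suc j"
      using adjacent_eq[OF map_lcoset_sorted[OF s] False] .
    have "(\<Oplus>\<^bsub>CM q\<^esub>i\<in>{..Suc q}. t i) = (\<Oplus>\<^bsub>CM q\<^esub>i\<in>{j, Suc j}. t i)"
    proof (rule Q.C.C.finsum_neutral)
      fix i assume "i \<in> {..Suc q} - {j, Suc j}"
      then have "\<not> distinct (face i ?\<tau>)"
        using face_not_distinct[OF j, of i] l by auto
      then show "t i = \<zero>\<^bsub>CM q\<^esub>" by (simp add: t_def)
    qed (use j l tc in auto)
    also have "\<dots> = t j \<oplus>\<^bsub>CM q\<^esub> t (Suc j)" using tc by (simp add: Q.C.C.finsum_insert)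
    also have "\<dots> = \<zero>\<^bsub>CM q\<^esub>"
      using face_eq_adjacent[OF j] cd
      by (simp add: t_def sg_Suc bq_neg Q.C.C.r_neg)
    finally show ?thesis unfolding 1 a by simp
  qed
qed

lemma boundary_boundary:
  assumes "x \<in> carrier (CM (Suc (Suc q)))"
  shows "boundary K M q (boundary K M (Suc q) x) = \<zero>\<^bsub>CM q\<^esub>"
  using add_map_comp[OF boundary_add_map boundary_add_map] add_map_zero[OF Q.C.abelian_C Q.C.abelian_C] assms
proof (rule Q.C.add_map_eqI)
  fix \<sigma> c assume s: "\<sigma> \<in> Ch (Suc (Suc q))" and c: "c \<in> carrier K"
  have l: "length \<sigma> = Suc (Suc (Suc q))" using s by (simp add: strict_chains_def)
  define t where "t p = bq q (face (snd p) (face (fst p) \<sigma>)) (sg (snd p) (sg (fst p) c))" for p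
  have tc: "t p \<in> carrier (CM q)" for p using c by (simp add: t_def)
  let ?U = "{..Suc (Suc q)} \<times> {..Suc q}"
  \<comment> \<open>\<open>?L\<close> and \<open>?G\<close> split the double sum, and (i, j) -> (Suc
    j, i) carries \<open>?G\<close> onto \<open>?L\<close>. By the simplicial identity corresponding
    double faces agree, and the shift by one flips the sign.\<close>
  let ?L = "{p \<in> ?U. snd p < fst p}" and ?G = "{p \<in> ?U. fst p \<le> snd p}"
  have "boundary K M q (boundary K M (Suc q) (bq (Suc (Suc q)) \<sigma> c)) =
    (\<Oplus>\<^bsub>CM q\<^esub>i\<in>{..Suc (Suc q)}. boundary K M q (bq (Suc q) (face i \<sigma>) (sg i c)))"
    unfolding boundary_bs[OF s c] using c
    by (intro add_map.finsum[OF boundary_add_map]) auto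
  also have "\<dots> = (\<Oplus>\<^bsub>CM q\<^esub>i\<in>{..Suc (Suc q)}. \<Oplus>\<^bsub>CM q\<^esub>j\<in>{..Suc q}. t (i, j))"
    using c s by (intro Q.C.C.finsum_cong') (auto simp: t_def boundary_bs face_Ch intro!: Q.C.C.finsum_closed)
  also have "\<dots> = (\<Oplus>\<^bsub>CM q\<^esub>p\<in>?U. t p)"
  proof -
    have U: "?U = (\<Union>i\<in>{..Suc (Suc q)}. Pair i ` {..Suc q})" by auto
    have "(\<Oplus>\<^bsub>CM q\<^esub>p\<in>?U. t p) = (\<Oplus>\<^bsub>CM q\<^esub>i\<in>{..Suc (Suc q)}. \<Oplus>\<^bsub>CM q\<^esub>p\<in>Pair i ` {..Suc q}. t p)"
      unfolding U using tc by (intro Q.C.C.add.finprod_UN_disjoint) (auto simp: pairwise_def disjnt_def)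
    also have "\<dots> = (\<Oplus>\<^bsub>CM q\<^esub>i\<in>{..Suc (Suc q)}. \<Oplus>\<^bsub>CM q\<^esub>j\<in>{..Suc q}. t (i, j))"
      using tc by (intro Q.C.C.finsum_cong' Q.C.C.finsum_reindex)
        (auto simp: inj_on_def intro!: Q.C.C.finsum_closed)
    finally show ?thesis by simp
  qed
  also have "\<dots> = (\<Oplus>\<^bsub>CM q\<^esub>p\<in>?L \<union> ?G. t p)" by (rule arg_cong[where f = "finsum _ _"]) auto
  also have "\<dots> = (\<Oplus>\<^bsub>CM q\<^esub>p\<in>?L. t p) \<oplus>\<^bsub>CM q\<^esub> (\<Oplus>\<^bsub>CM q\<^esub>p\<in>?G. t p)"
    using tc by (intro Q.C.C.finsum_Un_disjoint) auto
  also have "(\<Oplus>\<^bsub>CM q\<^esub>p\<in>?L. t p) = (\<Oplus>\<^bsub>CM q\<^esub>p\<in>(\<lambda>(i, j). (Suc j, i)) ` ?G. t p)"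
  proof (rule arg_cong[where f = "finsum _ _"])
    show "?L = (\<lambda>(i, j). (Suc j, i)) ` ?G"
    proof (intro equalityI subsetI)
      fix p assume "p \<in> ?L"
      then show "p \<in> (\<lambda>(i, j). (Suc j, i)) ` ?G"
        by (intro image_eqI[of _ _ "(snd p, fst p - 1)"]) auto
    qed auto
  qed
  also have "\<dots> = (\<Oplus>\<^bsub>CM q\<^esub>p\<in>?G. t (Suc (snd p), fst p))"
    using tc by (subst Q.C.C.finsum_reindex) (auto simp: inj_on_def case_prod_beta)
  also have "\<dots> = (\<Oplus>\<^bsub>CM q\<^esub>p\<in>?G. \<ominus>\<^bsub>CM q\<^esub> t p)"
  proof (rule Q.C.C.finsum_cong')
    fix p assume p: "p \<in> ?G"
    then have "face (fst p) (face (Suc (snd p)) \<sigma>) = face (snd p) (face (fst p) \<sigma>)"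
      using l by (intro face_face) auto
    then show "t (Suc (snd p), fst p) = \<ominus>\<^bsub>CM q\<^esub> t p"
      using c sg_commute[of c "fst p" "Suc (snd p)"] by (simp add: t_def sg_Suc bq_neg)
  qed (use tc in auto)
  also have "\<dots> \<oplus>\<^bsub>CM q\<^esub> (\<Oplus>\<^bsub>CM q\<^esub>p\<in>?G. t p) = (\<Oplus>\<^bsub>CM q\<^esub>p\<in>?G. \<ominus>\<^bsub>CM q\<^esub> t p \<oplus>\<^bsub>CM q\<^esub> t p)"
    using tc by (intro Q.C.C.finsum_addf[symmetric]) auto
  also have "\<dots> = (\<Oplus>\<^bsub>CM q\<^esub>p\<in>?G. \<zero>\<^bsub>CM q\<^esub>)"
    using tc by (intro Q.C.C.finsum_cong') (auto simp: Q.C.C.l_neg)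
  finally show "boundary K M q (boundary K M (Suc q) (bq (Suc (Suc q)) \<sigma> c)) = \<zero>\<^bsub>CM q\<^esub>" by simp
qed

lemma trivial_smult:
  assumes "x \<in> carrier R"
  shows "x \<odot>\<^bsub>trivial_module K M\<^esub> c = (\<Oplus>\<^bsub>K\<^esub>m\<in>carrier M. x m) \<otimes>\<^bsub>K\<^esub> c"
proof -
  have "(\<Oplus>\<^bsub>K\<^esub>m\<in>carrier M. x m) = (\<Oplus>\<^bsub>K\<^esub>m\<in>supp K (carrier M) x. x m)"
    using assms finite_M by (intro K.finsum_neutral) (auto simp: supp_def R.eval_closed)
  then show ?thesis by (simp add: trivial_module_def)
qed

lemma trivial_smult_gen:
  assumes "m \<in> carrier M" "c \<in> carrier K"
  shows "e m c \<odot>\<^bsub>trivial_module K M\<^esub> v = c \<otimes>\<^bsub>K\<^esub> v"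
proof -
  have "(\<Oplus>\<^bsub>K\<^esub>m'\<in>carrier M. e m c m') = e m c m"
    using assms finite_M by (intro K.finsum_single) (auto simp: R.bs_apply)
  then show ?thesis using assms by (simp add: trivial_smult R.bs_apply)
qed

lemma left_module_trivial: "left_module R (trivial_module K M)"
proof (rule left_moduleI)
  let ?T = "trivial_module K M"
  have T: "carrier ?T = carrier K" "\<zero>\<^bsub>?T\<^esub> = \<zero>\<^bsub>K\<^esub>" "x \<oplus>\<^bsub>?T\<^esub> y = x \<oplus>\<^bsub>K\<^esub> y" for x y
    by (simp_all add: trivial_module_def)
  show ab: "abelian_group ?T"
    by (rule abelian_groupI) (auto simp: T K.a_ac intro: bexI[of _ "\<ominus>\<^bsub>K\<^esub> _"] K.l_neg)
  note sm = trivial_smult and gen = trivial_smult_gen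
  have sc: "x \<in> carrier R \<Longrightarrow> (\<Oplus>\<^bsub>K\<^esub>m\<in>carrier M. x m) \<in> carrier K" for x
    by (auto simp: R.eval_closed intro!: K.finsum_closed)
  show cl: "x \<odot>\<^bsub>?T\<^esub> v \<in> carrier ?T" if "x \<in> carrier R" "v \<in> carrier ?T" for x v
    using that sc by (simp add: T sm)
  show "add_map R ?T (\<lambda>x. x \<odot>\<^bsub>?T\<^esub> v)" if v: "v \<in> carrier ?T" for v
  proof (intro add_map.intro add_map_axioms.intro R.abelian_C ab)
    fix x y assume xy: "x \<in> carrier R" "y \<in> carrier R"
    have "(\<Oplus>\<^bsub>K\<^esub>m\<in>carrier M. (x \<oplus>\<^bsub>R\<^esub> y) m) = (\<Oplus>\<^bsub>K\<^esub>m\<in>carrier M. x m) \<oplus>\<^bsub>K\<^esub> (\<Oplus>\<^bsub>K\<^esub>m\<in>carrier M. y m)"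
      using xy by (subst K.finsum_addf[symmetric])
        (auto simp: R.add_C R.eval_closed simp del: K.add.finprod_multf intro!: K.finsum_cong')
    then show "(x \<oplus>\<^bsub>R\<^esub> y) \<odot>\<^bsub>?T\<^esub> v = x \<odot>\<^bsub>?T\<^esub> v \<oplus>\<^bsub>?T\<^esub> y \<odot>\<^bsub>?T\<^esub> v"
      using xy v sc by (simp add: sm T K.l_distr)
  qed (use v cl in auto)
  show "add_map ?T ?T (\<lambda>v. x \<odot>\<^bsub>?T\<^esub> v)" if x: "x \<in> carrier R" for x
    using x sc cl by (intro add_map.intro add_map_axioms.intro ab) (auto simp: T sm K.r_distr)
  fix v assume v: "v \<in> carrier ?T"
  show "e \<one>\<^bsub>M\<^esub> \<one>\<^bsub>K\<^esub> \<odot>\<^bsub>?T\<^esub> v = v" using v by (simp add: gen T)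
  fix m n c d assume "m \<in> carrier M" "n \<in> carrier M" "c \<in> carrier K" "d \<in> carrier K"
  then show "e m c \<odot>\<^bsub>?T\<^esub> (e n d \<odot>\<^bsub>?T\<^esub> v) = e (m \<otimes>\<^bsub>M\<^esub> n) (c \<otimes>\<^bsub>K\<^esub> d) \<odot>\<^bsub>?T\<^esub> v"
    using v by (simp add: gen T K.m_assoc)
qed

end


section \<open>Augmentation and the contracting cone\<close>

context fm
begin

lemma augmentation_add_map: "add_map (CM 0) K (augmentation K M)"
  unfolding augmentation_def
  by (rule add_map_finsum[OF finite_Ch Q.C.abelian_C K.abelian_group_axioms Q.C.eval_add_map])

lemma augmentation_bs: "\<sigma> \<in> Ch 0 \<Longrightarrow> c \<in> carrier K \<Longrightarrow> augmentation K M (bq 0 \<sigma> c) = c"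
  unfolding augmentation_def
  by (subst K.finsum_single[of _ \<sigma>]) (auto simp: finite_Ch Q.C.bs_apply)

lemma Ch_0: "\<sigma> \<in> Ch 0 \<longleftrightarrow> (\<exists>I\<in>principal_right_ideals M. \<sigma> = [I])"
  by (auto simp: strict_chains_def length_Suc_conv)

lemma augmentation_hom: "augmentation K M \<in> left_module_hom R (CM 0) (trivial_module K M)"
proof (rule left_module_hom_basedI[OF based_chain left_module_trivial])
  show "add_map (CM 0) (trivial_module K M) (augmentation K M)"
    using augmentation_add_map left_module_trivial
    by (simp add: add_map_def add_map_axioms_def trivial_module_def left_module_def)
  fix m c \<sigma> d
  assume 1: "m \<in> carrier M" "c \<in> carrier K" "\<sigma> \<in> Ch 0" "d \<in> carrier K"
  then obtain I where I: "\<sigma> = [I]" by (auto simp: Ch_0)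
  then have a: "mact m \<sigma> = Some [m <#\<^bsub>M\<^esub> I]" by (simp add: mact_def)
  show "e m c \<odot>\<^bsub>trivial_module K M\<^esub> augmentation K M (bq 0 \<sigma> d) = (case mact m \<sigma> of
      None \<Rightarrow> \<zero>\<^bsub>trivial_module K M\<^esub> | Some b' \<Rightarrow> augmentation K M (bq 0 b' (c \<otimes>\<^bsub>K\<^esub> d)))"
    using 1 mact_closed[OF 1(1,3) a] by (simp add: a augmentation_bs trivial_smult_gen)
qed

lemma augmentation_boundary:
  assumes "x \<in> carrier (CM 1)"
  shows "augmentation K M (boundary K M 0 x) = \<zero>\<^bsub>K\<^esub>"
proof (rule Q.C.add_map_eqI[of 1 K "\<lambda>x. augmentation K M (boundary K M 0 x)" "\<lambda>x. \<zero>\<^bsub>K\<^esub>"])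
  show "add_map (CM 1) K (\<lambda>x. augmentation K M (boundary K M 0 x))"
    using add_map_comp[OF boundary_add_map[of 0] augmentation_add_map] by simp
  show "add_map (CM 1) K (\<lambda>x. \<zero>\<^bsub>K\<^esub>)" by (rule add_map_zero[OF Q.C.abelian_C K.abelian_group_axioms])
  fix \<sigma> c assume s: "\<sigma> \<in> Ch 1" and c: "c \<in> carrier K"
  have s': "\<sigma> \<in> Ch (Suc 0)" using s by simp
  have "augmentation K M (boundary K M 0 (bq 1 \<sigma> c)) =
    (\<Oplus>\<^bsub>K\<^esub>i\<in>{..Suc 0}. augmentation K M (bq 0 (face i \<sigma>) (sg i c)))"
    unfolding One_nat_def boundary_bs[OF s' c] using c
    by (intro add_map.finsum[OF augmentation_add_map]) auto
  also have "\<dots> = (\<Oplus>\<^bsub>K\<^esub>i\<in>{..Suc 0}. sg i c)"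
    using c face_Ch[OF s'] by (intro K.finsum_cong') (auto simp: augmentation_bs)
  also have "\<dots> = \<zero>\<^bsub>K\<^esub>" using c by (simp add: sg_def K.l_neg)
  finally show "augmentation K M (boundary K M 0 (bq 1 \<sigma> c)) = \<zero>\<^bsub>K\<^esub>" .
qed (use assms in simp)

text \<open>The sign makes \<open>\<sigma>\<close> occur with coefficient \<open>1\<close> in the boundary of the cone over it.\<close>

definition cone :: "nat \<Rightarrow> ('m set list \<Rightarrow> 'k) \<Rightarrow> ('m set list \<Rightarrow> 'k)" where
  "cone q = linext (CM (Suc q)) (Ch q) (\<lambda>\<sigma> c. if last \<sigma> = carrier M then \<zero>\<^bsub>CM (Suc q)\<^esub>
     else bq (Suc q) (\<sigma> @ [carrier M]) (sg (Suc q) c))"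

lemma Ch_snoc:
  assumes "\<sigma> \<in> Ch q" "last \<sigma> \<noteq> carrier M"
  shows "\<sigma> @ [carrier M] \<in> Ch (Suc q)"
proof -
  have l: "\<sigma> \<noteq> []" and s: "sorted_wrt (<) \<sigma>" using assms(1) by (auto simp: strict_chains_def)
  have "I < carrier M" if I: "I \<in> set \<sigma>" for I
  proof -
    have "I \<le> last \<sigma>"
      using s I l by (cases \<sigma> rule: rev_cases) (auto simp: sorted_wrt_append)
    also have "last \<sigma> < carrier M" using assms Ch_subset[OF assms(1), of "last \<sigma>"] l by auto
    finally show ?thesis .
  qed
  then show ?thesis
    using assms(1) M.top_principal by (auto simp: strict_chains_def sorted_wrt_append)
qed

lemma cone_gen_add_map:
  "add_map K (CM (Suc q)) (\<lambda>c. if last \<sigma> = carrier M then \<zero>\<^bsub>CM (Suc q)\<^esub>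
     else bq (Suc q) (\<sigma> @ [carrier M]) (sg (Suc q) c))"
  by (cases "last \<sigma> = carrier M")
    (simp_all add: add_map_comp[OF sg_add_map Q.C.bs_add_map]
      add_map_zero[OF K.abelian_group_axioms Q.C.abelian_C])

lemma cone_add_map: "add_map (CM q) (CM (Suc q)) (cone q)"
  unfolding cone_def by (rule Q.C.linext_add_map[OF Q.C.abelian_C subset_refl cone_gen_add_map])

lemma cone_bs: "\<sigma> \<in> Ch q \<Longrightarrow> c \<in> carrier K \<Longrightarrow> cone q (bq q \<sigma> c) =
    (if last \<sigma> = carrier M then \<zero>\<^bsub>CM (Suc q)\<^esub> else bq (Suc q) (\<sigma> @ [carrier M]) (sg (Suc q) c))"
  unfolding cone_def by (subst Q.C.linext_bs[OF Q.C.abelian_C subset_refl cone_gen_add_map]) auto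

text \<open>The last face of the cone is \<open>\<sigma>\<close>, and it carries the same sign
  twice; the other faces are the faces of \<open>\<sigma>\<close> with the apex attached.\<close>

lemma boundary_cone_bs:
  assumes s: "\<sigma> \<in> Ch q" and l: "last \<sigma> \<noteq> carrier M" and c: "c \<in> carrier K"
  shows "boundary K M q (cone q (bq q \<sigma> c)) = bq q \<sigma> c \<oplus>\<^bsub>CM q\<^esub>
    (\<Oplus>\<^bsub>CM q\<^esub>i\<in>{..q}. bq q (face i \<sigma> @ [carrier M]) (sg i (sg (Suc q) c)))"
proof -
  have len: "length \<sigma> = Suc q" using s by (simp add: strict_chains_def)
  have "boundary K M q (cone q (bq q \<sigma> c)) =
    (\<Oplus>\<^bsub>CM q\<^esub>i\<in>{..Suc q}. bq q (face i (\<sigma> @ [carrier M])) (sg i (sg (Suc q) c)))"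
    using s c l Ch_snoc[OF s l] by (simp add: cone_bs boundary_bs)
  also have "\<dots> = bq q \<sigma> c \<oplus>\<^bsub>CM q\<^esub>
    (\<Oplus>\<^bsub>CM q\<^esub>i\<in>{..q}. bq q (face i (\<sigma> @ [carrier M])) (sg i (sg (Suc q) c)))"
    using c face_append_last[of \<sigma> "carrier M"] len by (subst Q.C.C.finsum_Suc) auto
  also have "(\<Oplus>\<^bsub>CM q\<^esub>i\<in>{..q}. bq q (face i (\<sigma> @ [carrier M])) (sg i (sg (Suc q) c))) =
    (\<Oplus>\<^bsub>CM q\<^esub>i\<in>{..q}. bq q (face i \<sigma> @ [carrier M]) (sg i (sg (Suc q) c)))"
    using c len by (intro Q.C.C.finsum_cong') (auto simp: face_append)
  finally show ?thesis .
qed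

lemma cone_homotopy_0:
  assumes x: "x \<in> carrier (CM 0)"
  shows "boundary K M 0 (cone 0 x) \<oplus>\<^bsub>CM 0\<^esub> bq 0 [carrier M] (augmentation K M x) = x"
  using _ add_map_id[OF Q.C.abelian_C] x
proof (rule Q.C.add_map_eqI)
  show "add_map (CM 0) (CM 0) (\<lambda>x. boundary K M 0 (cone 0 x) \<oplus>\<^bsub>CM 0\<^esub> bq 0 [carrier M] (augmentation K M x))"
    by (rule add_map_sum[OF add_map_comp[OF cone_add_map boundary_add_map]
        add_map_comp[OF augmentation_add_map Q.C.bs_add_map]])
  fix \<sigma> c assume s: "\<sigma> \<in> Ch 0" and c: "c \<in> carrier K"
  then obtain I where I: "\<sigma> = [I]" by (auto simp: Ch_0)
  show "boundary K M 0 (cone 0 (bq 0 \<sigma> c)) \<oplus>\<^bsub>CM 0\<^esub> bq 0 [carrier M] (augmentation K M (bq 0 \<sigma> c)) = bq 0 \<sigma> c"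
  proof (cases "last \<sigma> = carrier M")
    case True
    then show ?thesis
      using s c I by (simp add: cone_bs augmentation_bs add_map.zero[OF boundary_add_map])
  next
    case False
    \<comment> \<open>Deleting the only vertex of \<open>\<sigma>\<close> leaves the apex alone,
      with a minus sign; it cancels against the augmentation term.\<close>
    have "(\<Oplus>\<^bsub>CM 0\<^esub>i\<in>{..0::nat}. bq 0 (face i \<sigma> @ [carrier M]) (sg i (sg (Suc 0) c))) =
      \<ominus>\<^bsub>CM 0\<^esub> bq 0 [carrier M] c"
      using c by (simp add: I face_def sg_def bq_neg)
    then show ?thesis
      using boundary_cone_bs[OF s False c] s c
      by (simp add: augmentation_bs Q.C.C.a_assoc Q.C.C.l_neg)
  qed
qed

lemma cone_homotopy:
  assumes x: "x \<in> carrier (CM (Suc q))"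
  shows "boundary K M (Suc q) (cone (Suc q) x) \<oplus>\<^bsub>CM (Suc q)\<^esub> cone q (boundary K M q x) = x"
  using _ add_map_id[OF Q.C.abelian_C] x
proof (rule Q.C.add_map_eqI)
  let ?C = "CM (Suc q)" and ?T = "carrier M"
  show "add_map ?C ?C (\<lambda>x. boundary K M (Suc q) (cone (Suc q) x) \<oplus>\<^bsub>?C\<^esub> cone q (boundary K M q x))"
    by (rule add_map_sum[OF add_map_comp[OF cone_add_map boundary_add_map]
          add_map_comp[OF boundary_add_map cone_add_map]])
  fix \<sigma> c assume s: "\<sigma> \<in> Ch (Suc q)" and c: "c \<in> carrier K"
  have len: "length \<sigma> = Suc (Suc q)" and sorted: "sorted_wrt (<) \<sigma>"
    using s by (auto simp: strict_chains_def)
  have lastface: "last (face i \<sigma>) = last \<sigma>" if "i \<le> q" for i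
    using len that by (auto simp: face_def)
  have lastface': "last (face (Suc q) \<sigma>) < last \<sigma>"
  proof -
    have n: "face (Suc q) \<sigma> \<noteq> []" using length_face[of "Suc q" \<sigma>] len by auto
    have "\<sigma> \<noteq> []" using len by auto
    with n have "last (face (Suc q) \<sigma>) = \<sigma> ! q" "last \<sigma> = \<sigma> ! Suc q"
      using len n by (auto simp: last_conv_nth length_face nth_face)
    then show ?thesis using sorted len by (simp add: sorted_wrt_iff_nth_less)
  qed
  have cb: "cone q (boundary K M q (bq (Suc q) \<sigma> c)) =
    (\<Oplus>\<^bsub>?C\<^esub>i\<in>{..Suc q}. cone q (bq q (face i \<sigma>) (sg i c)))"
    unfolding boundary_bs[OF s c] using c by (intro add_map.finsum[OF cone_add_map]) auto
  show "boundary K M (Suc q) (cone (Suc q) (bq (Suc q) \<sigma> c)) \<oplus>\<^bsub>?C\<^esub>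
      cone q (boundary K M q (bq (Suc q) \<sigma> c)) = bq (Suc q) \<sigma> c"
  proof (cases "last \<sigma> = ?T")
    case True
    \<comment> \<open>A chain already ending in the apex has cone zero, and so have its faces that
      keep the top. Only deleting the top leaves a chain to be coned off, its cone is
      \<open>\<sigma>\<close> again, and the two signs cancel.\<close>
    have nl: "last (face (Suc q) \<sigma>) \<noteq> ?T" using lastface' True by auto
    have "(\<Oplus>\<^bsub>?C\<^esub>i\<in>{..Suc q}. cone q (bq q (face i \<sigma>) (sg i c))) =
      cone q (bq q (face (Suc q) \<sigma>) (sg (Suc q) c))"
      using c face_Ch[OF s] lastface True add_map.closed[OF cone_add_map]
      by (intro Q.C.C.finsum_single) (auto simp: cone_bs le_Suc_eq)
    also have "\<dots> = bq (Suc q) (face (Suc q) \<sigma> @ [?T]) c"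
      using c face_Ch[OF s] nl by (simp add: cone_bs)
    also have "face (Suc q) \<sigma> @ [?T] = \<sigma>"
      using len True by (cases \<sigma> rule: rev_cases) (auto simp: face_def)
    finally show ?thesis
      using True s c by (simp add: cb cone_bs add_map.zero[OF boundary_add_map])
  next
    case False
    \<comment> \<open>Here no face ends in the apex, so all of them are coned off. Their cones
      cancel the faces of the cone other than \<open>\<sigma>\<close>, since the signs belonging to
      \<open>Suc q\<close> and \<open>Suc (Suc q)\<close> are opposite.\<close>
    have nf: "last (face i \<sigma>) \<noteq> ?T" if "i \<le> Suc q" for i
    proof (cases "i \<le> q")
      case False
      then have "last (face i \<sigma>) < last \<sigma>" using lastface' that by (simp add: le_Suc_eq)
      moreover have "last \<sigma> \<subseteq> ?T" using Ch_subset[OF s last_in_set] len by force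
      ultimately show ?thesis by auto
    qed (use lastface False in simp)
    let ?b = "\<lambda>i. bq (Suc q) (face i \<sigma> @ [?T]) (sg i (sg (Suc q) c))"
    have "(\<Oplus>\<^bsub>?C\<^esub>i\<in>{..Suc q}. cone q (bq q (face i \<sigma>) (sg i c))) = (\<Oplus>\<^bsub>?C\<^esub>i\<in>{..Suc q}. ?b i)"
      using c face_Ch[OF s] nf
      by (intro Q.C.C.finsum_cong') (auto simp: cone_bs sg_commute[of c])
    moreover have "(\<Oplus>\<^bsub>?C\<^esub>i\<in>{..Suc q}. bq (Suc q) (face i \<sigma> @ [?T]) (sg i (sg (Suc (Suc q)) c)))
       \<oplus>\<^bsub>?C\<^esub> (\<Oplus>\<^bsub>?C\<^esub>i\<in>{..Suc q}. ?b i) = \<zero>\<^bsub>?C\<^esub>"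
    proof -
      have "bq (Suc q) (face i \<sigma> @ [?T]) (sg i (sg (Suc (Suc q)) c)) \<oplus>\<^bsub>?C\<^esub> ?b i = \<zero>\<^bsub>?C\<^esub>" for i
        using c by (simp add: sg_Suc[of c "Suc q"] add_map.neg[OF sg_add_map] bq_neg Q.C.C.l_neg)
      then show ?thesis
        using c by (subst Q.C.C.finsum_addf[symmetric]) (auto simp del: Q.C.C.finsum_addf)
    qed
    ultimately show ?thesis
      using boundary_cone_bs[OF s False c] c
      by (simp add: cb Q.C.C.a_assoc Q.C.C.finsum_closed Pi_def)
  qed
qed

theorem resolution_trivial:
  "resolution R (chain_module K M) (boundary K M) (augmentation K M) (trivial_module K M)"
proof (rule resolutionI[where s = cone and t = "bq 0 [carrier M]"])
  have T: "carrier (trivial_module K M) = carrier K" "\<zero>\<^bsub>trivial_module K M\<^esub> = \<zero>\<^bsub>K\<^esub>"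
    by (simp_all add: trivial_module_def)
  show "add_map (trivial_module K M) (chain_module K M 0) (bq 0 [carrier M])"
    using Q.C.bs_add_map left_module_trivial
    by (simp add: add_map_def add_map_axioms_def trivial_module_def left_module_def chain_module_eq)
  have "[carrier M] \<in> Ch 0" by (simp add: Ch_0 M.top_principal)
  then show "augmentation K M (bq 0 [carrier M] y) = y" if "y \<in> carrier (trivial_module K M)" for y
    using that by (simp add: T augmentation_bs)
  show "augmentation K M (boundary K M 0 x) = \<zero>\<^bsub>trivial_module K M\<^esub>"
    if "x \<in> carrier (chain_module K M 1)" for x
    using that augmentation_boundary by (simp add: T chain_module_eq)
qed (auto simp: chain_module_eq Q.left_module_C left_module_trivial boundary_hom augmentation_hom
    cone_add_map boundary_boundary cone_homotopy_0 cone_homotopy)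

end


section \<open>Green's relations in a finite monoid\<close>

text \<open>The empty set counts as an ideal, which gives the inductions over ideals their
  base.\<close>

definition monoid_ideal :: "('m, 'c) monoid_scheme \<Rightarrow> 'm set \<Rightarrow> bool" where
  "monoid_ideal M I \<longleftrightarrow> I \<subseteq> carrier M \<and> (\<forall>x\<in>I. \<forall>m\<in>carrier M. m \<otimes>\<^bsub>M\<^esub> x \<in> I \<and> x \<otimes>\<^bsub>M\<^esub> m \<in> I)"

context monoid
begin

text \<open>Left multiplication by \<open>y\<close> is injective, since \<open>x\<close> undoes it,
  hence surjective on a finite set; so \<open>y\<close> has a right inverse, which must be
  \<open>x\<close>. Applied to local monoids, this is the source of the stability properties
  below.\<close>

lemma finite_inverse_commute:
  assumes "finite (carrier G)" "x \<in> carrier G" "y \<in> carrier G" "x \<otimes> y = \<one>"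
  shows "y \<otimes> x = \<one>"
proof -
  have "inj_on (\<lambda>z. y \<otimes> z) (carrier G)"
  proof (rule inj_onI)
    fix z w assume "z \<in> carrier G" "w \<in> carrier G" "y \<otimes> z = y \<otimes> w"
    then show "z = w" using assms by (metis m_assoc l_one)
  qed
  then have "(\<lambda>z. y \<otimes> z) ` carrier G = carrier G"
    using assms by (intro endo_inj_surj) auto
  then obtain z where z: "z \<in> carrier G" "y \<otimes> z = \<one>" by (metis imageE one_closed)
  then have "z = x" using assms by (metis m_assoc l_one r_one)
  then show ?thesis using z by simp
qed

lemma left_ideal_eq_iff:
  assumes "a \<in> carrier G" "b \<in> carrier G"
  shows "left_ideal G a = left_ideal G b \<longleftrightarrow>
    (\<exists>p\<in>carrier G. a = p \<otimes> b) \<and> (\<exists>p\<in>carrier G. b = p \<otimes> a)" (is "?L \<longleftrightarrow> ?R")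
proof
  have mem: "x \<in> left_ideal G c \<longleftrightarrow> (\<exists>p\<in>carrier G. x = p \<otimes> c)" for x c
    by (auto simp: left_ideal_def r_coset_def)
  {
    assume ?L
    have "a \<in> left_ideal G a" "b \<in> left_ideal G b"
      using assms by (auto simp: mem intro!: bexI[of _ \<one>])
    then show ?R using \<open>?L\<close> by (auto simp: mem)
  }
  have sub: "left_ideal G (p \<otimes> c) \<subseteq> left_ideal G c" if "p \<in> carrier G" "c \<in> carrier G" for p c
    using that by (auto simp: mem m_assoc[symmetric]) (blast intro: m_closed)
  assume ?R
  then show ?L using sub assms by (metis subset_antisym)
qed

lemma right_ideal_eq_iff:
  assumes "a \<in> carrier G" "b \<in> carrier G"
  shows "right_ideal G a = right_ideal G b \<longleftrightarrow>
    (\<exists>p\<in>carrier G. a = b \<otimes> p) \<and> (\<exists>p\<in>carrier G. b = a \<otimes> p)" (is "?L \<longleftrightarrow> ?R")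
proof
  assume ?L
  then show ?R using assms right_ideal_self by (metis mem_right_ideal)
next
  have sub: "right_ideal G (c \<otimes> p) \<subseteq> right_ideal G c" if "p \<in> carrier G" "c \<in> carrier G" for p c
    using that by (auto simp: mem_right_ideal m_assoc) (blast intro: m_closed)
  assume ?R
  then show ?L using sub assms by (metis subset_antisym)
qed

lemma mem_two_sided_ideal:
  assumes "a \<in> carrier G"
  shows "x \<in> two_sided_ideal G a \<longleftrightarrow> (\<exists>p\<in>carrier G. \<exists>q\<in>carrier G. x = p \<otimes> a \<otimes> q)"
proof -
  have "x \<in> two_sided_ideal G a \<longleftrightarrow> (\<exists>p\<in>carrier G. \<exists>y\<in>right_ideal G a. x = p \<otimes> y)"
    by (auto simp: two_sided_ideal_def set_mult_def)
  also have "\<dots> \<longleftrightarrow> (\<exists>p\<in>carrier G. \<exists>q\<in>carrier G. x = p \<otimes> (a \<otimes> q))"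
    unfolding Bex_def mem_right_ideal by blast
  finally show ?thesis using assms by (simp add: m_assoc cong: bex_cong)
qed

lemma two_sided_ideal_subset_iff:
  assumes "a \<in> carrier G" "b \<in> carrier G"
  shows "two_sided_ideal G a \<subseteq> two_sided_ideal G b \<longleftrightarrow> (\<exists>p\<in>carrier G. \<exists>q\<in>carrier G. a = p \<otimes> b \<otimes> q)"
proof
  assume "two_sided_ideal G a \<subseteq> two_sided_ideal G b"
  moreover have "a \<in> two_sided_ideal G a"
    using assms by (auto simp: mem_two_sided_ideal intro!: bexI[of _ \<one>])
  ultimately have "a \<in> two_sided_ideal G b" by blast
  then show "\<exists>p\<in>carrier G. \<exists>q\<in>carrier G. a = p \<otimes> b \<otimes> q"
    using assms by (simp add: mem_two_sided_ideal)
next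
  assume "\<exists>p\<in>carrier G. \<exists>q\<in>carrier G. a = p \<otimes> b \<otimes> q"
  then obtain p q where pq: "p \<in> carrier G" "q \<in> carrier G" "a = p \<otimes> b \<otimes> q" by auto
  show "two_sided_ideal G a \<subseteq> two_sided_ideal G b"
  proof
    fix x assume "x \<in> two_sided_ideal G a"
    then obtain r s where rs: "r \<in> carrier G" "s \<in> carrier G" "x = r \<otimes> a \<otimes> s"
      using assms by (auto simp: mem_two_sided_ideal)
    then have "x = (r \<otimes> p) \<otimes> b \<otimes> (q \<otimes> s)" using pq assms by (simp add: m_assoc)
    then show "x \<in> two_sided_ideal G b" using pq rs assms by (auto simp: mem_two_sided_ideal)
  qed
qed

lemma J_class_iff:
  assumes "a \<in> carrier G"
  shows "b \<in> J_class G a \<longleftrightarrow> b \<in> carrier G \<and>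
    (\<exists>p\<in>carrier G. \<exists>q\<in>carrier G. b = p \<otimes> a \<otimes> q) \<and> (\<exists>p\<in>carrier G. \<exists>q\<in>carrier G. a = p \<otimes> b \<otimes> q)"
  using assms two_sided_ideal_subset_iff[of a b] two_sided_ideal_subset_iff[of b a]
  by (auto simp: J_class_def)

lemma monoid_ideal_right_ideal:
  "monoid_ideal G I \<Longrightarrow> a \<in> carrier G \<Longrightarrow> right_ideal G a \<subseteq> I \<longleftrightarrow> a \<in> I"
  using right_ideal_self by (auto simp: monoid_ideal_def mem_right_ideal)

lemma idempotent_carrier: "f \<in> idempotents G \<Longrightarrow> f \<in> carrier G"
  by (auto simp: idempotents_def)

text \<open>Take \<open>x\<close> in \<open>I\<close> with maximal two-sided ideal and
  \<open>n\<close> with x n x = x; then x n is an idempotent in the J-class of \<open>x\<close>. If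
  a multiple of an element \<open>y\<close> of \<open>I\<close> lands in this J-class, then
  \<open>y\<close> is in it by maximality, so removing the J-class leaves an ideal.\<close>

lemma monoid_ideal_step:
  assumes "finite (carrier G)" "regular_monoid G" "monoid_ideal G I" "I \<noteq> {}"
  obtains f where "f \<in> I" "f \<in> idempotents G" "J_class G f \<subseteq> I" "monoid_ideal G (I - J_class G f)"
proof -
  have Ic: "I \<subseteq> carrier G" using assms(3) by (auto simp: monoid_ideal_def)
  have "finite (two_sided_ideal G ` I)" using assms(1) Ic by (auto intro: finite_subset)
  then obtain T where T: "T \<in> two_sided_ideal G ` I"
    and max: "\<And>S. S \<in> two_sided_ideal G ` I \<Longrightarrow> T \<subseteq> S \<Longrightarrow> T = S"
    using finite_has_maximal[of "two_sided_ideal G ` I"] assms(4) by auto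
  then obtain x where x: "x \<in> I" "T = two_sided_ideal G x" by auto
  then have xc: "x \<in> carrier G" using Ic by auto
  obtain n where n: "n \<in> carrier G" "x \<otimes> n \<otimes> x = x" using assms(2) xc by (auto simp: regular_monoid_def)
  let ?f = "x \<otimes> n"
  have f: "?f \<in> carrier G" "?f \<otimes> ?f = ?f" using xc n by (auto simp: m_assoc[symmetric])
  have "?f = \<one> \<otimes> x \<otimes> n" "x = \<one> \<otimes> ?f \<otimes> x" using xc n by auto
  then have tsi: "two_sided_ideal G ?f = two_sided_ideal G x"
    using two_sided_ideal_subset_iff[OF f(1) xc] two_sided_ideal_subset_iff[OF xc f(1)] xc n
    by (intro equalityI) (metis one_closed)+
  have fI: "?f \<in> I" using assms(3) x(1) n by (auto simp: monoid_ideal_def)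
  have J: "J_class G ?f \<subseteq> I"
  proof
    fix y assume "y \<in> J_class G ?f"
    then obtain p q where "p \<in> carrier G" "q \<in> carrier G" "y = p \<otimes> ?f \<otimes> q"
      using J_class_iff[OF f(1)] by auto
    then show "y \<in> I" using fI assms(3) f(1) by (auto simp: monoid_ideal_def)
  qed
  have up: "y \<in> J_class G ?f" if y: "y \<in> I" and m: "p \<in> carrier G" "q \<in> carrier G"
    "p \<otimes> y \<otimes> q \<in> J_class G ?f" for y p q
  proof -
    have yc: "y \<in> carrier G" using y Ic by auto
    have "two_sided_ideal G (p \<otimes> y \<otimes> q) = T" using m(3) tsi x(2) by (auto simp: J_class_def)
    moreover have "two_sided_ideal G (p \<otimes> y \<otimes> q) \<subseteq> two_sided_ideal G y"
      using two_sided_ideal_subset_iff[of "p \<otimes> y \<otimes> q" y] m yc by auto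
    ultimately have "T = two_sided_ideal G y" using max y by auto
    then show ?thesis using yc tsi x(2) by (auto simp: J_class_def)
  qed
  have "monoid_ideal G (I - J_class G ?f)"
    unfolding monoid_ideal_def
  proof (intro conjI ballI)
    fix y m assume y: "y \<in> I - J_class G ?f" and m: "m \<in> carrier G"
    then have yc: "y \<in> carrier G" using Ic by auto
    show "m \<otimes> y \<in> I - J_class G ?f"
      using up[of y m \<one>] y m yc assms(3) by (auto simp: monoid_ideal_def)
    show "y \<otimes> m \<in> I - J_class G ?f"
      using up[of y \<one> m] y m yc assms(3) by (auto simp: monoid_ideal_def)
  qed (use Ic in auto)
  then show ?thesis using that[of ?f] f fI J by (auto simp: idempotents_def)
qed

text \<open>Induction along a principal series, one J-class at a time. The filtration, the right
  identities and the lifts are all built along it.\<close>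

lemma monoid_ideal_induct [consumes 3, case_names empty step]:
  assumes "monoid_ideal G I" "finite (carrier G)" "regular_monoid G"
    and "P {}"
    and step: "\<And>I f. \<lbrakk>monoid_ideal G I; f \<in> I; f \<in> idempotents G; J_class G f \<subseteq> I;
      monoid_ideal G (I - J_class G f); P (I - J_class G f)\<rbrakk> \<Longrightarrow> P I"
  shows "P I"
  using assms(1)
proof (induction "card I" arbitrary: I rule: less_induct)
  case less
  show ?case
  proof (cases "I = {}")
    case False
    then obtain f where f: "f \<in> I" "f \<in> idempotents G" "J_class G f \<subseteq> I" "monoid_ideal G (I - J_class G f)"
      using monoid_ideal_step[OF assms(2,3) less.prems] by blast
    have "f \<in> J_class G f" using idempotent_carrier[OF f(2)] by (simp add: J_class_def)
    moreover have "finite I" using assms(2) less.prems by (auto simp: monoid_ideal_def intro: finite_subset)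
    ultimately have "card (I - J_class G f) < card I"
      using f(1) by (intro psubset_card_mono) auto
    then show ?thesis using less.hyps[OF _ f(4)] step[OF less.prems f] by blast
  qed (use assms(4) in simp)
qed

end

section \<open>Green's relations around an idempotent\<close>

locale idem = monoid M for M :: "('m, 'c) monoid_scheme" (structure) +
  fixes f :: 'm
  assumes fin: "finite (carrier M)" and f: "f \<in> idempotents M"
begin

lemma fc [simp]: "f \<in> carrier M" and ff [simp]: "f \<otimes> f = f"
  using f by (auto simp: idempotents_def)

lemma ff_assoc [simp]: "x \<in> carrier M \<Longrightarrow> f \<otimes> (f \<otimes> x) = f \<otimes> x"
  by (simp add: m_assoc[symmetric])

lemma local_carrier: "x \<in> carrier (local_monoid M f) \<longleftrightarrow> x \<in> carrier M \<and> f \<otimes> x = x \<and> x \<otimes> f = x"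
proof
  assume "x \<in> carrier (local_monoid M f)"
  then obtain m where "m \<in> carrier M" "x = f \<otimes> m \<otimes> f" by (auto simp: local_monoid_def)
  then show "x \<in> carrier M \<and> f \<otimes> x = x \<and> x \<otimes> f = x" by (simp add: m_assoc)
next
  assume "x \<in> carrier M \<and> f \<otimes> x = x \<and> x \<otimes> f = x"
  then show "x \<in> carrier (local_monoid M f)" by (auto simp: local_monoid_def intro!: exI[of _ x])
qed

lemma local_mult: "x \<otimes>\<^bsub>local_monoid M f\<^esub> y = x \<otimes> y" and local_one: "\<one>\<^bsub>local_monoid M f\<^esub> = f"
  by (auto simp: local_monoid_def)

lemma monoid_local: "monoid (local_monoid M f)"
  by (rule monoidI) (auto simp: local_carrier local_mult local_one m_assoc[symmetric], simp add: m_assoc)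

lemma local_inverse_commute:
  assumes "x \<in> carrier M" "f \<otimes> x = x" "x \<otimes> f = x" "y \<in> carrier M" "f \<otimes> y = y" "y \<otimes> f = y"
    "x \<otimes> y = f"
  shows "y \<otimes> x = f"
proof -
  have "finite (carrier (local_monoid M f))"
    by (rule finite_subset[OF _ fin]) (auto simp: local_carrier)
  then show ?thesis
    using monoid.finite_inverse_commute[OF monoid_local, of x y] assms
    by (auto simp: local_carrier local_mult local_one)
qed

abbreviation "G \<equiv> maximal_subgroup M f"

lemma mem_G: "g \<in> carrier G \<longleftrightarrow> g \<in> carrier M \<and> f \<otimes> g = g \<and> g \<otimes> f = g \<and>
    (\<exists>h\<in>carrier M. f \<otimes> h = h \<and> h \<otimes> f = h \<and> g \<otimes> h = f \<and> h \<otimes> g = f)"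
  by (simp add: maximal_subgroup_def units_of_def Units_def local_carrier local_mult local_one Bex_def) blast

lemma G_mult: "x \<otimes>\<^bsub>G\<^esub> y = x \<otimes> y" and G_one: "\<one>\<^bsub>G\<^esub> = f"
  by (auto simp: maximal_subgroup_def units_of_def local_mult local_one)

lemma group_G: "group G"
  unfolding maximal_subgroup_def by (rule monoid.units_group[OF monoid_local])

sublocale G: group "maximal_subgroup M f" by (rule group_G)

lemma G_carrier: "g \<in> carrier G \<Longrightarrow> g \<in> carrier M" by (simp add: mem_G)
lemma G_left: "g \<in> carrier G \<Longrightarrow> f \<otimes> g = g" by (simp add: mem_G)
lemma G_right: "g \<in> carrier G \<Longrightarrow> g \<otimes> f = g" by (simp add: mem_G)
lemma f_in_G: "f \<in> carrier G" using G.one_closed by (simp add: G_one)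
lemma G_inv: "g \<in> carrier G \<Longrightarrow> g \<otimes> inv\<^bsub>G\<^esub> g = f" "g \<in> carrier G \<Longrightarrow> inv\<^bsub>G\<^esub> g \<otimes> g = f"
  using G.r_inv G.l_inv by (simp_all add: G_mult G_one)

lemma finite_G: "finite (carrier G)"
  by (rule finite_subset[OF _ fin]) (auto simp: G_carrier)

text \<open>The two conditions on \<open>a\<close> are the inclusions of Ma in Mf and of Mf in Ma;
  as \<open>f\<close> is idempotent, belonging to Mf means being fixed by \<open>f\<close> on the
  right.\<close>

lemma mem_L: "a \<in> L_class M f \<longleftrightarrow> a \<in> carrier M \<and> a \<otimes> f = a \<and> (\<exists>n\<in>carrier M. n \<otimes> a = f)"
proof -
  have "left_ideal M a = left_ideal M f \<longleftrightarrow> a \<otimes> f = a \<and> (\<exists>n\<in>carrier M. n \<otimes> a = f)"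
    if a: "a \<in> carrier M" for a
    unfolding left_ideal_eq_iff[OF a fc]
    using a by (auto simp: m_assoc) (metis)+
  then show ?thesis by (auto simp: L_class_def)
qed

lemma L_carrier: "a \<in> L_class M f \<Longrightarrow> a \<in> carrier M" by (simp add: mem_L)
lemma L_right: "a \<in> L_class M f \<Longrightarrow> a \<otimes> f = a" by (simp add: mem_L)

text \<open>Replacing \<open>n\<close> by f n preserves n a = f and places \<open>n\<close> in fM,
  so that products of \<open>n\<close> with elements of the L-class lie in fMf.\<close>

lemma L_left_inverse:
  assumes "a \<in> L_class M f"
  obtains n where "n \<in> carrier M" "n \<otimes> a = f" "f \<otimes> n = n"
proof -
  obtain n where "n \<in> carrier M" "n \<otimes> a = f" using assms by (auto simp: mem_L)
  then show ?thesis using that[of "f \<otimes> n"] L_carrier[OF assms] by (simp add: m_assoc)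
qed

lemma finite_L: "finite (L_class M f)"
  by (rule finite_subset[OF _ fin]) (auto simp: L_carrier)

lemma G_in_L: "g \<in> carrier G \<Longrightarrow> g \<in> L_class M f"
  by (auto simp: mem_G mem_L)

lemma L_mult_G:
  assumes a: "a \<in> L_class M f" and g: "g \<in> carrier G"
  shows "a \<otimes> g \<in> L_class M f"
proof -
  obtain n where n: "n \<in> carrier M" "n \<otimes> a = f" using a by (auto simp: mem_L)
  note c = L_carrier[OF a] G_carrier[OF g] G_carrier[OF G.inv_closed[OF g]]
  have "n \<otimes> (a \<otimes> g) = f \<otimes> g" using n c by (simp add: m_assoc[symmetric])
  then have "(inv\<^bsub>G\<^esub> g \<otimes> n) \<otimes> (a \<otimes> g) = inv\<^bsub>G\<^esub> g \<otimes> (f \<otimes> g)"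
    using n c by (simp add: m_assoc)
  also have "\<dots> = f" using n g by (simp add: G_left G_inv)
  finally show ?thesis using c n g unfolding mem_L by (auto simp: m_assoc G_right intro!: bexI[of _ "inv\<^bsub>G\<^esub> g \<otimes> n"])
qed

lemma L_in_J: "a \<in> L_class M f \<Longrightarrow> a \<in> J_class M f"
  unfolding J_class_iff[OF fc] mem_L by (metis one_closed r_one m_closed fc)

text \<open>Multiplying f = p u q by \<open>f\<close> on both sides gives a factorisation of
  \<open>f\<close> inside fMf that involves \<open>u\<close>. Since one-sided inverses in the finite
  monoid fMf are two-sided, \<open>u\<close> is a unit there.\<close>

lemma local_J_in_G:
  assumes u: "u \<in> J_class M f" "f \<otimes> u = u" "u \<otimes> f = u"
  shows "u \<in> carrier G"
proof -
  obtain p q where pq: "p \<in> carrier M" "q \<in> carrier M" "f = p \<otimes> u \<otimes> q" and uc: "u \<in> carrier M"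
    using u J_class_iff[OF fc] by blast
  let ?a = "f \<otimes> p \<otimes> f" and ?c = "f \<otimes> q \<otimes> f"
  have "f = f \<otimes> (p \<otimes> u \<otimes> q) \<otimes> f" using pq(3) by (metis ff)
  also have "\<dots> = f \<otimes> (p \<otimes> (f \<otimes> u \<otimes> f) \<otimes> q) \<otimes> f" using u(2,3) by simp
  also have "\<dots> = ?a \<otimes> (u \<otimes> ?c)" using pq(1,2) uc by (simp add: m_assoc)
  finally have 1: "?a \<otimes> (u \<otimes> ?c) = f" by simp
  have fu: "f \<otimes> (u \<otimes> x) = u \<otimes> x" if "x \<in> carrier M" for x
    using u(2) uc that by (metis m_assoc fc)
  have "(u \<otimes> ?c) \<otimes> ?a = f"
    using pq(1,2) uc by (intro local_inverse_commute[OF _ _ _ _ _ _ 1]) (auto simp: m_assoc fu)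
  then have 2: "u \<otimes> (?c \<otimes> ?a) = f" using pq(1,2) uc by (simp add: m_assoc)
  have 3: "(?c \<otimes> ?a) \<otimes> u = f"
    using pq(1,2) uc u(2,3) by (intro local_inverse_commute[OF _ _ _ _ _ _ 2]) (auto simp: m_assoc)
  show ?thesis unfolding mem_G using uc u(2,3) 2 3 pq(1,2)
    by (auto intro!: bexI[of _ "?c \<otimes> ?a"] simp: m_assoc)
qed

text \<open>Stability of finite monoids. From f = p (n a) q one gets s = f p n a and t = f q f in
  fMf with s t = f, hence t s = f, and this exhibits t f p as a left inverse of n a.\<close>

lemma L_stable:
  assumes a: "a \<in> L_class M f" and n: "n \<in> carrier M" and na: "n \<otimes> a \<in> J_class M f"
  shows "n \<otimes> a \<in> L_class M f"
proof -
  note ac = L_carrier[OF a]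
  obtain p q where pq: "p \<in> carrier M" "q \<in> carrier M" "f = p \<otimes> (n \<otimes> a) \<otimes> q"
    using na J_class_iff[OF fc] by blast
  let ?s = "f \<otimes> p \<otimes> n \<otimes> a" and ?t = "f \<otimes> q \<otimes> f"
  have "f = f \<otimes> (p \<otimes> (n \<otimes> a) \<otimes> q) \<otimes> f" using pq(3) by (metis ff)
  also have "\<dots> = f \<otimes> (p \<otimes> (n \<otimes> (a \<otimes> f)) \<otimes> q) \<otimes> f" using a by (simp add: L_right)
  also have "\<dots> = ?s \<otimes> ?t" using pq(1,2) n ac by (simp add: m_assoc)
  finally have 1: "?s \<otimes> ?t = f" by simp
  have "?t \<otimes> ?s = f"
    using pq(1,2) n ac L_right[OF a] by (intro local_inverse_commute[OF _ _ _ _ _ _ 1]) (auto simp: m_assoc)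
  then have "(?t \<otimes> f \<otimes> p) \<otimes> (n \<otimes> a) = f" using pq(1,2) n ac by (simp add: m_assoc)
  then show ?thesis unfolding mem_L using pq(1,2) n ac L_right[OF a] by (auto simp: m_assoc intro!: bexI[of _ "?t \<otimes> f \<otimes> p"])
qed

text \<open>Write b = p f q and f = u b v; the witness is a = p f. With s = f u p f and t = f q v f
  one has s t = f, hence t s = f. This makes \<open>f\<close> a left multiple of a, and a = a t s a
  right multiple of \<open>b\<close>.\<close>

lemma J_right_ideal:
  assumes b: "b \<in> J_class M f"
  obtains a where "a \<in> L_class M f" "right_ideal M a = right_ideal M b"
proof -
  have bc: "b \<in> carrier M" using b by (simp add: J_class_def)
  obtain p q where pq: "p \<in> carrier M" "q \<in> carrier M" "b = p \<otimes> f \<otimes> q"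
    using b J_class_iff[OF fc] by blast
  obtain u v where uv: "u \<in> carrier M" "v \<in> carrier M" "f = u \<otimes> b \<otimes> v"
    using b J_class_iff[OF fc] by blast
  let ?s = "f \<otimes> u \<otimes> p \<otimes> f" and ?t = "f \<otimes> q \<otimes> v \<otimes> f" and ?a = "p \<otimes> f"
  have "f = f \<otimes> (u \<otimes> b \<otimes> v) \<otimes> f" using uv(3) by (metis ff)
  also have "\<dots> = f \<otimes> (u \<otimes> (p \<otimes> f \<otimes> q) \<otimes> v) \<otimes> f" by (simp only: pq(3))
  also have "\<dots> = ?s \<otimes> ?t" using pq(1,2) uv(1,2) by (simp add: m_assoc)
  finally have 1: "?s \<otimes> ?t = f" by simp
  have 2: "?t \<otimes> ?s = f"
    using pq(1,2) uv(1,2) by (intro local_inverse_commute[OF _ _ _ _ _ _ 1]) (auto simp: m_assoc)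
  have "(?t \<otimes> f \<otimes> u) \<otimes> ?a = f" using 2 pq(1,2) uv(1,2) by (simp add: m_assoc)
  then have L: "?a \<in> L_class M f"
    unfolding mem_L using pq(1,2) uv(1,2) by (auto simp: m_assoc intro!: bexI[of _ "?t \<otimes> f \<otimes> u"])
  have "?a = ?a \<otimes> (?t \<otimes> ?s)" unfolding 2 using pq(1,2) by (simp add: m_assoc)
  also have "\<dots> = (p \<otimes> f \<otimes> q) \<otimes> (v \<otimes> f \<otimes> ?s)" using pq(1,2) uv(1,2) by (simp add: m_assoc)
  also have "\<dots> = b \<otimes> (v \<otimes> f \<otimes> ?s)" by (simp only: pq(3))
  finally have "\<exists>x\<in>carrier M. ?a = b \<otimes> x" using pq(1,2) uv(1,2) by (metis fc m_closed)
  moreover have "\<exists>x\<in>carrier M. b = ?a \<otimes> x" using pq by blast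
  ultimately have "right_ideal M ?a = right_ideal M b"
    using right_ideal_eq_iff[of ?a b] pq(1) bc by simp
  then show ?thesis using that L by blast
qed

lemma G_right_ideal: "g \<in> carrier G \<Longrightarrow> right_ideal M g = right_ideal M f"
  using right_ideal_eq_iff[of g f] by (auto simp: mem_G) metis+

lemma L_right_ideal: "a \<in> L_class M f \<Longrightarrow> a <# right_ideal M f = right_ideal M a"
  by (simp add: lcoset_right_ideal L_carrier L_right)

text \<open>Left multiplication by a n is the identity on aM, and \<open>n\<close> carries aM into
  fM. Carrying \<open>a'\<close> there yields the element of G_f by which it differs from
  \<open>a\<close>; its inverse is n' a for a left inverse n' of \<open>a'\<close>.\<close>

lemma L_R_related:
  assumes a: "a \<in> L_class M f" and a': "a' \<in> L_class M f" and eq: "right_ideal M a = right_ideal M a'"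
    and n: "n \<in> carrier M" "n \<otimes> a = f" "f \<otimes> n = n"
  shows "n \<otimes> a' \<in> carrier G" "a \<otimes> (n \<otimes> a') = a'"
proof -
  obtain n' where n': "n' \<in> carrier M" "n' \<otimes> a' = f" "f \<otimes> n' = n'" using L_left_inverse[OF a'] .
  note c = L_carrier[OF a] L_carrier[OF a']
  have an: "x \<otimes> (k \<otimes> y) = y"
    if h: "x \<in> L_class M f" "k \<in> carrier M" "k \<otimes> x = f" "y \<in> right_ideal M x" for x k y
  proof -
    obtain z where z: "z \<in> carrier M" "y = x \<otimes> z" using h(4) unfolding mem_right_ideal by blast
    have "k \<otimes> y = f \<otimes> z" using z h(2,3) L_carrier[OF h(1)] by (simp add: m_assoc[symmetric])
    then have "x \<otimes> (k \<otimes> y) = (x \<otimes> f) \<otimes> z" using z(1) L_carrier[OF h(1)] by (simp add: m_assoc)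
    then show ?thesis using z L_right[OF h(1)] by simp
  qed
  have m: "a' \<in> right_ideal M a" "a \<in> right_ideal M a'" using right_ideal_self c eq by auto
  show 1: "a \<otimes> (n \<otimes> a') = a'" by (rule an[OF a n(1,2) m(1)])
  have 2: "a' \<otimes> (n' \<otimes> a) = a" by (rule an[OF a' n'(1,2) m(2)])
  have "(n \<otimes> a') \<otimes> (n' \<otimes> a) = f" "(n' \<otimes> a) \<otimes> (n \<otimes> a') = f"
    using 1 2 n n' c by (simp_all add: m_assoc)
  moreover have "f \<otimes> (n \<otimes> a') = n \<otimes> a'" "f \<otimes> (n' \<otimes> a) = n' \<otimes> a"
    using n n' c by (simp_all add: m_assoc[symmetric])
  moreover have "(n \<otimes> a') \<otimes> f = n \<otimes> a'" "(n' \<otimes> a) \<otimes> f = n' \<otimes> a"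
    using n n' c a a' by (simp_all add: m_assoc L_right)
  ultimately show "n \<otimes> a' \<in> carrier G" unfolding mem_G using n n' c by (auto intro!: bexI[of _ "n' \<otimes> a"])
qed

end


section \<open>Chains below an ideal\<close>

context fm
begin

abbreviation "mp m \<sigma> \<equiv> map (\<lambda>I. m <#\<^bsub>M\<^esub> I) \<sigma>"

text \<open>The last vertex is the largest one, so all vertices of such a chain lie in
  \<open>I\<close>.\<close>

definition Chi :: "'m set \<Rightarrow> nat \<Rightarrow> 'm set list set" where
  "Chi I q = {\<sigma> \<in> Ch q. last \<sigma> \<subseteq> I}"

lemma Chi_subset: "Chi I q \<subseteq> Ch q" by (auto simp: Chi_def)

lemma Ch_not_Nil: "\<sigma> \<in> Ch q \<Longrightarrow> \<sigma> \<noteq> []"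
  by (auto simp: strict_chains_def)

lemma last_principal: "\<sigma> \<in> Ch q \<Longrightarrow> last \<sigma> \<in> principal_right_ideals M"
  using Ch_not_Nil[of \<sigma> q] last_in_set[of \<sigma>] by (auto simp: strict_chains_def)

lemma Ch_le_last: "\<sigma> \<in> Ch q \<Longrightarrow> I \<in> set \<sigma> \<Longrightarrow> I \<subseteq> last \<sigma>"
  by (cases \<sigma> rule: rev_cases) (auto simp: strict_chains_def sorted_wrt_append)

lemma last_mp: "\<sigma> \<in> Ch q \<Longrightarrow> last (mp m \<sigma>) = m <#\<^bsub>M\<^esub> last \<sigma>"
  using Ch_not_Nil by (simp add: last_map)

lemma mact_eq: "mact m \<sigma> = Some \<tau> \<longleftrightarrow> distinct (mp m \<sigma>) \<and> \<tau> = mp m \<sigma>"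
  by (auto simp: mact_def Let_def)

lemma mp_Ch: "m \<in> carrier M \<Longrightarrow> \<sigma> \<in> Ch q \<Longrightarrow> distinct (mp m \<sigma>) \<Longrightarrow> mp m \<sigma> \<in> Ch q"
  using mact_closed mact_eq by blast

lemma mp_mult: "\<lbrakk>m \<in> carrier M; n \<in> carrier M; \<sigma> \<in> Ch q\<rbrakk> \<Longrightarrow> mp m (mp n \<sigma>) = mp (m \<otimes>\<^bsub>M\<^esub> n) \<sigma>"
  using map_lcoset_mult by simp

text \<open>An ideal absorbs from both sides, whence the two cases of the last assumption: an
  element of \<open>I\<close> moves every chain below \<open>I\<close>, and a chain below
  \<open>I\<close> is kept there by every \<open>m\<close>.\<close>

lemma mact_Chi:
  assumes I: "monoid_ideal M I" and m: "m \<in> carrier M" and "\<sigma> \<in> Ch q" "mact m \<sigma> = Some \<tau>"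
    and "m \<in> I \<or> \<sigma> \<in> Chi I q"
  shows "\<tau> \<in> Chi I q"
proof -
  have "last \<tau> = m <#\<^bsub>M\<^esub> last \<sigma>" using assms by (simp add: mact_eq last_mp)
  also have "\<dots> \<subseteq> I"
    using assms Ch_subset[OF assms(3) last_in_set[OF Ch_not_Nil[OF assms(3)]]]
    by (auto simp: l_coset_def Chi_def monoid_ideal_def)
  finally show ?thesis using mact_closed[OF m assms(3,4)] by (simp add: Chi_def)
qed

lemma Chi_empty: "Chi {} q = {}"
proof -
  have "I \<noteq> {}" if "I \<in> principal_right_ideals M" for I
    using that M.right_ideal_self by (auto simp: principal_right_ideals_def)
  then show ?thesis using last_principal by (auto simp: Chi_def)
qed

lemma Chi_carrier: "Chi (carrier M) q = Ch q"
  using last_principal M.principal_subset by (auto simp: Chi_def)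

end

locale fmi = fm K M + idem M f
  for K :: "('k, 'd) ring_scheme" and M :: "('m, 'c) monoid_scheme" and f
begin

abbreviation "Xf q \<equiv> {\<tau> \<in> Ch q. last \<tau> = right_ideal M f}"
abbreviation "Lf \<equiv> L_class M f"

text \<open>Since f (f y) = f y, the idempotent fixes fM pointwise and therefore each of its
  subsets, in particular all vertices of a chain with top fM.\<close>

lemma mp_f:
  assumes "\<tau> \<in> Xf q"
  shows "mp f \<tau> = \<tau>"
proof (rule map_idI)
  fix I assume "I \<in> set \<tau>"
  then have "I \<subseteq> right_ideal M f" using Ch_le_last[of \<tau> q I] assms by auto
  moreover have "f \<otimes>\<^bsub>M\<^esub> x = x" if "x \<in> right_ideal M f" for x using that by (auto simp: M.mem_right_ideal)
  ultimately show "f <#\<^bsub>M\<^esub> I = I" by (force simp: l_coset_def)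
qed

text \<open>A left inverse of \<open>a\<close> recovers \<open>\<tau>\<close> from its translate, so
  translation by \<open>a\<close> cannot identify two vertices of \<open>\<tau>\<close>.\<close>

lemma L_Xf:
  assumes a: "a \<in> Lf" and t: "\<tau> \<in> Xf q"
  shows "mact a \<tau> = Some (mp a \<tau>)" "mp a \<tau> \<in> Ch q" "last (mp a \<tau>) = right_ideal M a"
proof -
  obtain n where n: "n \<in> carrier M" "n \<otimes>\<^bsub>M\<^esub> a = f" "f \<otimes>\<^bsub>M\<^esub> n = n" using L_left_inverse[OF a] .
  have "mp n (mp a \<tau>) = \<tau>"
    using mp_mult[OF n(1) L_carrier[OF a], of \<tau> q] t mp_f[OF t] n by simp
  then have d: "distinct (mp a \<tau>)" using Ch_distinct[of \<tau> q] t by (metis (mono_tags, lifting) distinct_map mem_Collect_eq)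
  show "mact a \<tau> = Some (mp a \<tau>)" using d by (simp add: mact_eq)
  show "mp a \<tau> \<in> Ch q" using mp_Ch[OF L_carrier[OF a] _ d] t by auto
  show "last (mp a \<tau>) = right_ideal M a" using last_mp[of \<tau> q] t L_right_ideal[OF a] by simp
qed

lemma G_Xf: "g \<in> carrier G \<Longrightarrow> \<tau> \<in> Xf q \<Longrightarrow> mp g \<tau> \<in> Xf q"
  using L_Xf[OF G_in_L] G_right_ideal by auto

text \<open>Let \<open>a\<close> in the L-class of \<open>f\<close> generate the top of
  \<open>\<sigma>\<close>, with n a = f. Then a n fixes aM pointwise, so \<open>\<sigma>\<close> is
  the translate by \<open>a\<close> of the chain n \<sigma>, whose top is fM.\<close>

lemma chain_factor:
  assumes s: "\<sigma> \<in> Ch q" "last \<sigma> = right_ideal M b" and b: "b \<in> J_class M f"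
  obtains a \<tau> where "a \<in> Lf" "\<tau> \<in> Xf q" "\<sigma> = mp a \<tau>"
proof -
  obtain a where a: "a \<in> Lf" "right_ideal M a = right_ideal M b" using J_right_ideal[OF b] .
  obtain n where n: "n \<in> carrier M" "n \<otimes>\<^bsub>M\<^esub> a = f" "f \<otimes>\<^bsub>M\<^esub> n = n" using L_left_inverse[OF a(1)] .
  have ac: "a \<in> carrier M" by (rule L_carrier[OF a(1)])
  have "mp (a \<otimes>\<^bsub>M\<^esub> n) \<sigma> = \<sigma>"
  proof (rule map_idI)
    fix I assume "I \<in> set \<sigma>"
    then have "I \<subseteq> right_ideal M a" using Ch_le_last[OF s(1)] s a by auto
    moreover have "a \<otimes>\<^bsub>M\<^esub> n \<otimes>\<^bsub>M\<^esub> x = x" if x: "x \<in> right_ideal M a" for x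
    proof -
      obtain y where y: "y \<in> carrier M" "x = a \<otimes>\<^bsub>M\<^esub> y" using x by (auto simp: M.mem_right_ideal)
      have "n \<otimes>\<^bsub>M\<^esub> x = f \<otimes>\<^bsub>M\<^esub> y" using y n ac by (simp add: M.m_assoc[symmetric])
      then have "a \<otimes>\<^bsub>M\<^esub> n \<otimes>\<^bsub>M\<^esub> x = (a \<otimes>\<^bsub>M\<^esub> f) \<otimes>\<^bsub>M\<^esub> y" using y n ac by (simp add: M.m_assoc)
      then show ?thesis using y L_right[OF a(1)] by simp
    qed
    ultimately show "(a \<otimes>\<^bsub>M\<^esub> n) <#\<^bsub>M\<^esub> I = I" by (force simp: l_coset_def)
  qed
  then have 1: "mp a (mp n \<sigma>) = \<sigma>" using mp_mult[OF ac n(1) s(1)] by simp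
  then have "distinct (mp n \<sigma>)" using Ch_distinct[OF s(1)] by (metis distinct_map)
  then have 2: "mp n \<sigma> \<in> Ch q" using mp_Ch[OF n(1) s(1)] by simp
  have "last (mp n \<sigma>) = right_ideal M f"
    using last_mp[OF s(1)] s(2) a(2) M.lcoset_right_ideal[OF n(1) ac] n(2) by simp
  then show ?thesis using that[of a "mp n \<sigma>"] a 1 2 by auto
qed

text \<open>Both translates have the same top, so \<open>L_R_related\<close> applies to
  \<open>a\<close> and \<open>a'\<close>; cancelling \<open>a\<close> from the left moves the group
  element to \<open>\<tau>'\<close>. This is precisely the ambiguity that tensoring over KG_f
  removes.\<close>

lemma factor_unique:
  assumes a: "a \<in> Lf" "a' \<in> Lf" and t: "\<tau> \<in> Xf q" "\<tau>' \<in> Xf q" and eq: "mp a \<tau> = mp a' \<tau>'"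
  obtains g where "g \<in> carrier G" "a' = a \<otimes>\<^bsub>M\<^esub> g" "\<tau> = mp g \<tau>'"
proof -
  have R: "right_ideal M a = right_ideal M a'" using L_Xf(3)[OF a(1) t(1)] L_Xf(3)[OF a(2) t(2)] eq by simp
  obtain n where n: "n \<in> carrier M" "n \<otimes>\<^bsub>M\<^esub> a = f" "f \<otimes>\<^bsub>M\<^esub> n = n" using L_left_inverse[OF a(1)] .
  note g = L_R_related[OF a R n]
  have "mp (n \<otimes>\<^bsub>M\<^esub> a') \<tau>' = mp n (mp a' \<tau>')" using mp_mult[OF n(1) L_carrier[OF a(2)], of \<tau>' q] t by simp
  also have "\<dots> = mp f \<tau>" using mp_mult[OF n(1) L_carrier[OF a(1)], of \<tau> q] t eq n by simp
  also have "\<dots> = \<tau>" by (rule mp_f[OF t(1)])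
  finally show ?thesis using that g by simp
qed

end


section \<open>Tensor products\<close>

definition pure_tensor ::
  "('r, 'c) ring_scheme \<Rightarrow> ('a, 'd) ring_scheme \<Rightarrow> ('a \<Rightarrow> 'r \<Rightarrow> 'a) \<Rightarrow> ('r, 'b) module \<Rightarrow>
   'a \<Rightarrow> 'b \<Rightarrow> ('a \<times> 'b \<Rightarrow>\<^sub>0 int) set" where
  "pure_tensor R A ra B a b =
    tensor_null R A ra B #>\<^bsub>free_Abelian_group (carrier A \<times> carrier B)\<^esub> frag_of (a, b)"

lemma tensor_relationsE:
  assumes "t \<in> tensor_relations R A ra B"
  obtains (left) a a' b where "t = frag_of (a \<oplus>\<^bsub>A\<^esub> a', b) - frag_of (a, b) - frag_of (a', b)"
      "a \<in> carrier A" "a' \<in> carrier A" "b \<in> carrier B"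
    | (right) a b b' where "t = frag_of (a, b \<oplus>\<^bsub>B\<^esub> b') - frag_of (a, b) - frag_of (a, b')"
      "a \<in> carrier A" "b \<in> carrier B" "b' \<in> carrier B"
    | (balanced) a r b where "t = frag_of (ra a r, b) - frag_of (a, r \<odot>\<^bsub>B\<^esub> b)"
      "a \<in> carrier A" "r \<in> carrier R" "b \<in> carrier B"
  using assms unfolding tensor_relations_def by blast

text \<open>\<open>D\<close> is a record for the tensor product, written additively.\<close>

locale tensor = A: abelian_group A + B: abelian_group B
  for R :: "('r, 'c) ring_scheme" and A :: "('a, 'd) ring_scheme" and ra :: "'a \<Rightarrow> 'r \<Rightarrow> 'a"
    and B :: "('r, 'b) module" +
  fixes D :: "(('a \<times> 'b \<Rightarrow>\<^sub>0 int) set, 'z) ring_scheme"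
  assumes ra_closed: "a \<in> carrier A \<Longrightarrow> r \<in> carrier R \<Longrightarrow> ra a r \<in> carrier A"
    and sm_closed: "r \<in> carrier R \<Longrightarrow> b \<in> carrier B \<Longrightarrow> r \<odot>\<^bsub>B\<^esub> b \<in> carrier B"
    and carrier_D: "carrier D = carrier (tensor_group R A ra B)"
    and zero_D: "\<zero>\<^bsub>D\<^esub> = \<one>\<^bsub>tensor_group R A ra B\<^esub>"
    and add_D: "ring.add D = monoid.mult (tensor_group R A ra B)"
begin

abbreviation "F \<equiv> free_Abelian_group (carrier A \<times> carrier B)"
abbreviation "N \<equiv> tensor_null R A ra B"
abbreviation "cls t \<equiv> N #>\<^bsub>F\<^esub> t"
abbreviation "tn \<equiv> pure_tensor R A ra B"

lemma F_diff: "s \<in> carrier F \<Longrightarrow> t \<in> carrier F \<Longrightarrow> s - t \<in> carrier F"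
  using keys_diff[of s t] by auto

lemma F_of: "a \<in> carrier A \<Longrightarrow> b \<in> carrier B \<Longrightarrow> frag_of (a, b) \<in> carrier F"
  by simp

lemma rel_subset: "tensor_relations R A ra B \<subseteq> carrier F"
proof
  fix t assume "t \<in> tensor_relations R A ra B"
  then show "t \<in> carrier F"
    by (cases rule: tensor_relationsE)
      (simp_all only:, (intro F_diff F_of; simp add: ra_closed sm_closed)+)
qed

lemma N_generate: "N = generate F (tensor_relations R A ra B)"
  by (simp add: tensor_null_def)

lemma N_subset: "N \<subseteq> carrier F"
  unfolding N_generate by (rule group.generate_incl[OF group_free_Abelian_group rel_subset])

lemma N_zero: "0 \<in> N" using generate.one[of F] by (simp add: N_generate)
lemma N_add: "x \<in> N \<Longrightarrow> y \<in> N \<Longrightarrow> x + y \<in> N" using generate.eng[of x F] by (simp add: N_generate)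
lemma N_neg: "x \<in> N \<Longrightarrow> - x \<in> N"
  using group.generate_m_inv_closed[OF group_free_Abelian_group rel_subset] N_subset
  by (fastforce simp: N_generate)
lemma N_rel: "x \<in> tensor_relations R A ra B \<Longrightarrow> x \<in> N" by (simp add: N_generate generate.incl)

lemma N_induct [consumes 1, case_names zero rel neg add]:
  assumes "x \<in> N" "P 0" "\<And>x. x \<in> tensor_relations R A ra B \<Longrightarrow> P x"
    "\<And>x. x \<in> tensor_relations R A ra B \<Longrightarrow> P (- x)"
    "\<And>x y. x \<in> N \<Longrightarrow> y \<in> N \<Longrightarrow> P x \<Longrightarrow> P y \<Longrightarrow> P (x + y)"
  shows "P x"
  using assms(1) unfolding N_generate
proof (induction rule: generate.induct)
  case (inv h)
  then have "inv\<^bsub>F\<^esub> h = - h" using subsetD[OF rel_subset inv] by simp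
  then show ?case using assms(4)[OF inv] by simp
qed (use assms in \<open>auto simp: N_generate\<close>)

lemma mem_cls: "s \<in> cls t \<longleftrightarrow> (\<exists>n\<in>N. s = n + t)"
  by (auto simp: r_coset_def)

lemma cls_self: "t \<in> cls t" using N_zero by (auto simp: mem_cls)

lemma cls_eq: "t - s \<in> N \<Longrightarrow> cls t = cls s"
proof (intro equalityI subsetI)
  fix x assume d: "t - s \<in> N"
  { assume "x \<in> cls t"
    then obtain n where "n \<in> N" "x = n + t" by (auto simp: mem_cls)
    then show "x \<in> cls s" using N_add[OF _ d] by (auto simp: mem_cls intro!: bexI[of _ "n + (t - s)"]) }
  assume "x \<in> cls s"
  then obtain n where "n \<in> N" "x = n + s" by (auto simp: mem_cls)
  then show "x \<in> cls t"
    using N_add[OF _ N_neg[OF d]] by (auto simp: mem_cls intro!: bexI[of _ "n + - (t - s)"])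
qed

lemma cls_add: "cls s \<oplus>\<^bsub>D\<^esub> cls t = cls (s + t)"
proof -
  have "cls s \<oplus>\<^bsub>D\<^esub> cls t = {x + y | x y. x \<in> cls s \<and> y \<in> cls t}"
    by (auto simp: add_D tensor_group_def FactGroup_def set_mult_def)
  also have "\<dots> = cls (s + t)"
  proof (intro equalityI subsetI)
    fix x assume "x \<in> {x + y | x y. x \<in> cls s \<and> y \<in> cls t}"
    then obtain n m where nm: "n \<in> N" "m \<in> N" "x = n + s + (m + t)" by (auto simp: mem_cls)
    then have "x = (n + m) + (s + t)" by simp
    then show "x \<in> cls (s + t)" using N_add nm by (auto simp: mem_cls)
  next
    fix x assume "x \<in> cls (s + t)"
    then obtain n where n: "n \<in> N" "x = (n + s) + t" by (auto simp: mem_cls add.assoc)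
    then have "n + s \<in> cls s" "t \<in> cls t" using cls_self by (auto simp: mem_cls)
    then show "x \<in> {x + y | x y. x \<in> cls s \<and> y \<in> cls t}" using n(2) by blast
  qed
  finally show ?thesis .
qed

lemma D_carrier: "carrier D = cls ` carrier F"
  by (auto simp: carrier_D tensor_group_def FactGroup_def RCOSETS_def)

lemma D_zero: "\<zero>\<^bsub>D\<^esub> = cls 0"
proof -
  have "N = cls 0" by (auto simp: mem_cls)
  then show ?thesis by (simp add: zero_D tensor_group_def FactGroup_def)
qed

lemma F_add: "s \<in> carrier F \<Longrightarrow> t \<in> carrier F \<Longrightarrow> s + t \<in> carrier F"
  using keys_add[of s t] by auto

lemma D_E:
  assumes "x \<in> carrier D"
  obtains t where "t \<in> carrier F" "x = cls t"
  using assms by (auto simp: D_carrier)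

lemma cls_closed: "t \<in> carrier F \<Longrightarrow> cls t \<in> carrier D"
  unfolding D_carrier by (rule imageI)

lemma abelian_D: "abelian_group D"
proof (rule abelian_groupI)
  fix x y assume "x \<in> carrier D" "y \<in> carrier D"
  then obtain s t where st: "s \<in> carrier F" "x = cls s" "t \<in> carrier F" "y = cls t"
    by (metis D_E)
  show "x \<oplus>\<^bsub>D\<^esub> y \<in> carrier D" unfolding st(2,4) cls_add by (rule cls_closed[OF F_add[OF st(1,3)]])
  show "x \<oplus>\<^bsub>D\<^esub> y = y \<oplus>\<^bsub>D\<^esub> x" unfolding st(2,4) cls_add by (simp only: add.commute)
  show "\<zero>\<^bsub>D\<^esub> \<oplus>\<^bsub>D\<^esub> x = x" unfolding st(2) D_zero cls_add by simp
  have "- s \<in> carrier F" using st(1) by simp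
  then show "\<exists>z\<in>carrier D. z \<oplus>\<^bsub>D\<^esub> x = \<zero>\<^bsub>D\<^esub>"
    unfolding st(2) D_zero by (intro bexI[of _ "cls (- s)"]) (simp add: cls_add, rule cls_closed)
  fix z assume "z \<in> carrier D"
  then obtain u where u: "z = cls u" by (metis D_E)
  show "x \<oplus>\<^bsub>D\<^esub> y \<oplus>\<^bsub>D\<^esub> z = x \<oplus>\<^bsub>D\<^esub> (y \<oplus>\<^bsub>D\<^esub> z)"
    unfolding st(2,4) u cls_add by (simp only: add.assoc)
next
  show "\<zero>\<^bsub>D\<^esub> \<in> carrier D" unfolding D_zero by (rule cls_closed) simp
qed

sublocale D: abelian_group D by (rule abelian_D)

lemma tn_closed [simp]: "a \<in> carrier A \<Longrightarrow> b \<in> carrier B \<Longrightarrow> tn a b \<in> carrier D"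
  by (auto simp: D_carrier pure_tensor_def)

lemma tn_rel: "frag_of x - frag_of y - frag_of z \<in> tensor_relations R A ra B \<Longrightarrow>
    cls (frag_of x) = cls (frag_of y) \<oplus>\<^bsub>D\<^esub> cls (frag_of z)"
  unfolding cls_add by (rule cls_eq) (metis N_rel diff_diff_add)

lemma tn_left:
  assumes "b \<in> carrier B"
  shows "add_map A D (\<lambda>a. tn a b)"
proof unfold_locales
  fix a a' assume a: "a \<in> carrier A" "a' \<in> carrier A"
  show "tn a b \<in> carrier D" using a assms by simp
  show "tn (a \<oplus>\<^bsub>A\<^esub> a') b = tn a b \<oplus>\<^bsub>D\<^esub> tn a' b"
    unfolding pure_tensor_def using a assms
    by (intro tn_rel) (unfold tensor_relations_def, blast)
qed

lemma tn_right:
  assumes "a \<in> carrier A"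
  shows "add_map B D (\<lambda>b. tn a b)"
proof unfold_locales
  fix b b' assume b: "b \<in> carrier B" "b' \<in> carrier B"
  show "tn a b \<in> carrier D" using b assms by simp
  show "tn a (b \<oplus>\<^bsub>B\<^esub> b') = tn a b \<oplus>\<^bsub>D\<^esub> tn a b'"
    unfolding pure_tensor_def using b assms
    by (intro tn_rel) (unfold tensor_relations_def, blast)
qed

lemma tn_balanced:
  "\<lbrakk>a \<in> carrier A; r \<in> carrier R; b \<in> carrier B\<rbrakk> \<Longrightarrow> tn (ra a r) b = tn a (r \<odot>\<^bsub>B\<^esub> b)"
  unfolding pure_tensor_def by (intro cls_eq N_rel) (auto simp: tensor_relations_def)

text \<open>Negatives of generators also occur in the free group, but the negative of a pure tensor
  is pure again, with the left factor negated. So sums alone suffice.\<close>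

lemma tensor_induct [consumes 1, case_names tn add]:
  assumes "x \<in> carrier D"
    and tn: "\<And>a b. a \<in> carrier A \<Longrightarrow> b \<in> carrier B \<Longrightarrow> P (tn a b)"
    and add: "\<And>x y. x \<in> carrier D \<Longrightarrow> y \<in> carrier D \<Longrightarrow> P x \<Longrightarrow> P y \<Longrightarrow> P (x \<oplus>\<^bsub>D\<^esub> y)"
  shows "P x"
proof -
  have z: "P (cls 0)"
    using tn[of "\<zero>\<^bsub>A\<^esub>" "\<zero>\<^bsub>B\<^esub>"] add_map.zero[OF tn_left[of "\<zero>\<^bsub>B\<^esub>"]] by (simp add: D_zero)
  \<comment> \<open>The claims for \<open>t\<close> and for its negative are proved together,
    because the induction principle of the free group proceeds by differences.\<close>
  have "P (cls t) \<and> P (cls (- t))" if "Poly_Mapping.keys t \<subseteq> carrier A \<times> carrier B" for t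
    using that
  proof (induction t rule: free_Abelian_group_induct[consumes 1, case_names zero diff of])
    case (diff x y)
    have c: "cls x \<in> carrier D" "cls y \<in> carrier D" "cls (- x) \<in> carrier D" "cls (- y) \<in> carrier D"
      using diff by (auto simp: D_carrier)
    have "P (cls x \<oplus>\<^bsub>D\<^esub> cls (- y))" "P (cls y \<oplus>\<^bsub>D\<^esub> cls (- x))"
      using add diff c by auto
    then show ?case by (simp add: cls_add)
  next
    case (of p)
    then obtain a b where p: "p = (a, b)" "a \<in> carrier A" "b \<in> carrier B" by auto
    have "cls (- frag_of (a, b)) = tn (\<ominus>\<^bsub>A\<^esub> a) b"
    proof -
      have "cls (- frag_of (a, b)) \<oplus>\<^bsub>D\<^esub> tn a b = \<zero>\<^bsub>D\<^esub>" by (simp add: pure_tensor_def cls_add D_zero)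
      moreover have "cls (- frag_of (a, b)) \<in> carrier D" using p by (auto simp: D_carrier)
      ultimately have "cls (- frag_of (a, b)) = \<ominus>\<^bsub>D\<^esub> tn a b"
        using D.minus_equality p by (metis tn_closed)
      then show ?thesis using add_map.neg[OF tn_left[OF p(3)] p(2)] by simp
    qed
    then show ?case using tn[OF p(2,3)] tn[of "\<ominus>\<^bsub>A\<^esub> a" b] p by (simp add: pure_tensor_def)
  qed (use z in simp)
  then show ?thesis using assms(1) by (auto simp: D_carrier)
qed

lemma add_map_eqI:
  assumes "add_map D E f" "add_map D E g" "x \<in> carrier D"
    and "\<And>a b. a \<in> carrier A \<Longrightarrow> b \<in> carrier B \<Longrightarrow> f (tn a b) = g (tn a b)"
  shows "f x = g x"
  using assms(3)
  by (induction rule: tensor_induct)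
    (auto simp: assms(4) add_map.add[OF assms(1)] add_map.add[OF assms(2)])

text \<open>Maps out of the tensor product are given on cosets by formulas of different kinds:
  \<open>the_elem\<close> in \<open>tensor_lift\<close>, a union in \<open>tensor_map\<close>. Both
  work because \<open>h\<close> kills the relations and is therefore constant on cosets;
  \<open>k\<close> stands for any operator that returns this constant.\<close>

lemma induced_map:
  assumes E: "abelian_group E"
    and closed: "\<And>t. t \<in> carrier F \<Longrightarrow> h t \<in> carrier E"
    and add: "\<And>s t. s \<in> carrier F \<Longrightarrow> t \<in> carrier F \<Longrightarrow> h (s + t) = h s \<oplus>\<^bsub>E\<^esub> h t"
    and rel: "\<And>t. t \<in> tensor_relations R A ra B \<Longrightarrow> h t = \<zero>\<^bsub>E\<^esub>"
    and k: "\<And>T z. T \<in> carrier D \<Longrightarrow> T \<noteq> {} \<Longrightarrow> (\<And>t. t \<in> T \<Longrightarrow> h t = z) \<Longrightarrow> k T = z"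
  shows "add_map D E k" "a \<in> carrier A \<Longrightarrow> b \<in> carrier B \<Longrightarrow> k (tn a b) = h (frag_of (a, b))"
proof -
  interpret E: abelian_group E by fact
  have z: "h 0 = \<zero>\<^bsub>E\<^esub>"
    using add[of 0 0] closed[of 0] E.add.l_cancel_one[of "h 0" "h 0"] by simp
  have neg: "h (- x) = \<ominus>\<^bsub>E\<^esub> h x" if "x \<in> carrier F" for x
    using add[of "- x" x] that closed[of x] closed[of "- x"] z
    by (auto intro!: E.minus_equality[symmetric])
  have N0: "h n = \<zero>\<^bsub>E\<^esub>" if "n \<in> N" for n
    using that
  proof (induction rule: N_induct)
    case (neg x)
    then show ?case using rel[of x] \<open>\<And>x. x \<in> carrier F \<Longrightarrow> h (- x) = \<ominus>\<^bsub>E\<^esub> h x\<close>[of x] rel_subset by auto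
  next
    case (add x y)
    then have xy: "x \<in> carrier F" "y \<in> carrier F" using N_subset by blast+
    show ?case unfolding assms(3)[OF xy] using add.IH by simp
  qed (use z rel in auto)
  have kc: "k (cls t) = h t" if "t \<in> carrier F" for t
  proof (rule k)
    fix s assume "s \<in> cls t"
    then obtain n where n: "n \<in> N" "s = n + t" by (auto simp: mem_cls)
    have nF: "n \<in> carrier F" using n(1) N_subset by blast
    show "h s = h t" unfolding n(2) add[OF nF that] using N0[OF n(1)] closed[OF that] by simp
  qed (use that cls_self[of t] in \<open>auto simp: D_carrier\<close>)
  show "add_map D E k"
    by unfold_locales
      (auto simp: D_carrier kc cls_add F_add closed add simp del: carrier_free_Abelian_group_iff)
  show "k (tn a b) = h (frag_of (a, b))" if "a \<in> carrier A" "b \<in> carrier B"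
    using that kc[of "frag_of (a, b)"] by (simp add: pure_tensor_def)
qed

lemma tensor_lift:
  fixes E :: "('n, 'w) ring_scheme"
  assumes E: "abelian_group E"
    and left: "\<And>b. b \<in> carrier B \<Longrightarrow> add_map A E (\<lambda>a. \<beta> a b)"
    and right: "\<And>a. a \<in> carrier A \<Longrightarrow> add_map B E (\<lambda>b. \<beta> a b)"
    and bal: "\<And>a r b. \<lbrakk>a \<in> carrier A; r \<in> carrier R; b \<in> carrier B\<rbrakk> \<Longrightarrow> \<beta> (ra a r) b = \<beta> a (r \<odot>\<^bsub>B\<^esub> b)"
  shows "add_map D E (tensor_lift E \<beta>)"
    and "a \<in> carrier A \<Longrightarrow> b \<in> carrier B \<Longrightarrow> tensor_lift E \<beta> (tn a b) = \<beta> a b"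
proof -
  interpret E: abelian_group E by fact
  define h where "h t = finsum E (\<lambda>(a, b). [Poly_Mapping.lookup t (a, b)] \<cdot>\<^bsub>E\<^esub> \<beta> a b) (Poly_Mapping.keys t)"
    for t :: "'a \<times> 'b \<Rightarrow>\<^sub>0 int"
  have \<beta>: "\<beta> a b \<in> carrier E" if "a \<in> carrier A" "b \<in> carrier B" for a b
    using add_map.closed[OF left] that by blast
  have z: "add_pow E (0::int) x = \<zero>\<^bsub>E\<^esub>" for x by (simp add: add_pow_def)
  \<comment> \<open>The sum may run over any finite superset of the keys; for a sum of two elements
    the union of their keys then is a common index set.\<close>
  have hS: "h t = (\<Oplus>\<^bsub>E\<^esub>p\<in>S. [Poly_Mapping.lookup t p] \<cdot>\<^bsub>E\<^esub> \<beta> (fst p) (snd p))"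
    if "finite S" "Poly_Mapping.keys t \<subseteq> S" "S \<subseteq> carrier A \<times> carrier B" for t S
  proof -
    have *: "\<beta> a b \<in> carrier E" if "Poly_Mapping.lookup t (a, b) \<noteq> 0" for a b
    proof -
      have "(a, b) \<in> Poly_Mapping.keys t" using that by (simp add: in_keys_iff)
      then have "(a, b) \<in> carrier A \<times> carrier B"
        using \<open>Poly_Mapping.keys t \<subseteq> S\<close> \<open>S \<subseteq> carrier A \<times> carrier B\<close> by blast
      then show ?thesis using \<beta> by blast
    qed
    show ?thesis
    unfolding h_def split_def prod.collapse using that *
    by (intro E.finsum_neutral[symmetric])
      (auto simp: in_keys_iff z intro!: E.add.int_pow_closed)
  qed
  have c: "h t \<in> carrier E" if "t \<in> carrier F" for t
    using hS[of "Poly_Mapping.keys t" t] that \<beta> by (auto intro!: E.finsum_closed)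
  have hf: "h (frag_of (a, b)) = \<beta> a b" if "a \<in> carrier A" "b \<in> carrier B" for a b
    using that \<beta> by (simp add: h_def E.finsum_insert)
  have add: "h (s + t) = h s \<oplus>\<^bsub>E\<^esub> h t" if "s \<in> carrier F" "t \<in> carrier F" for s t
  proof -
    let ?S = "Poly_Mapping.keys s \<union> Poly_Mapping.keys t"
    have S: "finite ?S" "Poly_Mapping.keys s \<subseteq> ?S" "Poly_Mapping.keys t \<subseteq> ?S"
      "Poly_Mapping.keys (s + t) \<subseteq> ?S" "?S \<subseteq> carrier A \<times> carrier B"
      using that keys_add[of s t] by auto
    have \<beta>S: "\<beta> a b \<in> carrier E" if "(a, b) \<in> Poly_Mapping.keys s \<or> (a, b) \<in> Poly_Mapping.keys t" for a b
      using S(5) that \<beta> by auto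
    show ?thesis
      unfolding hS[OF S(1,2,5)] hS[OF S(1,3,5)] hS[OF S(1,4,5)]
      by (subst E.finsum_addf[symmetric])
        (auto simp: lookup_add E.add.int_pow_mult \<beta>S simp del: E.add.finprod_multf intro!: E.finsum_cong')
  qed
  have diff: "h (s - t) = h s \<ominus>\<^bsub>E\<^esub> h t" if "s \<in> carrier F" "t \<in> carrier F" for s t
  proof -
    have d: "s - t \<in> carrier F" using that keys_diff[of s t] by auto
    have "h s = h (s - t) \<oplus>\<^bsub>E\<^esub> h t" using add[OF d that(2)] by simp
    then show ?thesis using c[OF d] c[OF that(2)] by (simp add: E.minus_eq E.a_assoc E.r_neg)
  qed
  have rel: "h t = \<zero>\<^bsub>E\<^esub>" if "t \<in> tensor_relations R A ra B" for t
  proof -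
    have F: "frag_of (a, b) \<in> carrier F" if "a \<in> carrier A" "b \<in> carrier B" for a b using that by simp
    have F2: "frag_of (a, b) - frag_of (a', b') \<in> carrier F"
      if "a \<in> carrier A" "b \<in> carrier B" "a' \<in> carrier A" "b' \<in> carrier B" for a b a' b'
      using that keys_diff[of "frag_of (a, b)" "frag_of (a', b')"] by auto
    have 3: "x \<oplus>\<^bsub>E\<^esub> y \<ominus>\<^bsub>E\<^esub> x \<ominus>\<^bsub>E\<^esub> y = \<zero>\<^bsub>E\<^esub>" if "x \<in> carrier E" "y \<in> carrier E" for x y
    proof -
      have "x \<oplus>\<^bsub>E\<^esub> y \<ominus>\<^bsub>E\<^esub> x = y" using that by (simp add: E.minus_eq E.a_comm[of x y] E.a_assoc E.r_neg)
      then show ?thesis using that by (simp add: E.minus_eq E.r_neg)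
    qed
    from that show ?thesis
    proof (cases rule: tensor_relationsE)
      case left
      then show ?thesis
        unfolding left(1) by (subst diff[OF F2 F], simp_all, subst diff[OF F F])
          (simp_all add: hf \<beta> 3 add_map.add[OF assms(2)])
    next
      case right
      then show ?thesis
        unfolding right(1) by (subst diff[OF F2 F], simp_all, subst diff[OF F F])
          (simp_all add: hf \<beta> 3 add_map.add[OF assms(3)])
    next
      case balanced
      then show ?thesis
        unfolding balanced(1) by (subst diff[OF F F])
          (simp_all add: ra_closed sm_closed hf \<beta> bal E.minus_eq E.r_neg)
    qed
  qed
  have k: "tensor_lift E \<beta> T = z" if "T \<noteq> {}" "\<And>t. t \<in> T \<Longrightarrow> h t = z" for T z
  proof -
    have "h ` T = {z}" using that by auto
    then show ?thesis by (simp add: tensor_lift_def h_def[abs_def])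
  qed
  show "add_map D E (tensor_lift E \<beta>)" 
    by (rule induced_map(1)[where h = h, OF E]) (rule c add rel k; assumption)+
  show "tensor_lift E \<beta> (tn a b) = \<beta> a b" if "a \<in> carrier A" "b \<in> carrier B"
    unfolding hf[OF that, symmetric]
    by (rule induced_map(2)[where h = h, OF E]) (rule c add rel k that; assumption?)+
qed

end

text \<open>Balancedness is a condition on the pure tensors of the target, where scalars can still
  be moved from one factor to the other.\<close>

lemma tensor_map:
  fixes D :: "(('a \<times> 'b \<Rightarrow>\<^sub>0 int) set, 'z) ring_scheme"
    and D' :: "(('s \<times> 't \<Rightarrow>\<^sub>0 int) set, 'w) ring_scheme"
  assumes "tensor R' A' ra' B' D'" "tensor R A ra B D" "add_map A' A f" "add_map B' B g"
    and bal: "\<And>a r b. \<lbrakk>a \<in> carrier A'; r \<in> carrier R'; b \<in> carrier B'\<rbrakk> \<Longrightarrow>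
      pure_tensor R A ra B (f (ra' a r)) (g b) = pure_tensor R A ra B (f a) (g (r \<odot>\<^bsub>B'\<^esub> b))"
  shows "add_map D' D (tensor_map R A ra B f g)"
    and "a \<in> carrier A' \<Longrightarrow> b \<in> carrier B' \<Longrightarrow>
      tensor_map R A ra B f g (pure_tensor R' A' ra' B' a b) = pure_tensor R A ra B (f a) (g b)"
proof -
  interpret T': tensor R' A' ra' B' D' by fact
  interpret T: tensor R A ra B D by fact
  interpret f: add_map A' A f by fact
  interpret g: add_map B' B g by fact
  define h where "h t = T.cls (frag_extend (\<lambda>(a, b). frag_of (f a, g b)) t)" for t
  have cl: "frag_extend (\<lambda>(a, b). frag_of (f a, g b)) t \<in> carrier T.F" if "t \<in> carrier T'.F" for t
  proof -
    have "(\<Union>p\<in>Poly_Mapping.keys t. Poly_Mapping.keys (case p of (a, b) \<Rightarrow> frag_of (f a, g b)))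
        \<subseteq> carrier A \<times> carrier B"
    proof (rule UN_least)
      fix p assume "p \<in> Poly_Mapping.keys t"
      then have "p \<in> carrier A' \<times> carrier B'" using that by auto
      then show "Poly_Mapping.keys (case p of (a, b) \<Rightarrow> frag_of (f a, g b)) \<subseteq> carrier A \<times> carrier B"
        by (cases p) (simp add: f.closed g.closed)
    qed
    then show ?thesis using order.trans[OF keys_frag_extend] by simp
  qed
  have c: "h t \<in> carrier D" if "t \<in> carrier T'.F" for t
    using cl[OF that] by (auto simp: h_def T.D_carrier simp del: carrier_free_Abelian_group_iff)
  have add: "h (s + t) = h s \<oplus>\<^bsub>D\<^esub> h t" for s t
    by (simp add: h_def T.cls_add frag_extend_add)
  have hf: "h (frag_of (a, b)) = T.tn (f a) (g b)" for a b
    by (simp add: h_def pure_tensor_def)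
  have diff: "h (s - t) = h s \<ominus>\<^bsub>D\<^esub> h t" if "h (s - t) \<in> carrier D" "h t \<in> carrier D" for s t
    using add[of "s - t" t] that by (simp add: T.D.minus_eq T.D.a_assoc T.D.r_neg)
  have rel: "h t = \<zero>\<^bsub>D\<^esub>" if t: "t \<in> tensor_relations R' A' ra' B'" for t
  proof -
    have r3: "h (frag_of x - frag_of y - frag_of z) = \<zero>\<^bsub>D\<^esub>"
      if "h (frag_of x) = h (frag_of y) \<oplus>\<^bsub>D\<^esub> h (frag_of z)"
        "frag_of x - frag_of y - frag_of z \<in> carrier T'.F" "h (frag_of y) \<in> carrier D" "h (frag_of z) \<in> carrier D" for x y z
    proof -
      let ?u = "frag_of x - frag_of y - frag_of z"
      have "h ?u \<oplus>\<^bsub>D\<^esub> (h (frag_of y) \<oplus>\<^bsub>D\<^esub> h (frag_of z)) = h (?u + (frag_of y + frag_of z))" by (simp only: add)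
      also have "?u + (frag_of y + frag_of z) = frag_of x" by simp
      finally have "h ?u \<oplus>\<^bsub>D\<^esub> h (frag_of x) = h (frag_of x)" using that(1) by simp
      then show ?thesis using c[OF that(2)] that T.D.add.l_cancel_one[of "h (frag_of x)" "h ?u"]
        by simp
    qed
    have r2: "h (frag_of x - frag_of y) = \<zero>\<^bsub>D\<^esub>"
      if "h (frag_of x) = h (frag_of y)" "frag_of x - frag_of y \<in> carrier T'.F" "h (frag_of y) \<in> carrier D" for x y
      using add[of "frag_of x - frag_of y" "frag_of y"] that(1,3) c[OF that(2)]
        T.D.add.l_cancel_one[of "h (frag_of y)" "h (frag_of x - frag_of y)"]
      by simp
    have tF: "t \<in> carrier T'.F" using t T'.rel_subset by blast
    from t show ?thesis
    proof (cases rule: tensor_relationsE)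
      case left
      show ?thesis unfolding left(1)
        by (rule r3) (use left tF in \<open>simp_all only: hf f.add add_map.add[OF T.tn_left] f.closed g.closed T.tn_closed\<close>)
    next
      case right
      show ?thesis unfolding right(1)
        by (rule r3) (use right tF in \<open>simp_all only: hf g.add add_map.add[OF T.tn_right] f.closed g.closed T.tn_closed\<close>)
    next
      case balanced
      show ?thesis unfolding balanced(1)
        by (rule r2) (use balanced tF in \<open>simp_all only: hf bal T'.sm_closed f.closed g.closed T.tn_closed\<close>)
    qed
  qed
  have k: "tensor_map R A ra B f g S = z" if "S \<noteq> {}" "\<And>t. t \<in> S \<Longrightarrow> h t = z" for S z
  proof -
    have "tensor_map R A ra B f g S = (\<Union>t\<in>S. h t)" by (simp only: tensor_map_def h_def)
    also have "\<dots> = (\<Union>t\<in>S. z)" using that(2) by (rule SUP_cong[OF HOL.refl])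
    finally show ?thesis using that(1) by simp
  qed
  show "add_map D' D (tensor_map R A ra B f g)"
    by (rule T'.induced_map(1)[where h = h, OF T.abelian_D]) (rule c add rel k; assumption)+
  show "tensor_map R A ra B f g (pure_tensor R' A' ra' B' a b) = T.tn (f a) (g b)"
    if "a \<in> carrier A'" "b \<in> carrier B'"
    unfolding hf[symmetric]
    by (rule T'.induced_map(2)[where h = h, OF T.abelian_D]) (rule c add rel k that; assumption?)+
qed


section \<open>Filtrations by induced modules\<close>

text \<open>The cosets of \<open>N\<close> are the fibres of \<open>\<Phi>\<close>, so
  \<open>\<Phi>\<close> descends injectively. The union in the scalar multiplication of
  \<open>quotient_module\<close> is a union of copies of one and the same fibre.\<close>

lemma quotient_module_iso:
  fixes C :: "('r, 'a) module" and D :: "('r, 'b) module"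
  assumes C: "left_module R C" and D: "left_module R D" and \<Phi>: "\<Phi> \<in> left_module_hom R C D"
    and surj: "\<And>y. y \<in> carrier D \<Longrightarrow> \<exists>x\<in>carrier C. \<Phi> x = y"
    and N: "N \<subseteq> carrier C" and ker: "\<And>x. x \<in> carrier C \<Longrightarrow> \<Phi> x = \<zero>\<^bsub>D\<^esub> \<longleftrightarrow> x \<in> N"
  shows "left_module_iso R (quotient_module C N) D"
proof -
  interpret C: left_module R C by fact
  interpret D: left_module R D by fact
  interpret \<Phi>: add_map C D \<Phi> by (rule left_module_hom_add_map[OF C D \<Phi>])
  note sm = left_module_hom_smult[OF \<Phi>]
  have coset: "a_r_coset C N x = {z \<in> carrier C. \<Phi> z = \<Phi> x}" if x: "x \<in> carrier C" for x
  proof (intro equalityI subsetI)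
    fix z assume "z \<in> a_r_coset C N x"
    then obtain n where "n \<in> N" "z = n \<oplus>\<^bsub>C\<^esub> x" by (auto simp: a_r_coset_def')
    then show "z \<in> {z \<in> carrier C. \<Phi> z = \<Phi> x}"
      using x N ker[of n] by (auto simp: \<Phi>.add \<Phi>.closed subset_iff)
  next
    fix z assume z: "z \<in> {z \<in> carrier C. \<Phi> z = \<Phi> x}"
    then have "z \<ominus>\<^bsub>C\<^esub> x \<in> N"
      using ker[of "z \<ominus>\<^bsub>C\<^esub> x"] x by (simp add: \<Phi>.diff \<Phi>.closed D.minus_eq D.r_neg)
    moreover have "z = z \<ominus>\<^bsub>C\<^esub> x \<oplus>\<^bsub>C\<^esub> x" using x z by (simp add: C.minus_eq C.a_assoc C.l_neg)
    ultimately show "z \<in> a_r_coset C N x" by (auto simp: a_r_coset_def')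
  qed
  let ?Q = "quotient_module C N"
  define g where "g S = the_elem (\<Phi> ` S)" for S
  have gI: "g S = y" if "S \<noteq> {}" "\<And>s. s \<in> S \<Longrightarrow> \<Phi> s = y" for S y
  proof -
    have "\<Phi> ` S = {y}" using that by auto
    then show ?thesis by (simp add: g_def)
  qed
  have Qc: "carrier ?Q = a_r_coset C N ` carrier C"
    by (auto simp: quotient_module_def A_RCOSETS_def')
  have gc: "g (a_r_coset C N x) = \<Phi> x" if "x \<in> carrier C" for x
    using that by (intro gI) (auto simp: coset)
  have add: "g (S \<oplus>\<^bsub>?Q\<^esub> T) = g S \<oplus>\<^bsub>D\<^esub> g T" if S: "S \<in> carrier ?Q" and T: "T \<in> carrier ?Q" for S T
  proof -
    obtain x y where x: "x \<in> carrier C" "S = a_r_coset C N x" and y: "y \<in> carrier C" "T = a_r_coset C N y"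
      using S T by (auto simp: Qc)
    have "g (S \<oplus>\<^bsub>?Q\<^esub> T) = \<Phi> x \<oplus>\<^bsub>D\<^esub> \<Phi> y"
      using x y by (intro gI) (auto simp: quotient_module_def set_add_def' coset \<Phi>.add)
    then show ?thesis using x y by (simp add: gc)
  qed
  have smult: "g (r \<odot>\<^bsub>?Q\<^esub> S) = r \<odot>\<^bsub>D\<^esub> g S" if r: "r \<in> carrier R" and S: "S \<in> carrier ?Q" for r S
  proof -
    obtain x where x: "x \<in> carrier C" "S = a_r_coset C N x" using S by (auto simp: Qc)
    have "r \<odot>\<^bsub>?Q\<^esub> S = (\<Union>y\<in>S. a_r_coset C N (r \<odot>\<^bsub>C\<^esub> y))" by (simp add: quotient_module_def)
    also have "\<dots> = (\<Union>y\<in>S. {z \<in> carrier C. \<Phi> z = r \<odot>\<^bsub>D\<^esub> \<Phi> x})"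
      using x r by (intro SUP_cong HOL.refl) (simp add: coset sm)
    also have "\<dots> = {z \<in> carrier C. \<Phi> z = r \<odot>\<^bsub>D\<^esub> \<Phi> x}" using x coset[OF x(1)] by auto
    moreover have "r \<odot>\<^bsub>C\<^esub> x \<in> \<dots>" using x r by (simp add: sm)
    ultimately have "g (r \<odot>\<^bsub>?Q\<^esub> S) = r \<odot>\<^bsub>D\<^esub> \<Phi> x" by (intro gI) auto
    then show ?thesis using x by (simp add: gc)
  qed
  have "bij_betw g (carrier ?Q) (carrier D)"
  proof (rule bij_betw_imageI)
    show "inj_on g (carrier ?Q)"
    proof (rule inj_onI)
      fix S T assume "S \<in> carrier ?Q" "T \<in> carrier ?Q" and eq: "g S = g T"
      then obtain x y where x: "x \<in> carrier C" "S = a_r_coset C N x" and y: "y \<in> carrier C" "T = a_r_coset C N y"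
        by (auto simp: Qc)
      then have "\<Phi> x = \<Phi> y" using eq gc by metis
      then show "S = T" using x y by (simp add: coset)
    qed
    show "g ` carrier ?Q = carrier D"
      using surj by (auto simp: Qc gc \<Phi>.closed image_iff) (metis gc)
  qed
  moreover have "g \<in> left_module_hom R ?Q D"
    using add smult by (auto simp: left_module_hom_def Qc gc \<Phi>.closed)
  ultimately show ?thesis by (auto simp: left_module_iso_def)
qed

context fm
begin

lemma invariant_Chi: "monoid_ideal M I \<Longrightarrow> Q.invariant q (Chi I q)"
  unfolding Q.invariant_def using Chi_subset mact_Chi by blast

end

section \<open>The bimodule KL_f and the induced modules\<close>

context fmi
begin

lemma fm_G: "fm K G"
  by (simp add: fm_def fm_axioms_def K.field_axioms G.is_monoid finite_G)

sublocale FG: fm K "maximal_subgroup M f" by (rule fm_G)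

definition actL :: "'m \<Rightarrow> 'm \<Rightarrow> 'm option" where
  "actL m l = (if m \<otimes>\<^bsub>M\<^esub> l \<in> Lf then Some (m \<otimes>\<^bsub>M\<^esub> l) else None)"

lemma based_L: "based K M Lf actL"
proof unfold_locales
  show "finite Lf" by (rule finite_L)
  fix l assume l: "l \<in> Lf"
  then show "actL \<one>\<^bsub>M\<^esub> l = Some l" by (simp add: actL_def L_carrier)
  fix m n assume m: "m \<in> carrier M" and n: "n \<in> carrier M"
  \<comment> \<open>A left inverse of m n l yields one of n l. So a product that has left the
    L-class never returns to it, which makes the partial action associative.\<close>
  have "n \<otimes>\<^bsub>M\<^esub> l \<in> Lf" if h: "m \<otimes>\<^bsub>M\<^esub> (n \<otimes>\<^bsub>M\<^esub> l) \<in> Lf"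
  proof -
    obtain k where k: "k \<in> carrier M" "k \<otimes>\<^bsub>M\<^esub> (m \<otimes>\<^bsub>M\<^esub> (n \<otimes>\<^bsub>M\<^esub> l)) = f"
      by (rule L_left_inverse[OF h])
    then have "(k \<otimes>\<^bsub>M\<^esub> m) \<otimes>\<^bsub>M\<^esub> (n \<otimes>\<^bsub>M\<^esub> l) = f" using m n L_carrier[OF l] by (simp add: M.m_assoc)
    moreover have "n \<otimes>\<^bsub>M\<^esub> l \<otimes>\<^bsub>M\<^esub> f = n \<otimes>\<^bsub>M\<^esub> l"
      using n L_carrier[OF l] L_right[OF l] by (simp add: M.m_assoc)
    ultimately show ?thesis
      unfolding mem_L using k(1) m n L_carrier[OF l] by blast
  qed
  then show "actL (m \<otimes>\<^bsub>M\<^esub> n) l = Option.bind (actL n l) (actL m)"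
    using m n L_carrier[OF l] by (auto simp: actL_def M.m_assoc)
qed (auto simp: actL_def split: if_splits)

sublocale L: based K M "L_class M f" actL by (rule based_L)

text \<open>The group G_f permutes the chains with top fM, so this action is total, unlike
  \<open>mact\<close>.\<close>

definition actW :: "'m \<Rightarrow> 'm set list \<Rightarrow> 'm set list option" where "actW g \<tau> = Some (mp g \<tau>)"

lemma based_W: "based K G (Xf q) actW"
proof (intro based.intro based_axioms.intro fm_G)
  show "finite (Xf q)" by (rule finite_subset[OF _ finite_Ch[of q]]) auto
  show "actW g \<tau> = Some b' \<Longrightarrow> b' \<in> Xf q" if "g \<in> carrier G" "\<tau> \<in> Xf q" for g \<tau> b'
    using G_Xf[OF that] by (auto simp: actW_def)
  show "actW \<one>\<^bsub>G\<^esub> \<tau> = Some \<tau>" if "\<tau> \<in> Xf q" for \<tau>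
    using mp_f[OF that] by (simp add: actW_def G_one)
  show "actW (g \<otimes>\<^bsub>G\<^esub> h) \<tau> = Option.bind (actW h \<tau>) (actW g)"
    if "g \<in> carrier G" "h \<in> carrier G" "\<tau> \<in> Xf q" for g h \<tau>
    using that mp_mult[OF G_carrier G_carrier, of g h \<tau> q] by (simp add: actW_def G_mult)
qed

abbreviation "KL \<equiv> based_module K M Lf actL"
abbreviation "ra \<equiv> KL_right_action K M f"
abbreviation "bL \<equiv> basis_scaled K Lf"
abbreviation "eG \<equiv> basis_scaled K (carrier G)"
abbreviation "KW q \<equiv> based_module K G (Xf q) actW"
abbreviation "bW q \<equiv> basis_scaled K (Xf q)"

lemma KL_eq: "KL_module K M f = KL"
  by (simp add: KL_module_def actL_def[abs_def])

text \<open>This makes the biadditivity of \<^const>\<open>based_module\<close> available for the right action.\<close>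

lemma ra_eq:
  assumes u: "u \<in> carrier KL" and y: "y \<in> carrier FG.R"
  shows "ra u y = y \<odot>\<^bsub>based_module K G Lf (\<lambda>g l. Some (l \<otimes>\<^bsub>M\<^esub> g))\<^esub> u"
proof -
  let ?S = "\<lambda>l. {(l', g) \<in> supp K Lf u \<times> supp K (carrier G) y. l' \<otimes>\<^bsub>M\<^esub> g = l}"
  let ?T = "\<lambda>l. {(g, l') \<in> supp K (carrier G) y \<times> supp K Lf u. Some (l' \<otimes>\<^bsub>M\<^esub> g) = Some l}"
  have "finsum K (\<lambda>(l', g). u l' \<otimes>\<^bsub>K\<^esub> y g) (?S l) = finsum K (\<lambda>(g, l'). y g \<otimes>\<^bsub>K\<^esub> u l') (?T l)" for l
  proof -
    have "?S l = (\<lambda>(g, l'). (l', g)) ` ?T l" by auto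
    then have "finsum K (\<lambda>(l', g). u l' \<otimes>\<^bsub>K\<^esub> y g) (?S l)
      = finsum K (\<lambda>p. (\<lambda>(l', g). u l' \<otimes>\<^bsub>K\<^esub> y g) ((\<lambda>(g, l'). (l', g)) p)) (?T l)"
      using L.C.eval_closed[OF u] FG.R.eval_closed[OF y]
      by (simp only:, intro K.finsum_reindex) (auto simp: inj_on_def supp_def)
    also have "\<dots> = finsum K (\<lambda>(g, l'). y g \<otimes>\<^bsub>K\<^esub> u l') (?T l)"
      using L.C.eval_closed[OF u] FG.R.eval_closed[OF y]
      by (intro K.finsum_cong') (auto simp: supp_def K.m_comm)
    finally show ?thesis .
  qed
  then show ?thesis by (simp add: KL_right_action_def based_module_def)
qed

lemma AR_sel:
  "carrier (based_module K G Lf act) = carrier KL"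
  "\<zero>\<^bsub>based_module K G Lf act\<^esub> = \<zero>\<^bsub>KL\<^esub>"
  "x \<oplus>\<^bsub>based_module K G Lf act\<^esub> y = x \<oplus>\<^bsub>KL\<^esub> y"
  by (simp_all add: based_module_def)

lemma ra_closed: "u \<in> carrier KL \<Longrightarrow> y \<in> carrier FG.R \<Longrightarrow> ra u y \<in> carrier KL"
  using FG.based_smult_closed[OF finite_L] by (simp add: ra_eq AR_sel)

lemma ra_left:
  assumes y: "y \<in> carrier FG.R"
  shows "add_map KL KL (\<lambda>u. ra u y)"
proof (intro add_map.intro add_map_axioms.intro L.C.abelian_C)
  fix u v assume uv: "u \<in> carrier KL" "v \<in> carrier KL"
  show "ra u y \<in> carrier KL" using uv y by (simp add: ra_closed)
  show "ra (u \<oplus>\<^bsub>KL\<^esub> v) y = ra u y \<oplus>\<^bsub>KL\<^esub> ra v y"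
    using add_map.add[OF FG.based_smult_right[OF finite_L y], unfolded AR_sel] uv y
    by (simp add: ra_eq AR_sel)
qed

lemma ra_right:
  assumes u: "u \<in> carrier KL"
  shows "add_map FG.R KL (\<lambda>y. ra u y)"
proof (intro add_map.intro add_map_axioms.intro L.C.abelian_C FG.R.abelian_C)
  fix y z assume yz: "y \<in> carrier FG.R" "z \<in> carrier FG.R"
  show "ra u y \<in> carrier KL" using u yz by (simp add: ra_closed)
  have u': "u \<in> carrier (based_module K G Lf act)" for act using u by (simp add: AR_sel)
  show "ra u (y \<oplus>\<^bsub>FG.R\<^esub> z) = ra u y \<oplus>\<^bsub>KL\<^esub> ra u z"
    using add_map.add[OF FG.based_smult_left[OF finite_L u'], unfolded AR_sel] u yz
    by (simp add: ra_eq)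
qed

lemma ra_gen:
  assumes "l \<in> Lf" "g \<in> carrier G" "c \<in> carrier K" "d \<in> carrier K"
  shows "ra (bL l c) (eG g d) = bL (l \<otimes>\<^bsub>M\<^esub> g) (c \<otimes>\<^bsub>K\<^esub> d)"
  using assms
  by (subst ra_eq) (auto simp: based_smult_gen[OF K.field_axioms] K.m_comm)

lemma ra_smult:
  assumes x: "x \<in> carrier R" and u: "u \<in> carrier KL" and y: "y \<in> carrier FG.R"
  shows "x \<odot>\<^bsub>KL\<^esub> ra u y = ra (x \<odot>\<^bsub>KL\<^esub> u) y"
  using add_map_comp[OF ra_left[OF y] L.CM.smult_right_add_map[OF x]]
    add_map_comp[OF L.CM.smult_right_add_map[OF x] ra_left[OF y]] u
proof (rule L.C.add_map_eqI)
  fix l c assume l: "l \<in> Lf" and c: "c \<in> carrier K"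
  have b: "bL l c \<in> carrier KL" using c by simp
  show "x \<odot>\<^bsub>KL\<^esub> ra (bL l c) y = ra (x \<odot>\<^bsub>KL\<^esub> bL l c) y"
    using add_map_comp[OF ra_right[OF b] L.CM.smult_right_add_map[OF x]]
      ra_right[OF L.CM.smult_closed[OF x b]] y
  proof (rule FG.R.add_map_eqI)
    fix g d assume g: "g \<in> carrier G" and d: "d \<in> carrier K"
    have eg: "eG g d \<in> carrier FG.R" using d by simp
    have b': "bL (l \<otimes>\<^bsub>M\<^esub> g) (c \<otimes>\<^bsub>K\<^esub> d) \<in> carrier KL" using c d by simp
    show "x \<odot>\<^bsub>KL\<^esub> ra (bL l c) (eG g d) = ra (x \<odot>\<^bsub>KL\<^esub> bL l c) (eG g d)"
      unfolding ra_gen[OF l g c d]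
      using L.CM.smult_left_add_map[OF b'] add_map_comp[OF L.CM.smult_left_add_map[OF b] ra_left[OF eg]] x
    proof (rule R.add_map_eqI)
      fix m a assume m: "m \<in> carrier M" and a: "a \<in> carrier K"
      \<comment> \<open>As \<open>g\<close> is invertible, right multiplication by it does not
        affect membership in the L-class; so both orders of the two actions vanish on the same basis
        elements.\<close>
      have iff: "m \<otimes>\<^bsub>M\<^esub> (l \<otimes>\<^bsub>M\<^esub> g) \<in> Lf \<longleftrightarrow> m \<otimes>\<^bsub>M\<^esub> l \<in> Lf"
      proof
        assume "m \<otimes>\<^bsub>M\<^esub> (l \<otimes>\<^bsub>M\<^esub> g) \<in> Lf"
        then have "m \<otimes>\<^bsub>M\<^esub> (l \<otimes>\<^bsub>M\<^esub> g) \<otimes>\<^bsub>M\<^esub> inv\<^bsub>G\<^esub> g \<in> Lf" by (rule L_mult_G[OF _ G.inv_closed[OF g]])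
        moreover have "m \<otimes>\<^bsub>M\<^esub> (l \<otimes>\<^bsub>M\<^esub> g) \<otimes>\<^bsub>M\<^esub> inv\<^bsub>G\<^esub> g = m \<otimes>\<^bsub>M\<^esub> (l \<otimes>\<^bsub>M\<^esub> (g \<otimes>\<^bsub>M\<^esub> inv\<^bsub>G\<^esub> g))"
          using m L_carrier[OF l] G_carrier[OF g] G_carrier[OF G.inv_closed[OF g]] by (simp add: M.m_assoc)
        ultimately show "m \<otimes>\<^bsub>M\<^esub> l \<in> Lf" using g L_right[OF l] by (simp add: G_inv)
      next
        assume "m \<otimes>\<^bsub>M\<^esub> l \<in> Lf"
        then show "m \<otimes>\<^bsub>M\<^esub> (l \<otimes>\<^bsub>M\<^esub> g) \<in> Lf"
          using L_mult_G[OF _ g, of "m \<otimes>\<^bsub>M\<^esub> l"] m L_carrier[OF l] G_carrier[OF g] by (simp add: M.m_assoc)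
      qed
      show "e m a \<odot>\<^bsub>KL\<^esub> bL (l \<otimes>\<^bsub>M\<^esub> g) (c \<otimes>\<^bsub>K\<^esub> d) = ra (e m a \<odot>\<^bsub>KL\<^esub> bL l c) (eG g d)"
        using m a c d l g iff L_mult_G[OF l g] L_carrier[OF l] G_carrier[OF g]
        by (auto simp: L.smult_gen actL_def ra_gen add_map.zero[OF ra_left[OF eg]] M.m_assoc K.m_assoc)
    qed
  qed
qed

lemma tensor_Ind:
  assumes W: "left_module FG.R W"
  shows "tensor FG.R KL ra W (Ind K M f W)"
proof -
  interpret W: left_module FG.R W by fact
  show ?thesis
    by unfold_locales
      (auto simp: Ind_def Let_def KL_eq ra_closed)
qed

lemma Ind_smult:
  assumes W: "left_module FG.R W" and x: "x \<in> carrier R"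
  shows "add_map (Ind K M f W) (Ind K M f W) (\<lambda>T. x \<odot>\<^bsub>Ind K M f W\<^esub> T)"
    and "u \<in> carrier KL \<Longrightarrow> w \<in> carrier W \<Longrightarrow>
      x \<odot>\<^bsub>Ind K M f W\<^esub> pure_tensor FG.R KL ra W u w = pure_tensor FG.R KL ra W (x \<odot>\<^bsub>KL\<^esub> u) w"
proof -
  interpret W: left_module FG.R W by fact
  interpret T: tensor FG.R KL ra W "Ind K M f W" by (rule tensor_Ind[OF W])
  have I: "x \<odot>\<^bsub>Ind K M f W\<^esub> T = tensor_map FG.R KL ra W (\<lambda>u. x \<odot>\<^bsub>KL\<^esub> u) (\<lambda>w. w) T" for T
    by (simp add: Ind_def Let_def KL_eq)
  note tm = tensor_map[OF T.tensor_axioms T.tensor_axioms L.CM.smult_right_add_map[OF x]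
      add_map_id[OF W.abelian_group_axioms]]
  have bal: "T.tn (x \<odot>\<^bsub>KL\<^esub> ra u y) w = T.tn (x \<odot>\<^bsub>KL\<^esub> u) (y \<odot>\<^bsub>W\<^esub> w)"
    if "u \<in> carrier KL" "y \<in> carrier FG.R" "w \<in> carrier W" for u y w
    using that x by (simp add: ra_smult T.tn_balanced)
  show "add_map (Ind K M f W) (Ind K M f W) (\<lambda>T. x \<odot>\<^bsub>Ind K M f W\<^esub> T)"
    unfolding I using bal by (rule tm(1))
  show "x \<odot>\<^bsub>Ind K M f W\<^esub> T.tn u w = T.tn (x \<odot>\<^bsub>KL\<^esub> u) w" if "u \<in> carrier KL" "w \<in> carrier W"
    unfolding I using bal that by (rule tm(2))
qed

lemma left_module_Ind:
  assumes W: "left_module FG.R W"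
  shows "left_module R (Ind K M f W)"
proof -
  interpret W: left_module FG.R W by fact
  interpret T: tensor FG.R KL ra W "Ind K M f W" by (rule tensor_Ind[OF W])
  let ?I = "Ind K M f W"
  note sm = Ind_smult[OF W]
  show ?thesis
  proof (rule left_moduleI[OF T.abelian_D])
    show cl: "x \<odot>\<^bsub>?I\<^esub> v \<in> carrier ?I" if "x \<in> carrier R" "v \<in> carrier ?I" for x v
      using add_map.closed[OF sm(1)] that by blast
    show "add_map ?I ?I (\<lambda>v. x \<odot>\<^bsub>?I\<^esub> v)" if "x \<in> carrier R" for x using sm(1)[OF that] .
    show "add_map R ?I (\<lambda>x. x \<odot>\<^bsub>?I\<^esub> v)" if v: "v \<in> carrier ?I" for v
    proof (intro add_map.intro add_map_axioms.intro R.abelian_C T.abelian_D)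
      fix x y assume xy: "x \<in> carrier R" "y \<in> carrier R"
      show "(x \<oplus>\<^bsub>R\<^esub> y) \<odot>\<^bsub>?I\<^esub> v = x \<odot>\<^bsub>?I\<^esub> v \<oplus>\<^bsub>?I\<^esub> y \<odot>\<^bsub>?I\<^esub> v"
        using sm(1)[OF R.C.add.m_closed[OF xy]] add_map_sum[OF sm(1)[OF xy(1)] sm(1)[OF xy(2)]] v
      proof (rule T.add_map_eqI)
        fix u w assume "u \<in> carrier KL" "w \<in> carrier W"
        then show "(x \<oplus>\<^bsub>R\<^esub> y) \<odot>\<^bsub>?I\<^esub> T.tn u w = x \<odot>\<^bsub>?I\<^esub> T.tn u w \<oplus>\<^bsub>?I\<^esub> y \<odot>\<^bsub>?I\<^esub> T.tn u w"
          using xy by (simp add: sm(2) L.CM.smult_l_distr add_map.add[OF T.tn_left])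
      qed
    qed (use cl v in auto)
    fix v assume v: "v \<in> carrier ?I"
    have e1: "e \<one>\<^bsub>M\<^esub> \<one>\<^bsub>K\<^esub> \<in> carrier R" by simp
    show "e \<one>\<^bsub>M\<^esub> \<one>\<^bsub>K\<^esub> \<odot>\<^bsub>?I\<^esub> v = v"
      using sm(1)[OF e1] add_map_id[OF T.abelian_D] v
      by (rule T.add_map_eqI) (simp add: sm(2), simp add: one_R[symmetric])
    fix m n c d assume 1: "m \<in> carrier M" "n \<in> carrier M" "c \<in> carrier K" "d \<in> carrier K"
    have ee: "e m c \<in> carrier R" "e n d \<in> carrier R" "e (m \<otimes>\<^bsub>M\<^esub> n) (c \<otimes>\<^bsub>K\<^esub> d) \<in> carrier R" using 1 by auto
    show "e m c \<odot>\<^bsub>?I\<^esub> (e n d \<odot>\<^bsub>?I\<^esub> v) = e (m \<otimes>\<^bsub>M\<^esub> n) (c \<otimes>\<^bsub>K\<^esub> d) \<odot>\<^bsub>?I\<^esub> v"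
      using add_map_comp[OF sm(1)[OF ee(2)] sm(1)[OF ee(1)]] sm(1)[OF ee(3)] v
    proof (rule T.add_map_eqI)
      fix u w assume "u \<in> carrier KL" "w \<in> carrier W"
      then show "e m c \<odot>\<^bsub>?I\<^esub> (e n d \<odot>\<^bsub>?I\<^esub> T.tn u w) = e (m \<otimes>\<^bsub>M\<^esub> n) (c \<otimes>\<^bsub>K\<^esub> d) \<odot>\<^bsub>?I\<^esub> T.tn u w"
        using ee 1 by (simp add: sm(2) L.CM.smult_assoc1[symmetric] mult_gen)
    qed
  qed
qed

end


section \<open>One layer of the filtration\<close>

locale layer = fmi K M f
  for K :: "('k, 'd) ring_scheme" and M :: "('m, 'c) monoid_scheme" and f +
  fixes I :: "'m set"
  assumes I: "monoid_ideal M I" and J: "J_class M f \<subseteq> I"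
    and I': "monoid_ideal M (I - J_class M f)"
begin

abbreviation "I' \<equiv> I - J_class M f"
abbreviation "XJ q \<equiv> Chi I q - Chi I' q"
abbreviation "ChJ q \<equiv> supported K (Ch q) (Chi I q)"
abbreviation "ChJ' q \<equiv> supported K (Ch q) (Chi I' q)"

lemma XJ_subset: "XJ q \<subseteq> Ch q" using Chi_subset by blast

lemma XJ_factor:
  assumes "\<sigma> \<in> XJ q"
  shows "\<exists>a \<tau>. a \<in> Lf \<and> \<tau> \<in> Xf q \<and> \<sigma> = mp a \<tau>"
proof -
  have s: "\<sigma> \<in> Ch q" using assms XJ_subset by blast
  obtain b where b: "b \<in> carrier M" "last \<sigma> = right_ideal M b"
    using last_principal[OF s] by (auto simp: principal_right_ideals_def)
  have "b \<in> I" "b \<notin> I'"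
    using assms s b M.monoid_ideal_right_ideal[OF I b(1)] M.monoid_ideal_right_ideal[OF I' b(1)]
    by (auto simp: Chi_def)
  then have "b \<in> J_class M f" by blast
  then show ?thesis by (rule chain_factor[OF s b(2)]) blast
qed

lemma XJ_mem:
  assumes "a \<in> Lf" "\<tau> \<in> Xf q"
  shows "mp a \<tau> \<in> XJ q"
proof -
  have "a \<in> I" "a \<notin> I'" using L_in_J[OF assms(1)] J by auto
  then show ?thesis
    using L_Xf[OF assms] L_carrier[OF assms(1)] M.monoid_ideal_right_ideal[OF I]
      M.monoid_ideal_right_ideal[OF I'] by (auto simp: Chi_def)
qed

text \<open>A choice of the factorisation into an element of the L-class and a chain with top fM.
  Two choices differ by an element of G_f, and what is built from them is shown not to depend on
  it.\<close>

definition fa :: "nat \<Rightarrow> 'm set list \<Rightarrow> 'm" where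
  "fa q \<sigma> = (SOME a. \<exists>\<tau>. a \<in> Lf \<and> \<tau> \<in> Xf q \<and> \<sigma> = mp a \<tau>)"
definition ft :: "nat \<Rightarrow> 'm set list \<Rightarrow> 'm set list" where
  "ft q \<sigma> = (SOME \<tau>. fa q \<sigma> \<in> Lf \<and> \<tau> \<in> Xf q \<and> \<sigma> = mp (fa q \<sigma>) \<tau>)"

lemma fa_ft:
  assumes "\<sigma> \<in> XJ q"
  shows "fa q \<sigma> \<in> Lf" "ft q \<sigma> \<in> Xf q" "mp (fa q \<sigma>) (ft q \<sigma>) = \<sigma>"
proof -
  have "\<exists>\<tau>. fa q \<sigma> \<in> Lf \<and> \<tau> \<in> Xf q \<and> \<sigma> = mp (fa q \<sigma>) \<tau>"
    unfolding fa_def by (rule someI_ex[OF XJ_factor[OF assms]])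
  from someI_ex[OF this, folded ft_def]
  show "fa q \<sigma> \<in> Lf" "ft q \<sigma> \<in> Xf q" "mp (fa q \<sigma>) (ft q \<sigma>) = \<sigma>" by auto
qed

text \<open>By stability the product m a either stays in the L-class or drops into
  \<open>I'\<close>; in the second case the translated chain is zero or lies below
  \<open>I'\<close>.\<close>

lemma mact_layer:
  assumes a: "a \<in> Lf" and t: "\<tau> \<in> Xf q" and m: "m \<in> carrier M"
  shows "m \<otimes>\<^bsub>M\<^esub> a \<in> Lf \<Longrightarrow> mact m (mp a \<tau>) = Some (mp (m \<otimes>\<^bsub>M\<^esub> a) \<tau>)"
    and "m \<otimes>\<^bsub>M\<^esub> a \<notin> Lf \<Longrightarrow> m \<otimes>\<^bsub>M\<^esub> a \<in> I'"
    and "m \<otimes>\<^bsub>M\<^esub> a \<notin> Lf \<Longrightarrow> mact m (mp a \<tau>) = Some \<sigma> \<Longrightarrow> \<sigma> \<in> Chi I' q"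
proof -
  have t': "\<tau> \<in> Ch q" using t by simp
  have eq: "mp m (mp a \<tau>) = mp (m \<otimes>\<^bsub>M\<^esub> a) \<tau>" by (rule mp_mult[OF m L_carrier[OF a] t'])
  have mc: "mact m (mp a \<tau>) = mact (m \<otimes>\<^bsub>M\<^esub> a) \<tau>" unfolding mact_def eq by (rule HOL.refl)
  show "mact m (mp a \<tau>) = Some (mp (m \<otimes>\<^bsub>M\<^esub> a) \<tau>)" if "m \<otimes>\<^bsub>M\<^esub> a \<in> Lf"
    unfolding mc by (rule L_Xf(1)[OF that t])
  show 1: "m \<otimes>\<^bsub>M\<^esub> a \<in> I'" if "m \<otimes>\<^bsub>M\<^esub> a \<notin> Lf"
  proof -
    have "m \<otimes>\<^bsub>M\<^esub> a \<in> I" using L_in_J[OF a] J I m by (auto simp: monoid_ideal_def)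
    then show ?thesis using L_stable[OF a m] that by blast
  qed
  show "\<sigma> \<in> Chi I' q" if "m \<otimes>\<^bsub>M\<^esub> a \<notin> Lf" "mact m (mp a \<tau>) = Some \<sigma>"
    using mact_Chi[OF I' _ t', of "m \<otimes>\<^bsub>M\<^esub> a" \<sigma>] that mc 1 m L_carrier[OF a] by simp
qed

theorem layer_iso:
  "left_module_iso R (quotient_module (CM q\<lparr>carrier := ChJ q\<rparr>) (ChJ' q)) (Ind K M f (KW q))"
proof -
  let ?I = "Ind K M f (KW q)"
  interpret W: based K G "Xf q" actW by (rule based_W)
  interpret T: tensor FG.R KL ra "KW q" ?I by (rule tensor_Ind[OF W.left_module_C])
  interpret D: left_module R ?I by (rule left_module_Ind[OF W.left_module_C])
  note inv = invariant_Chi[OF I, of q] and inv' = invariant_Chi[OF I', of q]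
  have cb: "bL l c \<in> carrier KL" "bW q \<tau> c \<in> carrier (KW q)" if "c \<in> carrier K" for l \<tau> c
    using that by auto
  \<comment> \<open>The chain a \<tau> will go to the pure tensor of a and \<tau>; chains below
    \<open>I'\<close> go to zero, as the extension runs over \<open>XJ q\<close> only.\<close>
  define \<phi> where "\<phi> \<sigma> c = T.tn (bL (fa q \<sigma>) c) (bW q (ft q \<sigma>) \<one>\<^bsub>K\<^esub>)" for \<sigma> c
  define \<Phi> where "\<Phi> = linext ?I (XJ q) \<phi>"
  have \<phi>: "add_map K ?I (\<phi> \<sigma>)" for \<sigma>
    unfolding \<phi>_def by (rule add_map_comp[OF L.C.bs_add_map T.tn_left]) (simp add: cb)
  have \<Phi>: "add_map (CM q) ?I \<Phi>"
    unfolding \<Phi>_def by (rule Q.C.linext_add_map[OF T.abelian_D XJ_subset \<phi>])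
  interpret \<Phi>: add_map "CM q" ?I \<Phi> by (rule \<Phi>)
  have \<Phi>b: "\<Phi> (bq q \<sigma> c) = (if \<sigma> \<in> XJ q then \<phi> \<sigma> c else \<zero>\<^bsub>?I\<^esub>)" if "\<sigma> \<in> Ch q" "c \<in> carrier K" for \<sigma> c
    unfolding \<Phi>_def using Q.C.linext_bs[OF T.abelian_D XJ_subset \<phi> that(2,1)] .
  \<comment> \<open>Independence of the chosen factorisation: the element of G_f between two
    factorisations moves across the tensor sign.\<close>
  have \<Phi>mp: "\<Phi> (bq q (mp a \<tau>) c) = T.tn (bL a c) (bW q \<tau> \<one>\<^bsub>K\<^esub>)"
    if a: "a \<in> Lf" and t: "\<tau> \<in> Xf q" and c: "c \<in> carrier K" for a \<tau> c
  proof -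
    note x = XJ_mem[OF a t]
    have "\<Phi> (bq q (mp a \<tau>) c) = T.tn (bL (fa q (mp a \<tau>)) c) (bW q (ft q (mp a \<tau>)) \<one>\<^bsub>K\<^esub>)"
      using \<Phi>b[OF subsetD[OF XJ_subset x] c] x by (simp only: if_True \<phi>_def)
    also obtain g where g: "g \<in> carrier G" "a = fa q (mp a \<tau>) \<otimes>\<^bsub>M\<^esub> g" "ft q (mp a \<tau>) = mp g \<tau>"
      using factor_unique[OF fa_ft(1)[OF x] a fa_ft(2)[OF x] t fa_ft(3)[OF x]] by blast
    have "bW q (ft q (mp a \<tau>)) \<one>\<^bsub>K\<^esub> = eG g \<one>\<^bsub>K\<^esub> \<odot>\<^bsub>KW q\<^esub> bW q \<tau> \<one>\<^bsub>K\<^esub>"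
      using W.smult_gen[OF g(1) t, of "\<one>\<^bsub>K\<^esub>" "\<one>\<^bsub>K\<^esub>"] g(3) by (simp add: actW_def)
    also have "T.tn (bL (fa q (mp a \<tau>)) c) (eG g \<one>\<^bsub>K\<^esub> \<odot>\<^bsub>KW q\<^esub> bW q \<tau> \<one>\<^bsub>K\<^esub>) =
      T.tn (ra (bL (fa q (mp a \<tau>)) c) (eG g \<one>\<^bsub>K\<^esub>)) (bW q \<tau> \<one>\<^bsub>K\<^esub>)"
      using c by (intro T.tn_balanced[symmetric]) auto
    also have "ra (bL (fa q (mp a \<tau>)) c) (eG g \<one>\<^bsub>K\<^esub>) = bL a c"
      using ra_gen[OF fa_ft(1)[OF x] g(1) c, of "\<one>\<^bsub>K\<^esub>"] g(2)[symmetric] c by simp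
    finally show ?thesis .
  qed
  have hom: "\<Phi> \<in> left_module_hom R (CM q\<lparr>carrier := ChJ q\<rparr>) ?I"
  proof (rule Q.hom_supportedI[OF inv D.left_module_axioms \<Phi>])
    fix m c \<sigma> d assume m: "m \<in> carrier M" and c: "c \<in> carrier K" and s: "\<sigma> \<in> Chi I q" and d: "d \<in> carrier K"
    have e: "e m c \<in> carrier R" using c by simp
    show "e m c \<odot>\<^bsub>?I\<^esub> \<Phi> (bq q \<sigma> d) =
      (case mact m \<sigma> of None \<Rightarrow> \<zero>\<^bsub>?I\<^esub> | Some \<tau> \<Rightarrow> \<Phi> (bq q \<tau> (c \<otimes>\<^bsub>K\<^esub> d)))"
    proof (cases "\<sigma> \<in> Chi I' q")
      case True
      have "\<Phi> (bq q \<sigma> d) = \<zero>\<^bsub>?I\<^esub>" using True \<Phi>b[OF subsetD[OF Chi_subset s] d] by simp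
      moreover have "\<Phi> (bq q \<tau> (c \<otimes>\<^bsub>K\<^esub> d)) = \<zero>\<^bsub>?I\<^esub>" if "mact m \<sigma> = Some \<tau>" for \<tau>
      proof -
        have "\<tau> \<in> Chi I' q" using mact_Chi[OF I' m subsetD[OF Chi_subset True] that] True by simp
        then show ?thesis using \<Phi>b[of \<tau> "c \<otimes>\<^bsub>K\<^esub> d"] Chi_subset c d by auto
      qed
      ultimately show ?thesis using e by (auto split: option.splits)
    next
      case False
      then have "\<sigma> \<in> XJ q" using s by simp
      then obtain a \<tau> where a: "a \<in> Lf" and t: "\<tau> \<in> Xf q" and s': "\<sigma> = mp a \<tau>" using XJ_factor by blast
      have lhs: "e m c \<odot>\<^bsub>?I\<^esub> \<Phi> (bq q \<sigma> d) = T.tn (e m c \<odot>\<^bsub>KL\<^esub> bL a d) (bW q \<tau> \<one>\<^bsub>K\<^esub>)"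
        unfolding s' \<Phi>mp[OF a t d] using d e by (intro Ind_smult(2)[OF W.left_module_C]) auto
      show ?thesis
      proof (cases "m \<otimes>\<^bsub>M\<^esub> a \<in> Lf")
        case True
        then have "actL m a = Some (m \<otimes>\<^bsub>M\<^esub> a)" by (simp add: actL_def)
        then have "e m c \<odot>\<^bsub>?I\<^esub> \<Phi> (bq q \<sigma> d) = T.tn (bL (m \<otimes>\<^bsub>M\<^esub> a) (c \<otimes>\<^bsub>K\<^esub> d)) (bW q \<tau> \<one>\<^bsub>K\<^esub>)"
          using lhs m a c d by (simp add: L.smult_gen)
        then show ?thesis
          using mact_layer(1)[OF a t m True] \<Phi>mp[OF True t] c d by (simp add: s')
      next
        case False
        then have "actL m a = None" by (simp add: actL_def)
        then have "e m c \<odot>\<^bsub>?I\<^esub> \<Phi> (bq q \<sigma> d) = \<zero>\<^bsub>?I\<^esub>"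
          using lhs m a c d add_map.zero[OF T.tn_left[OF cb(2)[OF K.one_closed]]] by (simp add: L.smult_gen)
        moreover have "\<Phi> (bq q \<rho> (c \<otimes>\<^bsub>K\<^esub> d)) = \<zero>\<^bsub>?I\<^esub>" if "mact m \<sigma> = Some \<rho>" for \<rho>
        proof -
          have "\<rho> \<in> Chi I' q" using mact_layer(3)[OF a t m False] that s' by simp
          then show ?thesis using \<Phi>b[of \<rho> "c \<otimes>\<^bsub>K\<^esub> d"] Chi_subset c d by auto
        qed
        ultimately show ?thesis by (auto split: option.splits)
      qed
    qed
  qed
  have sub: "ChJ q \<subseteq> carrier (CM q)" by (rule Q.C.supported_subset)
  have surj: "y \<in> \<Phi> ` ChJ q" if "y \<in> carrier ?I" for y
  proof -
    have add: "\<Phi> u \<oplus>\<^bsub>?I\<^esub> \<Phi> v \<in> \<Phi> ` ChJ q" if "u \<in> ChJ q" "v \<in> ChJ q" for u v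
      unfolding \<Phi>.add[OF subsetD[OF sub that(1)] subsetD[OF sub that(2)], symmetric]
      by (rule imageI[OF Q.C.supported_add[OF that]])
    have z: "\<zero>\<^bsub>?I\<^esub> \<in> \<Phi> ` ChJ q"
      unfolding \<Phi>.zero[symmetric] by (rule imageI[OF Q.C.supported_zero])
    \<comment> \<open>The coefficient \<open>d\<close> is moved to the left factor as
      \<open>d\<close> times \<open>f\<close>, the latter being the identity of G_f.\<close>
    have gen: "T.tn (bL l c) (bW q \<tau> d) \<in> \<Phi> ` ChJ q"
      if l: "l \<in> Lf" and t: "\<tau> \<in> Xf q" and c: "c \<in> carrier K" and d: "d \<in> carrier K" for l \<tau> c d
    proof -
      have "T.tn (bL l c) (bW q \<tau> d) = T.tn (bL l c) (eG f d \<odot>\<^bsub>KW q\<^esub> bW q \<tau> \<one>\<^bsub>K\<^esub>)"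
        using W.smult_gen[OF f_in_G t d, of "\<one>\<^bsub>K\<^esub>"] mp_f[OF t] d by (simp add: actW_def)
      also have "\<dots> = T.tn (ra (bL l c) (eG f d)) (bW q \<tau> \<one>\<^bsub>K\<^esub>)"
        using c d by (intro T.tn_balanced[symmetric]) auto
      also have "ra (bL l c) (eG f d) = bL l (c \<otimes>\<^bsub>K\<^esub> d)"
        using ra_gen[OF l f_in_G c d] L_right[OF l] by simp
      also have "T.tn \<dots> (bW q \<tau> \<one>\<^bsub>K\<^esub>) = \<Phi> (bq q (mp l \<tau>) (c \<otimes>\<^bsub>K\<^esub> d))"
        using \<Phi>mp[OF l t] c d by simp
      finally have eq: "T.tn (bL l c) (bW q \<tau> d) = \<Phi> (bq q (mp l \<tau>) (c \<otimes>\<^bsub>K\<^esub> d))" .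
      have "mp l \<tau> \<in> Chi I q" using XJ_mem[OF l t] by simp
      then have "bq q (mp l \<tau>) (c \<otimes>\<^bsub>K\<^esub> d) \<in> ChJ q" using c d by (intro Q.C.bs_supported) auto
      then show ?thesis unfolding eq by (rule imageI)
    qed
    have tn: "T.tn u w \<in> \<Phi> ` ChJ q" if u: "u \<in> carrier KL" and w: "w \<in> carrier (KW q)" for u w
      using u
    proof (induction rule: L.C.C_induct)
      case zero
      then show ?case using z w by (simp add: add_map.zero[OF T.tn_left])
    next
      case (add u v)
      then show ?case using w \<open>\<And>u v. u \<in> ChJ q \<Longrightarrow> v \<in> ChJ q \<Longrightarrow> _ \<in> \<Phi> ` ChJ q\<close>
        by (auto simp: add_map.add[OF T.tn_left])
    next
      case (bs l c)
      show ?case using w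
      proof (induction rule: W.C.C_induct)
        case zero
        then show ?case using z bs by (simp add: add_map.zero[OF T.tn_right] cb)
      next
        case (add u v)
        then show ?case using bs \<open>\<And>u v. u \<in> ChJ q \<Longrightarrow> v \<in> ChJ q \<Longrightarrow> _ \<in> \<Phi> ` ChJ q\<close>
          by (auto simp: add_map.add[OF T.tn_right] cb)
      next
        case (bs \<tau> d)
        show ?case by (rule gen) (use bs \<open>l \<in> Lf\<close> \<open>c \<in> carrier K\<close> in auto)
      qed
    qed
    show ?thesis using that
      by (induction rule: T.tensor_induct) (use tn add in auto)
  qed
  have ker: "\<Phi> u = \<zero>\<^bsub>?I\<^esub> \<longleftrightarrow> u \<in> ChJ' q" if u: "u \<in> ChJ q" for u
  proof
    have uC: "u \<in> carrier (CM q)" using u sub by blast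
    {
      assume "u \<in> ChJ' q"
      then have "\<phi> \<sigma> (u \<sigma>) = \<zero>\<^bsub>?I\<^esub>" if "\<sigma> \<in> XJ q" for \<sigma>
        using that subsetD[OF XJ_subset that] add_map.zero[OF \<phi>] by (auto simp: supported_def)
      then have "\<Phi> u = (\<Oplus>\<^bsub>?I\<^esub>\<sigma>\<in>XJ q. \<zero>\<^bsub>?I\<^esub>)"
        unfolding \<Phi>_def linext_def by (intro T.D.finsum_cong') auto
      then show "\<Phi> u = \<zero>\<^bsub>?I\<^esub>" by simp
    }
    \<comment> \<open>Injectivity modulo the lower chains needs a map back. With KL_f embedded
      linearly into the monoid algebra and the permutation module into the chains, the action sends
      the pair of a and \<tau> to the chain a \<tau>. This is balanced over KG_f, and its composite
      with \<open>\<Phi>\<close> is the projection onto the coordinates in the layer.\<close>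
    assume z: "\<Phi> u = \<zero>\<^bsub>?I\<^esub>"
    define x1 where "x1 = linext R Lf e"
    define x2 where "x2 = linext (CM q) (Xf q) (bq q)"
    have LM: "Lf \<subseteq> carrier M" using L_carrier by blast
    have x1: "add_map KL R x1" unfolding x1_def
      by (rule L.C.linext_add_map[OF R.abelian_C subset_refl R.bs_add_map])
    have x1b: "x1 (bL l c) = e l c" if "l \<in> Lf" "c \<in> carrier K" for l c
      unfolding x1_def using L.C.linext_bs[OF R.abelian_C subset_refl R.bs_add_map that(2,1)] that by simp
    have x2: "add_map (KW q) (CM q) x2" unfolding x2_def
      by (rule W.C.linext_add_map[OF Q.C.abelian_C subset_refl Q.C.bs_add_map])
    have x2b: "x2 (bW q \<tau> c) = bq q \<tau> c" if "\<tau> \<in> Xf q" "c \<in> carrier K" for \<tau> c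
      unfolding x2_def using W.C.linext_bs[OF Q.C.abelian_C subset_refl Q.C.bs_add_map that(2,1)] that by simp
    define \<beta> where "\<beta> u w = x1 u \<odot>\<^bsub>CM q\<^esub> x2 w" for u w
    have l: "add_map KL (CM q) (\<lambda>u. \<beta> u w)" if "w \<in> carrier (KW q)" for w
      unfolding \<beta>_def by (rule add_map_comp[OF x1 Q.CM.smult_left_add_map[OF add_map.closed[OF x2 that]]])
    have r: "add_map (KW q) (CM q) (\<lambda>w. \<beta> u w)" if "u \<in> carrier KL" for u
      unfolding \<beta>_def by (rule add_map_comp[OF x2 Q.CM.smult_right_add_map[OF add_map.closed[OF x1 that]]])
    have \<beta>g: "\<beta> (bL a c) (bW q \<tau> d) = bq q (mp a \<tau>) (c \<otimes>\<^bsub>K\<^esub> d)"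
      if "a \<in> Lf" "\<tau> \<in> Xf q" "c \<in> carrier K" "d \<in> carrier K" for a \<tau> c d
      using that L_Xf(1)[OF that(1,2)] Q.smult_gen[OF L_carrier[OF that(1)], of \<tau> q c d]
      by (simp add: \<beta>_def x1b x2b)
    have bal: "\<beta> (ra v y) w = \<beta> v (y \<odot>\<^bsub>KW q\<^esub> w)"
      if v: "v \<in> carrier KL" and y: "y \<in> carrier FG.R" and w: "w \<in> carrier (KW q)" for v y w
      using add_map_comp[OF ra_left[OF y] l[OF w]] l[OF W.CM.smult_closed[OF y w]] v
    proof (rule L.C.add_map_eqI)
      fix a c assume a: "a \<in> Lf" and c: "c \<in> carrier K"
      show "\<beta> (ra (bL a c) y) w = \<beta> (bL a c) (y \<odot>\<^bsub>KW q\<^esub> w)"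
        using add_map_comp[OF ra_right[OF cb(1)[OF c]] l[OF w]]
          add_map_comp[OF W.CM.smult_left_add_map[OF w] r[OF cb(1)[OF c]]] y
      proof (rule FG.R.add_map_eqI)
        fix g a' assume g: "g \<in> carrier G" and a': "a' \<in> carrier K"
        have eg: "eG g a' \<in> carrier FG.R" using a' by simp
        show "\<beta> (ra (bL a c) (eG g a')) w = \<beta> (bL a c) (eG g a' \<odot>\<^bsub>KW q\<^esub> w)"
          using r[OF ra_closed[OF cb(1)[OF c] eg]]
            add_map_comp[OF W.CM.smult_right_add_map[OF eg] r[OF cb(1)[OF c]]] w
        proof (rule W.C.add_map_eqI)
          fix \<tau> d assume t: "\<tau> \<in> Xf q" and d: "d \<in> carrier K"
          have t': "\<tau> \<in> Ch q" using t by simp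
          show "\<beta> (ra (bL a c) (eG g a')) (bW q \<tau> d) = \<beta> (bL a c) (eG g a' \<odot>\<^bsub>KW q\<^esub> bW q \<tau> d)"
            using W.smult_gen[OF g t a' d] \<beta>g[OF L_mult_G[OF a g] t, of "c \<otimes>\<^bsub>K\<^esub> a'" d]
              \<beta>g[OF a G_Xf[OF g t] c, of "a' \<otimes>\<^bsub>K\<^esub> d"] mp_mult[OF L_carrier[OF a] G_carrier[OF g] t'] c a' d
            by (simp add: ra_gen[OF a g c a'] actW_def K.m_assoc del: map_map)
        qed
      qed
    qed
    have tl1: "add_map ?I (CM q) (tensor_lift (CM q) \<beta>)"
      by (rule T.tensor_lift(1)[OF Q.C.abelian_C]) (rule l r bal; assumption)+
    have tl2: "tensor_lift (CM q) \<beta> (T.tn u w) = \<beta> u w" if "u \<in> carrier KL" "w \<in> carrier (KW q)" for u w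
      by (rule T.tensor_lift(2)[OF Q.C.abelian_C]) (rule l r bal that; assumption?)+
    have "tensor_lift (CM q) \<beta> (\<Phi> u) = linext (CM q) (XJ q) (bq q) u"
      using add_map_comp[OF \<Phi> tl1] Q.C.linext_add_map[OF Q.C.abelian_C XJ_subset Q.C.bs_add_map] uC
    proof (rule Q.C.add_map_eqI)
      fix \<sigma> c assume s: "\<sigma> \<in> Ch q" and c: "c \<in> carrier K"
      show "tensor_lift (CM q) \<beta> (\<Phi> (bq q \<sigma> c)) = linext (CM q) (XJ q) (bq q) (bq q \<sigma> c)"
      proof (cases "\<sigma> \<in> XJ q")
        case True
        then show ?thesis
          using fa_ft[OF True] s c
            Q.C.linext_bs[OF Q.C.abelian_C XJ_subset Q.C.bs_add_map c s]
            \<beta>g[OF fa_ft(1,2)[OF True] c K.one_closed]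
          by (simp add: \<Phi>b \<phi>_def tl2)
      next
        case False
        then show ?thesis
          using Q.C.linext_bs[OF Q.C.abelian_C XJ_subset Q.C.bs_add_map c s]
          by (simp only: \<Phi>b[OF s c] if_False add_map.zero[OF tl1])
      qed
    qed
    then have "linext (CM q) (XJ q) (bq q) u = \<zero>\<^bsub>CM q\<^esub>"
      unfolding z add_map.zero[OF tl1] by simp
    then have "u \<sigma> = \<zero>\<^bsub>K\<^esub>" if "\<sigma> \<in> XJ q" for \<sigma>
      using Q.C.linext_bs_eval[OF uC XJ_subset subsetD[OF XJ_subset that]] that subsetD[OF XJ_subset that]
      by (simp add: Q.C.zero_C)
    then show "u \<in> ChJ' q" using u by (auto simp: supported_def)
  qed
  have "Chi I' q \<subseteq> Chi I q" by (auto simp: Chi_def)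
  then have sub': "ChJ' q \<subseteq> ChJ q" by (auto simp: supported_def)
  show ?thesis
    by (rule quotient_module_iso[OF Q.left_module_supported[OF inv] D.left_module_axioms hom])
      (use surj sub' ker in auto)
qed

end

context fm
begin

theorem filtered_chain_module:
  assumes "regular_monoid M"
  shows "filtered_by_induced K M (chain_module K M q)"
proof -
  define steps where "steps F n \<longleftrightarrow> (\<forall>i\<le>n. submodule (F i) R (CM q)) \<and>
    (\<forall>i<n. F i \<subseteq> F (Suc i) \<and> (\<exists>f\<in>idempotents M. \<exists>W :: ('m \<Rightarrow> 'k, 'm set list \<Rightarrow> 'k) module.
      left_module (monoid_algebra K (maximal_subgroup M f)) W \<and>
      left_module_iso R (quotient_module (CM q\<lparr>carrier := F (Suc i)\<rparr>) (F i)) (Ind K M f W)))"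
    for F and n :: nat
  have "monoid_ideal M (carrier M)" by (auto simp: monoid_ideal_def)
  then have "\<exists>F n. F 0 = {\<zero>\<^bsub>CM q\<^esub>} \<and> F n = supported K (Ch q) (Chi (carrier M) q) \<and> steps F n"
    using finite_M assms
  proof (induction rule: M.monoid_ideal_induct)
    case empty
    have z: "supported K (Ch q) (Chi {} q) = {\<zero>\<^bsub>CM q\<^esub>}"
    proof -
      have "u = \<zero>\<^bsub>CM q\<^esub>" if "u \<in> supported K (Ch q) {}" for u
        using Q.C.expand[OF that] by simp
      then show ?thesis using Q.C.supported_zero by (auto simp: Chi_empty)
    qed
    have "submodule (supported K (Ch q) (Chi {} q)) R (CM q)"
      by (intro Q.submodule_supported invariant_Chi) (auto simp: monoid_ideal_def)
    then show ?case
      by (intro exI[of _ "\<lambda>i. {\<zero>\<^bsub>CM q\<^esub>}"] exI[of _ 0]) (auto simp: z steps_def)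
  next
    case (step I f)
    interpret layer K M f I
      by (intro layer.intro fmi.intro idem.intro fm_axioms M.monoid_axioms layer_axioms.intro
          idem_axioms.intro finite_M step)
    obtain F n where F: "F 0 = {\<zero>\<^bsub>CM q\<^esub>}" "F n = ChJ' q" "steps F n" using step.IH by blast
    \<comment> \<open>\<open>steps F n\<close> constrains \<open>F\<close> only up to
      \<open>n\<close>, so it survives the redefinition at \<open>Suc n\<close>, which adds one more
      layer on top.\<close>
    let ?F = "F(Suc n := ChJ q)"
    have "submodule (ChJ q) R (CM q)" by (rule Q.submodule_supported[OF invariant_Chi[OF I]])
    moreover have "ChJ' q \<subseteq> ChJ q" by (auto simp: supported_def Chi_def)
    moreover have "left_module FG.R (KW q)" by (rule based.left_module_C[OF based_W])
    ultimately have "steps ?F (Suc n)"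
      using F layer_iso[of q] f unfolding steps_def by (auto simp: less_Suc_eq le_Suc_eq)
    moreover have "?F 0 = {\<zero>\<^bsub>CM q\<^esub>}" "?F (Suc n) = ChJ q" using F(1) by simp_all
    ultimately show ?case by blast
  qed
  then show ?thesis
    unfolding filtered_by_induced_def steps_def chain_module_eq
    by (simp add: Chi_carrier Q.C.supported_UNIV)
qed

end


section \<open>Right identities of ideals\<close>

context fm
begin

abbreviation "RS I \<equiv> supported K (carrier M) I"

lemma RS_mult:
  assumes I: "monoid_ideal M I" and u: "u \<in> RS I" and x: "x \<in> carrier R"
  shows "x \<otimes>\<^bsub>R\<^esub> u \<in> RS I" "u \<otimes>\<^bsub>R\<^esub> x \<in> RS I"
proof -
  have IM: "I \<subseteq> carrier M" using I by (simp add: monoid_ideal_def)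
  have "x \<otimes>\<^bsub>R\<^esub> u \<in> RS I \<and> u \<otimes>\<^bsub>R\<^esub> x \<in> RS I"
    using u IM
  proof (induction rule: R.supported_induct)
    case zero
    then show ?case using x R.supported_zero by simp
  next
    case (add u v)
    then show ?case using x R.supported_add by (simp add: RR.l_distr RR.r_distr)
  next
    case (bs k c)
    then have k: "k \<in> carrier M" using IM by auto
    show ?case using x
    proof (induction rule: R.C_induct)
      case zero
      then show ?case using bs R.supported_zero by simp
    next
      case (add x y)
      then show ?case using bs R.supported_add by (simp add: RR.l_distr RR.r_distr)
    next
      case (bs m d)
      then show ?case
        using \<open>k \<in> I\<close> k \<open>c \<in> carrier K\<close> I by (auto simp: mult_gen monoid_ideal_def intro!: R.bs_supported)
    qed
  qed
  then show "x \<otimes>\<^bsub>R\<^esub> u \<in> RS I" "u \<otimes>\<^bsub>R\<^esub> x \<in> RS I" by auto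
qed

text \<open>Tested on the monoid elements in \<open>I\<close> only;
  \<open>right_identity_supported\<close> extends it to all of KI.\<close>

definition right_identity :: "'m set \<Rightarrow> ('m \<Rightarrow> 'k) \<Rightarrow> bool" where
  "right_identity I \<eta> \<longleftrightarrow> \<eta> \<in> RS I \<and> (\<forall>k\<in>I. e k \<one>\<^bsub>K\<^esub> \<otimes>\<^bsub>R\<^esub> \<eta> = e k \<one>\<^bsub>K\<^esub>)"

lemma right_identity_supported:
  assumes "right_identity I \<eta>" "I \<subseteq> carrier M" "z \<in> RS I"
  shows "z \<otimes>\<^bsub>R\<^esub> \<eta> = z"
proof -
  have \<eta>: "\<eta> \<in> carrier R" using assms(1) R.supported_subset by (auto simp: right_identity_def)
  show ?thesis
    using assms(3,2)
  proof (induction rule: R.supported_induct)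
    case (bs k c)
    then have k: "k \<in> carrier M" using assms(2) by auto
    have "e k c = e \<one>\<^bsub>M\<^esub> c \<otimes>\<^bsub>R\<^esub> e k \<one>\<^bsub>K\<^esub>" using k bs by (simp add: mult_gen)
    then show ?case using assms(1) bs \<eta> by (simp add: right_identity_def RR.m_assoc)
  qed (use \<eta> in \<open>auto simp: RR.l_distr\<close>)
qed

end

context layer
begin

text \<open>For PQ = I, the sum of the r_a Q_ab l_b over all a and b is a right identity of KI
  modulo KI': multiplying it by l_b from the left produces row b of PQ. The right identity
  \<open>\<eta>'\<close> of KI' then removes the error.\<close>

lemma right_identity_step:
  assumes r: "\<And>a. a \<in> R_class M ` J_class M f \<Longrightarrow> r a \<in> Lf"
    and l: "\<And>b. b \<in> L_class M ` J_class M f \<Longrightarrow> l b \<in> b \<and> l b \<in> R_class M f"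
    and inv: "right_invertible_matrix FG.R (L_class M ` J_class M f) (R_class M ` J_class M f)
      (sandwich_matrix K M f r l)"
    and \<eta>': "right_identity I' \<eta>'"
  shows "\<exists>\<eta>. right_identity I \<eta>"
proof -
  let ?A = "R_class M ` J_class M f" and ?B = "L_class M ` J_class M f"
  let ?P = "sandwich_matrix K M f r l"
  have JM: "J_class M f \<subseteq> carrier M" by (auto simp: J_class_def)
  have fA: "finite ?A" and fB: "finite ?B" using finite_subset[OF JM finite_M] by auto
  obtain Q where Q0: "\<forall>a\<in>?A. \<forall>b\<in>?B. Q a b \<in> carrier FG.R"
    and PQ0: "\<forall>b\<in>?B. \<forall>b'\<in>?B.
      (\<Oplus>\<^bsub>FG.R\<^esub>a\<in>?A. ?P b a \<otimes>\<^bsub>FG.R\<^esub> Q a b') = (if b = b' then \<one>\<^bsub>FG.R\<^esub> else \<zero>\<^bsub>FG.R\<^esub>)"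
    using inv unfolding right_invertible_matrix_def by (elim exE conjE)
  have Q: "Q a b \<in> carrier FG.R" if "a \<in> ?A" "b \<in> ?B" for a b using Q0 that by blast
  have PQ: "(\<Oplus>\<^bsub>FG.R\<^esub>a\<in>?A. ?P b a \<otimes>\<^bsub>FG.R\<^esub> Q a b') = (if b = b' then \<one>\<^bsub>FG.R\<^esub> else \<zero>\<^bsub>FG.R\<^esub>)"
    if "b \<in> ?B" "b' \<in> ?B" for b b' by (rule bspec[OF bspec[OF PQ0 that(1)] that(2)])
  have rc: "r a \<in> carrier M" if "a \<in> ?A" for a using r[OF that] L_carrier by blast
  have lc: "l b \<in> carrier M" and fl: "f \<otimes>\<^bsub>M\<^esub> l b = l b" if "b \<in> ?B" for b
  proof -
    show c: "l b \<in> carrier M" using l[OF that] by (simp add: R_class_def)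
    have "right_ideal M (l b) = right_ideal M f" using l[OF that] by (simp add: R_class_def)
    then obtain y where "y \<in> carrier M" "l b = f \<otimes>\<^bsub>M\<^esub> y"
      using M.right_ideal_eq_iff[OF c fc] by blast
    then show "f \<otimes>\<^bsub>M\<^esub> l b = l b" by simp
  qed
  have IM: "I \<subseteq> carrier M" and I'M: "I' \<subseteq> carrier M" using I by (auto simp: monoid_ideal_def)
  have e1: "e m \<one>\<^bsub>K\<^esub> \<in> carrier R" for m by simp
  \<comment> \<open>The embedding of KG_f into the monoid algebra. It is multiplicative, but it
    sends the identity of KG_f to \<open>f\<close>.\<close>
  define \<iota> where "\<iota> = linext R (carrier G) e"
  have \<iota>: "add_map FG.R R \<iota>" unfolding \<iota>_def
    by (rule FG.R.linext_add_map[OF R.abelian_C subset_refl R.bs_add_map])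
  interpret \<iota>: add_map FG.R R \<iota> by (rule \<iota>)
  have \<iota>b: "\<iota> (eG g c) = e g c" if "g \<in> carrier G" "c \<in> carrier K" for g c
    unfolding \<iota>_def using FG.R.linext_bs[OF R.abelian_C subset_refl R.bs_add_map that(2,1)] that by simp
  have \<iota>m: "\<iota> (x \<otimes>\<^bsub>FG.R\<^esub> y) = \<iota> x \<otimes>\<^bsub>R\<^esub> \<iota> y" if x: "x \<in> carrier FG.R" and y: "y \<in> carrier FG.R" for x y
    using add_map_comp[OF FG.mult_left[OF y] \<iota>] add_map_comp[OF \<iota> mult_left[OF \<iota>.closed[OF y]]] x
  proof (rule FG.R.add_map_eqI)
    fix g c assume g: "g \<in> carrier G" and c: "c \<in> carrier K"
    have eg: "eG g c \<in> carrier FG.R" using c by simp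
    show "\<iota> (eG g c \<otimes>\<^bsub>FG.R\<^esub> y) = \<iota> (eG g c) \<otimes>\<^bsub>R\<^esub> \<iota> y"
      using add_map_comp[OF FG.mult_right[OF eg] \<iota>] add_map_comp[OF \<iota> mult_right[OF \<iota>.closed[OF eg]]] y
    proof (rule FG.R.add_map_eqI)
      fix h d assume h: "h \<in> carrier G" and d: "d \<in> carrier K"
      have "g \<otimes>\<^bsub>M\<^esub> h \<in> carrier G" using G.m_closed[OF g h] by (simp add: G_mult)
      then show "\<iota> (eG g c \<otimes>\<^bsub>FG.R\<^esub> eG h d) = \<iota> (eG g c) \<otimes>\<^bsub>R\<^esub> \<iota> (eG h d)"
        using g h c d by (simp add: FG.mult_gen mult_gen \<iota>b G_mult G_carrier)
    qed
  qed
  have Pc: "?P b a \<in> carrier FG.R" for a b by (simp add: sandwich_matrix_def)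
  \<comment> \<open>The product l_b r_a is fixed by \<open>f\<close> on both sides, so it belongs to
    G_f if it stays in the J-class; otherwise it drops into \<open>I'\<close>. Hence it agrees with
    the sandwich entry modulo KI'.\<close>
  have key: "\<exists>z\<in>RS I'. e (l b \<otimes>\<^bsub>M\<^esub> r a) \<one>\<^bsub>K\<^esub> = \<iota> (?P b a) \<oplus>\<^bsub>R\<^esub> z" if a: "a \<in> ?A" and b: "b \<in> ?B" for a b
  proof (cases "l b \<otimes>\<^bsub>M\<^esub> r a \<in> carrier G")
    case True
    then show ?thesis
      by (intro bexI[OF _ R.supported_zero]) (simp add: sandwich_matrix_def \<iota>b)
  next
    case False
    have "l b \<otimes>\<^bsub>M\<^esub> r a \<notin> J_class M f"
    proof
      assume "l b \<otimes>\<^bsub>M\<^esub> r a \<in> J_class M f"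
      moreover have "f \<otimes>\<^bsub>M\<^esub> (l b \<otimes>\<^bsub>M\<^esub> r a) = l b \<otimes>\<^bsub>M\<^esub> r a"
        using fl[OF b] lc[OF b] rc[OF a] by (simp add: M.m_assoc[symmetric])
      moreover have "(l b \<otimes>\<^bsub>M\<^esub> r a) \<otimes>\<^bsub>M\<^esub> f = l b \<otimes>\<^bsub>M\<^esub> r a"
        using L_right[OF r[OF a]] lc[OF b] rc[OF a] by (simp add: M.m_assoc)
      ultimately show False using local_J_in_G False by blast
    qed
    moreover have "l b \<otimes>\<^bsub>M\<^esub> r a \<in> I"
      using I J L_in_J[OF r[OF a]] lc[OF b] by (auto simp: monoid_ideal_def)
    ultimately have "l b \<otimes>\<^bsub>M\<^esub> r a \<in> I'" by blast
    then have "e (l b \<otimes>\<^bsub>M\<^esub> r a) \<one>\<^bsub>K\<^esub> \<in> RS I'" by (rule R.bs_supported) simp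
    then show ?thesis using False
      by (intro bexI[of _ "e (l b \<otimes>\<^bsub>M\<^esub> r a) \<one>\<^bsub>K\<^esub>"]) (simp_all add: sandwich_matrix_def \<iota>.zero)
  qed
  define z where "z b a = (SOME z. z \<in> RS I' \<and> e (l b \<otimes>\<^bsub>M\<^esub> r a) \<one>\<^bsub>K\<^esub> = \<iota> (?P b a) \<oplus>\<^bsub>R\<^esub> z)" for a b
  have z: "z b a \<in> RS I'" "e (l b \<otimes>\<^bsub>M\<^esub> r a) \<one>\<^bsub>K\<^esub> = \<iota> (?P b a) \<oplus>\<^bsub>R\<^esub> z b a" if "a \<in> ?A" "b \<in> ?B" for a b
    using someI_ex[OF key[OF that, unfolded Bex_def], folded z_def] by auto
  have RSc: "x \<in> RS Y \<Longrightarrow> x \<in> carrier R" for x Y using R.supported_subset by blast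
  \<comment> \<open>The row of the r_a times column b of Q; so \<open>\<eta>J\<close> becomes the
    sum of the r_a Q_ab l_b.\<close>
  define s where "s b = (\<Oplus>\<^bsub>R\<^esub>a\<in>?A. e (r a) \<one>\<^bsub>K\<^esub> \<otimes>\<^bsub>R\<^esub> \<iota> (Q a b))" for b
  define \<eta>J where "\<eta>J = (\<Oplus>\<^bsub>R\<^esub>b\<in>?B. s b \<otimes>\<^bsub>R\<^esub> e (l b) \<one>\<^bsub>K\<^esub>)"
  have sI: "s b \<in> RS I" if "b \<in> ?B" for b
    unfolding s_def
  proof (rule R.supported_finsum[OF fA])
    fix a assume a: "a \<in> ?A"
    have "r a \<in> I" using L_in_J[OF r[OF a]] J by blast
    then show "e (r a) \<one>\<^bsub>K\<^esub> \<otimes>\<^bsub>R\<^esub> \<iota> (Q a b) \<in> RS I"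
      by (intro RS_mult(2)[OF I] R.bs_supported \<iota>.closed Q a that) auto
  qed
  have \<eta>JI: "\<eta>J \<in> RS I"
    unfolding \<eta>J_def by (intro R.supported_finsum[OF fB] RS_mult(2)[OF I] sI e1)
  \<comment> \<open>Modulo KI' the product of l_b with \<open>s b'\<close> is the entry of PQ at (b,
    b'), that is \<open>f\<close> or zero. Thus only the term f l_b = l_b survives.\<close>
  have mod_l: "\<exists>w\<in>RS I'. e (l b) \<one>\<^bsub>K\<^esub> \<otimes>\<^bsub>R\<^esub> \<eta>J = e (l b) \<one>\<^bsub>K\<^esub> \<oplus>\<^bsub>R\<^esub> w" if b: "b \<in> ?B" for b
  proof -
    define w where "w b' = (\<Oplus>\<^bsub>R\<^esub>a\<in>?A. z b a \<otimes>\<^bsub>R\<^esub> \<iota> (Q a b'))" for b'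
    have w: "w b' \<in> RS I'" if "b' \<in> ?B" for b'
      unfolding w_def
      by (intro R.supported_finsum[OF fA] RS_mult(2)[OF I'] z(1) \<iota>.closed Q that b)
    have ls: "e (l b) \<one>\<^bsub>K\<^esub> \<otimes>\<^bsub>R\<^esub> s b' = (if b = b' then e f \<one>\<^bsub>K\<^esub> else \<zero>\<^bsub>R\<^esub>) \<oplus>\<^bsub>R\<^esub> w b'" if b': "b' \<in> ?B" for b'
    proof -
      have "e (l b) \<one>\<^bsub>K\<^esub> \<otimes>\<^bsub>R\<^esub> s b' = (\<Oplus>\<^bsub>R\<^esub>a\<in>?A. e (l b) \<one>\<^bsub>K\<^esub> \<otimes>\<^bsub>R\<^esub> (e (r a) \<one>\<^bsub>K\<^esub> \<otimes>\<^bsub>R\<^esub> \<iota> (Q a b')))"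
        unfolding s_def by (rule add_map.finsum[OF mult_right[OF e1]]) (use Q[OF _ b'] \<iota>.closed in auto)
      also have "\<dots> = (\<Oplus>\<^bsub>R\<^esub>a\<in>?A. \<iota> (?P b a \<otimes>\<^bsub>FG.R\<^esub> Q a b') \<oplus>\<^bsub>R\<^esub> z b a \<otimes>\<^bsub>R\<^esub> \<iota> (Q a b'))"
      proof (rule R.C.finsum_cong')
        fix a assume a: "a \<in> ?A"
        have "e (l b) \<one>\<^bsub>K\<^esub> \<otimes>\<^bsub>R\<^esub> (e (r a) \<one>\<^bsub>K\<^esub> \<otimes>\<^bsub>R\<^esub> \<iota> (Q a b')) = e (l b \<otimes>\<^bsub>M\<^esub> r a) \<one>\<^bsub>K\<^esub> \<otimes>\<^bsub>R\<^esub> \<iota> (Q a b')"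
          using lc[OF b] rc[OF a] \<iota>.closed[OF Q[OF a b']] by (simp add: RR.m_assoc[symmetric] mult_gen)
        also have "\<dots> = \<iota> (?P b a) \<otimes>\<^bsub>R\<^esub> \<iota> (Q a b') \<oplus>\<^bsub>R\<^esub> z b a \<otimes>\<^bsub>R\<^esub> \<iota> (Q a b')"
          unfolding z(2)[OF a b]
          by (rule RR.l_distr[OF \<iota>.closed[OF Pc] RSc[OF z(1)[OF a b]] \<iota>.closed[OF Q[OF a b']]])
        finally show "e (l b) \<one>\<^bsub>K\<^esub> \<otimes>\<^bsub>R\<^esub> (e (r a) \<one>\<^bsub>K\<^esub> \<otimes>\<^bsub>R\<^esub> \<iota> (Q a b')) =
          \<iota> (?P b a \<otimes>\<^bsub>FG.R\<^esub> Q a b') \<oplus>\<^bsub>R\<^esub> z b a \<otimes>\<^bsub>R\<^esub> \<iota> (Q a b')"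
          unfolding \<iota>m[OF Pc Q[OF a b']] .
      qed (use RSc[OF z(1)[OF _ b]] \<iota>.closed Pc Q[OF _ b'] in auto)
      also have "\<dots> = (\<Oplus>\<^bsub>R\<^esub>a\<in>?A. \<iota> (?P b a \<otimes>\<^bsub>FG.R\<^esub> Q a b')) \<oplus>\<^bsub>R\<^esub> w b'"
        unfolding w_def using RSc[OF z(1)[OF _ b]] \<iota>.closed Pc Q[OF _ b']
        by (intro R.C.finsum_addf) auto
      also have "(\<Oplus>\<^bsub>R\<^esub>a\<in>?A. \<iota> (?P b a \<otimes>\<^bsub>FG.R\<^esub> Q a b')) = \<iota> (\<Oplus>\<^bsub>FG.R\<^esub>a\<in>?A. ?P b a \<otimes>\<^bsub>FG.R\<^esub> Q a b')"
        using Pc Q[OF _ b'] by (intro \<iota>.finsum[symmetric]) auto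
      also have "\<dots> = (if b = b' then e f \<one>\<^bsub>K\<^esub> else \<zero>\<^bsub>R\<^esub>)"
        unfolding PQ[OF b b'] by (simp add: \<iota>.zero FG.one_R G_one \<iota>b[OF f_in_G])
      finally show ?thesis .
    qed
    have sR: "s b' \<in> carrier R" if "b' \<in> ?B" for b' using RSc[OF sI[OF that]] .
    have "e (l b) \<one>\<^bsub>K\<^esub> \<otimes>\<^bsub>R\<^esub> \<eta>J = (\<Oplus>\<^bsub>R\<^esub>b'\<in>?B. e (l b) \<one>\<^bsub>K\<^esub> \<otimes>\<^bsub>R\<^esub> (s b' \<otimes>\<^bsub>R\<^esub> e (l b') \<one>\<^bsub>K\<^esub>))"
      unfolding \<eta>J_def using sR by (intro add_map.finsum[OF mult_right[OF e1]]) auto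
    also have "\<dots> = (\<Oplus>\<^bsub>R\<^esub>b'\<in>?B. (if b = b' then e (l b') \<one>\<^bsub>K\<^esub> else \<zero>\<^bsub>R\<^esub>) \<oplus>\<^bsub>R\<^esub> w b' \<otimes>\<^bsub>R\<^esub> e (l b') \<one>\<^bsub>K\<^esub>)"
    proof (rule R.C.finsum_cong')
      fix b' assume b': "b' \<in> ?B"
      have "e (l b) \<one>\<^bsub>K\<^esub> \<otimes>\<^bsub>R\<^esub> (s b' \<otimes>\<^bsub>R\<^esub> e (l b') \<one>\<^bsub>K\<^esub>) =
          ((if b = b' then e f \<one>\<^bsub>K\<^esub> else \<zero>\<^bsub>R\<^esub>) \<oplus>\<^bsub>R\<^esub> w b') \<otimes>\<^bsub>R\<^esub> e (l b') \<one>\<^bsub>K\<^esub>"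
        unfolding ls[OF b', symmetric] using sR[OF b'] by (simp add: RR.m_assoc)
      also have "\<dots> = (if b = b' then e f \<one>\<^bsub>K\<^esub> else \<zero>\<^bsub>R\<^esub>) \<otimes>\<^bsub>R\<^esub> e (l b') \<one>\<^bsub>K\<^esub> \<oplus>\<^bsub>R\<^esub> w b' \<otimes>\<^bsub>R\<^esub> e (l b') \<one>\<^bsub>K\<^esub>"
        using RSc[OF w[OF b']] by (intro RR.l_distr) auto
      finally show "e (l b) \<one>\<^bsub>K\<^esub> \<otimes>\<^bsub>R\<^esub> (s b' \<otimes>\<^bsub>R\<^esub> e (l b') \<one>\<^bsub>K\<^esub>) =
          (if b = b' then e (l b') \<one>\<^bsub>K\<^esub> else \<zero>\<^bsub>R\<^esub>) \<oplus>\<^bsub>R\<^esub> w b' \<otimes>\<^bsub>R\<^esub> e (l b') \<one>\<^bsub>K\<^esub>"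
        using lc[OF b'] fl[OF b'] by (simp add: mult_gen split: if_splits)
    qed (use RSc[OF w] in auto)
    also have "\<dots> = (\<Oplus>\<^bsub>R\<^esub>b'\<in>?B. if b = b' then e (l b') \<one>\<^bsub>K\<^esub> else \<zero>\<^bsub>R\<^esub>) \<oplus>\<^bsub>R\<^esub>
        (\<Oplus>\<^bsub>R\<^esub>b'\<in>?B. w b' \<otimes>\<^bsub>R\<^esub> e (l b') \<one>\<^bsub>K\<^esub>)"
      using RSc[OF w] by (intro R.C.finsum_addf) auto
    also have "(\<Oplus>\<^bsub>R\<^esub>b'\<in>?B. if b = b' then e (l b') \<one>\<^bsub>K\<^esub> else \<zero>\<^bsub>R\<^esub>) = e (l b) \<one>\<^bsub>K\<^esub>"
      using R.C.finsum_singleton[OF b fB, of "\<lambda>b. e (l b) \<one>\<^bsub>K\<^esub>"] by simp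
    finally show ?thesis
      by (intro bexI[of _ "\<Oplus>\<^bsub>R\<^esub>b'\<in>?B. w b' \<otimes>\<^bsub>R\<^esub> e (l b') \<one>\<^bsub>K\<^esub>"] R.supported_finsum[OF fB]
          RS_mult(2)[OF I'] w e1)
  qed
  have \<eta>Jc: "\<eta>J \<in> carrier R" and \<eta>'c: "\<eta>' \<in> carrier R" and \<eta>'I: "\<eta>' \<in> RS I'"
    using RSc[OF \<eta>JI] \<eta>' RSc by (auto simp: right_identity_def)
  \<comment> \<open>An element of the J-class is a left multiple of the representative of its
    L-class, and left multiplication preserves the congruence modulo KI'. For elements of
    \<open>I'\<close> both sides lie in KI' anyway.\<close>
  have mod: "\<exists>w\<in>RS I'. e k \<one>\<^bsub>K\<^esub> \<otimes>\<^bsub>R\<^esub> \<eta>J = e k \<one>\<^bsub>K\<^esub> \<oplus>\<^bsub>R\<^esub> w" if k: "k \<in> I" for k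
  proof (cases "k \<in> J_class M f")
    case True
    let ?b = "L_class M k"
    have b: "?b \<in> ?B" using True by blast
    have kc: "k \<in> carrier M" using k IM by auto
    have "left_ideal M k = left_ideal M (l ?b)" using l[OF b] by (simp add: L_class_def)
    then obtain y where y: "y \<in> carrier M" "k = y \<otimes>\<^bsub>M\<^esub> l ?b"
      using M.left_ideal_eq_iff[OF kc lc[OF b]] by blast
    obtain w where w: "w \<in> RS I'" "e (l ?b) \<one>\<^bsub>K\<^esub> \<otimes>\<^bsub>R\<^esub> \<eta>J = e (l ?b) \<one>\<^bsub>K\<^esub> \<oplus>\<^bsub>R\<^esub> w"
      using mod_l[OF b] by blast
    have ek: "e k \<one>\<^bsub>K\<^esub> = e y \<one>\<^bsub>K\<^esub> \<otimes>\<^bsub>R\<^esub> e (l ?b) \<one>\<^bsub>K\<^esub>" using y lc[OF b] by (simp add: mult_gen)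
    have "e k \<one>\<^bsub>K\<^esub> \<otimes>\<^bsub>R\<^esub> \<eta>J = e y \<one>\<^bsub>K\<^esub> \<otimes>\<^bsub>R\<^esub> (e (l ?b) \<one>\<^bsub>K\<^esub> \<otimes>\<^bsub>R\<^esub> \<eta>J)"
      unfolding ek using \<eta>Jc by (intro RR.m_assoc) auto
    also have "\<dots> = e k \<one>\<^bsub>K\<^esub> \<oplus>\<^bsub>R\<^esub> e y \<one>\<^bsub>K\<^esub> \<otimes>\<^bsub>R\<^esub> w"
      unfolding w(2) ek using RSc[OF w(1)] by (intro RR.r_distr) auto
    finally show ?thesis using RS_mult(1)[OF I' w(1) e1] by blast
  next
    case False
    then have "k \<in> I'" using k by blast
    then have ek: "e k \<one>\<^bsub>K\<^esub> \<in> RS I'" by (rule R.bs_supported) simp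
    have x: "e k \<one>\<^bsub>K\<^esub> \<otimes>\<^bsub>R\<^esub> \<eta>J \<in> RS I'" by (rule RS_mult(2)[OF I' ek \<eta>Jc])
    have "\<ominus>\<^bsub>R\<^esub> e k \<one>\<^bsub>K\<^esub> \<oplus>\<^bsub>R\<^esub> e k \<one>\<^bsub>K\<^esub> \<otimes>\<^bsub>R\<^esub> \<eta>J \<in> RS I'"
      by (rule R.supported_add[OF R.supported_neg[OF ek] x])
    moreover have "e k \<one>\<^bsub>K\<^esub> \<otimes>\<^bsub>R\<^esub> \<eta>J = e k \<one>\<^bsub>K\<^esub> \<oplus>\<^bsub>R\<^esub> (\<ominus>\<^bsub>R\<^esub> e k \<one>\<^bsub>K\<^esub> \<oplus>\<^bsub>R\<^esub> e k \<one>\<^bsub>K\<^esub> \<otimes>\<^bsub>R\<^esub> \<eta>J)"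
      using RSc[OF x] by (simp add: R.C.a_assoc[symmetric] R.C.r_neg)
    ultimately show ?thesis by blast
  qed
  \<comment> \<open>Chosen so that 1 - \<eta> = (1 - \<eta>J)(1 - \<eta>'): multiplication by the
    first factor moves an element of \<open>I\<close> into KI', where the second factor annihilates
    it.\<close>
  define \<eta> where "\<eta> = \<eta>J \<oplus>\<^bsub>R\<^esub> (\<eta>' \<oplus>\<^bsub>R\<^esub> \<ominus>\<^bsub>R\<^esub> (\<eta>J \<otimes>\<^bsub>R\<^esub> \<eta>'))"
  have "RS I' \<subseteq> RS I" by (auto simp: supported_def)
  then have "\<eta> \<in> RS I"
    unfolding \<eta>_def using \<eta>JI \<eta>'I RS_mult(2)[OF I \<eta>JI \<eta>'c]
    by (intro R.supported_add R.supported_neg) auto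
  moreover have "e k \<one>\<^bsub>K\<^esub> \<otimes>\<^bsub>R\<^esub> \<eta> = e k \<one>\<^bsub>K\<^esub>" if k: "k \<in> I" for k
  proof -
    obtain w where w: "w \<in> RS I'" "e k \<one>\<^bsub>K\<^esub> \<otimes>\<^bsub>R\<^esub> \<eta>J = e k \<one>\<^bsub>K\<^esub> \<oplus>\<^bsub>R\<^esub> w" using mod[OF k] by blast
    note wc = RSc[OF w(1)]
    have w\<eta>: "w \<otimes>\<^bsub>R\<^esub> \<eta>' = w" by (rule right_identity_supported[OF \<eta>' I'M w(1)])
    let ?x = "e k \<one>\<^bsub>K\<^esub>"
    have "?x \<otimes>\<^bsub>R\<^esub> \<eta> = ?x \<otimes>\<^bsub>R\<^esub> \<eta>J \<oplus>\<^bsub>R\<^esub> (?x \<otimes>\<^bsub>R\<^esub> \<eta>' \<oplus>\<^bsub>R\<^esub> \<ominus>\<^bsub>R\<^esub> ((?x \<otimes>\<^bsub>R\<^esub> \<eta>J) \<otimes>\<^bsub>R\<^esub> \<eta>'))"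
      unfolding \<eta>_def using \<eta>Jc \<eta>'c by (simp add: RR.r_distr RR.r_minus RR.m_assoc)
    also have "\<dots> = ?x \<oplus>\<^bsub>R\<^esub> w \<oplus>\<^bsub>R\<^esub> (?x \<otimes>\<^bsub>R\<^esub> \<eta>' \<oplus>\<^bsub>R\<^esub> \<ominus>\<^bsub>R\<^esub> (?x \<otimes>\<^bsub>R\<^esub> \<eta>' \<oplus>\<^bsub>R\<^esub> w))"
      unfolding w(2) using wc \<eta>'c by (simp add: RR.l_distr w\<eta>)
    also have "\<dots> = ?x"
    proof -
      have x: "?x \<in> carrier R" and y: "?x \<otimes>\<^bsub>R\<^esub> \<eta>' \<in> carrier R" using \<eta>'c by auto
      have "?x \<otimes>\<^bsub>R\<^esub> \<eta>' \<oplus>\<^bsub>R\<^esub> \<ominus>\<^bsub>R\<^esub> (?x \<otimes>\<^bsub>R\<^esub> \<eta>' \<oplus>\<^bsub>R\<^esub> w) = \<ominus>\<^bsub>R\<^esub> w"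
        using y wc by (simp add: R.C.minus_add R.C.a_assoc[symmetric] R.C.r_neg)
      then show ?thesis using x wc by (simp add: R.C.a_assoc R.C.r_neg)
    qed
    finally show ?thesis .
  qed
  ultimately show ?thesis by (auto simp: right_identity_def)
qed

end

lemma (in fm) right_identity_exists:
  assumes "regular_monoid M" and I: "monoid_ideal M I"
    and sandwich: "\<forall>a\<in>carrier M. sandwich_right_invertible K M (J_class M a)"
  shows "\<exists>\<eta>. right_identity I \<eta>"
  using I finite_M assms(1)
proof (induction rule: M.monoid_ideal_induct)
  case empty
  show ?case using R.supported_zero by (auto simp: right_identity_def)
next
  case (step I f)
  have fc: "f \<in> carrier M" using step(3) by (simp add: idempotents_def)
  have "sandwich_right_invertible K M (J_class M f)" using sandwich fc by blast
  then obtain f' r l where f'': "f' \<in> J_class M f \<inter> idempotents M"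
    and r: "\<forall>a\<in>R_class M ` J_class M f. r a \<in> a \<and> r a \<in> L_class M f'"
    and l: "\<forall>b\<in>L_class M ` J_class M f. l b \<in> b \<and> l b \<in> R_class M f'"
    and inv: "right_invertible_matrix (monoid_algebra K (maximal_subgroup M f'))
         (L_class M ` J_class M f) (R_class M ` J_class M f) (sandwich_matrix K M f' r l)"
    unfolding sandwich_right_invertible_def by (elim bexE exE conjE)
  \<comment> \<open>The sandwich hypothesis comes with an idempotent of its own, so the layer is set
    up at \<open>f'\<close> instead of \<open>f\<close>; the J-class is the same.\<close>
  have f': "f' \<in> J_class M f" "f' \<in> idempotents M" using f'' by auto
  have JJ: "J_class M f' = J_class M f" using f' by (auto simp: J_class_def)
  interpret layer K M f' I
    by (intro layer.intro fmi.intro idem.intro fm_axioms M.monoid_axioms layer_axioms.intro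
        idem_axioms.intro finite_M f') (use step JJ in auto)
  obtain \<eta>' where \<eta>': "right_identity (I - J_class M f') \<eta>'" using step.IH unfolding JJ by blast
  show ?case
  proof (rule right_identity_step[OF _ _ _ \<eta>'])
    show "r a \<in> Lf" if "a \<in> R_class M ` J_class M f'" for a using r that unfolding JJ by blast
    show "l b \<in> b \<and> l b \<in> R_class M f'" if "b \<in> L_class M ` J_class M f'" for b
      using l that unfolding JJ by blast
  qed (use inv JJ in simp)
qed


section \<open>Projectivity of the chain modules\<close>

context fm
begin

text \<open>Elements of an ideal push every chain below that ideal. So a lift known only below the
  smaller ideal can be applied after multiplication by its right identity.\<close>

lemma RS_smult:
  assumes I: "monoid_ideal M I" and u: "u \<in> RS I" and x: "x \<in> carrier (CM q)"
  shows "u \<odot>\<^bsub>CM q\<^esub> x \<in> supported K (Ch q) (Chi I q)"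
proof -
  have IM: "I \<subseteq> carrier M" using I by (simp add: monoid_ideal_def)
  show ?thesis
    using u IM
  proof (induction rule: R.supported_induct)
    case zero
    then show ?case using x Q.C.supported_zero by simp
  next
    case (add u v)
    then show ?case using x Q.C.supported_add by (simp add: Q.CM.smult_l_distr)
  next
    case (bs k c)
    then have k: "k \<in> carrier M" using IM by auto
    have ek: "e k c \<in> carrier R" using bs by simp
    show ?case using x
    proof (induction rule: Q.C.C_induct)
      case zero
      then show ?case using ek Q.C.supported_zero by simp
    next
      case (add x y)
      then show ?case using ek Q.C.supported_add by (simp add: Q.CM.smult_r_distr)
    next
      case (bs \<sigma> d)
      show ?case
      proof (cases "mact k \<sigma>")
        case None
        then show ?thesis using bs k \<open>c \<in> carrier K\<close> Q.C.supported_zero by (simp add: Q.smult_gen)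
      next
        case (Some \<tau>)
        have "\<tau> \<in> Chi I q" using mact_Chi[OF I k bs(1) Some] \<open>k \<in> I\<close> by simp
        then show ?thesis
          using bs k \<open>c \<in> carrier K\<close> Some by (simp add: Q.smult_gen Q.C.bs_supported)
      qed
    qed
  qed
qed

end

text \<open>The lift on the layer is an average over \<open>G\<^sub>f\<close> of linear lifts corrected by the right
  identity of the smaller ideal.\<close>

context layer
begin

lemma lift_step:
  fixes A :: "('m \<Rightarrow> 'k, 'x) module" and B :: "('m \<Rightarrow> 'k, 'y) module"
  assumes A: "left_module R A" and B: "left_module R B" and F: "F \<in> left_module_hom R A B"
    and surj: "F ` carrier A = carrier B"
    and g: "g \<in> left_module_hom R (CM q\<lparr>carrier := ChJ q\<rparr>) B"
    and H: "H \<in> left_module_hom R (CM q\<lparr>carrier := ChJ' q\<rparr>) A"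
    and FH: "\<And>p. p \<in> ChJ' q \<Longrightarrow> F (H p) = g p"
    and \<eta>: "right_identity I' \<eta>"
    and char: "\<not> ring_char K dvd order G"
  shows "\<exists>h\<in>left_module_hom R (CM q\<lparr>carrier := ChJ q\<rparr>) A. \<forall>p\<in>ChJ q. F (h p) = g p"
proof -
  interpret A: left_module R A by (rule A)
  interpret B: left_module R B by (rule B)
  interpret F: add_map A B F by (rule left_module_hom_add_map[OF A B F])
  note inv = invariant_Chi[OF I, of q] and inv' = invariant_Chi[OF I', of q]
  let ?CI = "CM q\<lparr>carrier := ChJ q\<rparr>" and ?CI' = "CM q\<lparr>carrier := ChJ' q\<rparr>"
  have ChI: "Chi I q \<subseteq> Ch q" and ChI': "Chi I' q \<subseteq> Chi I q" using Chi_subset by (auto simp: Chi_def)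
  have sub: "ChJ' q \<subseteq> ChJ q" using ChI' by (auto simp: supported_def)
  have subC: "ChJ q \<subseteq> carrier (CM q)" by (rule Q.C.supported_subset)
  interpret g: add_map ?CI B g by (rule left_module_hom_add_map[OF Q.left_module_supported[OF inv] B g])
  interpret H: add_map ?CI' A H by (rule left_module_hom_add_map[OF Q.left_module_supported[OF inv'] A H])
  have g_smult: "g (x \<odot>\<^bsub>CM q\<^esub> p) = x \<odot>\<^bsub>B\<^esub> g p" if "x \<in> carrier R" "p \<in> ChJ q" for x p
    using left_module_hom_smult[OF g] that by simp
  have H_smult: "H (x \<odot>\<^bsub>CM q\<^esub> p) = x \<odot>\<^bsub>A\<^esub> H p" if "x \<in> carrier R" "p \<in> ChJ' q" for x p
    using left_module_hom_smult[OF H] that by simp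
  have F_smult: "F (x \<odot>\<^bsub>A\<^esub> v) = x \<odot>\<^bsub>B\<^esub> F v" if "x \<in> carrier R" "v \<in> carrier A" for x v
    using left_module_hom_smult[OF F] that by simp
  have ec: "c \<in> carrier K \<Longrightarrow> e m c \<in> carrier R" for m c by simp
  have \<eta>c: "\<eta> \<in> carrier R" and \<eta>I: "\<eta> \<in> RS I'" using \<eta> R.supported_subset by (auto simp: right_identity_def)
  have XfI: "Xf q \<subseteq> Chi I q"
  proof
    fix \<tau> assume t: "\<tau> \<in> Xf q"
    then show "\<tau> \<in> Chi I q" using XJ_mem[OF G_in_L[OF f_in_G] t] mp_f[OF t] by simp
  qed
  have b1: "bq q \<sigma> c \<in> ChJ q" if "\<sigma> \<in> Chi I q" "c \<in> carrier K" for \<sigma> c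
    using that by (rule Q.C.bs_supported)
  have b1': "bq q \<sigma> c \<in> ChJ' q" if "\<sigma> \<in> Chi I' q" "c \<in> carrier K" for \<sigma> c
    using that by (rule Q.C.bs_supported)
  obtain h0 where h0: "\<And>\<tau>. \<tau> \<in> Xf q \<Longrightarrow> h0 \<tau> \<in> carrier A \<and> F (h0 \<tau>) = g (bq q \<tau> \<one>\<^bsub>K\<^esub>)"
  proof -
    have "\<exists>v. v \<in> carrier A \<and> F v = g (bq q \<tau> \<one>\<^bsub>K\<^esub>)" if "\<tau> \<in> Xf q" for \<tau>
    proof -
      have "g (bq q \<tau> \<one>\<^bsub>K\<^esub>) \<in> F ` carrier A"
        unfolding surj using that XfI b1 by (intro g.closed) auto
      then show ?thesis by auto
    qed
    then have "\<forall>\<tau>. \<exists>v. \<tau> \<in> Xf q \<longrightarrow> v \<in> carrier A \<and> F v = g (bq q \<tau> \<one>\<^bsub>K\<^esub>)" by blast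
    from choice[OF this] show thesis using that by blast
  qed
  \<comment> \<open>An arbitrary preimage \<open>h0 \<tau>\<close> need not respect the relations
    that tie \<tau> to the lower chains. In (1 - \<eta>) h0 \<tau> + H (\<eta> \<tau>) the first
    part is killed by every element of \<open>I'\<close>, and on the second part such an element
    acts as \<open>H\<close> prescribes.\<close>
  define \<zeta> where "\<zeta> \<tau> = h0 \<tau> \<ominus>\<^bsub>A\<^esub> \<eta> \<odot>\<^bsub>A\<^esub> h0 \<tau> \<oplus>\<^bsub>A\<^esub> H (\<eta> \<odot>\<^bsub>CM q\<^esub> bq q \<tau> \<one>\<^bsub>K\<^esub>)" for \<tau>
  have \<eta>b: "\<eta> \<odot>\<^bsub>CM q\<^esub> bq q \<tau> \<one>\<^bsub>K\<^esub> \<in> ChJ' q" for \<tau> by (rule RS_smult[OF I' \<eta>I]) simp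
  have H\<eta>: "H (\<eta> \<odot>\<^bsub>CM q\<^esub> bq q \<tau> \<one>\<^bsub>K\<^esub>) \<in> carrier A" for \<tau> using H.closed \<eta>b by simp
  have \<zeta>c: "\<zeta> \<tau> \<in> carrier A" if "\<tau> \<in> Xf q" for \<tau>
    unfolding \<zeta>_def using h0[OF that] H\<eta> \<eta>c by simp
  have cancel: "x \<ominus>\<^bsub>E\<^esub> y \<oplus>\<^bsub>E\<^esub> y = x"
    if "abelian_group E" "x \<in> carrier E" "y \<in> carrier E" for E :: "('m \<Rightarrow> 'k, 'w) module" and x y
  proof -
    interpret E: abelian_group E by fact
    show ?thesis using that by (simp add: E.minus_eq E.a_assoc E.l_neg)
  qed
  \<comment> \<open>The correction is invisible under \<open>F\<close>: both terms with \<eta>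
    become \<eta> times the value of \<open>g\<close> and cancel.\<close>
  have F\<zeta>: "F (\<zeta> \<tau>) = g (bq q \<tau> \<one>\<^bsub>K\<^esub>)" if t: "\<tau> \<in> Xf q" for \<tau>
  proof -
    have gb: "bq q \<tau> \<one>\<^bsub>K\<^esub> \<in> ChJ q" using t XfI b1 by auto
    have gc: "g (bq q \<tau> \<one>\<^bsub>K\<^esub>) \<in> carrier B" using g.closed gb by simp
    have "F (\<zeta> \<tau>) = g (bq q \<tau> \<one>\<^bsub>K\<^esub>) \<ominus>\<^bsub>B\<^esub> \<eta> \<odot>\<^bsub>B\<^esub> g (bq q \<tau> \<one>\<^bsub>K\<^esub>) \<oplus>\<^bsub>B\<^esub> \<eta> \<odot>\<^bsub>B\<^esub> g (bq q \<tau> \<one>\<^bsub>K\<^esub>)"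
      unfolding \<zeta>_def using h0[OF t] H\<eta> \<eta>c gb \<eta>b
      by (simp add: F.add F.diff F_smult FH g_smult)
    then show ?thesis
      using gc \<eta>c by (simp add: B.minus_eq B.a_assoc B.l_neg)
  qed
  have k\<zeta>: "e k \<one>\<^bsub>K\<^esub> \<odot>\<^bsub>A\<^esub> \<zeta> \<tau> = H (e k \<one>\<^bsub>K\<^esub> \<odot>\<^bsub>CM q\<^esub> bq q \<tau> \<one>\<^bsub>K\<^esub>)"
    if k: "k \<in> I'" and t: "\<tau> \<in> Xf q" for k \<tau>
  proof -
    have k\<eta>: "e k \<one>\<^bsub>K\<^esub> \<otimes>\<^bsub>R\<^esub> \<eta> = e k \<one>\<^bsub>K\<^esub>" using \<eta> k by (simp add: right_identity_def)
    have h: "h0 \<tau> \<in> carrier A" using h0[OF t] by simp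
    have kc: "e k \<one>\<^bsub>K\<^esub> \<in> carrier R" by simp
    have m1: "e k \<one>\<^bsub>K\<^esub> \<odot>\<^bsub>A\<^esub> (\<eta> \<odot>\<^bsub>A\<^esub> h0 \<tau>) = e k \<one>\<^bsub>K\<^esub> \<odot>\<^bsub>A\<^esub> h0 \<tau>"
      using A.smult_assoc1[OF kc \<eta>c h] k\<eta> by simp
    have m2: "e k \<one>\<^bsub>K\<^esub> \<odot>\<^bsub>A\<^esub> H (\<eta> \<odot>\<^bsub>CM q\<^esub> bq q \<tau> \<one>\<^bsub>K\<^esub>) = H (e k \<one>\<^bsub>K\<^esub> \<odot>\<^bsub>CM q\<^esub> bq q \<tau> \<one>\<^bsub>K\<^esub>)"
      using H_smult[OF kc \<eta>b, of \<tau>] Q.CM.smult_assoc1[OF kc \<eta>c, of "bq q \<tau> \<one>\<^bsub>K\<^esub>" q] k\<eta> by simp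
    have Hc: "H (e k \<one>\<^bsub>K\<^esub> \<odot>\<^bsub>CM q\<^esub> bq q \<tau> \<one>\<^bsub>K\<^esub>) \<in> carrier A"
      unfolding m2[symmetric] using H\<eta> by simp
    have "e k \<one>\<^bsub>K\<^esub> \<odot>\<^bsub>A\<^esub> \<zeta> \<tau> = e k \<one>\<^bsub>K\<^esub> \<odot>\<^bsub>A\<^esub> h0 \<tau> \<ominus>\<^bsub>A\<^esub> e k \<one>\<^bsub>K\<^esub> \<odot>\<^bsub>A\<^esub> (\<eta> \<odot>\<^bsub>A\<^esub> h0 \<tau>) \<oplus>\<^bsub>A\<^esub>
        e k \<one>\<^bsub>K\<^esub> \<odot>\<^bsub>A\<^esub> H (\<eta> \<odot>\<^bsub>CM q\<^esub> bq q \<tau> \<one>\<^bsub>K\<^esub>)"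
      unfolding \<zeta>_def using h \<eta>c H\<eta> kc
      by (simp add: A.smult_r_distr add_map.diff[OF A.smult_right_add_map[OF kc]])
    then show ?thesis unfolding m1 m2 using h kc Hc by (simp add: A.minus_eq A.r_neg)
  qed
  \<comment> \<open>\<open>c0\<close> is the inverse of the order of G_f in \<open>K\<close>; it
    exists because the additive order of 1 does not divide the order of G_f.\<close>
  obtain c0 where c0: "c0 \<in> carrier K" "(\<Oplus>\<^bsub>K\<^esub>g\<in>carrier G. c0) = \<one>\<^bsub>K\<^esub>"
  proof -
    let ?n = "add_pow K (order G) \<one>\<^bsub>K\<^esub>"
    have "?n \<noteq> \<zero>\<^bsub>K\<^esub>"
      using char K.add.pow_eq_id[of "\<one>\<^bsub>K\<^esub>" "order G"] by (simp add: ring_char_def)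
    then have u: "?n \<in> Units K" using K.field_Units by simp
    let ?c = "inv\<^bsub>K\<^esub> ?n"
    have cc: "?c \<in> carrier K" using u by (rule K.Units_inv_closed)
    have "(\<Oplus>\<^bsub>K\<^esub>g\<in>carrier G. ?c) = add_pow K (order G) ?c"
      using K.add.finprod_const[OF cc, of "carrier G"] by (simp add: order_def)
    also have "\<dots> = ?n \<otimes>\<^bsub>K\<^esub> ?c"
      using K.add_pow_ldistr[of "\<one>\<^bsub>K\<^esub>" ?c "order G"] cc by simp
    also have "\<dots> = \<one>\<^bsub>K\<^esub>" using u by (rule K.Units_r_inv)
    finally show thesis using that cc by blast
  qed
  \<comment> \<open>The mean over all factorisations of the chain a \<tau> into a g and g^-1 \<tau>.
    A single factorisation would make the value depend on its choice, since \<open>h0\<close> was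
    chosen chain by chain.\<close>
  define avg where "avg a \<tau> = (\<Oplus>\<^bsub>A\<^esub>g\<in>carrier G. e (a \<otimes>\<^bsub>M\<^esub> g) c0 \<odot>\<^bsub>A\<^esub> \<zeta> (mp (inv\<^bsub>G\<^esub> g) \<tau>))" for a \<tau>
  have \<zeta>g: "\<zeta> (mp (inv\<^bsub>G\<^esub> g) \<tau>) \<in> carrier A" if "g \<in> carrier G" "\<tau> \<in> Xf q" for g \<tau>
    using \<zeta>c[OF G_Xf[OF G.inv_closed[OF that(1)] that(2)]] .
  have avg_c: "avg a \<tau> \<in> carrier A" if "\<tau> \<in> Xf q" for a \<tau>
    unfolding avg_def using \<zeta>g that c0(1) by (intro A.finsum_closed) auto
  have mp_inv: "mp (a \<otimes>\<^bsub>M\<^esub> g) (mp (inv\<^bsub>G\<^esub> g) \<tau>) = mp a \<tau>"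
    if a: "a \<in> Lf" and g: "g \<in> carrier G" and t: "\<tau> \<in> Xf q" for a g \<tau>
  proof -
    have t': "\<tau> \<in> Ch q" using t by simp
    have "mp (a \<otimes>\<^bsub>M\<^esub> g) (mp (inv\<^bsub>G\<^esub> g) \<tau>) = mp (a \<otimes>\<^bsub>M\<^esub> g \<otimes>\<^bsub>M\<^esub> inv\<^bsub>G\<^esub> g) \<tau>"
      using mp_mult[OF _ G_carrier[OF G.inv_closed[OF g]] t'] L_carrier[OF a] G_carrier[OF g] by blast
    also have "a \<otimes>\<^bsub>M\<^esub> g \<otimes>\<^bsub>M\<^esub> inv\<^bsub>G\<^esub> g = a"
      using M.m_assoc[OF L_carrier[OF a] G_carrier[OF g] G_carrier[OF G.inv_closed[OF g]]] G_inv(1)[OF g] L_right[OF a] by simp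
    finally show ?thesis .
  qed
  \<comment> \<open>Another factorisation differs by an element \<open>k\<close> of G_f, and
    substituting k g for g in the sum absorbs it.\<close>
  have avg_eq: "avg a \<tau> = avg a' \<tau>'"
    if a: "a \<in> Lf" "a' \<in> Lf" and t: "\<tau> \<in> Xf q" "\<tau>' \<in> Xf q" and eq: "mp a \<tau> = mp a' \<tau>'" for a a' \<tau> \<tau>'
  proof -
    obtain k where k: "k \<in> carrier G" "a' = a \<otimes>\<^bsub>M\<^esub> k" "\<tau> = mp k \<tau>'" by (rule factor_unique[OF a t eq])
    have t': "\<tau>' \<in> Ch q" using t by simp
    have bij: "(\<lambda>g. k \<otimes>\<^bsub>M\<^esub> g) ` carrier G = carrier G" "inj_on (\<lambda>g. k \<otimes>\<^bsub>M\<^esub> g) (carrier G)"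
      using G.surj_const_mult[OF k(1)] G.inj_on_cmult[OF k(1)] by (simp_all add: G_mult)
    have "avg a \<tau> = (\<Oplus>\<^bsub>A\<^esub>g\<in>(\<lambda>g. k \<otimes>\<^bsub>M\<^esub> g) ` carrier G. e (a \<otimes>\<^bsub>M\<^esub> g) c0 \<odot>\<^bsub>A\<^esub> \<zeta> (mp (inv\<^bsub>G\<^esub> g) \<tau>))"
      unfolding avg_def bij(1) ..
    also have "\<dots> = (\<Oplus>\<^bsub>A\<^esub>g\<in>carrier G. e (a \<otimes>\<^bsub>M\<^esub> (k \<otimes>\<^bsub>M\<^esub> g)) c0 \<odot>\<^bsub>A\<^esub> \<zeta> (mp (inv\<^bsub>G\<^esub> (k \<otimes>\<^bsub>M\<^esub> g)) \<tau>))"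
      using \<zeta>g[OF _ t(1)] c0(1) bij by (intro A.finsum_reindex) auto
    also have "\<dots> = avg a' \<tau>'"
      unfolding avg_def
    proof (rule A.finsum_cong')
      fix g assume g: "g \<in> carrier G"
      have kg: "k \<otimes>\<^bsub>M\<^esub> g \<in> carrier G" using G.m_closed[OF k(1) g] by (simp add: G_mult)
      have "inv\<^bsub>G\<^esub> (k \<otimes>\<^bsub>M\<^esub> g) \<otimes>\<^bsub>M\<^esub> k = inv\<^bsub>G\<^esub> (k \<otimes>\<^bsub>G\<^esub> g) \<otimes>\<^bsub>G\<^esub> k" by (simp add: G_mult)
      also have "\<dots> = inv\<^bsub>G\<^esub> g" using k(1) g by (simp add: G.inv_mult_group G.m_assoc)
      finally have "mp (inv\<^bsub>G\<^esub> (k \<otimes>\<^bsub>M\<^esub> g)) \<tau> = mp (inv\<^bsub>G\<^esub> g) \<tau>'"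
        unfolding k(3) using mp_mult[OF G_carrier[OF G.inv_closed[OF kg]] G_carrier[OF k(1)] t'] by simp
      moreover have "a \<otimes>\<^bsub>M\<^esub> (k \<otimes>\<^bsub>M\<^esub> g) = a' \<otimes>\<^bsub>M\<^esub> g"
        unfolding k(2) using L_carrier[OF a(1)] G_carrier[OF k(1)] G_carrier[OF g] by (simp add: M.m_assoc)
      ultimately show "e (a \<otimes>\<^bsub>M\<^esub> (k \<otimes>\<^bsub>M\<^esub> g)) c0 \<odot>\<^bsub>A\<^esub> \<zeta> (mp (inv\<^bsub>G\<^esub> (k \<otimes>\<^bsub>M\<^esub> g)) \<tau>) =
        e (a' \<otimes>\<^bsub>M\<^esub> g) c0 \<odot>\<^bsub>A\<^esub> \<zeta> (mp (inv\<^bsub>G\<^esub> g) \<tau>')" by simp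
    qed (use \<zeta>g[OF _ t(2)] c0(1) in auto)
    finally show ?thesis .
  qed
  define \<phi> where "\<phi> \<sigma> = (if \<sigma> \<in> Chi I' q then H (bq q \<sigma> \<one>\<^bsub>K\<^esub>) else avg (fa q \<sigma>) (ft q \<sigma>))" for \<sigma>
  have \<phi>mp: "\<phi> (mp a \<tau>) = avg a \<tau>" if a: "a \<in> Lf" and t: "\<tau> \<in> Xf q" for a \<tau>
    using fa_ft[OF XJ_mem[OF a t]] XJ_mem[OF a t] avg_eq[OF a _ t] by (auto simp: \<phi>_def)
  have \<phi>I': "\<phi> \<sigma> = H (bq q \<sigma> \<one>\<^bsub>K\<^esub>)" if "\<sigma> \<in> Chi I' q" for \<sigma> using that by (simp add: \<phi>_def)
  have \<phi>c: "\<phi> \<sigma> \<in> carrier A" if "\<sigma> \<in> Chi I q" for \<sigma>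
    using avg_c fa_ft(2)[of \<sigma> q] that H.closed b1' by (auto simp: \<phi>_def)
  have sumc0: "(\<Oplus>\<^bsub>A\<^esub>g\<in>carrier G. e \<one>\<^bsub>M\<^esub> c0 \<odot>\<^bsub>A\<^esub> v) = v" if v: "v \<in> carrier A" for v
  proof -
    have am: "add_map K A (\<lambda>c. e \<one>\<^bsub>M\<^esub> c \<odot>\<^bsub>A\<^esub> v)"
      by (rule add_map_comp[OF R.bs_add_map A.smult_left_add_map[OF v]])
    have "(\<Oplus>\<^bsub>A\<^esub>g\<in>carrier G. e \<one>\<^bsub>M\<^esub> c0 \<odot>\<^bsub>A\<^esub> v) = e \<one>\<^bsub>M\<^esub> (\<Oplus>\<^bsub>K\<^esub>g\<in>carrier G. c0) \<odot>\<^bsub>A\<^esub> v"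
      using add_map.finsum[OF am, of "\<lambda>g. c0" "carrier G"] c0(1) by simp
    then show ?thesis using c0(2) A.smult_one[OF v] by (simp add: one_R)
  qed
  have split1: "e m c \<odot>\<^bsub>A\<^esub> v = e \<one>\<^bsub>M\<^esub> c \<odot>\<^bsub>A\<^esub> (e m \<one>\<^bsub>K\<^esub> \<odot>\<^bsub>A\<^esub> v)"
    if "m \<in> carrier M" "c \<in> carrier K" "v \<in> carrier A" for m c v
    using that by (simp add: A.smult_assoc1[symmetric] mult_gen)
  \<comment> \<open>If m a stays in the L-class, multiplying the mean by m gives the mean for m a.
    If m a drops into \<open>I'\<close>, then \<open>k\<zeta>\<close> turns every term into the same
    multiple of the value of \<open>H\<close> on the translated chain, and the multiples add up to
    that value.\<close>
  have equi: "e m \<one>\<^bsub>K\<^esub> \<odot>\<^bsub>A\<^esub> \<phi> \<sigma> = (case mact m \<sigma> of None \<Rightarrow> \<zero>\<^bsub>A\<^esub> | Some \<tau> \<Rightarrow> \<phi> \<tau>)"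
    if m: "m \<in> carrier M" and s: "\<sigma> \<in> Chi I q" for m \<sigma>
  proof -
    have e1: "e m \<one>\<^bsub>K\<^esub> \<in> carrier R" by simp
    have sC: "\<sigma> \<in> Ch q" using s ChI by blast
    have Hcase: "H (e m \<one>\<^bsub>K\<^esub> \<odot>\<^bsub>CM q\<^esub> bq q \<sigma> \<one>\<^bsub>K\<^esub>) = (case mact m \<sigma> of None \<Rightarrow> \<zero>\<^bsub>A\<^esub> | Some \<tau> \<Rightarrow> \<phi> \<tau>)"
      if "\<And>\<tau>. mact m \<sigma> = Some \<tau> \<Longrightarrow> \<tau> \<in> Chi I' q"
      using m sC that H.zero by (auto simp: Q.smult_gen \<phi>I' split: option.split)
    show ?thesis
    proof (cases "\<sigma> \<in> Chi I' q")
      case True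
      then have "e m \<one>\<^bsub>K\<^esub> \<odot>\<^bsub>A\<^esub> \<phi> \<sigma> = H (e m \<one>\<^bsub>K\<^esub> \<odot>\<^bsub>CM q\<^esub> bq q \<sigma> \<one>\<^bsub>K\<^esub>)"
        using H_smult[OF e1 b1'[OF True K.one_closed]] by (simp add: \<phi>I')
      then show ?thesis using Hcase mact_Chi[OF I' m sC] True by simp
    next
      case False
      then obtain a \<tau> where a: "a \<in> Lf" and t: "\<tau> \<in> Xf q" and s': "\<sigma> = mp a \<tau>"
        using XJ_factor[of \<sigma> q] s by blast
      have ac: "a \<in> carrier M" by (rule L_carrier[OF a])
      have "e m \<one>\<^bsub>K\<^esub> \<odot>\<^bsub>A\<^esub> \<phi> \<sigma> =
        (\<Oplus>\<^bsub>A\<^esub>g\<in>carrier G. e m \<one>\<^bsub>K\<^esub> \<odot>\<^bsub>A\<^esub> (e (a \<otimes>\<^bsub>M\<^esub> g) c0 \<odot>\<^bsub>A\<^esub> \<zeta> (mp (inv\<^bsub>G\<^esub> g) \<tau>)))"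
        unfolding s' \<phi>mp[OF a t] avg_def
        using \<zeta>g[OF _ t] c0(1) by (intro add_map.finsum[OF A.smult_right_add_map[OF e1]]) auto
      also have "\<dots> = avg (m \<otimes>\<^bsub>M\<^esub> a) \<tau>"
        unfolding avg_def
      proof (rule A.finsum_cong')
        fix g assume g: "g \<in> carrier G"
        show "e m \<one>\<^bsub>K\<^esub> \<odot>\<^bsub>A\<^esub> (e (a \<otimes>\<^bsub>M\<^esub> g) c0 \<odot>\<^bsub>A\<^esub> \<zeta> (mp (inv\<^bsub>G\<^esub> g) \<tau>)) =
          e (m \<otimes>\<^bsub>M\<^esub> a \<otimes>\<^bsub>M\<^esub> g) c0 \<odot>\<^bsub>A\<^esub> \<zeta> (mp (inv\<^bsub>G\<^esub> g) \<tau>)"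
          using A.smult_assoc1[OF e1 ec[OF c0(1)] \<zeta>g[OF g t], of "a \<otimes>\<^bsub>M\<^esub> g"] m ac G_carrier[OF g] c0(1)
          by (simp add: mult_gen M.m_assoc)
      qed (use \<zeta>g[OF _ t] c0(1) in auto)
      finally have 1: "e m \<one>\<^bsub>K\<^esub> \<odot>\<^bsub>A\<^esub> \<phi> \<sigma> = avg (m \<otimes>\<^bsub>M\<^esub> a) \<tau>" .
      show ?thesis
      proof (cases "m \<otimes>\<^bsub>M\<^esub> a \<in> Lf")
        case True
        then show ?thesis using 1 mact_layer(1)[OF a t m True] \<phi>mp[OF True t] by (simp add: s')
      next
        case False
        have ma: "m \<otimes>\<^bsub>M\<^esub> a \<in> I'" by (rule mact_layer(2)[OF a t m False])
        let ?w = "e m \<one>\<^bsub>K\<^esub> \<odot>\<^bsub>CM q\<^esub> bq q \<sigma> \<one>\<^bsub>K\<^esub>"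
        have "?w = e (m \<otimes>\<^bsub>M\<^esub> a) \<one>\<^bsub>K\<^esub> \<odot>\<^bsub>CM q\<^esub> bq q \<tau> \<one>\<^bsub>K\<^esub>"
        proof -
          have "bq q \<sigma> \<one>\<^bsub>K\<^esub> = e a \<one>\<^bsub>K\<^esub> \<odot>\<^bsub>CM q\<^esub> bq q \<tau> \<one>\<^bsub>K\<^esub>"
            using Q.smult_gen[OF ac, of \<tau> q "\<one>\<^bsub>K\<^esub>" "\<one>\<^bsub>K\<^esub>"] L_Xf(1)[OF a t] t by (simp add: s')
          then show ?thesis using m ac by (simp add: Q.CM.smult_assoc1[symmetric] mult_gen)
        qed
        then have "?w \<in> ChJ' q" using RS_smult[OF I' R.bs_supported[OF ma K.one_closed]] by simp
        then have Hw: "H ?w \<in> carrier A" using H.closed by simp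
        have "avg (m \<otimes>\<^bsub>M\<^esub> a) \<tau> = (\<Oplus>\<^bsub>A\<^esub>g\<in>carrier G. e \<one>\<^bsub>M\<^esub> c0 \<odot>\<^bsub>A\<^esub> H ?w)"
          unfolding avg_def
        proof (rule A.finsum_cong')
          fix g assume g: "g \<in> carrier G"
          let ?\<tau>' = "mp (inv\<^bsub>G\<^esub> g) \<tau>" and ?k = "m \<otimes>\<^bsub>M\<^esub> a \<otimes>\<^bsub>M\<^esub> g"
          have t': "?\<tau>' \<in> Xf q" by (rule G_Xf[OF G.inv_closed[OF g] t])
          have k: "?k \<in> I'" using I' ma G_carrier[OF g] by (auto simp: monoid_ideal_def)
          have kc: "?k \<in> carrier M" using m ac G_carrier[OF g] by simp
          have ag: "a \<otimes>\<^bsub>M\<^esub> g \<in> carrier M" using ac G_carrier[OF g] by simp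
          have "e ?k \<one>\<^bsub>K\<^esub> \<odot>\<^bsub>CM q\<^esub> bq q ?\<tau>' \<one>\<^bsub>K\<^esub> = e m \<one>\<^bsub>K\<^esub> \<odot>\<^bsub>CM q\<^esub> (e (a \<otimes>\<^bsub>M\<^esub> g) \<one>\<^bsub>K\<^esub> \<odot>\<^bsub>CM q\<^esub> bq q ?\<tau>' \<one>\<^bsub>K\<^esub>)"
            using m ac ag G_carrier[OF g] by (simp add: Q.CM.smult_assoc1[symmetric] mult_gen M.m_assoc)
          also have "e (a \<otimes>\<^bsub>M\<^esub> g) \<one>\<^bsub>K\<^esub> \<odot>\<^bsub>CM q\<^esub> bq q ?\<tau>' \<one>\<^bsub>K\<^esub> = bq q \<sigma> \<one>\<^bsub>K\<^esub>"
            using Q.smult_gen[OF ag, of ?\<tau>' q "\<one>\<^bsub>K\<^esub>" "\<one>\<^bsub>K\<^esub>"] t' L_Xf(1)[OF L_mult_G[OF a g] t'] mp_inv[OF a g t]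
            by (simp add: s' del: map_map)
          finally have "e ?k \<one>\<^bsub>K\<^esub> \<odot>\<^bsub>A\<^esub> \<zeta> ?\<tau>' = H ?w" using k\<zeta>[OF k t'] by simp
          then show "e ?k c0 \<odot>\<^bsub>A\<^esub> \<zeta> ?\<tau>' = e \<one>\<^bsub>M\<^esub> c0 \<odot>\<^bsub>A\<^esub> H ?w"
            using split1[OF kc c0(1) \<zeta>c[OF t']] by simp
        qed (use Hw c0(1) in auto)
        also have "\<dots> = H ?w" by (rule sumc0[OF Hw])
        also have "\<dots> = (case mact m \<sigma> of None \<Rightarrow> \<zero>\<^bsub>A\<^esub> | Some \<tau> \<Rightarrow> \<phi> \<tau>)"
          using Hcase mact_layer(3)[OF a t m False] by (simp add: s')
        finally show ?thesis using 1 by simp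
      qed
    qed
  qed
  \<comment> \<open>All factorisations produce the same chain \<open>\<sigma>\<close>, so each term
    of the mean lies over the value of \<open>g\<close> at c0 \<sigma>; summed over G_f these values
    give the one at \<open>\<sigma>\<close>.\<close>
  have F\<phi>: "F (\<phi> \<sigma>) = g (bq q \<sigma> \<one>\<^bsub>K\<^esub>)" if s: "\<sigma> \<in> Chi I q" for \<sigma>
  proof (cases "\<sigma> \<in> Chi I' q")
    case True
    then show ?thesis using FH[OF b1'[OF True K.one_closed]] by (simp add: \<phi>I')
  next
    case False
    then obtain a \<tau> where a: "a \<in> Lf" and t: "\<tau> \<in> Xf q" and s': "\<sigma> = mp a \<tau>"
      using XJ_factor[of \<sigma> q] s by blast
    have am: "add_map K B (\<lambda>c. g (bq q \<sigma> c))"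
      using Q.C.bs_add_map[of q \<sigma>] b1[OF s] g.closed g.add
      by (simp add: add_map_def add_map_axioms_def B.abelian_group_axioms)
    have "F (\<phi> \<sigma>) = (\<Oplus>\<^bsub>B\<^esub>g\<in>carrier G. F (e (a \<otimes>\<^bsub>M\<^esub> g) c0 \<odot>\<^bsub>A\<^esub> \<zeta> (mp (inv\<^bsub>G\<^esub> g) \<tau>)))"
      unfolding s' \<phi>mp[OF a t] avg_def using \<zeta>g[OF _ t] c0(1) by (intro F.finsum) auto
    also have "\<dots> = (\<Oplus>\<^bsub>B\<^esub>k\<in>carrier G. g (bq q \<sigma> c0))"
    proof (rule B.finsum_cong')
      fix k assume k: "k \<in> carrier G"
      let ?\<tau>' = "mp (inv\<^bsub>G\<^esub> k) \<tau>"
      have t': "?\<tau>' \<in> Xf q" by (rule G_Xf[OF G.inv_closed[OF k] t])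
      have ag: "a \<otimes>\<^bsub>M\<^esub> k \<in> carrier M" using L_carrier[OF a] G_carrier[OF k] by simp
      have "F (e (a \<otimes>\<^bsub>M\<^esub> k) c0 \<odot>\<^bsub>A\<^esub> \<zeta> ?\<tau>') = e (a \<otimes>\<^bsub>M\<^esub> k) c0 \<odot>\<^bsub>B\<^esub> g (bq q ?\<tau>' \<one>\<^bsub>K\<^esub>)"
        using F_smult[OF ec[OF c0(1)] \<zeta>c[OF t']] F\<zeta>[OF t'] by simp
      also have "\<dots> = g (e (a \<otimes>\<^bsub>M\<^esub> k) c0 \<odot>\<^bsub>CM q\<^esub> bq q ?\<tau>' \<one>\<^bsub>K\<^esub>)"
        by (rule g_smult[symmetric, OF ec[OF c0(1)] b1[OF subsetD[OF XfI t'] K.one_closed]])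
      also have "e (a \<otimes>\<^bsub>M\<^esub> k) c0 \<odot>\<^bsub>CM q\<^esub> bq q ?\<tau>' \<one>\<^bsub>K\<^esub> = bq q \<sigma> c0"
        using Q.smult_gen[OF ag, of ?\<tau>' q c0 "\<one>\<^bsub>K\<^esub>"] t' L_Xf(1)[OF L_mult_G[OF a k] t'] mp_inv[OF a k t] c0(1)
        by (simp add: s' del: map_map)
      finally show "F (e (a \<otimes>\<^bsub>M\<^esub> k) c0 \<odot>\<^bsub>A\<^esub> \<zeta> ?\<tau>') = g (bq q \<sigma> c0)" .
    qed (use add_map.closed[OF am] c0(1) in auto)
    also have "\<dots> = g (bq q \<sigma> (\<Oplus>\<^bsub>K\<^esub>k\<in>carrier G. c0))"
      using add_map.finsum[OF am, of "\<lambda>g. c0" "carrier G"] c0(1) by simp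
    finally show ?thesis unfolding c0(2) .
  qed
  define h where "h = linext A (Chi I q) (\<lambda>\<sigma> c. e \<one>\<^bsub>M\<^esub> c \<odot>\<^bsub>A\<^esub> \<phi> \<sigma>)"
  have am: "add_map K A (\<lambda>c. e \<one>\<^bsub>M\<^esub> c \<odot>\<^bsub>A\<^esub> \<phi> \<sigma>)" if "\<sigma> \<in> Chi I q" for \<sigma>
    by (rule add_map_comp[OF R.bs_add_map A.smult_left_add_map[OF \<phi>c[OF that]]])
  have h: "add_map (CM q) A h"
    unfolding h_def by (rule Q.C.linext_add_map[OF A.abelian_group_axioms ChI am])
  have hb: "h (bq q \<sigma> c) = e \<one>\<^bsub>M\<^esub> c \<odot>\<^bsub>A\<^esub> \<phi> \<sigma>" if "\<sigma> \<in> Chi I q" "c \<in> carrier K" for \<sigma> c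
    unfolding h_def
    using Q.C.linext_bs[OF A.abelian_group_axioms ChI am that(2) subsetD[OF ChI that(1)]] that(1) by simp
  have hom: "h \<in> left_module_hom R ?CI A"
  proof (rule Q.hom_supportedI[OF inv A h])
    fix m c \<sigma> d assume m: "m \<in> carrier M" and c: "c \<in> carrier K" and s: "\<sigma> \<in> Chi I q" and d: "d \<in> carrier K"
    have "e m c \<odot>\<^bsub>A\<^esub> h (bq q \<sigma> d) = e \<one>\<^bsub>M\<^esub> (c \<otimes>\<^bsub>K\<^esub> d) \<odot>\<^bsub>A\<^esub> (e m \<one>\<^bsub>K\<^esub> \<odot>\<^bsub>A\<^esub> \<phi> \<sigma>)"
      using m c d \<phi>c[OF s] by (simp add: hb[OF s d] A.smult_assoc1[symmetric] mult_gen)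
    then show "e m c \<odot>\<^bsub>A\<^esub> h (bq q \<sigma> d) = (case mact m \<sigma> of None \<Rightarrow> \<zero>\<^bsub>A\<^esub> | Some b' \<Rightarrow> h (bq q b' (c \<otimes>\<^bsub>K\<^esub> d)))"
      using equi[OF m s] hb mact_Chi[OF I m subsetD[OF ChI s]] s c d by (auto split: option.splits)
  qed
  have "F (h p) = g p" if "p \<in> ChJ q" for p
    using that ChI
  proof (induction rule: Q.C.supported_induct_strong)
    case zero
    then show ?case using add_map.zero[OF h] F.zero g.zero by simp
  next
    case (bs \<sigma> c)
    have "F (h (bq q \<sigma> c)) = e \<one>\<^bsub>M\<^esub> c \<odot>\<^bsub>B\<^esub> g (bq q \<sigma> \<one>\<^bsub>K\<^esub>)"
      using bs F_smult[OF ec[OF bs(2)] \<phi>c[OF bs(1)]] by (simp add: hb F\<phi>)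
    also have "\<dots> = g (bq q \<sigma> c)"
      using g_smult[OF ec[OF bs(2)] b1[OF bs(1) K.one_closed], of "\<one>\<^bsub>M\<^esub>"] bs subsetD[OF ChI bs(1)]
      by (simp add: Q.smult_gen Q.act_one)
    finally show ?case .
  next
    case (add u v)
    have uv: "u \<in> carrier (CM q)" "v \<in> carrier (CM q)" using add subC by auto
    have "F (h (u \<oplus>\<^bsub>CM q\<^esub> v)) = F (h u) \<oplus>\<^bsub>B\<^esub> F (h v)"
      unfolding add_map.add[OF h uv] by (rule F.add[OF add_map.closed[OF h uv(1)] add_map.closed[OF h uv(2)]])
    also have "\<dots> = g (u \<oplus>\<^bsub>CM q\<^esub> v)" using add g.add[of u v] by simp
    finally show ?case .
  qed
  then show ?thesis using hom by blast
qed

end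

text \<open>For fixed test modules the lifting problem is solved directly: the zero lift on the
  empty ideal is extended along a principal series until all chains are reached, instead of
  splitting the filtration.\<close>

theorem (in fm) projective_chain_module:
  assumes "regular_monoid M"
    and char: "\<forall>f\<in>idempotents M. \<not> ring_char K dvd order (maximal_subgroup M f)"
    and sandwich: "\<forall>a\<in>carrier M. sandwich_right_invertible K M (J_class M a)"
  shows "projective_module TYPE('x) TYPE('y) R (CM q)"
proof -
  have "\<exists>h\<in>left_module_hom R (CM q) A. \<forall>p\<in>carrier (CM q). F (h p) = g p"
    if A: "left_module R A" and B: "left_module R B" and F: "F \<in> left_module_hom R A B"
      and surj: "F ` carrier A = carrier B" and g: "g \<in> left_module_hom R (CM q) B"
    for A :: "('m \<Rightarrow> 'k, 'x) module" and B :: "('m \<Rightarrow> 'k, 'y) module" and F g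
  proof -
    have restr: "g \<in> left_module_hom R (CM q\<lparr>carrier := supported K (Ch q) Y\<rparr>) B" for Y
      using g subsetD[OF Q.C.supported_subset[of q Y]] by (simp add: left_module_hom_def Pi_def)
    have "monoid_ideal M (carrier M)" by (auto simp: monoid_ideal_def)
    then have "\<exists>h\<in>left_module_hom R (CM q\<lparr>carrier := supported K (Ch q) (Chi (carrier M) q)\<rparr>) A.
      \<forall>p\<in>supported K (Ch q) (Chi (carrier M) q). F (h p) = g p"
      using finite_M assms(1)
    proof (induction rule: M.monoid_ideal_induct)
      case empty
      interpret A: left_module R A by (rule A)
      interpret F: add_map A B F by (rule left_module_hom_add_map[OF A B F])
      have g0: "g \<zero>\<^bsub>CM q\<^esub> = \<zero>\<^bsub>B\<^esub>"
        by (rule add_map.zero[OF left_module_hom_add_map[OF Q.left_module_C B g]])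
      have z: "supported K (Ch q) (Chi {} q) = {\<zero>\<^bsub>CM q\<^esub>}"
      proof -
        have "u = \<zero>\<^bsub>CM q\<^esub>" if "u \<in> supported K (Ch q) {}" for u
          using Q.C.expand[OF that] by simp
        then show ?thesis using Q.C.supported_zero by (auto simp: Chi_empty)
      qed
      show ?case
        by (rule bexI[of _ "\<lambda>p. \<zero>\<^bsub>A\<^esub>"]) (auto simp: z F.zero g0 left_module_hom_def)
    next
      case (step I f)
      interpret layer K M f I
        by (intro layer.intro fmi.intro idem.intro fm_axioms M.monoid_axioms layer_axioms.intro
            idem_axioms.intro finite_M step)
      obtain H where H: "H \<in> left_module_hom R (CM q\<lparr>carrier := ChJ' q\<rparr>) A" "\<And>p. p \<in> ChJ' q \<Longrightarrow> F (H p) = g p"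
        using step.IH by blast
      obtain \<eta> where "right_identity I' \<eta>" using right_identity_exists[OF assms(1) step(5) sandwich] by blast
      then show ?case
        using lift_step[OF A B F surj restr H] char step(3) by blast
    qed
    then show ?thesis by (simp add: Chi_carrier Q.C.supported_UNIV)
  qed
  then show ?thesis using Q.left_module_C by (auto simp: projective_module_def)
qed


section \<open>Linear sections\<close>

text \<open>The modules may be infinite-dimensional, so a maximal linear section on a subspace is
  taken by Zorn's lemma, applied to graphs ordered by inclusion. Scalars of \<open>K\<close> act as
  multiples of the identity of \<open>M\<close>.\<close>

lemma (in fm) linear_section:
  fixes A :: "('m \<Rightarrow> 'k, 'x) module" and B :: "('m \<Rightarrow> 'k, 'y) module"
  assumes A: "left_module R A" and B: "left_module R B" and F: "F \<in> left_module_hom R A B"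
    and surj: "F ` carrier A = carrier B"
  obtains s where "add_map B A s"
    "\<And>c b. c \<in> carrier K \<Longrightarrow> b \<in> carrier B \<Longrightarrow> s (e \<one>\<^bsub>M\<^esub> c \<odot>\<^bsub>B\<^esub> b) = e \<one>\<^bsub>M\<^esub> c \<odot>\<^bsub>A\<^esub> s b"
    "\<And>b. b \<in> carrier B \<Longrightarrow> F (s b) = b"
proof -
  interpret A: left_module R A by (rule A)
  interpret B: left_module R B by (rule B)
  interpret F: add_map A B F by (rule left_module_hom_add_map[OF A B F])
  have F_smult: "F (x \<odot>\<^bsub>A\<^esub> v) = x \<odot>\<^bsub>B\<^esub> F v" if "x \<in> carrier R" "v \<in> carrier A" for x v
    using left_module_hom_smult[OF F] that by simp
  let ?s = "\<lambda>c. e \<one>\<^bsub>M\<^esub> c"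
  have sR: "c \<in> carrier K \<Longrightarrow> ?s c \<in> carrier R" for c by simp
  \<comment> \<open>Graphs of linear sections on subspaces. For a subspace of pairs,
    single-valuedness amounts to the last condition.\<close>
  define lin where "lin G \<longleftrightarrow> G \<subseteq> carrier B \<times> carrier A \<and> (\<zero>\<^bsub>B\<^esub>, \<zero>\<^bsub>A\<^esub>) \<in> G \<and>
    (\<forall>b a b' a'. (b, a) \<in> G \<longrightarrow> (b', a') \<in> G \<longrightarrow> (b \<oplus>\<^bsub>B\<^esub> b', a \<oplus>\<^bsub>A\<^esub> a') \<in> G) \<and>
    (\<forall>c\<in>carrier K. \<forall>b a. (b, a) \<in> G \<longrightarrow> (?s c \<odot>\<^bsub>B\<^esub> b, ?s c \<odot>\<^bsub>A\<^esub> a) \<in> G) \<and>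
    (\<forall>b a. (b, a) \<in> G \<longrightarrow> F a = b) \<and> (\<forall>a. (\<zero>\<^bsub>B\<^esub>, a) \<in> G \<longrightarrow> a = \<zero>\<^bsub>A\<^esub>)" for G
  have linD: "G \<subseteq> carrier B \<times> carrier A" "(\<zero>\<^bsub>B\<^esub>, \<zero>\<^bsub>A\<^esub>) \<in> G"
    "\<And>b a b' a'. (b, a) \<in> G \<Longrightarrow> (b', a') \<in> G \<Longrightarrow> (b \<oplus>\<^bsub>B\<^esub> b', a \<oplus>\<^bsub>A\<^esub> a') \<in> G"
    "\<And>c b a. c \<in> carrier K \<Longrightarrow> (b, a) \<in> G \<Longrightarrow> (?s c \<odot>\<^bsub>B\<^esub> b, ?s c \<odot>\<^bsub>A\<^esub> a) \<in> G"
    "\<And>b a. (b, a) \<in> G \<Longrightarrow> F a = b" "\<And>a. (\<zero>\<^bsub>B\<^esub>, a) \<in> G \<Longrightarrow> a = \<zero>\<^bsub>A\<^esub>" if "lin G" for G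
    using that by (simp_all add: lin_def)
  have "\<exists>G\<in>Collect lin. \<forall>H\<in>Collect lin. G \<subseteq> H \<longrightarrow> H = G"
  proof (rule subset_Zorn_nonempty)
    have "lin {(\<zero>\<^bsub>B\<^esub>, \<zero>\<^bsub>A\<^esub>)}" by (auto simp: lin_def F.zero)
    then show "Collect lin \<noteq> {}" by blast
    fix \<C> assume ne: "\<C> \<noteq> {}" and chain: "subset.chain (Collect lin) \<C>"
    have C: "lin G" if "G \<in> \<C>" for G using that chain by (auto simp: subset.chain_def)
    have "lin (\<Union>\<C>)"
      unfolding lin_def
    proof (intro conjI allI ballI impI)
      show "\<Union>\<C> \<subseteq> carrier B \<times> carrier A" using linD(1)[OF C] by blast
      show "(\<zero>\<^bsub>B\<^esub>, \<zero>\<^bsub>A\<^esub>) \<in> \<Union>\<C>" using linD(2)[OF C] ne by blast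
      show "F a = b" if "(b, a) \<in> \<Union>\<C>" for b a using linD(5)[OF C] that by blast
      show "a = \<zero>\<^bsub>A\<^esub>" if "(\<zero>\<^bsub>B\<^esub>, a) \<in> \<Union>\<C>" for a using linD(6)[OF C] that by blast
      show "(?s c \<odot>\<^bsub>B\<^esub> b, ?s c \<odot>\<^bsub>A\<^esub> a) \<in> \<Union>\<C>" if "c \<in> carrier K" "(b, a) \<in> \<Union>\<C>" for c b a
        using linD(4)[OF C] that by blast
      fix b a b' a' assume "(b, a) \<in> \<Union>\<C>" "(b', a') \<in> \<Union>\<C>"
      then obtain G G' where G: "G \<in> \<C>" "(b, a) \<in> G" "G' \<in> \<C>" "(b', a') \<in> G'" by blast
      then have "G \<subseteq> G' \<or> G' \<subseteq> G" using chain by (auto simp: subset.chain_def)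
      then obtain H where H: "H \<in> \<C>" "(b, a) \<in> H" "(b', a') \<in> H" using G by blast
      show "(b \<oplus>\<^bsub>B\<^esub> b', a \<oplus>\<^bsub>A\<^esub> a') \<in> \<Union>\<C>"
        using linD(3)[OF C[OF H(1)] H(2,3)] H(1) by blast
    qed
    then show "\<Union>\<C> \<in> Collect lin" by simp
  qed
  then obtain G where lin: "lin G" and max: "\<And>H. lin H \<Longrightarrow> G \<subseteq> H \<Longrightarrow> H = G" by blast
  note G0 = linD(2)[OF lin] and Gadd = linD(3)[OF lin] and Gs = linD(4)[OF lin]
    and GF = linD(5)[OF lin] and Gz = linD(6)[OF lin]
  have Gc: "b \<in> carrier B" "a \<in> carrier A" if "(b, a) \<in> G" for b a using linD(1)[OF lin] that by blast+
  have negA: "?s (\<ominus>\<^bsub>K\<^esub> \<one>\<^bsub>K\<^esub>) \<odot>\<^bsub>A\<^esub> a = \<ominus>\<^bsub>A\<^esub> a" if "a \<in> carrier A" for a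
    using add_map.neg[OF add_map_comp[OF R.bs_add_map A.smult_left_add_map[OF that]] K.one_closed, of "\<one>\<^bsub>M\<^esub>"]
      that by (simp add: one_R[symmetric])
  have negB: "?s (\<ominus>\<^bsub>K\<^esub> \<one>\<^bsub>K\<^esub>) \<odot>\<^bsub>B\<^esub> b = \<ominus>\<^bsub>B\<^esub> b" if "b \<in> carrier B" for b
    using add_map.neg[OF add_map_comp[OF R.bs_add_map B.smult_left_add_map[OF that]] K.one_closed, of "\<one>\<^bsub>M\<^esub>"]
      that by (simp add: one_R[symmetric])
  have Gneg: "(\<ominus>\<^bsub>B\<^esub> b, \<ominus>\<^bsub>A\<^esub> a) \<in> G" if "(b, a) \<in> G" for b a
    using Gs[OF K.a_inv_closed[OF K.one_closed] that] Gc[OF that] by (simp add: negA negB)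
  have unique: "a = a'" if "(b, a) \<in> G" "(b, a') \<in> G" for b a a'
  proof -
    have "(\<zero>\<^bsub>B\<^esub>, a \<oplus>\<^bsub>A\<^esub> \<ominus>\<^bsub>A\<^esub> a') \<in> G"
      using Gadd[OF that(1) Gneg[OF that(2)]] Gc[OF that(1)] by (simp add: B.r_neg)
    then have "a \<oplus>\<^bsub>A\<^esub> \<ominus>\<^bsub>A\<^esub> a' = \<zero>\<^bsub>A\<^esub>" by (rule Gz)
    then show ?thesis using Gc(2)[OF that(1)] Gc(2)[OF that(2)]
      by (metis A.a_inv_closed A.add.inv_inv A.minus_equality)
  qed
  have dom: "\<exists>a. (b0, a) \<in> G" if b0: "b0 \<in> carrier B" for b0
  proof (rule ccontr)
    assume no: "\<nexists>a. (b0, a) \<in> G"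
    obtain a0 where a0: "a0 \<in> carrier A" "F a0 = b0" using b0 surj by (metis imageE)
    \<comment> \<open>If \<open>b0\<close> is missing from the domain, the graph is enlarged by the
      pair of \<open>b0\<close> and any preimage \<open>a0\<close> of it.\<close>
    define H where "H = {(b \<oplus>\<^bsub>B\<^esub> ?s c \<odot>\<^bsub>B\<^esub> b0, a \<oplus>\<^bsub>A\<^esub> ?s c \<odot>\<^bsub>A\<^esub> a0) | b a c. (b, a) \<in> G \<and> c \<in> carrier K}"
    have HI: "(b \<oplus>\<^bsub>B\<^esub> ?s c \<odot>\<^bsub>B\<^esub> b0, a \<oplus>\<^bsub>A\<^esub> ?s c \<odot>\<^bsub>A\<^esub> a0) \<in> H" if "(b, a) \<in> G" "c \<in> carrier K" for b a c
      using that unfolding H_def by blast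
    have HE: "\<exists>b a c. x = b \<oplus>\<^bsub>B\<^esub> ?s c \<odot>\<^bsub>B\<^esub> b0 \<and> y = a \<oplus>\<^bsub>A\<^esub> ?s c \<odot>\<^bsub>A\<^esub> a0 \<and> (b, a) \<in> G \<and> c \<in> carrier K"
      if "(x, y) \<in> H" for x y using that unfolding H_def by blast
    have GH: "G \<subseteq> H"
    proof
      fix p assume "p \<in> G"
      then obtain b a where p: "p = (b, a)" "(b, a) \<in> G" by (cases p) auto
      then show "p \<in> H" using HI[OF p(2) K.zero_closed] Gc[OF p(2)] b0 a0 by (simp add: R.bs_zero)
    qed
    have "lin H"
      unfolding lin_def
    proof (intro conjI allI ballI impI)
      show "H \<subseteq> carrier B \<times> carrier A"
        using Gc b0 a0 by (auto simp: H_def)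
      show "(\<zero>\<^bsub>B\<^esub>, \<zero>\<^bsub>A\<^esub>) \<in> H" using G0 GH by blast
    next
      fix x y x' y' assume "(x, y) \<in> H" "(x', y') \<in> H"
      then obtain b a c b' a' c' where 1: "x = b \<oplus>\<^bsub>B\<^esub> ?s c \<odot>\<^bsub>B\<^esub> b0" "y = a \<oplus>\<^bsub>A\<^esub> ?s c \<odot>\<^bsub>A\<^esub> a0" "(b, a) \<in> G" "c \<in> carrier K"
        and 2: "x' = b' \<oplus>\<^bsub>B\<^esub> ?s c' \<odot>\<^bsub>B\<^esub> b0" "y' = a' \<oplus>\<^bsub>A\<^esub> ?s c' \<odot>\<^bsub>A\<^esub> a0" "(b', a') \<in> G" "c' \<in> carrier K"
        using HE by metis
      have "x \<oplus>\<^bsub>B\<^esub> x' = (b \<oplus>\<^bsub>B\<^esub> b') \<oplus>\<^bsub>B\<^esub> ?s (c \<oplus>\<^bsub>K\<^esub> c') \<odot>\<^bsub>B\<^esub> b0"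
        using 1 2 Gc[OF 1(3)] Gc[OF 2(3)] b0 by (simp add: R.bs_add B.smult_l_distr B.a_ac)
      moreover have "y \<oplus>\<^bsub>A\<^esub> y' = (a \<oplus>\<^bsub>A\<^esub> a') \<oplus>\<^bsub>A\<^esub> ?s (c \<oplus>\<^bsub>K\<^esub> c') \<odot>\<^bsub>A\<^esub> a0"
        using 1 2 Gc[OF 1(3)] Gc[OF 2(3)] a0 by (simp add: R.bs_add A.smult_l_distr A.a_ac)
      ultimately show "(x \<oplus>\<^bsub>B\<^esub> x', y \<oplus>\<^bsub>A\<^esub> y') \<in> H"
        using HI[OF Gadd[OF 1(3) 2(3)] K.a_closed[OF 1(4) 2(4)]] by simp
    next
      fix d x y assume d: "d \<in> carrier K" and "(x, y) \<in> H"
      then obtain b a c where 1: "x = b \<oplus>\<^bsub>B\<^esub> ?s c \<odot>\<^bsub>B\<^esub> b0" "y = a \<oplus>\<^bsub>A\<^esub> ?s c \<odot>\<^bsub>A\<^esub> a0" "(b, a) \<in> G" "c \<in> carrier K"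
        using HE by metis
      have "?s d \<odot>\<^bsub>B\<^esub> x = ?s d \<odot>\<^bsub>B\<^esub> b \<oplus>\<^bsub>B\<^esub> ?s (d \<otimes>\<^bsub>K\<^esub> c) \<odot>\<^bsub>B\<^esub> b0"
        using 1 d Gc[OF 1(3)] b0 by (simp add: B.smult_r_distr B.smult_assoc1[symmetric] mult_gen)
      moreover have "?s d \<odot>\<^bsub>A\<^esub> y = ?s d \<odot>\<^bsub>A\<^esub> a \<oplus>\<^bsub>A\<^esub> ?s (d \<otimes>\<^bsub>K\<^esub> c) \<odot>\<^bsub>A\<^esub> a0"
        using 1 d Gc[OF 1(3)] a0 by (simp add: A.smult_r_distr A.smult_assoc1[symmetric] mult_gen)
      ultimately show "(?s d \<odot>\<^bsub>B\<^esub> x, ?s d \<odot>\<^bsub>A\<^esub> y) \<in> H"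
        using HI[OF Gs[OF d 1(3)] K.m_closed[OF d 1(4)]] by simp
    next
      fix x y assume "(x, y) \<in> H"
      then obtain b a c where 1: "x = b \<oplus>\<^bsub>B\<^esub> ?s c \<odot>\<^bsub>B\<^esub> b0" "y = a \<oplus>\<^bsub>A\<^esub> ?s c \<odot>\<^bsub>A\<^esub> a0" "(b, a) \<in> G" "c \<in> carrier K"
        using HE by metis
      then show "F y = x" using Gc[OF 1(3)] GF[OF 1(3)] a0 by (simp add: F.add F_smult)
    next
      fix y assume "(\<zero>\<^bsub>B\<^esub>, y) \<in> H"
      then obtain b a c where 1: "\<zero>\<^bsub>B\<^esub> = b \<oplus>\<^bsub>B\<^esub> ?s c \<odot>\<^bsub>B\<^esub> b0" "y = a \<oplus>\<^bsub>A\<^esub> ?s c \<odot>\<^bsub>A\<^esub> a0" "(b, a) \<in> G" "c \<in> carrier K"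
        using HE by metis
      \<comment> \<open>Otherwise division by \<open>c\<close> would place \<open>b0\<close> in the
        domain of the maximal graph.\<close>
      have "c = \<zero>\<^bsub>K\<^esub>"
      proof (rule ccontr)
        assume "c \<noteq> \<zero>\<^bsub>K\<^esub>"
        then have u: "c \<in> Units K" using 1(4) K.field_Units by simp
        let ?d = "inv\<^bsub>K\<^esub> c"
        have d: "?d \<in> carrier K" "?d \<otimes>\<^bsub>K\<^esub> c = \<one>\<^bsub>K\<^esub>"
          using K.Units_inv_closed[OF u] K.Units_l_inv[OF u] by auto
        have scb: "?s c \<odot>\<^bsub>B\<^esub> b0 \<in> carrier B" using sR[OF 1(4)] b0 by simp
        have "?s c \<odot>\<^bsub>B\<^esub> b0 \<oplus>\<^bsub>B\<^esub> b = \<zero>\<^bsub>B\<^esub>"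
          unfolding 1(1) by (rule B.a_comm[OF scb Gc(1)[OF 1(3)]])
        then have sb: "?s c \<odot>\<^bsub>B\<^esub> b0 = \<ominus>\<^bsub>B\<^esub> b"
          using B.minus_equality Gc(1)[OF 1(3)] scb by simp
        have "b0 = ?s ?d \<odot>\<^bsub>B\<^esub> (?s c \<odot>\<^bsub>B\<^esub> b0)"
          using d b0 1(4) by (simp add: B.smult_assoc1[symmetric] mult_gen one_R[symmetric])
        then have "(b0, ?s ?d \<odot>\<^bsub>A\<^esub> (\<ominus>\<^bsub>A\<^esub> a)) \<in> G" using Gs[OF d(1) Gneg[OF 1(3)]] sb by simp
        then show False using no by blast
      qed
      then show "y = \<zero>\<^bsub>A\<^esub>" using 1 Gc[OF 1(3)] Gz b0 a0 by (simp add: R.bs_zero)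
    qed
    then have "H = G" using max GH by blast
    moreover have "(b0, a0) \<in> H"
      using HI[OF G0 K.one_closed] b0 a0 by (simp add: one_R[symmetric])
    ultimately show False using no by blast
  qed
  define s where "s b = (THE a. (b, a) \<in> G)" for b
  have sG: "(b, s b) \<in> G" if "b \<in> carrier B" for b
    unfolding s_def using dom[OF that] unique by (metis theI')
  have seq: "s b = a" if "(b, a) \<in> G" for b a
    using unique[OF that sG[OF Gc(1)[OF that]]] by simp
  show thesis
  proof (rule that[of s])
    show "add_map B A s"
      by unfold_locales (auto intro!: seq Gadd sG Gc(2)[OF sG])
    show "s (?s c \<odot>\<^bsub>B\<^esub> b) = ?s c \<odot>\<^bsub>A\<^esub> s b" if "c \<in> carrier K" "b \<in> carrier B" for c b
      by (rule seq[OF Gs[OF that(1) sG[OF that(2)]]])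
    show "F (s b) = b" if "b \<in> carrier B" for b by (rule GF[OF sG[OF that]])
  qed
qed


section \<open>Diagonal tensor products\<close>

locale diagonal = fm K M + C: left_module "monoid_algebra K M" C + V: left_module "monoid_algebra K M" V
  for K :: "('k, 'd) ring_scheme" and M :: "('m, 'c) monoid_scheme"
    and C :: "('m \<Rightarrow> 'k, 'a) module" and V :: "('m \<Rightarrow> 'k, 'v) module"
begin

abbreviation "sc c u \<equiv> e \<one>\<^bsub>M\<^esub> c \<odot>\<^bsub>C\<^esub> u"
abbreviation "VK \<equiv> underlying_vs K M V"
abbreviation "CV \<equiv> diagonal_tensor K M C V"

lemma VK_sel: "carrier VK = carrier V" "\<zero>\<^bsub>VK\<^esub> = \<zero>\<^bsub>V\<^esub>" "x \<oplus>\<^bsub>VK\<^esub> y = x \<oplus>\<^bsub>V\<^esub> y"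
  "c \<odot>\<^bsub>VK\<^esub> x = e \<one>\<^bsub>M\<^esub> c \<odot>\<^bsub>V\<^esub> x"
  by (simp_all add: underlying_vs_def scalar_mult_def)

lemma abelian_VK: "abelian_group VK"
  by (rule abelian_groupI) (auto simp: VK_sel V.a_ac intro: bexI[of _ "\<ominus>\<^bsub>V\<^esub> _"] V.l_neg)

lemma add_map_VK: "add_map VK E f \<longleftrightarrow> add_map V E f" "add_map E' VK f' \<longleftrightarrow> add_map E' V f'"
  using abelian_VK V.abelian_group_axioms by (simp_all add: add_map_def add_map_axioms_def VK_sel)

sublocale T: tensor K C "\<lambda>u c. scalar_mult K M C c u" "underlying_vs K M V" "diagonal_tensor K M C V"
proof (intro tensor.intro tensor_axioms.intro abelian_VK C.abelian_group_axioms)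
qed (auto simp: scalar_mult_def VK_sel diagonal_tensor_def K_tensor_group_def)

abbreviation "tn \<equiv> pure_tensor K C (\<lambda>u c. scalar_mult K M C c u) VK"

text \<open>With the coefficient in the left factor alone the operator is additive in it, as a
  module action requires; in both factors it would be quadratic.\<close>

definition act :: "'m \<Rightarrow> 'k \<Rightarrow> ('a \<times> 'v \<Rightarrow>\<^sub>0 int) set \<Rightarrow> ('a \<times> 'v \<Rightarrow>\<^sub>0 int) set" where
  "act m c = K_tensor_map K M C V (\<lambda>u. e m c \<odot>\<^bsub>C\<^esub> u) (\<lambda>v. e m \<one>\<^bsub>K\<^esub> \<odot>\<^bsub>V\<^esub> v)"

lemma tn_scalar:
  "\<lbrakk>u \<in> carrier C; c \<in> carrier K; v \<in> carrier V\<rbrakk> \<Longrightarrow> tn (sc c u) v = tn u (e \<one>\<^bsub>M\<^esub> c \<odot>\<^bsub>V\<^esub> v)"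
  using T.tn_balanced[of u c v] by (simp add: VK_sel scalar_mult_def)

lemma act_props:
  assumes m: "m \<in> carrier M" and c: "c \<in> carrier K"
  shows "add_map CV CV (act m c)"
    and "u \<in> carrier C \<Longrightarrow> v \<in> carrier V \<Longrightarrow>
      act m c (tn u v) = tn (e m c \<odot>\<^bsub>C\<^esub> u) (e m \<one>\<^bsub>K\<^esub> \<odot>\<^bsub>V\<^esub> v)"
proof -
  have ec: "e m c \<in> carrier R" and e1: "e m \<one>\<^bsub>K\<^esub> \<in> carrier R" using c by auto
  have bal: "tn (e m c \<odot>\<^bsub>C\<^esub> scalar_mult K M C d u) (e m \<one>\<^bsub>K\<^esub> \<odot>\<^bsub>V\<^esub> v) =
    tn (e m c \<odot>\<^bsub>C\<^esub> u) (e m \<one>\<^bsub>K\<^esub> \<odot>\<^bsub>V\<^esub> (d \<odot>\<^bsub>VK\<^esub> v))"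
    if "u \<in> carrier C" "d \<in> carrier K" "v \<in> carrier VK" for u d v
  proof -
    have v: "v \<in> carrier V" using that by (simp add: VK_sel)
    have "e m c \<odot>\<^bsub>C\<^esub> scalar_mult K M C d u = sc d (e m c \<odot>\<^bsub>C\<^esub> u)"
      using that m c by (simp add: scalar_mult_def C.smult_assoc1[symmetric] mult_gen K.m_comm)
    moreover have "e m \<one>\<^bsub>K\<^esub> \<odot>\<^bsub>V\<^esub> (d \<odot>\<^bsub>VK\<^esub> v) = e \<one>\<^bsub>M\<^esub> d \<odot>\<^bsub>V\<^esub> (e m \<one>\<^bsub>K\<^esub> \<odot>\<^bsub>V\<^esub> v)"
      using that v m by (simp add: VK_sel V.smult_assoc1[symmetric] mult_gen)
    ultimately show ?thesis using tn_scalar[of "e m c \<odot>\<^bsub>C\<^esub> u" d "e m \<one>\<^bsub>K\<^esub> \<odot>\<^bsub>V\<^esub> v"] that v ec e1 by simp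
  qed
  have am: "add_map VK VK (\<lambda>v. e m \<one>\<^bsub>K\<^esub> \<odot>\<^bsub>V\<^esub> v)"
    using V.smult_right_add_map[OF e1] by (simp add: add_map_VK)
  note tm = tensor_map[OF T.tensor_axioms T.tensor_axioms C.smult_right_add_map[OF ec] am]
  show "add_map CV CV (act m c)"
    unfolding act_def K_tensor_map_def using bal by (rule tm(1))
  show "act m c (tn u v) = tn (e m c \<odot>\<^bsub>C\<^esub> u) (e m \<one>\<^bsub>K\<^esub> \<odot>\<^bsub>V\<^esub> v)" if "u \<in> carrier C" "v \<in> carrier V"
    unfolding act_def K_tensor_map_def using bal by (rule tm(2)) (use that in \<open>auto simp: VK_sel\<close>)
qed

lemma act_zero:
  assumes m: "m \<in> carrier M" and t: "t \<in> carrier CV"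
  shows "act m \<zero>\<^bsub>K\<^esub> t = \<zero>\<^bsub>CV\<^esub>"
  using act_props(1)[OF m K.zero_closed] add_map_zero[OF T.abelian_D T.abelian_D] t
proof (rule T.add_map_eqI)
  fix u v assume "u \<in> carrier C" "v \<in> carrier VK"
  then show "act m \<zero>\<^bsub>K\<^esub> (tn u v) = \<zero>\<^bsub>CV\<^esub>"
    using m add_map.zero[OF T.tn_left] by (simp add: act_props(2) VK_sel R.bs_zero)
qed

lemma act_add:
  assumes m: "m \<in> carrier M" and c: "c \<in> carrier K" and d: "d \<in> carrier K" and t: "t \<in> carrier CV"
  shows "act m (c \<oplus>\<^bsub>K\<^esub> d) t = act m c t \<oplus>\<^bsub>CV\<^esub> act m d t"
  using act_props(1)[OF m K.a_closed[OF c d]] add_map_sum[OF act_props(1)[OF m c] act_props(1)[OF m d]] t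
proof (rule T.add_map_eqI)
  fix u v assume "u \<in> carrier C" "v \<in> carrier VK"
  then show "act m (c \<oplus>\<^bsub>K\<^esub> d) (tn u v) = act m c (tn u v) \<oplus>\<^bsub>CV\<^esub> act m d (tn u v)"
    using m c d by (simp add: act_props(2) VK_sel R.bs_add C.smult_l_distr add_map.add[OF T.tn_left])
qed

lemma diagonal_smult:
  assumes x: "x \<in> carrier R" and t: "t \<in> carrier CV"
  shows "x \<odot>\<^bsub>CV\<^esub> t = (\<Oplus>\<^bsub>CV\<^esub>m\<in>carrier M. act m (x m) t)"
proof -
  have cl: "act m (x m) t \<in> carrier CV" if "m \<in> carrier M" for m
    using add_map.closed[OF act_props(1)[OF that R.eval_closed[OF x that]] t] .
  have "x \<odot>\<^bsub>CV\<^esub> t = finprod (K_tensor_group K M C V) (\<lambda>m. act m (x m) t) (supp K (carrier M) x)"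
    by (simp add: diagonal_tensor_def act_def)
  also have "\<dots> = (\<Oplus>\<^bsub>CV\<^esub>m\<in>supp K (carrier M) x. act m (x m) t)"
    by (simp add: finsum_def finprod_def diagonal_tensor_def)
  also have "\<dots> = (\<Oplus>\<^bsub>CV\<^esub>m\<in>carrier M. act m (x m) t)"
    using finite_M cl t by (intro T.D.finsum_neutral[symmetric]) (auto simp: supp_def act_zero)
  finally show ?thesis .
qed

lemma diagonal_smult_gen:
  assumes m: "m \<in> carrier M" and c: "c \<in> carrier K" and t: "t \<in> carrier CV"
  shows "e m c \<odot>\<^bsub>CV\<^esub> t = act m c t"
proof -
  have "(\<Oplus>\<^bsub>CV\<^esub>n\<in>carrier M. act n (e m c n) t) = act m (e m c m) t"
    using m c t finite_M add_map.closed[OF act_props(1)[OF m c]]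
    by (intro T.D.finsum_single) (auto simp: R.bs_apply act_zero)
  then show ?thesis using diagonal_smult[of "e m c" t] m c t by (simp add: R.bs_apply)
qed

lemma smult_tn:
  "\<lbrakk>m \<in> carrier M; c \<in> carrier K; u \<in> carrier C; v \<in> carrier V\<rbrakk> \<Longrightarrow>
    e m c \<odot>\<^bsub>CV\<^esub> tn u v = tn (e m c \<odot>\<^bsub>C\<^esub> u) (e m \<one>\<^bsub>K\<^esub> \<odot>\<^bsub>V\<^esub> v)"
  by (simp add: diagonal_smult_gen act_props(2) VK_sel)

lemma left_module_CV: "left_module R CV"
proof (rule left_moduleI[OF T.abelian_D])
  have ac: "act m c t \<in> carrier CV" if "m \<in> carrier M" "c \<in> carrier K" "t \<in> carrier CV" for m c t
    using add_map.closed[OF act_props(1)[OF that(1,2)] that(3)] .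
  show cl: "x \<odot>\<^bsub>CV\<^esub> t \<in> carrier CV" if "x \<in> carrier R" "t \<in> carrier CV" for x t
    using that ac by (simp add: diagonal_smult, intro T.D.finsum_closed) (auto simp: R.eval_closed)
  show "add_map R CV (\<lambda>x. x \<odot>\<^bsub>CV\<^esub> t)" if t: "t \<in> carrier CV" for t
  proof (intro add_map.intro add_map_axioms.intro R.abelian_C T.abelian_D)
    fix x y assume xy: "x \<in> carrier R" "y \<in> carrier R"
    show "(x \<oplus>\<^bsub>R\<^esub> y) \<odot>\<^bsub>CV\<^esub> t = x \<odot>\<^bsub>CV\<^esub> t \<oplus>\<^bsub>CV\<^esub> y \<odot>\<^bsub>CV\<^esub> t"
      unfolding diagonal_smult[OF xy(1) t] diagonal_smult[OF xy(2) t] diagonal_smult[OF R.C.add.m_closed[OF xy] t]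
      using xy t ac
      by (subst T.D.finsum_addf[symmetric], simp add: R.eval_closed, simp add: R.eval_closed,
          intro T.D.finsum_cong' HOL.refl) (simp_all add: R.add_C R.eval_closed act_add)
  qed (use cl t in auto)
  show "add_map CV CV (\<lambda>t. x \<odot>\<^bsub>CV\<^esub> t)" if x: "x \<in> carrier R" for x
  proof (intro add_map.intro add_map_axioms.intro T.abelian_D)
    fix s t assume st: "s \<in> carrier CV" "t \<in> carrier CV"
    show "x \<odot>\<^bsub>CV\<^esub> (s \<oplus>\<^bsub>CV\<^esub> t) = x \<odot>\<^bsub>CV\<^esub> s \<oplus>\<^bsub>CV\<^esub> x \<odot>\<^bsub>CV\<^esub> t"
      unfolding diagonal_smult[OF x st(1)] diagonal_smult[OF x st(2)] diagonal_smult[OF x T.D.a_closed[OF st]]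
      using x st ac
      by (subst T.D.finsum_addf[symmetric], simp add: R.eval_closed, simp add: R.eval_closed,
          intro T.D.finsum_cong' HOL.refl) (simp_all add: R.eval_closed add_map.add[OF act_props(1)])
  qed (use cl x in auto)
  fix t assume t: "t \<in> carrier CV"
  show "e \<one>\<^bsub>M\<^esub> \<one>\<^bsub>K\<^esub> \<odot>\<^bsub>CV\<^esub> t = t"
    unfolding diagonal_smult_gen[OF M.one_closed K.one_closed t]
    using act_props(1)[OF M.one_closed K.one_closed] add_map_id[OF T.abelian_D] t
  proof (rule T.add_map_eqI)
    fix u v assume "u \<in> carrier C" "v \<in> carrier VK"
    then show "act \<one>\<^bsub>M\<^esub> \<one>\<^bsub>K\<^esub> (tn u v) = tn u v" by (simp add: act_props(2) VK_sel one_R[symmetric])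
  qed
  fix m n c d assume 1: "m \<in> carrier M" "n \<in> carrier M" "c \<in> carrier K" "d \<in> carrier K"
  have mn: "m \<otimes>\<^bsub>M\<^esub> n \<in> carrier M" "c \<otimes>\<^bsub>K\<^esub> d \<in> carrier K" using 1 by auto
  have "act m c (act n d t) = act (m \<otimes>\<^bsub>M\<^esub> n) (c \<otimes>\<^bsub>K\<^esub> d) t"
    using add_map_comp[OF act_props(1)[OF 1(2,4)] act_props(1)[OF 1(1,3)]] act_props(1)[OF mn] t
  proof (rule T.add_map_eqI)
    fix u v assume uv: "u \<in> carrier C" "v \<in> carrier VK"
    then show "act m c (act n d (tn u v)) = act (m \<otimes>\<^bsub>M\<^esub> n) (c \<otimes>\<^bsub>K\<^esub> d) (tn u v)"
      using 1 mn by (simp add: act_props(2) VK_sel C.smult_assoc1[symmetric] V.smult_assoc1[symmetric] mult_gen)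
  qed
  then show "e m c \<odot>\<^bsub>CV\<^esub> (e n d \<odot>\<^bsub>CV\<^esub> t) = e (m \<otimes>\<^bsub>M\<^esub> n) (c \<otimes>\<^bsub>K\<^esub> d) \<odot>\<^bsub>CV\<^esub> t"
    using 1 mn t ac by (simp add: diagonal_smult_gen)
qed

end

text \<open>Balancedness over \<open>K\<close> involves only the multiples of the identity of
  \<open>M\<close>. Hence \<open>f\<close> may be the cone, which does not commute with
  \<open>M\<close>.\<close>

lemma (in fm) diagonal_map:
  fixes C :: "('m \<Rightarrow> 'k, 'a) module" and D :: "('m \<Rightarrow> 'k, 'b) module" and V :: "('m \<Rightarrow> 'k, 'v) module"
  assumes "left_module R C" "left_module R D" "left_module R V" and f: "add_map C D f"
    and lin: "\<And>c u. c \<in> carrier K \<Longrightarrow> u \<in> carrier C \<Longrightarrow> f (e \<one>\<^bsub>M\<^esub> c \<odot>\<^bsub>C\<^esub> u) = e \<one>\<^bsub>M\<^esub> c \<odot>\<^bsub>D\<^esub> f u"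
  shows "add_map (diagonal_tensor K M C V) (diagonal_tensor K M D V) (K_tensor_map K M D V f (\<lambda>v. v))"
    and "u \<in> carrier C \<Longrightarrow> v \<in> carrier V \<Longrightarrow>
      K_tensor_map K M D V f (\<lambda>v. v) (pure_tensor K C (\<lambda>u c. scalar_mult K M C c u) (underlying_vs K M V) u v) =
      pure_tensor K D (\<lambda>u c. scalar_mult K M D c u) (underlying_vs K M V) (f u) v"
proof -
  interpret C: diagonal K M C V by (intro diagonal.intro fm_axioms assms)
  interpret D: diagonal K M D V by (intro diagonal.intro fm_axioms assms)
  have bal: "D.tn (f (scalar_mult K M C c u)) v = D.tn (f u) (c \<odot>\<^bsub>C.VK\<^esub> v)"
    if "u \<in> carrier C" "c \<in> carrier K" "v \<in> carrier C.VK" for u c v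
    using that lin D.tn_scalar[OF add_map.closed[OF f]] by (simp add: scalar_mult_def C.VK_sel)
  note tm = tensor_map[OF C.T.tensor_axioms D.T.tensor_axioms f add_map_id[OF C.abelian_VK]]
  show "add_map C.CV D.CV (K_tensor_map K M D V f (\<lambda>v. v))"
    unfolding K_tensor_map_def using bal by (rule tm(1))
  show "K_tensor_map K M D V f (\<lambda>v. v) (C.tn u v) = D.tn (f u) v" if "u \<in> carrier C" "v \<in> carrier V"
    unfolding K_tensor_map_def using bal by (rule tm(2)) (use that in \<open>auto simp: C.VK_sel\<close>)
qed


section \<open>Coefficients in a module over a group algebra\<close>

lemma projective_moduleD:
  fixes A :: "('r, 'x) module" and B :: "('r, 'y) module"
  assumes "projective_module TYPE('x) TYPE('y) R P" "f \<in> left_module_hom R A B" "g \<in> left_module_hom R P B"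
    "left_module R A" "left_module R B" "f ` carrier A = carrier B"
  shows "\<exists>h\<in>left_module_hom R P A. \<forall>p\<in>carrier P. f (h p) = g p"
  using assms by (simp add: projective_module_def)

text \<open>\<open>U\<close> is an arbitrary group, possibly infinite, so the results of
  \<open>fspace\<close> cannot be applied to its group algebra; elements of the latter enter through
  \<open>eU\<close> and through the image of the monoid algebra.\<close>

locale inflated = fm K M + U: group U + KU: left_module "monoid_algebra K U" V
  for K :: "('k, 'd) ring_scheme" and M :: "('m, 'c) monoid_scheme"
    and U :: "('g, 'f) monoid_scheme" and V :: "('g \<Rightarrow> 'k, 'v) module" +
  fixes \<psi> :: "'m \<Rightarrow> 'g"
  assumes \<psi>: "\<psi> \<in> hom M U"
begin

abbreviation "eU \<equiv> basis_scaled K (carrier U)"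
abbreviation "V' \<equiv> inflation K M U \<psi> V"

lemma \<psi>_closed: "m \<in> carrier M \<Longrightarrow> \<psi> m \<in> carrier U"
  and \<psi>_mult: "m \<in> carrier M \<Longrightarrow> n \<in> carrier M \<Longrightarrow> \<psi> (m \<otimes>\<^bsub>M\<^esub> n) = \<psi> m \<otimes>\<^bsub>U\<^esub> \<psi> n"
  using \<psi> by (auto simp: hom_def)

lemma \<psi>_one: "\<psi> \<one>\<^bsub>M\<^esub> = \<one>\<^bsub>U\<^esub>"
  using \<psi>_mult[of "\<one>\<^bsub>M\<^esub>" "\<one>\<^bsub>M\<^esub>"] \<psi>_closed[of "\<one>\<^bsub>M\<^esub>"] U.l_cancel_one by fastforce

lemma KU_sel: "carrier (monoid_algebra K U) = fin_supp_funs K (carrier U)"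
  "x \<oplus>\<^bsub>monoid_algebra K U\<^esub> y = (\<lambda>g\<in>carrier U. x g \<oplus>\<^bsub>K\<^esub> y g)"
  "\<one>\<^bsub>monoid_algebra K U\<^esub> = eU \<one>\<^bsub>U\<^esub> \<one>\<^bsub>K\<^esub>"
  by (simp_all add: monoid_algebra_def)

lemma eU_closed: "c \<in> carrier K \<Longrightarrow> eU g c \<in> carrier (monoid_algebra K U)"
proof -
  assume c: "c \<in> carrier K"
  have "supp K (carrier U) (eU g c) \<subseteq> {g}" by (auto simp: supp_def basis_scaled_def)
  then have "finite (supp K (carrier U) (eU g c))" by (rule finite_subset) simp
  then show ?thesis using c by (auto simp: KU_sel fin_supp_funs_def basis_scaled_def)
qed

lemma eU_mult: "\<lbrakk>g \<in> carrier U; h \<in> carrier U; c \<in> carrier K; d \<in> carrier K\<rbrakk> \<Longrightarrow>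
    eU g c \<otimes>\<^bsub>monoid_algebra K U\<^esub> eU h d = eU (g \<otimes>\<^bsub>U\<^esub> h) (c \<otimes>\<^bsub>K\<^esub> d)"
  by (rule monoid_algebra_mult_gen[OF K.field_axioms])

text \<open>The map from KM to KU induced by \<open>\<psi>\<close>. Summing over the fibres of
  \<open>\<psi>\<close> instead of supports makes its additivity visible.\<close>

definition push :: "('m \<Rightarrow> 'k) \<Rightarrow> 'g \<Rightarrow> 'k" where
  "push x = (\<lambda>g\<in>carrier U. \<Oplus>\<^bsub>K\<^esub>m\<in>{m \<in> carrier M. \<psi> m = g}. x m)"

lemma push_eq:
  assumes "x \<in> carrier R"
  shows "(\<lambda>g\<in>carrier U. \<Oplus>\<^bsub>K\<^esub>m\<in>{m \<in> supp K (carrier M) x. \<psi> m = g}. x m) = push x"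
  unfolding push_def
  by (rule restrict_ext, rule K.finsum_neutral[symmetric])
    (use assms finite_M in \<open>auto simp: supp_def R.eval_closed\<close>)

lemma push_add_map: "add_map R (monoid_algebra K U) push"
proof (intro add_map.intro add_map_axioms.intro R.abelian_C KU.R.abelian_group_axioms)
  fix x assume x: "x \<in> carrier R"
  have "supp K (carrier U) (push x) \<subseteq> \<psi> ` carrier M"
  proof
    fix g assume g: "g \<in> supp K (carrier U) (push x)"
    show "g \<in> \<psi> ` carrier M"
    proof (rule ccontr)
      assume "g \<notin> \<psi> ` carrier M"
      then have "{m \<in> carrier M. \<psi> m = g} = {}" by auto
      then have "push x g = \<zero>\<^bsub>K\<^esub>" if "g \<in> carrier U" using that by (simp only: push_def restrict_apply' K.finsum_empty)
      then show False using g by (simp add: supp_def)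
    qed
  qed
  then have "finite (supp K (carrier U) (push x))" by (rule finite_subset) (use finite_M in simp)
  moreover have "push x \<in> carrier U \<rightarrow>\<^sub>E carrier K"
    using x by (auto simp: push_def R.eval_closed intro!: K.finsum_closed)
  ultimately show "push x \<in> carrier (monoid_algebra K U)" by (simp add: KU_sel fin_supp_funs_def)
next
  fix x y assume xy: "x \<in> carrier R" "y \<in> carrier R"
  show "push (x \<oplus>\<^bsub>R\<^esub> y) = push x \<oplus>\<^bsub>monoid_algebra K U\<^esub> push y"
    unfolding KU_sel
    by (simp only: push_def, rule restrict_ext, simp only: restrict_apply', subst K.finsum_addf[symmetric])
      (use xy in \<open>auto simp: R.add_C R.eval_closed simp del: K.add.finprod_multf intro!: K.finsum_cong'\<close>)
qed

lemma push_gen: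
  assumes m: "m \<in> carrier M" and c: "c \<in> carrier K"
  shows "push (e m c) = eU (\<psi> m) c"
  unfolding push_def basis_scaled_def[of K "carrier U"]
proof (rule restrict_ext)
  fix g assume g: "g \<in> carrier U"
  have "(\<Oplus>\<^bsub>K\<^esub>n\<in>{n \<in> carrier M. \<psi> n = g}. e m c n) = (\<Oplus>\<^bsub>K\<^esub>n\<in>(if g = \<psi> m then {m} else {}). e m c n)"
    using m c finite_M by (intro K.finsum_neutral) (auto simp: R.bs_apply split: if_splits)
  then show "(\<Oplus>\<^bsub>K\<^esub>n\<in>{n \<in> carrier M. \<psi> n = g}. e m c n) = (if g = \<psi> m then c else \<zero>\<^bsub>K\<^esub>)"
    using m c by (simp add: K.finsum_insert R.bs_apply)
qed

lemma V'_sel: "carrier V' = carrier V" "\<zero>\<^bsub>V'\<^esub> = \<zero>\<^bsub>V\<^esub>" "v \<oplus>\<^bsub>V'\<^esub> w = v \<oplus>\<^bsub>V\<^esub> w"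
  "x \<in> carrier R \<Longrightarrow> x \<odot>\<^bsub>V'\<^esub> v = push x \<odot>\<^bsub>V\<^esub> v"
  by (simp_all add: inflation_def push_eq)

lemma V'_gen: "m \<in> carrier M \<Longrightarrow> c \<in> carrier K \<Longrightarrow> e m c \<odot>\<^bsub>V'\<^esub> v = eU (\<psi> m) c \<odot>\<^bsub>V\<^esub> v"
  by (simp add: V'_sel push_gen)

lemma abelian_V': "abelian_group V'"
  by (rule abelian_groupI) (auto simp: V'_sel KU.M.a_ac intro: bexI[of _ "\<ominus>\<^bsub>V\<^esub> _"] KU.M.l_neg)

lemma add_map_V': "add_map V' E h \<longleftrightarrow> add_map V E h" "add_map E' V' h' \<longleftrightarrow> add_map E' V h'"
  using abelian_V' KU.M.abelian_group_axioms by (simp_all add: add_map_def add_map_axioms_def V'_sel)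

lemma left_module_V': "left_module R V'"
proof (rule left_moduleI[OF abelian_V'])
  show cl: "x \<odot>\<^bsub>V'\<^esub> v \<in> carrier V'" if "x \<in> carrier R" "v \<in> carrier V'" for x v
    using that add_map.closed[OF push_add_map] by (simp add: V'_sel)
  show "add_map R V' (\<lambda>x. x \<odot>\<^bsub>V'\<^esub> v)" if "v \<in> carrier V'" for v
    using that cl add_map.closed[OF push_add_map] R.C.add.m_closed
    by (intro add_map.intro add_map_axioms.intro R.abelian_C abelian_V')
      (auto simp: V'_sel add_map.add[OF push_add_map] KU.smult_l_distr)
  show "add_map V' V' (\<lambda>v. x \<odot>\<^bsub>V'\<^esub> v)" if "x \<in> carrier R" for x
    using that cl add_map.closed[OF push_add_map]
    by (intro add_map.intro add_map_axioms.intro abelian_V') (auto simp: V'_sel KU.smult_r_distr)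
  fix v assume v: "v \<in> carrier V'"
  show "e \<one>\<^bsub>M\<^esub> \<one>\<^bsub>K\<^esub> \<odot>\<^bsub>V'\<^esub> v = v"
    using v KU.smult_one[of v] by (simp add: V'_gen \<psi>_one V'_sel(1) KU_sel(3))
  fix m n c d assume 1: "m \<in> carrier M" "n \<in> carrier M" "c \<in> carrier K" "d \<in> carrier K"
  then show "e m c \<odot>\<^bsub>V'\<^esub> (e n d \<odot>\<^bsub>V'\<^esub> v) = e (m \<otimes>\<^bsub>M\<^esub> n) (c \<otimes>\<^bsub>K\<^esub> d) \<odot>\<^bsub>V'\<^esub> v"
    using v by (simp add: V'_gen V'_sel(1) KU.smult_assoc1[symmetric] eU_closed eU_mult \<psi>_closed \<psi>_mult)
qed

sublocale V': left_module "monoid_algebra K M" "inflation K M U \<psi> V" by (rule left_module_V')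

sublocale D: diagonal K M "based_module K M (strict_chains (principal_right_ideals M) q) mact" "inflation K M U \<psi> V"
  for q :: nat
  by (intro diagonal.intro fm_axioms Q.left_module_C left_module_V')

abbreviation "CV q \<equiv> diagonal_tensor K M (CM q) V'"
abbreviation "tn q \<equiv> pure_tensor K (CM q) (\<lambda>u c. scalar_mult K M (CM q) c u) (underlying_vs K M V')"

lemma chain_module_coeff_eq: "chain_module_coeff K M V' q = CV q"
  by (simp add: chain_module_coeff_def chain_module_eq)

lemma boundary_coeff:
  shows "add_map (CV (Suc q)) (CV q) (boundary_coeff K M V' q)"
    and "u \<in> carrier (CM (Suc q)) \<Longrightarrow> v \<in> carrier V \<Longrightarrow>
      boundary_coeff K M V' q (tn (Suc q) u v) = tn q (boundary K M q u) v"
  unfolding boundary_coeff_def chain_module_eq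
  using diagonal_map[OF Q.left_module_C Q.left_module_C left_module_V' boundary_add_map]
    left_module_hom_smult[OF boundary_hom] by (auto simp: V'_sel)

lemma boundary_coeff_hom: "boundary_coeff K M V' q \<in> left_module_hom R (CV (Suc q)) (CV q)"
proof (rule left_module_homI[OF D.left_module_CV D.left_module_CV boundary_coeff(1)])
  let ?d = "boundary_coeff K M V' q"
  fix m c t assume m: "m \<in> carrier M" and c: "c \<in> carrier K" and t: "t \<in> carrier (CV (Suc q))"
  interpret A: left_module R "CV (Suc q)" by (rule D.left_module_CV)
  interpret B: left_module R "CV q" by (rule D.left_module_CV)
  have ec: "e m c \<in> carrier R" using c by simp
  show "?d (e m c \<odot>\<^bsub>CV (Suc q)\<^esub> t) = e m c \<odot>\<^bsub>CV q\<^esub> ?d t"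
    using add_map_comp[OF A.smult_right_add_map[OF ec] boundary_coeff(1)]
      add_map_comp[OF boundary_coeff(1) B.smult_right_add_map[OF ec]] t
  proof (rule D.T.add_map_eqI)
    fix u v assume "u \<in> carrier (CM (Suc q))" "v \<in> carrier (underlying_vs K M V')"
    then have u: "u \<in> carrier (CM (Suc q))" and v: "v \<in> carrier V'" by (auto simp: D.VK_sel)
    have "e m \<one>\<^bsub>K\<^esub> \<odot>\<^bsub>V'\<^esub> v \<in> carrier V" using V'.smult_closed[of "e m \<one>\<^bsub>K\<^esub>" v] v by (simp add: V'_sel(1))
    then show "?d (e m c \<odot>\<^bsub>CV (Suc q)\<^esub> tn (Suc q) u v) = e m c \<odot>\<^bsub>CV q\<^esub> ?d (tn (Suc q) u v)"
      using u v ec m c add_map.closed[OF boundary_add_map u]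
      by (simp add: D.smult_tn boundary_coeff(2) V'_sel(1) left_module_hom_smult[OF boundary_hom])
  qed
qed

lemma augmentation_coeff:
  shows "add_map (CV 0) V' (augmentation_coeff K M V')"
    and "u \<in> carrier (CM 0) \<Longrightarrow> v \<in> carrier V' \<Longrightarrow>
      augmentation_coeff K M V' (tn 0 u v) = e \<one>\<^bsub>M\<^esub> (augmentation K M u) \<odot>\<^bsub>V'\<^esub> v"
proof -
  let ?b = "\<lambda>u v. scalar_mult K M V' (augmentation K M u) v"
  have ac: "augmentation K M u \<in> carrier K" if "u \<in> carrier (CM 0)" for u
    using add_map.closed[OF augmentation_add_map that] .
  have l: "add_map (CM 0) V' (\<lambda>u. ?b u v)" if "v \<in> carrier (underlying_vs K M V')" for v
    using that unfolding scalar_mult_def D.VK_sel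
    by (intro add_map_comp[OF augmentation_add_map add_map_comp[OF R.bs_add_map V'.smult_left_add_map]])
  have r: "add_map (underlying_vs K M V') V' (\<lambda>v. ?b u v)" if "u \<in> carrier (CM 0)" for u
    unfolding D.add_map_VK scalar_mult_def using ac[OF that] by (intro V'.smult_right_add_map) simp
  have bal: "?b (scalar_mult K M (CM 0) c u) v = ?b u (c \<odot>\<^bsub>underlying_vs K M V'\<^esub> v)"
    if "u \<in> carrier (CM 0)" "c \<in> carrier K" "v \<in> carrier (underlying_vs K M V')" for u c v
  proof -
    have v: "v \<in> carrier V'" using that by (simp add: D.VK_sel)
    have "augmentation K M (e \<one>\<^bsub>M\<^esub> c \<odot>\<^bsub>CM 0\<^esub> u) = c \<otimes>\<^bsub>K\<^esub> augmentation K M u"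
      using left_module_hom_smult[OF augmentation_hom, of "e \<one>\<^bsub>M\<^esub> c" u] that by (simp add: trivial_smult_gen)
    then show ?thesis
      using that v ac by (simp add: scalar_mult_def D.VK_sel V'.smult_assoc1[symmetric] mult_gen K.m_comm)
  qed
  show "add_map (CV 0) V' (augmentation_coeff K M V')"
    unfolding augmentation_coeff_def
    by (rule D.T.tensor_lift(1)[OF V'.abelian_group_axioms]) (rule l r bal; assumption)+
  show "augmentation_coeff K M V' (tn 0 u v) = e \<one>\<^bsub>M\<^esub> (augmentation K M u) \<odot>\<^bsub>V'\<^esub> v"
    if u: "u \<in> carrier (CM 0)" and v: "v \<in> carrier V'"
  proof -
    have v': "v \<in> carrier (underlying_vs K M V')" using v by (simp add: D.VK_sel)
    have "augmentation_coeff K M V' (tn 0 u v) = ?b u v"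
      unfolding augmentation_coeff_def
      by (rule D.T.tensor_lift(2)[OF V'.abelian_group_axioms]) (rule l r bal u v'; assumption?)+
    then show ?thesis by (simp add: scalar_mult_def)
  qed
qed

lemma augmentation_smult: "m \<in> carrier M \<Longrightarrow> c \<in> carrier K \<Longrightarrow> u \<in> carrier (CM 0) \<Longrightarrow>
    augmentation K M (e m c \<odot>\<^bsub>CM 0\<^esub> u) = c \<otimes>\<^bsub>K\<^esub> augmentation K M u"
  using left_module_hom_smult[OF augmentation_hom, of "e m c" u] by (simp add: trivial_smult_gen)

lemma augmentation_coeff_hom: "augmentation_coeff K M V' \<in> left_module_hom R (CV 0) V'"
proof (rule left_module_homI[OF D.left_module_CV left_module_V' augmentation_coeff(1)])
  fix m c t assume m: "m \<in> carrier M" and c: "c \<in> carrier K" and t: "t \<in> carrier (CV 0)"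
  interpret A: left_module R "CV 0" by (rule D.left_module_CV)
  have ec: "e m c \<in> carrier R" and e1: "e m \<one>\<^bsub>K\<^esub> \<in> carrier R" using c by auto
  show "augmentation_coeff K M V' (e m c \<odot>\<^bsub>CV 0\<^esub> t) = e m c \<odot>\<^bsub>V'\<^esub> augmentation_coeff K M V' t"
    using add_map_comp[OF A.smult_right_add_map[OF ec] augmentation_coeff(1)]
      add_map_comp[OF augmentation_coeff(1) V'.smult_right_add_map[OF ec]] t
  proof (rule D.T.add_map_eqI)
    fix u v assume "u \<in> carrier (CM 0)" "v \<in> carrier (underlying_vs K M V')"
    then have u: "u \<in> carrier (CM 0)" and v: "v \<in> carrier V'" by (auto simp: D.VK_sel)
    have a: "augmentation K M u \<in> carrier K" by (rule add_map.closed[OF augmentation_add_map u])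
    have "augmentation_coeff K M V' (e m c \<odot>\<^bsub>CV 0\<^esub> tn 0 u v) =
      e \<one>\<^bsub>M\<^esub> (c \<otimes>\<^bsub>K\<^esub> augmentation K M u) \<odot>\<^bsub>V'\<^esub> (e m \<one>\<^bsub>K\<^esub> \<odot>\<^bsub>V'\<^esub> v)"
      using u v m c ec e1 by (simp add: D.smult_tn augmentation_coeff(2) augmentation_smult)
    also have "\<dots> = e m c \<odot>\<^bsub>V'\<^esub> (e \<one>\<^bsub>M\<^esub> (augmentation K M u) \<odot>\<^bsub>V'\<^esub> v)"
      using v m c a by (simp add: V'.smult_assoc1[symmetric] mult_gen)
    finally show "augmentation_coeff K M V' (e m c \<odot>\<^bsub>CV 0\<^esub> tn 0 u v) =
      e m c \<odot>\<^bsub>V'\<^esub> augmentation_coeff K M V' (tn 0 u v)"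
      using u v by (simp add: augmentation_coeff(2))
  qed
qed

text \<open>The cone changes coefficients by a sign only; this is the linearity that allows
  tensoring it with \<open>V\<close>.\<close>

lemma cone_scalar:
  assumes c: "c \<in> carrier K" and u: "u \<in> carrier (CM q)"
  shows "cone q (e \<one>\<^bsub>M\<^esub> c \<odot>\<^bsub>CM q\<^esub> u) = e \<one>\<^bsub>M\<^esub> c \<odot>\<^bsub>CM (Suc q)\<^esub> cone q u"
proof -
  have ec: "e \<one>\<^bsub>M\<^esub> c \<in> carrier R" using c by simp
  show ?thesis
    using add_map_comp[OF Q.CM.smult_right_add_map[OF ec] cone_add_map]
      add_map_comp[OF cone_add_map Q.CM.smult_right_add_map[OF ec]] u
  proof (rule Q.C.add_map_eqI)
    fix \<sigma> d assume s: "\<sigma> \<in> Ch q" and d: "d \<in> carrier K"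
    show "cone q (e \<one>\<^bsub>M\<^esub> c \<odot>\<^bsub>CM q\<^esub> bq q \<sigma> d) = e \<one>\<^bsub>M\<^esub> c \<odot>\<^bsub>CM (Suc q)\<^esub> cone q (bq q \<sigma> d)"
      using s c d ec Ch_snoc[OF s]
      by (cases "last \<sigma> = carrier M") (simp_all add: Q.smult_gen Q.act_one cone_bs sg_mult)
  qed
qed

text \<open>The homotopy is the cone tensored with the identity of \<open>V\<close>, and the section
  of the augmentation tensors a vector with the apex. On pure tensors all identities reduce to those
  without coefficients.\<close>

theorem resolution_coeff:
  "resolution R (chain_module_coeff K M V') (boundary_coeff K M V') (augmentation_coeff K M V') V'"
proof -
  let ?s = "\<lambda>q. K_tensor_map K M (CM (Suc q)) V' (cone q) (\<lambda>v. v)"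
  let ?\<tau> = "bq 0 [carrier M] \<one>\<^bsub>K\<^esub>"
  have s: "add_map (CV q) (CV (Suc q)) (?s q)"
    and st: "u \<in> carrier (CM q) \<Longrightarrow> v \<in> carrier V' \<Longrightarrow> ?s q (tn q u v) = tn (Suc q) (cone q u) v" for q u v
    using diagonal_map[OF Q.left_module_C Q.left_module_C left_module_V' cone_add_map] cone_scalar by auto
  have T: "[carrier M] \<in> Ch 0" by (simp add: Ch_0 M.top_principal)
  have \<tau>: "?\<tau> \<in> carrier (CM 0)" by simp
  have t: "add_map V' (CV 0) (tn 0 ?\<tau>)" using D.T.tn_right[OF \<tau>] by (simp add: D.add_map_VK)
  have bt: "boundary_coeff K M V' q (tn (Suc q) u v) = tn q (boundary K M q u) v"
    if "u \<in> carrier (CM (Suc q))" "v \<in> carrier V'" for q u v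
    using boundary_coeff(2) that by (simp add: V'_sel)
  note bc = add_map.closed[OF boundary_add_map] and cc = add_map.closed[OF cone_add_map]
  have tl: "add_map (CM q) (CV q) (\<lambda>u. tn q u v)" if "v \<in> carrier V'" for q v
    using D.T.tn_left that by (simp add: D.VK_sel)
  show ?thesis
  proof (rule resolutionI[where s = ?s and t = "tn 0 ?\<tau>"], unfold chain_module_coeff_eq)
    show "augmentation_coeff K M V' (tn 0 ?\<tau> y) = y" if "y \<in> carrier V'" for y
      using that T V'.smult_one[OF that] by (simp add: augmentation_coeff(2) augmentation_bs one_R)
    show "augmentation_coeff K M V' (boundary_coeff K M V' 0 x) = \<zero>\<^bsub>V'\<^esub>" if x: "x \<in> carrier (CV 1)" for x
    proof -
      have x': "x \<in> carrier (CV (Suc 0))" using x by simp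
      show ?thesis
        using add_map_comp[OF boundary_coeff(1) augmentation_coeff(1)]
          add_map_zero[OF D.T.abelian_D V'.abelian_group_axioms] x'
      proof (rule D.T.add_map_eqI)
        fix u v assume "u \<in> carrier (CM (Suc 0))" "v \<in> carrier (underlying_vs K M V')"
        then have u: "u \<in> carrier (CM (Suc 0))" and v: "v \<in> carrier V'" by (auto simp: D.VK_sel)
        then show "augmentation_coeff K M V' (boundary_coeff K M V' 0 (tn (Suc 0) u v)) = \<zero>\<^bsub>V'\<^esub>"
          using augmentation_boundary[of u] bc[OF u] by (simp add: bt augmentation_coeff(2) R.bs_zero)
      qed
    qed
    show "boundary_coeff K M V' q (boundary_coeff K M V' (Suc q) x) = \<zero>\<^bsub>CV q\<^esub>"
      if x: "x \<in> carrier (CV (Suc (Suc q)))" for q x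
      using add_map_comp[OF boundary_coeff(1) boundary_coeff(1)]
        add_map_zero[OF D.T.abelian_D D.T.abelian_D] x
    proof (rule D.T.add_map_eqI)
      fix u v assume "u \<in> carrier (CM (Suc (Suc q)))" "v \<in> carrier (underlying_vs K M V')"
      then have u: "u \<in> carrier (CM (Suc (Suc q)))" and v: "v \<in> carrier V'" by (auto simp: D.VK_sel)
      show "boundary_coeff K M V' q (boundary_coeff K M V' (Suc q) (tn (Suc (Suc q)) u v)) = \<zero>\<^bsub>CV q\<^esub>"
        using u v bc[OF u] add_map.zero[OF tl[OF v]] by (simp add: bt boundary_boundary)
    qed
    show "boundary_coeff K M V' 0 (?s 0 x) \<oplus>\<^bsub>CV 0\<^esub> tn 0 ?\<tau> (augmentation_coeff K M V' x) = x"
      if x: "x \<in> carrier (CV 0)" for x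
      using add_map_sum[OF add_map_comp[OF s boundary_coeff(1)] add_map_comp[OF augmentation_coeff(1) t]]
        add_map_id[OF D.T.abelian_D] x
    proof (rule D.T.add_map_eqI)
      fix u v assume "u \<in> carrier (CM 0)" "v \<in> carrier (underlying_vs K M V')"
      then have u: "u \<in> carrier (CM 0)" and v: "v \<in> carrier V'" by (auto simp: D.VK_sel)
      have a: "augmentation K M u \<in> carrier K" by (rule add_map.closed[OF augmentation_add_map u])
      have "tn 0 ?\<tau> (augmentation_coeff K M V' (tn 0 u v)) = tn 0 (e \<one>\<^bsub>M\<^esub> (augmentation K M u) \<odot>\<^bsub>CM 0\<^esub> ?\<tau>) v"
        using D.tn_scalar[OF \<tau> a v] by (simp add: augmentation_coeff(2)[OF u v])
      also have "e \<one>\<^bsub>M\<^esub> (augmentation K M u) \<odot>\<^bsub>CM 0\<^esub> ?\<tau> = bq 0 [carrier M] (augmentation K M u)"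
        using a T by (simp add: Q.smult_gen Q.act_one)
      finally show "boundary_coeff K M V' 0 (?s 0 (tn 0 u v)) \<oplus>\<^bsub>CV 0\<^esub>
          tn 0 ?\<tau> (augmentation_coeff K M V' (tn 0 u v)) = tn 0 u v"
        using u v a cc[OF u] bc[OF cc[OF u]] cone_homotopy_0[OF u] add_map.add[OF tl[OF v], symmetric]
        by (simp add: st bt)
    qed
    show "boundary_coeff K M V' (Suc q) (?s (Suc q) x) \<oplus>\<^bsub>CV (Suc q)\<^esub> ?s q (boundary_coeff K M V' q x) = x"
      if x: "x \<in> carrier (CV (Suc q))" for q x
      using add_map_sum[OF add_map_comp[OF s boundary_coeff(1)] add_map_comp[OF boundary_coeff(1) s]]
        add_map_id[OF D.T.abelian_D] x
    proof (rule D.T.add_map_eqI)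
      fix u v assume "u \<in> carrier (CM (Suc q))" "v \<in> carrier (underlying_vs K M V')"
      then have u: "u \<in> carrier (CM (Suc q))" and v: "v \<in> carrier V'" by (auto simp: D.VK_sel)
      show "boundary_coeff K M V' (Suc q) (?s (Suc q) (tn (Suc q) u v)) \<oplus>\<^bsub>CV (Suc q)\<^esub>
          ?s q (boundary_coeff K M V' q (tn (Suc q) u v)) = tn (Suc q) u v"
        using u v cc[OF u] bc[OF cc[OF u]] bc[OF u] cc[OF bc[OF u]] cone_homotopy[OF u]
          add_map.add[OF tl[OF v], symmetric] by (simp add: st bt)
    qed
  qed (auto simp: D.left_module_CV left_module_V' boundary_coeff_hom augmentation_coeff_hom s t)
qed

text \<open>A section of the action map \<open>K[M \<times> X] \<rightarrow> K[X]\<close>, where \<open>M\<close> acts on the left factor only, turns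
  linear lifts on \<open>K[X] \<otimes> V\<close> into equivariant ones; the twist by \<open>\<psi>\<close> is undone by inverses in the group.\<close>

theorem projective_coeff:
  assumes regular: "regular_monoid M"
    and char: "\<forall>f\<in>idempotents M. \<not> ring_char K dvd order (maximal_subgroup M f)"
    and sandwich: "\<forall>a\<in>carrier M. sandwich_right_invertible K M (J_class M a)"
  shows "projective_module TYPE('x) TYPE('y) R (CV q)"
proof -
  \<comment> \<open>The free module on the chains: \<open>M\<close> multiplies the first entry and
    ignores the chain, so the action is total.\<close>
  define actX where "actX n p = Some (n \<otimes>\<^bsub>M\<^esub> fst p, snd p)" for n :: 'm and p :: "'m \<times> 'm set list"
  let ?X = "carrier M \<times> Ch q"
  have based_X: "based K M ?X actX"
    by (intro based.intro based_axioms.intro fm_axioms)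
      (auto simp: actX_def M.m_assoc finite_M finite_Ch)
  interpret X: based K M ?X actX by (rule based_X)
  define \<pi> where "\<pi> = linext (CM q) ?X (\<lambda>p c. e (fst p) c \<odot>\<^bsub>CM q\<^esub> bq q (snd p) \<one>\<^bsub>K\<^esub>)"
  have gen: "add_map K (CM q) (\<lambda>c. e (fst p) c \<odot>\<^bsub>CM q\<^esub> bq q (snd p) \<one>\<^bsub>K\<^esub>)" for p :: "'m \<times> 'm set list"
    by (rule add_map_comp[OF R.bs_add_map Q.CM.smult_left_add_map]) simp
  have \<pi>: "add_map X.C (CM q) \<pi>"
    unfolding \<pi>_def by (rule X.C.linext_add_map[OF Q.C.abelian_C subset_refl gen])
  have \<pi>b: "\<pi> (X.\<beta> (m, \<sigma>) c) = e m c \<odot>\<^bsub>CM q\<^esub> bq q \<sigma> \<one>\<^bsub>K\<^esub>"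
    if "m \<in> carrier M" "\<sigma> \<in> Ch q" "c \<in> carrier K" for m \<sigma> c
    unfolding \<pi>_def using X.C.linext_bs[OF Q.C.abelian_C subset_refl gen that(3), of "(m, \<sigma>)"] that by simp
  have \<pi>hom: "\<pi> \<in> left_module_hom R X.C (CM q)"
  proof (rule left_module_hom_basedI[OF based_X Q.left_module_C \<pi>])
    fix n c p d assume 1: "n \<in> carrier M" "c \<in> carrier K" "p \<in> ?X" "d \<in> carrier K"
    then obtain m \<sigma> where p: "p = (m, \<sigma>)" "m \<in> carrier M" "\<sigma> \<in> Ch q" by auto
    show "e n c \<odot>\<^bsub>CM q\<^esub> \<pi> (X.\<beta> p d) =
      (case actX n p of None \<Rightarrow> \<zero>\<^bsub>CM q\<^esub> | Some b' \<Rightarrow> \<pi> (X.\<beta> b' (c \<otimes>\<^bsub>K\<^esub> d)))"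
      using 1 p by (simp add: actX_def \<pi>b Q.CM.smult_assoc1[symmetric] mult_gen)
  qed
  have \<pi>surj: "\<pi> ` carrier X.C = carrier (CM q)"
  proof
    show "\<pi> ` carrier X.C \<subseteq> carrier (CM q)" using add_map.closed[OF \<pi>] by blast
    show "carrier (CM q) \<subseteq> \<pi> ` carrier X.C"
    proof
      fix u assume "u \<in> carrier (CM q)"
      then show "u \<in> \<pi> ` carrier X.C"
      proof (induction rule: Q.C.C_induct)
        case zero
        show ?case using add_map.zero[OF \<pi>] X.C.C.zero_closed by (metis imageI)
      next
        case (bs \<sigma> c)
        then have "\<pi> (X.\<beta> (\<one>\<^bsub>M\<^esub>, \<sigma>) c) = bq q \<sigma> c"
          by (simp add: \<pi>b Q.smult_gen Q.act_one)
        then show ?case using X.C.bs_closed[OF bs(2)] by (metis imageI)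
      next
        case (add u v)
        then obtain x y where "x \<in> carrier X.C" "u = \<pi> x" "y \<in> carrier X.C" "v = \<pi> y" by blast
        then have "u \<oplus>\<^bsub>CM q\<^esub> v = \<pi> (x \<oplus>\<^bsub>X.C\<^esub> y)" "x \<oplus>\<^bsub>X.C\<^esub> y \<in> carrier X.C"
          by (simp_all add: add_map.add[OF \<pi>])
        then show ?case by blast
      qed
    qed
  qed
  have id: "(\<lambda>u. u) \<in> left_module_hom R (CM q) (CM q)" by (simp add: left_module_hom_def)
  \<comment> \<open>Projectivity of the chain module splits the free cover \<open>\<pi>\<close>; so
    a lift only has to be found on the free module and can then be composed with
    \<open>S\<close>.\<close>
  obtain S where S: "S \<in> left_module_hom R (CM q) X.C" and \<pi>S: "\<forall>u\<in>carrier (CM q). \<pi> (S u) = u"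
    using projective_moduleD[OF projective_chain_module[OF regular char sandwich] \<pi>hom id
        X.left_module_C Q.left_module_C \<pi>surj] by blast
  have Sa: "add_map (CM q) X.C S" by (rule left_module_hom_add_map[OF Q.left_module_C X.left_module_C S])
  have Sc: "S u \<in> carrier X.C" if "u \<in> carrier (CM q)" for u using add_map.closed[OF Sa that] .
  have "\<exists>h\<in>left_module_hom R (CV q) A. \<forall>p\<in>carrier (CV q). F (h p) = g p"
    if A: "left_module R A" and B: "left_module R B" and F: "F \<in> left_module_hom R A B"
      and surj: "F ` carrier A = carrier B" and g: "g \<in> left_module_hom R (CV q) B"
    for A :: "('m \<Rightarrow> 'k, 'x) module" and B :: "('m \<Rightarrow> 'k, 'y) module" and F g
  proof -
    interpret A: left_module R A by (rule A)
    interpret B: left_module R B by (rule B)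
    interpret F: add_map A B F by (rule left_module_hom_add_map[OF A B F])
    interpret P: left_module R "CV q" by (rule D.left_module_CV)
    interpret g: add_map "CV q" B g by (rule left_module_hom_add_map[OF D.left_module_CV B g])
    \<comment> \<open>\<open>s\<close> splits \<open>F\<close> as a linear map only; equivariance is
      built in afterwards by the formula for \<open>H\<close>.\<close>
    obtain s where s: "add_map B A s"
      and ss: "\<And>c b. c \<in> carrier K \<Longrightarrow> b \<in> carrier B \<Longrightarrow> s (e \<one>\<^bsub>M\<^esub> c \<odot>\<^bsub>B\<^esub> b) = e \<one>\<^bsub>M\<^esub> c \<odot>\<^bsub>A\<^esub> s b"
      and Fs: "\<And>b. b \<in> carrier B \<Longrightarrow> F (s b) = b"
      using linear_section[OF A B F surj] by blast
    note F_smult = left_module_hom_smult[OF F] and g_smult = left_module_hom_smult[OF g]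
    have tnc: "tn q u v \<in> carrier (CV q)" if "u \<in> carrier (CM q)" "v \<in> carrier V'" for u v
      using that by (simp add: D.VK_sel)
    \<comment> \<open>Multiplication by the inverse of \<psi>(m), available because \<open>M\<close>
      acts on the coefficients through a group.\<close>
    define iv where "iv m v = eU (inv\<^bsub>U\<^esub> (\<psi> m)) \<one>\<^bsub>K\<^esub> \<odot>\<^bsub>V\<^esub> v" for m v
    have ivc: "iv m v \<in> carrier V'" if "m \<in> carrier M" "v \<in> carrier V'" for m v
      using that eU_closed[OF K.one_closed] by (simp add: iv_def V'_sel)
    have iva: "add_map V' V' (iv m)" for m
      unfolding add_map_V' iv_def[abs_def] by (rule KU.smult_right_add_map) (simp add: eU_closed)
    have iv1: "e m \<one>\<^bsub>K\<^esub> \<odot>\<^bsub>V'\<^esub> iv m v = v" if "m \<in> carrier M" "v \<in> carrier V'" for m v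
      using that KU.smult_one[of v] \<psi>_closed[OF that(1)]
      by (simp add: V'_gen iv_def V'_sel(1) KU.smult_assoc1[symmetric] eU_closed eU_mult KU_sel(3))
    have iv2: "iv (n \<otimes>\<^bsub>M\<^esub> m) (e n \<one>\<^bsub>K\<^esub> \<odot>\<^bsub>V'\<^esub> v) = iv m v"
      if "m \<in> carrier M" "n \<in> carrier M" "v \<in> carrier V'" for m n v
    proof -
      have "inv\<^bsub>U\<^esub> (\<psi> n \<otimes>\<^bsub>U\<^esub> \<psi> m) \<otimes>\<^bsub>U\<^esub> \<psi> n = inv\<^bsub>U\<^esub> (\<psi> m)"
        using \<psi>_closed[OF that(1)] \<psi>_closed[OF that(2)] by (simp add: U.inv_mult_group U.m_assoc)
      then show ?thesis
        using that \<psi>_closed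
        by (simp add: V'_gen iv_def V'_sel(1) KU.smult_assoc1[symmetric] eU_closed eU_mult \<psi>_mult)
    qed
    have ivs: "iv m (e \<one>\<^bsub>M\<^esub> c \<odot>\<^bsub>V'\<^esub> v) = e \<one>\<^bsub>M\<^esub> c \<odot>\<^bsub>V'\<^esub> iv m v"
      if "m \<in> carrier M" "c \<in> carrier K" "v \<in> carrier V'" for m c v
      using that \<psi>_closed
      by (simp add: V'_gen iv_def V'_sel(1) KU.smult_assoc1[symmetric] eU_closed eU_mult \<psi>_one)
    define h0 where "h0 \<sigma> v = s (g (tn q (bq q \<sigma> \<one>\<^bsub>K\<^esub>) v))" for \<sigma> v
    have h0c: "h0 \<sigma> v \<in> carrier A" if "v \<in> carrier V'" for \<sigma> v
      unfolding h0_def using that by (intro add_map.closed[OF s] g.closed tnc) auto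
    have h0a: "add_map V' A (h0 \<sigma>)" for \<sigma>
    proof -
      have "add_map V' (CV q) (tn q (bq q \<sigma> \<one>\<^bsub>K\<^esub>))"
        using D.T.tn_right[of "bq q \<sigma> \<one>\<^bsub>K\<^esub>" q] by (simp add: D.add_map_VK)
      from add_map_comp[OF add_map_comp[OF this g.add_map_axioms] s] show ?thesis by (simp add: h0_def[abs_def])
    qed
    have h0s: "h0 \<sigma> (e \<one>\<^bsub>M\<^esub> c \<odot>\<^bsub>V'\<^esub> v) = e \<one>\<^bsub>M\<^esub> c \<odot>\<^bsub>A\<^esub> h0 \<sigma> v"
      if c: "c \<in> carrier K" and v: "v \<in> carrier V'" for \<sigma> c v
    proof -
      have b: "bq q \<sigma> \<one>\<^bsub>K\<^esub> \<in> carrier (CM q)" by simp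
      have "tn q (bq q \<sigma> \<one>\<^bsub>K\<^esub>) (e \<one>\<^bsub>M\<^esub> c \<odot>\<^bsub>V'\<^esub> v) = e \<one>\<^bsub>M\<^esub> c \<odot>\<^bsub>CV q\<^esub> tn q (bq q \<sigma> \<one>\<^bsub>K\<^esub>) v"
        using D.smult_tn[OF M.one_closed c b v] D.tn_scalar[OF b c v] V'.smult_one[OF v] by (simp add: one_R)
      then show ?thesis using c v by (simp add: h0_def g_smult tnc ss g.closed)
    qed
    \<comment> \<open>Modelled on the identity (m \<sigma>) tensor v = m (\<sigma> tensor
      \<psi>(m)^-1 v): the basis element (m, \<sigma>) together with v is sent to m times the linear
      lift of \<sigma> tensor \<psi>(m)^-1 v.\<close>
    define H where "H v = linext A ?X (\<lambda>p c. e (fst p) c \<odot>\<^bsub>A\<^esub> h0 (snd p) (iv (fst p) v))" for v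
    have Hgen: "add_map K A (\<lambda>c. e (fst p) c \<odot>\<^bsub>A\<^esub> h0 (snd p) (iv (fst p) v))"
      if "v \<in> carrier V'" "p \<in> ?X" for v and p
      using that by (intro add_map_comp[OF R.bs_add_map A.smult_left_add_map] h0c ivc) auto
    have H: "add_map X.C A (H v)" if "v \<in> carrier V'" for v
      unfolding H_def by (rule X.C.linext_add_map[OF A.abelian_group_axioms subset_refl Hgen[OF that]])
    have Hb: "H v (X.\<beta> (m, \<sigma>) c) = e m c \<odot>\<^bsub>A\<^esub> h0 \<sigma> (iv m v)"
      if "v \<in> carrier V'" "m \<in> carrier M" "\<sigma> \<in> Ch q" "c \<in> carrier K" for v m \<sigma> c
      unfolding H_def
      using X.C.linext_bs[OF A.abelian_group_axioms subset_refl Hgen[OF that(1)] that(4), where b = "(m, \<sigma>)"] that by simp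
    have Hv: "add_map V' A (\<lambda>v. H v x)" if x: "x \<in> carrier X.C" for x
      unfolding H_def linext_def
    proof (rule add_map_finsum[OF X.finite_basis abelian_V' A.abelian_group_axioms])
      fix p assume p: "p \<in> ?X"
      have "e (fst p) (x p) \<in> carrier R" using X.C.eval_closed[OF x p] by simp
      then show "add_map V' A (\<lambda>v. e (fst p) (x p) \<odot>\<^bsub>A\<^esub> h0 (snd p) (iv (fst p) v))"
        by (rule add_map_comp[OF add_map_comp[OF iva h0a] A.smult_right_add_map])
    qed
    let ?h = "tensor_lift A (\<lambda>u v. H v (S u))"
    have l: "add_map (CM q) A (\<lambda>u. H v (S u))" if "v \<in> carrier (underlying_vs K M V')" for v
      using that add_map_comp[OF Sa H] by (simp add: D.VK_sel)
    have r: "add_map (underlying_vs K M V') A (\<lambda>v. H v (S u))" if "u \<in> carrier (CM q)" for u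
      using Hv[OF Sc[OF that]] by (simp add: D.add_map_VK)
    \<comment> \<open>Passing from m and v to n m and n v leaves \<psi>(m)^-1 v unchanged, by
      \<open>iv2\<close>, so only the factor n in front remains.\<close>
    have Hequi: "H (e n \<one>\<^bsub>K\<^esub> \<odot>\<^bsub>V'\<^esub> v) (e n c \<odot>\<^bsub>X.C\<^esub> x) = e n c \<odot>\<^bsub>A\<^esub> H v x"
      if n: "n \<in> carrier M" and c: "c \<in> carrier K" and v: "v \<in> carrier V'" and x: "x \<in> carrier X.C" for n c v x
    proof -
      have en: "e n c \<in> carrier R" "e n \<one>\<^bsub>K\<^esub> \<in> carrier R" using c by auto
      have nv: "e n \<one>\<^bsub>K\<^esub> \<odot>\<^bsub>V'\<^esub> v \<in> carrier V'" using en v by simp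
      show ?thesis
        using add_map_comp[OF X.CM.smult_right_add_map[OF en(1)] H[OF nv]]
          add_map_comp[OF H[OF v] A.smult_right_add_map[OF en(1)]] x
      proof (rule X.C.add_map_eqI)
        fix p d assume "p \<in> ?X" and d: "d \<in> carrier K"
        then obtain m \<sigma> where p: "p = (m, \<sigma>)" "m \<in> carrier M" "\<sigma> \<in> Ch q" by auto
        have "e n c \<odot>\<^bsub>X.C\<^esub> X.\<beta> p d = X.\<beta> (n \<otimes>\<^bsub>M\<^esub> m, \<sigma>) (c \<otimes>\<^bsub>K\<^esub> d)"
          using p n c d by (simp add: X.smult_gen actX_def)
        then show "H (e n \<one>\<^bsub>K\<^esub> \<odot>\<^bsub>V'\<^esub> v) (e n c \<odot>\<^bsub>X.C\<^esub> X.\<beta> p d) = e n c \<odot>\<^bsub>A\<^esub> H v (X.\<beta> p d)"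
          using p n c d v nv h0c[OF ivc[OF p(2) v]]
          by (simp add: Hb iv2 A.smult_assoc1[symmetric] mult_gen)
      qed
    qed
    have Hscal: "H v (e \<one>\<^bsub>M\<^esub> c \<odot>\<^bsub>X.C\<^esub> x) = H (e \<one>\<^bsub>M\<^esub> c \<odot>\<^bsub>V'\<^esub> v) x"
      if c: "c \<in> carrier K" and v: "v \<in> carrier V'" and x: "x \<in> carrier X.C" for c v x
    proof -
      have ec: "e \<one>\<^bsub>M\<^esub> c \<in> carrier R" using c by simp
      have cv: "e \<one>\<^bsub>M\<^esub> c \<odot>\<^bsub>V'\<^esub> v \<in> carrier V'" using ec v by simp
      show ?thesis
        using add_map_comp[OF X.CM.smult_right_add_map[OF ec] H[OF v]] H[OF cv] x
      proof (rule X.C.add_map_eqI)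
        fix p d assume "p \<in> ?X" and d: "d \<in> carrier K"
        then obtain m \<sigma> where p: "p = (m, \<sigma>)" "m \<in> carrier M" "\<sigma> \<in> Ch q" by auto
        have "e \<one>\<^bsub>M\<^esub> c \<odot>\<^bsub>X.C\<^esub> X.\<beta> p d = X.\<beta> p (c \<otimes>\<^bsub>K\<^esub> d)"
          using p c d by (simp add: X.smult_gen actX_def)
        then show "H v (e \<one>\<^bsub>M\<^esub> c \<odot>\<^bsub>X.C\<^esub> X.\<beta> p d) = H (e \<one>\<^bsub>M\<^esub> c \<odot>\<^bsub>V'\<^esub> v) (X.\<beta> p d)"
          using p c d v cv h0c[OF ivc[OF p(2) v]] ivc[OF p(2) v]
          by (simp add: Hb ivs h0s A.smult_assoc1[symmetric] mult_gen K.m_comm)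
      qed
    qed
    have bal: "H v (S (scalar_mult K M (CM q) c u)) = H (c \<odot>\<^bsub>underlying_vs K M V'\<^esub> v) (S u)"
      if "u \<in> carrier (CM q)" "c \<in> carrier K" "v \<in> carrier (underlying_vs K M V')" for u c v
      using that Hscal[OF that(2) _ Sc[OF that(1)]] left_module_hom_smult[OF S, of "e \<one>\<^bsub>M\<^esub> c" u]
      by (simp add: D.VK_sel scalar_mult_def)
    have ha: "add_map (CV q) A ?h"
      by (rule D.T.tensor_lift(1)[OF A.abelian_group_axioms]) (rule l r bal; assumption)+
    have ht: "?h (tn q u v) = H v (S u)" if u: "u \<in> carrier (CM q)" and v: "v \<in> carrier V'" for u v
    proof -
      have v': "v \<in> carrier (underlying_vs K M V')" using v by (simp add: D.VK_sel)
      show ?thesis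
        by (rule D.T.tensor_lift(2)[OF A.abelian_group_axioms]) (rule l r bal u v'; assumption?)+
    qed
    have "?h \<in> left_module_hom R (CV q) A"
    proof (rule left_module_homI[OF D.left_module_CV A ha])
      fix n c t assume n: "n \<in> carrier M" and c: "c \<in> carrier K" and t: "t \<in> carrier (CV q)"
      have en: "e n c \<in> carrier R" "e n \<one>\<^bsub>K\<^esub> \<in> carrier R" using c by auto
      show "?h (e n c \<odot>\<^bsub>CV q\<^esub> t) = e n c \<odot>\<^bsub>A\<^esub> ?h t"
        using add_map_comp[OF P.smult_right_add_map[OF en(1)] ha] add_map_comp[OF ha A.smult_right_add_map[OF en(1)]] t
      proof (rule D.T.add_map_eqI)
        fix u v assume "u \<in> carrier (CM q)" "v \<in> carrier (underlying_vs K M V')"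
        then have u: "u \<in> carrier (CM q)" and v: "v \<in> carrier V'" by (auto simp: D.VK_sel)
        show "?h (e n c \<odot>\<^bsub>CV q\<^esub> tn q u v) = e n c \<odot>\<^bsub>A\<^esub> ?h (tn q u v)"
          using n c u v en Hequi[OF n c v Sc[OF u]]
          by (simp add: D.smult_tn ht left_module_hom_smult[OF S])
      qed
    qed
    moreover have "F (?h t) = g t" if t: "t \<in> carrier (CV q)" for t
      using add_map_comp[OF ha F.add_map_axioms] g.add_map_axioms t
    proof (rule D.T.add_map_eqI)
      fix u v assume "u \<in> carrier (CM q)" "v \<in> carrier (underlying_vs K M V')"
      then have u: "u \<in> carrier (CM q)" and v: "v \<in> carrier V'" by (auto simp: D.VK_sel)
      have tl: "add_map (CM q) (CV q) (\<lambda>u. tn q u v)" using D.T.tn_left v by (simp add: D.VK_sel)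
      \<comment> \<open>On the free cover, \<open>H\<close> lifts \<open>g\<close> composed with
        \<open>\<pi>\<close> tensored with the identity of the coefficients; precomposing with the
        section \<open>S\<close> of \<open>\<pi>\<close> yields a lift of \<open>g\<close>
        itself.\<close>
      have "F (H v x) = g (tn q (\<pi> x) v)" if x: "x \<in> carrier X.C" for x
        using add_map_comp[OF H[OF v] F.add_map_axioms]
          add_map_comp[OF add_map_comp[OF \<pi> tl] g.add_map_axioms] x
      proof (rule X.C.add_map_eqI)
        fix p d assume "p \<in> ?X" and d: "d \<in> carrier K"
        then obtain m \<sigma> where p: "p = (m, \<sigma>)" "m \<in> carrier M" "\<sigma> \<in> Ch q" by auto
        have b: "bq q \<sigma> \<one>\<^bsub>K\<^esub> \<in> carrier (CM q)" by simp
        have ed: "e m d \<in> carrier R" using d by simp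
        note i = ivc[OF p(2) v]
        have gt: "g (tn q (bq q \<sigma> \<one>\<^bsub>K\<^esub>) (iv m v)) \<in> carrier B" by (rule g.closed[OF tnc[OF b i]])
        have "F (H v (X.\<beta> p d)) = e m d \<odot>\<^bsub>B\<^esub> g (tn q (bq q \<sigma> \<one>\<^bsub>K\<^esub>) (iv m v))"
          using p d v h0c[OF i] Fs[OF gt] F_smult[OF ed h0c[OF i]] by (simp add: Hb h0_def)
        also have "\<dots> = g (e m d \<odot>\<^bsub>CV q\<^esub> tn q (bq q \<sigma> \<one>\<^bsub>K\<^esub>) (iv m v))"
          by (rule g_smult[OF ed tnc[OF b i], symmetric])
        also have "e m d \<odot>\<^bsub>CV q\<^esub> tn q (bq q \<sigma> \<one>\<^bsub>K\<^esub>) (iv m v) = tn q (\<pi> (X.\<beta> p d)) v"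
          using D.smult_tn[OF p(2) d b i] iv1[OF p(2) v] \<pi>b[OF p(2,3) d] p(1) by simp
        finally show "F (H v (X.\<beta> p d)) = g (tn q (\<pi> (X.\<beta> p d)) v)" .
      qed
      then show "F (?h (tn q u v)) = g (tn q u v)" using u v Sc[OF u] \<pi>S by (simp add: ht)
    qed
    ultimately show ?thesis by blast
  qed
  then show ?thesis using D.left_module_CV by (auto simp: projective_module_def)
qed

end

theorem theorem6p4:
  fixes M :: "('m, 'c) monoid_scheme" and K :: "('k, 'd) ring_scheme"
  assumes "monoid M" and "finite (carrier M)" and "regular_monoid M" and "field K"
  shows
    "resolution (monoid_algebra K M) (chain_module K M) (boundary K M)
       (augmentation K M) (trivial_module K M) \<and>
     (\<forall>q. filtered_by_induced K M (chain_module K M q)) \<and>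
     ((\<forall>e\<in>idempotents M. \<not> ring_char K dvd order (maximal_subgroup M e)) \<and>
      (\<forall>a\<in>carrier M. sandwich_right_invertible K M (J_class M a)) \<longrightarrow>
        projective_resolution TYPE('x) TYPE('y) (monoid_algebra K M) (chain_module K M)
          (boundary K M) (augmentation K M) (trivial_module K M) \<and>
        (\<forall>V :: (('m \<times> bool) list set \<Rightarrow> 'k, 'v) module.
           left_module (monoid_algebra K (universal_group M)) V \<longrightarrow>
           (let V' = inflation K M (universal_group M) (universal_map M) V in
            projective_resolution TYPE('x) TYPE('y) (monoid_algebra K M)
              (chain_module_coeff K M V') (boundary_coeff K M V')
              (augmentation_coeff K M V') V')))"
proof -
  interpret fm K M by (intro fm.intro fm_axioms.intro assms)
  have "projective_resolution TYPE('x) TYPE('y) R (chain_module K M)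
      (boundary K M) (augmentation K M) (trivial_module K M) \<and>
    (\<forall>V :: (('m \<times> bool) list set \<Rightarrow> 'k, 'v) module.
      left_module (monoid_algebra K (universal_group M)) V \<longrightarrow>
      (let V' = inflation K M (universal_group M) (universal_map M) V in
        projective_resolution TYPE('x) TYPE('y) R (chain_module_coeff K M V')
          (boundary_coeff K M V') (augmentation_coeff K M V') V'))"
    if char: "\<forall>e\<in>idempotents M. \<not> ring_char K dvd order (maximal_subgroup M e)"
      and sandwich: "\<forall>a\<in>carrier M. sandwich_right_invertible K M (J_class M a)"
  proof (intro conjI allI impI)
    have pc: "projective_module TYPE('x) TYPE('y) R (CM q)" for q
      by (rule projective_chain_module[OF assms(3) char sandwich])
    show "projective_resolution TYPE('x) TYPE('y) R (chain_module K M)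
        (boundary K M) (augmentation K M) (trivial_module K M)"
      using resolution_trivial pc by (simp add: projective_resolution_def chain_module_eq)
    fix V :: "(('m \<times> bool) list set \<Rightarrow> 'k, 'v) module"
    assume V: "left_module (monoid_algebra K (universal_group M)) V"
    interpret inflated K M "universal_group M" V "universal_map M"
      by (intro inflated.intro inflated_axioms.intro fm_axioms V
          group_universal_group universal_map_hom assms(1))
    have pv: "projective_module TYPE('x) TYPE('y) R (CV q)" for q
      by (rule projective_coeff[OF assms(3) char sandwich])
    show "let V' = inflation K M (universal_group M) (universal_map M) V in
        projective_resolution TYPE('x) TYPE('y) R (chain_module_coeff K M V')
          (boundary_coeff K M V') (augmentation_coeff K M V') V'"
      using resolution_coeff pv by (simp add: projective_resolution_def chain_module_coeff_eq)
  qed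
  then show ?thesis
    using resolution_trivial filtered_chain_module[OF assms(3)] by blast
qed

end
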